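(* Assume that $\mathcal{D}(A)=\mathcal{D}(M)$ with equivalent norms $|Mv|_0$ and $\|Av\|_0$. If $\sigma\ge 1/2$ and $v\in\mathcal{D}(M^\sigma)$, then $$\|v-P_{n,1/2}v\|_0=o\big(\mu_{n+1}^{-\sigma}\big)\quad\text{as }n\to\infty.$$ Moreover, if $\sigma\ge1/2$ and the first $\ell$ eigenvectors $u_1,\dots,u_\ell$ of $A$ are in $\mathcal{D}(M^\sigma)$, then for all large $n$ there exist eigenvectors $u_{j,n}$ of $A$ in the $\lambda_j$-eigenspace, normalized in $\mathcal{H}$, such that, as $n\to\infty$, in addition to $$\Lambda_j^{(n,1/2)}=\lambda_j+o\big(\mu_{n+1}^{1-2\sigma}\big)\quad\text{and}\quad\|u_{j,n}-u_j^{(n,1/2)}\|_{1/2}=o\big(\mu_{n+1}^{1/2-\sigma}\big),\qquad 1\le j\le\ell,$$ one has $$\|u_{j,n}-u_j^{(n,1/2)}\|_0=o\big(\mu_{n+1}^{-\sigma}\big),\qquad 1\le j\le\ell.$$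
   Context: $\mathcal{H}=\mathcal{H}_0$ is a separable complex Hilbert space with inner product $\langle\cdot,\cdot\rangle$ and norm $\|\cdot\|=\|\cdot\|_0$. $A$ is a selfadjoint operator in $\mathcal{H}$ that is positive definite ($\langle Au,u\rangle\ge\alpha\|u\|^2$ for $u\in\mathcal{D}(A)$, some $\alpha>0$), and the lower part of its spectrum consists of isolated eigenvalues of finite multiplicity $0<\lambda_1\le\lambda_2\le\dots$ (counted with multiplicity) lying below $\lambda_\infty$, the least point of the essential spectrum ($\lambda_\infty=\infty$ if $A^{-1}$ is compact), with corresponding orthonormal eigenvectors $u_1,u_2,\dots$. The eigenpairs with indices $1,\dots,\ell$ are among these. For $\tau\ge0$, $\mathcal{H}_\tau=\mathcal{D}(A^\tau)$ with inner product $\langle u,v\rangle_\tau=\langle A^\tau u,A^\tau v\rangle$ and norm $\|u\|_\tau=\|A^\tau u\|$. $\mathcal{G}_0$ is a Hilbert space consisting of the same elements as $\mathcal{H}_0$ with an equivalent norm; its inner product and norm are $(\cdot,\cdot)_0$ and $|\cdot|_0$. $M$ is a positive definite selfadjoint operator in $\mathcal{G}_0$ with $M^{-1}$ compact, with eigenvalues $0<\mu_1\le\mu_2\le\dots\to\infty$ (counted with multiplicity) and corresponding eigenvectors $q_1,q_2,\dots$ orthonormal in $\mathcal{G}_0$. For $s\ge0$, $\mathcal{D}(M^s)$ carries the norm $|M^sv|_0$. $P_{n,1/2}$ is the orthogonal projection in $\mathcal{H}_{1/2}$ onto $\mathrm{span}\{q_1,\dots,q_n\}$. Regular Rayleigh–Ritz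 method (in $\mathcal{H}_{1/2}$) with trial vectors $q_k$: $\Lambda_1^{(n,1/2)}\le\dots\le\Lambda_n^{(n,1/2)}$ are the eigenvalues of $[\langle q_i,q_j\rangle_{1/2}]_{i,j=1}^n\mathbf{x}=\Lambda[\langle q_i,q_j\rangle]_{i,j=1}^n\mathbf{x}$, and $u_1^{(n,1/2)},\dots,u_n^{(n,1/2)}\in\mathrm{span}\{q_1,\dots,q_n\}$ are the corresponding eigenvectors normalized so that $\langle u_i^{(n,1/2)},u_j^{(n,1/2)}\rangle=\delta_{ij}$ and $\langle u_i^{(n,1/2)},u_j^{(n,1/2)}\rangle_{1/2}=\Lambda_i^{(n,1/2)}\delta_{ij}$. *)

theory Defs
  imports "HOL-Analysis.Analysis" "HOL-Library.Landau_Symbols" "HOL-Library.Extended_Nat"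
begin

section \<open>Complex Hilbert spaces\<close>

class complex_vector = ab_group_add +
  fixes scaleC :: "complex \<Rightarrow> 'a \<Rightarrow> 'a"  (infixr \<open>*\<^sub>C\<close> 75)
  assumes scaleC_add_right: "a *\<^sub>C (x + y) = a *\<^sub>C x + a *\<^sub>C y"
    and scaleC_add_left: "(a + b) *\<^sub>C x = a *\<^sub>C x + b *\<^sub>C x"
    and scaleC_scaleC: "a *\<^sub>C b *\<^sub>C x = (a * b) *\<^sub>C x"
    and scaleC_one: "1 *\<^sub>C x = x"

global_interpretation cvec: vector_space "scaleC :: complex \<Rightarrow> 'a \<Rightarrow> 'a::complex_vector"
  by unfold_locales (simp_all add: scaleC_add_right scaleC_add_left scaleC_scaleC scaleC_one)

text \<open>
  The inner product is an explicit argument and not a class operation, because the same vector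
  space carries several of them (\<open>\<H>\<^sub>0\<close> and \<open>\<G>\<^sub>0\<close> have the same elements). Inner products are
  linear in the second argument, so that a solution \<open>x\<close> of the matrix equation
  \<open>[\<langle>q\<^sub>i, q\<^sub>j\<rangle>\<^sub>1\<^sub>/\<^sub>2] x = \<Lambda> [\<langle>q\<^sub>i, q\<^sub>j\<rangle>] x\<close> is the coordinate vector of the Ritz vector
  \<open>\<Sum>\<^sub>k x\<^sub>k q\<^sub>k\<close>.
\<close>

type_synonym 'h inner_prod = "'h \<Rightarrow> 'h \<Rightarrow> complex"

definition inner_product :: "'h::complex_vector inner_prod \<Rightarrow> bool" where
  "inner_product H \<longleftrightarrow>
     (\<forall>x y z. H x (y + z) = H x y + H x z) \<and>
     (\<forall>c x y. H x (c *\<^sub>C y) = c * H x y) \<and>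
     (\<forall>x y. H y x = cnj (H x y)) \<and>
     (\<forall>x. x \<noteq> 0 \<longrightarrow> Re (H x x) > 0)"

definition hnorm :: "'h::complex_vector inner_prod \<Rightarrow> 'h \<Rightarrow> real" where
  "hnorm H x = sqrt (Re (H x x))"

definition hdist :: "'h::complex_vector inner_prod \<Rightarrow> 'h \<Rightarrow> 'h \<Rightarrow> real" where
  "hdist H x y = hnorm H (x - y)"

definition htop :: "'h::complex_vector inner_prod \<Rightarrow> 'h topology" where
  "htop H = Metric_space.mtopology UNIV (hdist H)"

definition hilbert_space :: "'h::complex_vector inner_prod \<Rightarrow> bool" where
  "hilbert_space H \<longleftrightarrow> inner_product H \<and> Metric_space.mcomplete UNIV (hdist H)"

definition orthonormal_on :: "'h::complex_vector inner_prod \<Rightarrow> nat set \<Rightarrow> (nat \<Rightarrow> 'h) \<Rightarrow> bool" where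
  "orthonormal_on H J e \<longleftrightarrow> (\<forall>i\<in>J. \<forall>j\<in>J. H (e i) (e j) = (if i = j then 1 else 0))"

definition equivalent_norms_on :: "'h set \<Rightarrow> ('h \<Rightarrow> real) \<Rightarrow> ('h \<Rightarrow> real) \<Rightarrow> bool" where
  "equivalent_norms_on D f g \<longleftrightarrow> (\<exists>c>0. \<exists>C>0. \<forall>v\<in>D. c * g v \<le> f v \<and> f v \<le> C * g v)"

text \<open>
  \<open>B\<close> is an inner product that need only be meaningful on a subspace of the type containing
  \<open>v\<close> and \<open>S\<close>.
\<close>

definition orth_proj :: "'h::complex_vector inner_prod \<Rightarrow> 'h set \<Rightarrow> 'h \<Rightarrow> 'h" where
  "orth_proj B S v = (THE w. w \<in> S \<and> (\<forall>z\<in>S. B z (v - w) = 0))"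


section \<open>Unbounded operators\<close>

text \<open>An operator is a partial function \<open>A\<close>; its domain \<open>\<D>(A)\<close> is \<open>dom A\<close>.\<close>

type_synonym 'h operator = "'h \<Rightarrow> 'h option"

definition linear_operator :: "'h::complex_vector operator \<Rightarrow> bool" where
  "linear_operator A \<longleftrightarrow> cvec.subspace (dom A) \<and>
     (\<forall>x\<in>dom A. \<forall>y\<in>dom A. the (A (x + y)) = the (A x) + the (A y)) \<and>
     (\<forall>c. \<forall>x\<in>dom A. the (A (c *\<^sub>C x)) = c *\<^sub>C the (A x))"

text \<open>The last clause says that the graph of \<open>A\<close> equals the graph of its adjoint.\<close>

definition selfadjoint :: "'h::complex_vector inner_prod \<Rightarrow> 'h operator \<Rightarrow> bool" where
  "selfadjoint H A \<longleftrightarrow> linear_operator A \<and> htop H closure_of (dom A) = UNIV \<and>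
     (\<forall>u w. A u = Some w \<longleftrightarrow> (\<forall>v\<in>dom A. H w v = H u (the (A v))))"

definition positive_definite :: "'h::complex_vector inner_prod \<Rightarrow> 'h operator \<Rightarrow> bool" where
  "positive_definite H A \<longleftrightarrow>
     (\<exists>\<alpha>>0. \<forall>u\<in>dom A. Re (H (the (A u)) u) \<ge> \<alpha> * (hnorm H u)\<^sup>2)"

definition eigenspace :: "'h::complex_vector operator \<Rightarrow> complex \<Rightarrow> 'h set" where
  "eigenspace A z = {u \<in> dom A. the (A u) = z *\<^sub>C u}"

definition spectrum :: "'h::complex_vector inner_prod \<Rightarrow> 'h operator \<Rightarrow> complex set" where
  "spectrum H A = {z. \<not> (bij_betw (\<lambda>u. the (A u) - z *\<^sub>C u) (dom A) UNIV \<and>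
     (\<exists>C. \<forall>u\<in>dom A. hnorm H u \<le> C * hnorm H (the (A u) - z *\<^sub>C u)))}"

definition discrete_spectrum :: "'h::complex_vector inner_prod \<Rightarrow> 'h operator \<Rightarrow> complex set" where
  "discrete_spectrum H A = {z. z isolated_in spectrum H A \<and> eigenspace A z \<noteq> {0} \<and>
     (\<exists>F. finite F \<and> eigenspace A z \<subseteq> cvec.span F)}"

definition essential_spectrum :: "'h::complex_vector inner_prod \<Rightarrow> 'h operator \<Rightarrow> complex set" where
  "essential_spectrum H A = spectrum H A - discrete_spectrum H A"

text \<open>Equals \<open>\<infinity>\<close> if the essential spectrum is empty.\<close>

definition inf_essential_spectrum :: "'h::complex_vector inner_prod \<Rightarrow> 'h operator \<Rightarrow> ereal" where
  "inf_essential_spectrum H A = (INF z\<in>essential_spectrum H A. ereal (Re z))"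

definition compact_operator :: "'h::complex_vector inner_prod \<Rightarrow> ('h \<Rightarrow> 'h) \<Rightarrow> bool" where
  "compact_operator H T \<longleftrightarrow> Vector_Spaces.linear scaleC scaleC T \<and>
     (\<forall>S. Metric_space.mbounded UNIV (hdist H) S \<longrightarrow>
        compactin (htop H) (htop H closure_of (T ` S)))"

definition compact_inverse :: "'h::complex_vector inner_prod \<Rightarrow> 'h operator \<Rightarrow> bool" where
  "compact_inverse H A \<longleftrightarrow> bij_betw (\<lambda>u. the (A u)) (dom A) UNIV \<and>
     compact_operator H (inv_into (dom A) (\<lambda>u. the (A u)))"

text \<open>
  The eigenvalues of \<open>A\<close> strictly below \<open>b\<close> are \<open>\<kappa>\<^sub>j\<close>, \<open>j \<in> J\<close>, counted with multiplicity and in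
  nondecreasing order, and \<open>e\<^sub>j\<close> are corresponding orthonormal eigenvectors. A value \<open>t < b\<close> that is
  not an eigenvalue has a zero-dimensional eigenspace, so it does not occur among the \<open>\<kappa>\<^sub>j\<close>.
\<close>

definition eigenpairs_below ::
  "'h::complex_vector inner_prod \<Rightarrow> 'h operator \<Rightarrow> ereal \<Rightarrow> nat set \<Rightarrow> (nat \<Rightarrow> real) \<Rightarrow> (nat \<Rightarrow> 'h) \<Rightarrow> bool"
  where
  "eigenpairs_below H A b J \<kappa> e \<longleftrightarrow>
     (\<forall>i\<in>J. \<forall>j\<in>J. i \<le> j \<longrightarrow> \<kappa> i \<le> \<kappa> j) \<and>
     (\<forall>j\<in>J. ereal (\<kappa> j) < b \<and> e j \<in> eigenspace A (of_real (\<kappa> j))) \<and>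
     orthonormal_on H J e \<and>
     (\<forall>t::real. ereal t < b \<longrightarrow>
        finite {j\<in>J. \<kappa> j = t} \<and> card {j\<in>J. \<kappa> j = t} = cvec.dim (eigenspace A (of_real t)))"


section \<open>Powers of a positive selfadjoint operator\<close>

definition projection_valued_measure ::
  "'h::complex_vector inner_prod \<Rightarrow> (real set \<Rightarrow> 'h \<Rightarrow> 'h) \<Rightarrow> bool" where
  "projection_valued_measure H E \<longleftrightarrow>
     (\<forall>S\<in>sets borel. Vector_Spaces.linear scaleC scaleC (E S) \<and>
        (\<forall>x. E S (E S x) = E S x) \<and> (\<forall>x y. H (E S x) y = H x (E S y))) \<and>
     E UNIV = id \<and>
     (\<forall>S\<in>sets borel. \<forall>T\<in>sets borel. E (S \<inter> T) = E S \<circ> E T) \<and>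
     (\<forall>F :: nat \<Rightarrow> real set. range F \<subseteq> sets borel \<longrightarrow> disjoint_family F \<longrightarrow>
        (\<forall>x. limitin (htop H) (\<lambda>n. \<Sum>k<n. E (F k) x) (E (\<Union>k. F k) x) sequentially))"

definition scalar_spectral_measure ::
  "'h::complex_vector inner_prod \<Rightarrow> (real set \<Rightarrow> 'h \<Rightarrow> 'h) \<Rightarrow> 'h \<Rightarrow> real measure" where
  "scalar_spectral_measure H E x =
     measure_of UNIV (sets borel) (\<lambda>S. ennreal (Re (H x (E S x))))"

text \<open>
  The operator \<open>\<integral> f dE\<close> with domain \<open>{y. \<integral> f\<^sup>2 d\<langle>y, E y\<rangle> < \<infinity>}\<close>. Its value \<open>w\<close> at \<open>y\<close> is determined by
  \<open>\<langle>x, w\<rangle> = \<integral> f d\<langle>x, E y\<rangle>\<close> for all \<open>x\<close> in that (dense) domain, the complex measure \<open>\<langle>x, E y\<rangle>\<close> being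
  written as the polarization of the positive measures \<open>\<langle>z, E z\<rangle>\<close>.
\<close>

definition spectral_domain ::
  "'h::complex_vector inner_prod \<Rightarrow> (real set \<Rightarrow> 'h \<Rightarrow> 'h) \<Rightarrow> (real \<Rightarrow> real) \<Rightarrow> 'h set" where
  "spectral_domain H E f = {y. integrable (scalar_spectral_measure H E y) (\<lambda>t. (f t)\<^sup>2)}"

definition spectral_integral ::
  "'h::complex_vector inner_prod \<Rightarrow> (real set \<Rightarrow> 'h \<Rightarrow> 'h) \<Rightarrow> (real \<Rightarrow> real) \<Rightarrow> 'h operator" where
  "spectral_integral H E f = (\<lambda>y.
     if y \<in> spectral_domain H E f
     then Some (THE w. \<forall>x\<in>spectral_domain H E f.
       H x w = (1/4) * (\<Sum>k<4. \<i> ^ k *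
         of_real (\<integral>t. f t \<partial>(scalar_spectral_measure H E (y + \<i> ^ k *\<^sub>C x)))))
     else None)"

definition spectral_resolution ::
  "'h::complex_vector inner_prod \<Rightarrow> 'h operator \<Rightarrow> (real set \<Rightarrow> 'h \<Rightarrow> 'h) \<Rightarrow> bool" where
  "spectral_resolution H A E \<longleftrightarrow>
     projection_valued_measure H E \<and> spectral_integral H E (\<lambda>t. t) = A"

text \<open>
  By the spectral theorem a selfadjoint \<open>A\<close> has a spectral resolution, and its values on Borel sets,
  the only ones used by \<^const>\<open>spectral_integral\<close>, are unique.
\<close>

definition op_power :: "'h::complex_vector inner_prod \<Rightarrow> 'h operator \<Rightarrow> real \<Rightarrow> 'h operator" where
  "op_power H A \<tau> = spectral_integral H (SOME E. spectral_resolution H A E) (\<lambda>t. t powr \<tau>)"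

text \<open>The inner product of \<open>\<H>\<^sub>\<tau> = \<D>(A\<^sup>\<tau>)\<close>; it is meaningful on \<open>dom (op_power H A \<tau>)\<close> only.\<close>

definition pow_inner :: "'h::complex_vector inner_prod \<Rightarrow> 'h operator \<Rightarrow> real \<Rightarrow> 'h inner_prod" where
  "pow_inner H A \<tau> u v = H (the (op_power H A \<tau> u)) (the (op_power H A \<tau> v))"


section \<open>The Rayleigh-Ritz method\<close>

text \<open>
  \<open>(\<Lambda>\<^sub>j, w\<^sub>j)\<close>, \<open>1 \<le> j \<le> n\<close>, are the Ritz pairs for the form \<open>B\<close> relative to \<open>H\<close> with trial vectors
  \<open>q\<^sub>1, \<dots>, q\<^sub>n\<close>. The normalization makes the \<open>w\<^sub>j\<close> independent, so the \<open>\<Lambda>\<^sub>j\<close> are all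
  eigenvalues of the matrix pencil with their multiplicities.
\<close>

definition rayleigh_ritz ::
  "'h::complex_vector inner_prod \<Rightarrow> 'h inner_prod \<Rightarrow> (nat \<Rightarrow> 'h) \<Rightarrow> nat \<Rightarrow>
   (nat \<Rightarrow> real) \<Rightarrow> (nat \<Rightarrow> 'h) \<Rightarrow> bool" where
  "rayleigh_ritz B H q n \<Lambda> w \<longleftrightarrow>
     (\<forall>i\<in>{1..n}. \<forall>j\<in>{1..n}. i \<le> j \<longrightarrow> \<Lambda> i \<le> \<Lambda> j) \<and>
     (\<forall>j\<in>{1..n}. \<exists>x :: nat \<Rightarrow> complex. w j = (\<Sum>k=1..n. x k *\<^sub>C q k) \<and>
        (\<forall>i\<in>{1..n}. (\<Sum>k=1..n. B (q i) (q k) * x k) =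
                    of_real (\<Lambda> j) * (\<Sum>k=1..n. H (q i) (q k) * x k))) \<and>
     (\<forall>i\<in>{1..n}. \<forall>j\<in>{1..n}. H (w i) (w j) = (if i = j then 1 else 0) \<and>
        B (w i) (w j) = (if i = j then of_real (\<Lambda> i) else 0))"

end

(*
The fractional powers of A and M are obtained from a spectral theorem: for the positive
contraction X = alpha A^{-1} the quadratic moments of X are a completely monotone sequence, hence
by Bernstein weights and Helly selection the moments of a finite measure on [0,1]; this measure,
transported by s |-> alpha/s, is the spectral measure of A.

For v in D(M^sigma) the partial sums of its expansion in the q_k converge to v in the energy norm
of M at the rate o(mu_{n+1}^{1/2-sigma}).  Equivalence of |Mv| and |Av| implies, by Krein's lemma on
operators symmetric with respect to a weaker form, that the energy norm of A is bounded by that of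
M, so the Galerkin projection has at least this rate in the energy norm of A.  The Aubin-Nitsche
duality argument, with the dual solution A^{-1}e in D(A) = D(M), gains the remaining factor
mu_{n+1}^{-1/2} in the norm of the Hilbert space.

By min-max the Ritz values exceed lambda_j by a quantity quadratic in the energy error of the
projected eigenvectors.  Testing the Ritz equation against a reduced resolvent of A, and using the
same duality, gives the eigenvector estimates.
*)
theory Submission
  imports Defs "HOL-Probability.Probability" "HOL-Real_Asymp.Real_Asymp"
begin

section \<open>Hermitian forms and Hilbert spaces\<close>

text \<open>The two operators are selfadjoint for different inner products, so no joint functional
  calculus is available; the only bridges are the equivalence of the norms and of the graph norms.
  Passing from graph norms to energy norms is an interpolation statement, and Krein's lemma settles
  it by iterating one symmetric operator, without fractional powers.

  A multiple eigenvalue shapes the eigenvector estimate. Ritz vectors need not settle on the given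
  \<open>u j\<close>, so the comparison vector is the normalized projection of the Ritz vector onto
  the eigenspace. Moreover, that eigenspace may contain \<open>u i\<close> with i > l, for which no
  smoothness is assumed. Hence the Ritz vector is split into its parts on smaller eigenvalues, on
  the eigenspace and on the rest: the first is computed from the Ritz equation with the smooth
  \<open>u i\<close>, and the rest is bounded by an energy balance, so no approximation of the whole
  eigenspace is required.

  The o instead of O comes from tails of convergent coefficient series of the given vectors. The
  dual problems, whose right-hand sides vary with n, only get a uniform O.\<close>

text \<open>Semidefiniteness and the restriction to a subspace let one development serve the Hilbert
  inner products, the energy form on \<open>dom half\<close>, the shifted forms of
  \<open>weak_solution\<close> and the forms \<open>mint (indicator S)\<close>.\<close>

locale psd_form =
  fixes V :: "'h::complex_vector set" and B :: "'h inner_prod"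
  assumes V: "cvec.subspace V"
    and add_right: "\<lbrakk>x \<in> V; y \<in> V; z \<in> V\<rbrakk> \<Longrightarrow> B x (y + z) = B x y + B x z"
    and scale_right: "\<lbrakk>x \<in> V; y \<in> V\<rbrakk> \<Longrightarrow> B x (c *\<^sub>C y) = c * B x y"
    and herm: "\<lbrakk>x \<in> V; y \<in> V\<rbrakk> \<Longrightarrow> B y x = cnj (B x y)"
    and nonneg: "x \<in> V \<Longrightarrow> Re (B x x) \<ge> 0"
begin

lemma V_add: "x \<in> V \<Longrightarrow> y \<in> V \<Longrightarrow> x + y \<in> V"
  and V_scale: "x \<in> V \<Longrightarrow> c *\<^sub>C x \<in> V"
  and V_zero: "0 \<in> V"
  and V_diff: "x \<in> V \<Longrightarrow> y \<in> V \<Longrightarrow> x - y \<in> V"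
  and V_sum: "(\<And>i. i \<in> I \<Longrightarrow> f i \<in> V) \<Longrightarrow> sum f I \<in> V"
  and V_neg: "x \<in> V \<Longrightarrow> - x \<in> V"
  using V by (auto intro: cvec.subspace_add cvec.subspace_scale cvec.subspace_0 cvec.subspace_diff
      cvec.subspace_sum cvec.subspace_neg)

lemmas V_closed = V_add V_scale V_zero V_diff V_neg

lemma add_left: "\<lbrakk>x \<in> V; y \<in> V; z \<in> V\<rbrakk> \<Longrightarrow> B (x + y) z = B x z + B y z"
  by (metis add_right V_add complex_cnj_add herm)

lemma scale_left: "\<lbrakk>x \<in> V; y \<in> V\<rbrakk> \<Longrightarrow> B (c *\<^sub>C x) y = cnj c * B x y"
  by (metis scale_right V_scale complex_cnj_mult herm)

lemma zero_right: "x \<in> V \<Longrightarrow> B x 0 = 0"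
  using scale_right[of x 0 0] by (simp add: V_zero)

lemma zero_left: "x \<in> V \<Longrightarrow> B 0 x = 0"
  using scale_left[of 0 x 0] by (simp add: V_zero)

lemma minus_right: "\<lbrakk>x \<in> V; y \<in> V\<rbrakk> \<Longrightarrow> B x (- y) = - B x y"
  using scale_right[of x y "-1"] by (simp add: cvec.scale_minus_left)

lemma minus_left: "\<lbrakk>x \<in> V; y \<in> V\<rbrakk> \<Longrightarrow> B (- x) y = - B x y"
  using scale_left[of x y "-1"] by (simp add: cvec.scale_minus_left)

lemma diff_right: "\<lbrakk>x \<in> V; y \<in> V; z \<in> V\<rbrakk> \<Longrightarrow> B x (y - z) = B x y - B x z"
  using add_right[of x y "-z"] by (simp add: minus_right V_neg)

lemma diff_left: "\<lbrakk>x \<in> V; y \<in> V; z \<in> V\<rbrakk> \<Longrightarrow> B (x - y) z = B x z - B y z"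
  using add_left[of x "-y" z] by (simp add: minus_left V_neg)

lemmas bilin = add_right scale_right add_left scale_left minus_right minus_left diff_right
  diff_left zero_left zero_right

lemma sum_right: "x \<in> V \<Longrightarrow> (\<And>i. i \<in> I \<Longrightarrow> f i \<in> V) \<Longrightarrow> B x (sum f I) = (\<Sum>i\<in>I. B x (f i))"
  by (induction I rule: infinite_finite_induct) (auto simp: bilin V_sum)

lemma sum_left: "x \<in> V \<Longrightarrow> (\<And>i. i \<in> I \<Longrightarrow> f i \<in> V) \<Longrightarrow> B (sum f I) x = (\<Sum>i\<in>I. B (f i) x)"
  by (induction I rule: infinite_finite_induct) (auto simp: bilin V_sum)

lemma self_real: "x \<in> V \<Longrightarrow> B x x = of_real (Re (B x x))"
  using herm[of x x] by (simp add: complex_eq_iff)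

lemma Re_commute: "x \<in> V \<Longrightarrow> y \<in> V \<Longrightarrow> Re (B x y) = Re (B y x)"
  using herm[of x y] by simp

lemma norm_sq: "x \<in> V \<Longrightarrow> (hnorm B x)\<^sup>2 = Re (B x x)"
  by (simp add: hnorm_def nonneg)

lemma hnorm_ge0 [simp]: "x \<in> V \<Longrightarrow> 0 \<le> hnorm B x"
  by (simp add: hnorm_def nonneg)

lemma self_eq: "x \<in> V \<Longrightarrow> B x x = of_real ((hnorm B x)\<^sup>2)"
  using self_real norm_sq by simp

lemma add_sq: "x \<in> V \<Longrightarrow> y \<in> V \<Longrightarrow> Re (B (x + y) (x + y)) = Re (B x x) + 2 * Re (B x y) + Re (B y y)"
  using Re_commute[of x y] by (simp add: bilin V_add)

lemma diff_sq: "x \<in> V \<Longrightarrow> y \<in> V \<Longrightarrow> Re (B (x - y) (x - y)) = Re (B x x) - 2 * Re (B x y) + Re (B y y)"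
  using Re_commute[of x y] by (simp add: bilin V_diff)

lemma scale_sq: "x \<in> V \<Longrightarrow> Re (B (c *\<^sub>C x) (c *\<^sub>C x)) = (cmod c)\<^sup>2 * Re (B x x)"
proof -
  assume x: "x \<in> V"
  have "B (c *\<^sub>C x) (c *\<^sub>C x) = (c * cnj c) * B x x"
    using x by (simp add: bilin V_scale algebra_simps)
  also have "c * cnj c = of_real ((cmod c)\<^sup>2)"
    by (simp only: complex_norm_square)
  finally show ?thesis by simp
qed

lemma cauchy_schwarz:
  assumes x: "x \<in> V" and y: "y \<in> V"
  shows "cmod (B x y) \<le> hnorm B x * hnorm B y"
proof -
  define a b z where "a = Re (B x x)" and "b = Re (B y y)" and "z = B x y"
  have ab: "a \<ge> 0" "b \<ge> 0" using nonneg x y by (auto simp: a_def b_def)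
  \<comment> \<open>The phase \<open>cnj z\<close> in the test vector makes the mixed term
    real.\<close>
  have q: "a + 2 * t * (cmod z)\<^sup>2 + t\<^sup>2 * (cmod z)\<^sup>2 * b \<ge> 0" for t :: real
  proof -
    let ?s = "of_real t * cnj z"
    have "0 \<le> Re (B (x + ?s *\<^sub>C y) (x + ?s *\<^sub>C y))"
      using x y by (intro nonneg V_closed)
    also have "\<dots> = a + 2 * Re (?s * z) + (cmod ?s)\<^sup>2 * b"
      unfolding add_sq[OF x V_scale[OF y]] scale_sq[OF y] scale_right[OF x y] a_def b_def z_def ..
    also have "Re (?s * z) = t * (cmod z)\<^sup>2"
      by (simp add: cmod_def power2_eq_square algebra_simps)
    finally show ?thesis by (simp add: norm_mult power_mult_distrib algebra_simps)
  qed
  have "(cmod z)\<^sup>2 \<le> a * b"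
  proof (cases "b = 0")
    case True
    have "z = 0"
    proof (rule ccontr)
      assume "z \<noteq> 0"
      define k where "k = (cmod z)\<^sup>2"
      have "k > 0" using \<open>z \<noteq> 0\<close> by (simp add: k_def)
      hence "2 * (- (a + 1) / (2 * k)) * k = - (a + 1)" by simp
      with q[of "- (a + 1) / (2 * k)"] True show False unfolding k_def[symmetric] by simp
    qed
    thus ?thesis using True by simp
  next
    case False
    hence b: "b > 0" using ab by simp
    define k where "k = (cmod z)\<^sup>2"
    have "(- 1 / b)\<^sup>2 * k * b = k / b" using b by (simp add: power2_eq_square)
    with q[of "- 1 / b"] have "0 \<le> a - k / b" unfolding k_def[symmetric] by simp
    thus ?thesis using b unfolding k_def[symmetric] by (simp add: field_simps)
  qed
  hence "cmod z \<le> sqrt (a * b)" by (simp add: real_le_rsqrt)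
  thus ?thesis by (simp add: hnorm_def a_def b_def z_def real_sqrt_mult)
qed

lemma triangle: "x \<in> V \<Longrightarrow> y \<in> V \<Longrightarrow> hnorm B (x + y) \<le> hnorm B x + hnorm B y"
proof -
  assume xy: "x \<in> V" "y \<in> V"
  have "(hnorm B (x + y))\<^sup>2 = (hnorm B x)\<^sup>2 + 2 * Re (B x y) + (hnorm B y)\<^sup>2"
    using xy by (simp add: norm_sq V_add add_sq)
  also have "Re (B x y) \<le> hnorm B x * hnorm B y"
    using cauchy_schwarz[OF xy] complex_Re_le_cmod order_trans by blast
  finally have "(hnorm B (x + y))\<^sup>2 \<le> (hnorm B x + hnorm B y)\<^sup>2"
    by (simp add: power2_eq_square algebra_simps)
  thus ?thesis using xy by (auto intro: power2_le_imp_le)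
qed

lemma norm_scale: "x \<in> V \<Longrightarrow> hnorm B (c *\<^sub>C x) = cmod c * hnorm B x"
  by (simp add: hnorm_def scale_sq real_sqrt_mult)

lemma norm_zero [simp]: "hnorm B 0 = 0"
  using zero_right[OF V_zero] by (simp add: hnorm_def)

lemma norm_minus: "x \<in> V \<Longrightarrow> hnorm B (- x) = hnorm B x"
  using norm_scale[of x "-1"] by (simp add: cvec.scale_minus_left)

lemma norm_diff_commute: "x \<in> V \<Longrightarrow> y \<in> V \<Longrightarrow> hnorm B (x - y) = hnorm B (y - x)"
  using norm_minus[of "x - y"] by (simp add: V_diff)

lemma triangle_diff: "x \<in> V \<Longrightarrow> y \<in> V \<Longrightarrow> hnorm B (x - y) \<le> hnorm B x + hnorm B y"
  using triangle[of x "- y"] by (simp add: norm_minus V_neg)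

lemma triangle3: "x \<in> V \<Longrightarrow> y \<in> V \<Longrightarrow> z \<in> V \<Longrightarrow> hnorm B (x - z) \<le> hnorm B (x - y) + hnorm B (y - z)"
  using triangle[of "x - y" "y - z"] by (simp add: V_diff)

lemma triangle_rev: "x \<in> V \<Longrightarrow> y \<in> V \<Longrightarrow> \<bar>hnorm B x - hnorm B y\<bar> \<le> hnorm B (x - y)"
  using triangle[of "x - y" y] triangle[of "y - x" x] norm_diff_commute[of x y]
  by (simp add: V_diff abs_le_iff)

lemma triangle_sum:
  "(\<And>i. i \<in> I \<Longrightarrow> f i \<in> V) \<Longrightarrow> hnorm B (sum f I) \<le> (\<Sum>i\<in>I. hnorm B (f i))"
proof (induction I rule: infinite_finite_induct)
  case (insert x F)
  then show ?case using triangle[of "f x" "sum f F"] by (fastforce intro: V_sum)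
qed auto

text \<open>Bounded linear functionals are represented only in the limit, since \<^term>\<open>V\<close> need not be complete.\<close>

lemma riesz_sequence:
  assumes add: "\<And>x y. x \<in> V \<Longrightarrow> y \<in> V \<Longrightarrow> \<phi> (x + y) = \<phi> x + \<phi> y"
    and scale: "\<And>c x. x \<in> V \<Longrightarrow> \<phi> (c *\<^sub>C x) = c * \<phi> x"
    and bound: "\<And>x. x \<in> V \<Longrightarrow> cmod (\<phi> x) \<le> C * hnorm B x"
  obtains X where "\<And>k. X k \<in> V"
    and "\<And>k m. (hnorm B (X k - X m))\<^sup>2 \<le> 2 / (real k + 1) + 2 / (real m + 1)"
    and "\<And>v. v \<in> V \<Longrightarrow> (\<lambda>k. B (X k) v) \<longlonglongrightarrow> \<phi> v"
proof -
  \<comment> \<open>The functional whose minimizer would represent \<open>\<phi>\<close>; its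
    infimum need not be attained on \<open>V\<close>, so a minimizing sequence takes its
    place.\<close>
  define J where "J x = Re (B x x) - 2 * Re (\<phi> x)" for x
  have lower: "J x \<ge> - C\<^sup>2" if "x \<in> V" for x
  proof -
    have "Re (\<phi> x) \<le> C * hnorm B x" using bound[OF that] complex_Re_le_cmod order_trans by blast
    moreover have "(hnorm B x - C)\<^sup>2 \<ge> 0" by simp
    ultimately show ?thesis using that norm_sq[OF that]
      by (simp add: J_def power2_eq_square algebra_simps)
  qed
  define d where "d = Inf (J ` V)"
  have bdd: "bdd_below (J ` V)" using lower by (meson bdd_belowI2)
  have dle: "d \<le> J x" if "x \<in> V" for x
    unfolding d_def using that bdd by (simp add: cINF_lower)
  have "\<exists>x\<in>V. J x < d + 1 / (real k + 1)" for k
  proof (rule ccontr)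
    assume "\<not> ?thesis"
    hence "d + 1 / (real k + 1) \<le> d" unfolding d_def using V_zero
      by (intro cINF_greatest) (auto simp: not_less d_def)
    thus False by (simp add: field_simps)
  qed
  then obtain X where X: "\<And>k. X k \<in> V" "\<And>k. J (X k) < d + 1 / (real k + 1)" by metis
  have "(hnorm B (X k - X m))\<^sup>2 \<le> 2 / (real k + 1) + 2 / (real m + 1)" for k m
  proof -
    \<comment> \<open>At the midpoint, the parallelogram law bounds the distance of two
      near-minimizers by their excess over the infimum \<open>d\<close>.\<close>
    let ?m = "(1/2) *\<^sub>C (X k + X m)"
    have mV: "?m \<in> V" using X by (intro V_closed)
    have "J ?m = (Re (B (X k) (X k)) + 2 * Re (B (X k) (X m)) + Re (B (X m) (X m))) / 4
        - (Re (\<phi> (X k)) + Re (\<phi> (X m)))"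
      using X by (simp add: J_def scale_sq V_add add_sq scale add power2_eq_square norm_divide add_divide_distrib)
    hence "Re (B (X k - X m) (X k - X m)) = 2 * J (X k) + 2 * J (X m) - 4 * J ?m"
      using X by (simp add: diff_sq J_def field_simps)
    also have "\<dots> \<le> 2 / (real k + 1) + 2 / (real m + 1)"
    proof -
      have "2 / (real i + 1) = 2 * (1 / (real i + 1))" for i by simp
      thus ?thesis using X(2)[of k] X(2)[of m] dle[OF mV] by linarith
    qed
    finally show ?thesis using X by (simp add: norm_sq V_diff)
  qed
  moreover have "(\<lambda>k. B (X k) v) \<longlonglongrightarrow> \<phi> v" if v: "v \<in> V" for v
  proof -
    have re: "\<bar>Re (B (X k) v - \<phi> v)\<bar> \<le> (1 + Re (B v v)) / (2 * sqrt (real k + 1))" if v: "v \<in> V" for k v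
    proof -
      \<comment> \<open>The square of this step size is the slack 1 / (k + 1) of \<open>X k\<close>,
        which balances the two error terms of the quadratic inequality.\<close>
      let ?s = "1 / sqrt (real k + 1)"
      have s2: "?s\<^sup>2 = 1 / (real k + 1)" by (simp add: power_divide)
      have spos: "?s > 0" by simp
      have key: "t\<^sup>2 * Re (B v v) + 2 * t * Re (B (X k) v - \<phi> v) \<ge> - (1 / (real k + 1))" for t :: real
      proof -
        let ?y = "of_real t *\<^sub>C v"
        have y: "?y \<in> V" using v by (rule V_scale)
        have "d \<le> J (X k + ?y)" using X y by (intro dle V_add)
        also have "J (X k + ?y) = J (X k) + t\<^sup>2 * Re (B v v) + 2 * t * Re (B (X k) v - \<phi> v)"
          using X(1)[of k] v y scale_sq[OF v, of "of_real t"]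
          by (simp add: J_def add_sq add scale scale_right right_diff_distrib)
        finally show ?thesis using X(2)[of k] by (simp add: algebra_simps)
      qed
      have "2 * ?s * \<bar>Re (B (X k) v - \<phi> v)\<bar> \<le> ?s\<^sup>2 * Re (B v v) + ?s\<^sup>2"
      proof -
        define D s where "D = Re (B (X k) v - \<phi> v)" and "s = ?s"
        have "- s\<^sup>2 \<le> s\<^sup>2 * Re (B v v) + 2 * s * D" "- s\<^sup>2 \<le> s\<^sup>2 * Re (B v v) - 2 * s * D"
          using key[of s] key[of "- s"] s2 unfolding D_def[symmetric] s_def[symmetric] by simp_all
        thus ?thesis unfolding D_def[symmetric] s_def[symmetric] by (cases "D \<ge> 0") simp_all
      qed
      hence "?s * (2 * \<bar>Re (B (X k) v - \<phi> v)\<bar>) \<le> ?s * (?s * (1 + Re (B v v)))"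
        by (simp only: power2_eq_square distrib_left mult_1_right mult.assoc mult.left_commute add.commute)
      hence "2 * \<bar>Re (B (X k) v - \<phi> v)\<bar> \<le> ?s * (1 + Re (B v v))"
        using spos by (simp only: mult_le_cancel_left_pos)
      thus ?thesis by (simp add: field_simps)
    qed
    have lim: "(\<lambda>k. K / (2 * sqrt (real k + 1))) \<longlonglongrightarrow> 0" for K by real_asymp
    have 1: "(\<lambda>k. Re (B (X k) v - \<phi> v)) \<longlonglongrightarrow> 0"
      by (rule Lim_null_comparison[OF always_eventually lim]) (use re[OF v] in auto)
    \<comment> \<open>Imaginary parts at \<open>v\<close> are, up to sign, real parts at
      \<open>\<i> *\<^sub>C v\<close>.\<close>
    have iv: "\<i> *\<^sub>C v \<in> V" using v by (rule V_scale)
    have "Re (B (X k) (\<i> *\<^sub>C v) - \<phi> (\<i> *\<^sub>C v)) = - Im (B (X k) v - \<phi> v)" for k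
      using X v by (simp add: scale scale_right)
    hence "\<bar>Im (B (X k) v - \<phi> v)\<bar> \<le> (1 + Re (B (\<i> *\<^sub>C v) (\<i> *\<^sub>C v))) / (2 * sqrt (real k + 1))" for k
      using re[OF iv, of k] by simp
    hence 2: "(\<lambda>k. Im (B (X k) v - \<phi> v)) \<longlonglongrightarrow> 0"
      by (intro Lim_null_comparison[OF always_eventually lim]) auto
    have "(\<lambda>k. B (X k) v - \<phi> v) \<longlonglongrightarrow> 0"
      using 1 2 by (simp add: tendsto_complex_iff)
    thus ?thesis using Lim_null by blast
  qed
  ultimately show ?thesis using that X(1) by blast
qed

end

section \<open>Limits, Riesz representation and orthonormal systems in a Hilbert space\<close>

abbreviation hlim :: "'h::complex_vector inner_prod \<Rightarrow> (nat \<Rightarrow> 'h) \<Rightarrow> 'h \<Rightarrow> bool" where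
  "hlim H X x \<equiv> (\<lambda>n. hnorm H (X n - x)) \<longlonglongrightarrow> 0"

locale hilb =
  fixes H :: "'h::complex_vector inner_prod"
  assumes hilb: "hilbert_space H"
begin

lemma inner: "inner_product H"
  using hilb by (simp add: hilbert_space_def)

lemma inner_pos: "x \<noteq> 0 \<Longrightarrow> Re (H x x) > 0"
  using inner unfolding inner_product_def by blast

sublocale psd_form UNIV H
proof
  show sc: "H x (c *\<^sub>C y) = c * H x y" for c x y using inner unfolding inner_product_def by blast
  show "Re (H x x) \<ge> 0" for x
    using inner_pos[of x] sc[of 0 0 0] by (cases "x = 0") simp_all
  show "H x (y + z) = H x y + H x z" "H y x = cnj (H x y)" for x y z
    using inner unfolding inner_product_def by blast+
qed (rule cvec.subspace_UNIV)

lemmas lin = bilin[simplified]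

lemma norm_pos: "x \<noteq> 0 \<Longrightarrow> hnorm H x > 0"
  by (simp add: hnorm_def inner_pos)

lemma norm_eq_0 [simp]: "hnorm H x = 0 \<longleftrightarrow> x = 0"
  using norm_pos[of x] by (cases "x = 0") simp_all

lemma inner_self_eq_0: "H x x = 0 \<longleftrightarrow> x = 0"
  using self_eq[of x] by auto

lemma metric: "Metric_space UNIV (hdist H)"
proof
  show "hdist H x y = hdist H y x" for x y by (simp add: hdist_def norm_diff_commute)
  show "hdist H x z \<le> hdist H x y + hdist H y z" for x y z
    using triangle3 by (simp add: hdist_def)
qed (auto simp: hdist_def)

lemma limitin_iff: "limitin (htop H) X x sequentially \<longleftrightarrow> hlim H X x"
  unfolding htop_def Metric_space.limit_metric_sequentially[OF metric] LIMSEQ_def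
  by (simp add: hdist_def)

lemma complete:
  assumes "\<And>e. e > 0 \<Longrightarrow> \<exists>N. \<forall>m\<ge>N. \<forall>n\<ge>N. hnorm H (X m - X n) < e"
  obtains x where "hlim H X x"
proof -
  have "Metric_space.MCauchy UNIV (hdist H) X"
    unfolding Metric_space.MCauchy_def[OF metric] hdist_def using assms by (auto simp: image_subset_iff)
  then obtain x where "limitin (Metric_space.mtopology UNIV (hdist H)) X x sequentially"
    using hilb unfolding hilbert_space_def Metric_space.mcomplete_def[OF metric] by blast
  thus ?thesis using that limitin_iff htop_def by metis
qed

lemma hlim_norm: "hlim H X x \<Longrightarrow> (\<lambda>n. hnorm H (X n)) \<longlonglongrightarrow> hnorm H x"
  by (rule LIM_zero_cancel, rule Lim_null_comparison[rotated], assumption)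
     (auto simp: triangle_rev)

lemma hlim_inner:
  assumes "hlim H X x" "hlim H Y y"
  shows "(\<lambda>n. H (X n) (Y n)) \<longlonglongrightarrow> H x y"
proof (rule LIM_zero_cancel, rule Lim_null_comparison)
  show "\<forall>\<^sub>F n in sequentially. norm (H (X n) (Y n) - H x y)
      \<le> hnorm H (X n) * hnorm H (Y n - y) + hnorm H (X n - x) * hnorm H y"
  proof (rule always_eventually, rule allI)
    fix n
    have "H (X n) (Y n) - H x y = H (X n) (Y n - y) + H (X n - x) y" by (simp add: lin)
    also have "norm \<dots> \<le> cmod (H (X n) (Y n - y)) + cmod (H (X n - x) y)" by (rule norm_triangle_ineq)
    also have "\<dots> \<le> hnorm H (X n) * hnorm H (Y n - y) + hnorm H (X n - x) * hnorm H y"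
      by (intro add_mono cauchy_schwarz) auto
    finally show "norm (H (X n) (Y n) - H x y)
      \<le> hnorm H (X n) * hnorm H (Y n - y) + hnorm H (X n - x) * hnorm H y" .
  qed
  have "(\<lambda>n. hnorm H (X n) * hnorm H (Y n - y) + hnorm H (X n - x) * hnorm H y)
      \<longlonglongrightarrow> hnorm H x * 0 + 0 * hnorm H y"
    by (intro tendsto_intros hlim_norm assms)
  thus "(\<lambda>n. hnorm H (X n) * hnorm H (Y n - y) + hnorm H (X n - x) * hnorm H y) \<longlonglongrightarrow> 0" by simp
qed

lemma hlim_const: "hlim H (\<lambda>n. x) x" by simp

lemma hlim_unique:
  assumes "hlim H X x" "hlim H X y" shows "x = y"
proof -
  have "H x (x - y) = H y (x - y)"
    using LIMSEQ_unique hlim_inner[OF assms(1) hlim_const] hlim_inner[OF assms(2) hlim_const] by blast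
  hence "H (x - y) (x - y) = 0" by (simp only: diff_left UNIV_I) simp
  thus ?thesis by (simp add: inner_self_eq_0)
qed

lemma hlim_add: "hlim H X x \<Longrightarrow> hlim H Y y \<Longrightarrow> hlim H (\<lambda>n. X n + Y n) (x + y)"
proof (rule Lim_null_comparison)
  assume "hlim H X x" "hlim H Y y"
  from tendsto_add[OF this]
  show "(\<lambda>n. hnorm H (X n - x) + hnorm H (Y n - y)) \<longlonglongrightarrow> 0" by simp
  show "\<forall>\<^sub>F n in sequentially. norm (hnorm H (X n + Y n - (x + y))) \<le> hnorm H (X n - x) + hnorm H (Y n - y)"
    using triangle[of "X _ - x" "Y _ - y"] by (auto simp: algebra_simps)
qed

lemma hlim_scale: "hlim H X x \<Longrightarrow> hlim H (\<lambda>n. c *\<^sub>C X n) (c *\<^sub>C x)"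
  using tendsto_mult_left[of "\<lambda>n. hnorm H (X n - x)" 0 sequentially "cmod c"]
  by (simp add: norm_scale flip: cvec.scale_right_diff_distrib)

lemma hlim_diff: "hlim H X x \<Longrightarrow> hlim H Y y \<Longrightarrow> hlim H (\<lambda>n. X n - Y n) (x - y)"
  using hlim_add[of X x "\<lambda>n. (-1) *\<^sub>C Y n" "(-1) *\<^sub>C y"] hlim_scale[of Y y "-1"]
  by (simp add: cvec.scale_minus_left)

text \<open>Minimizing sequences, partial sums of orthogonal series and L2 approximations all
  deliver the Cauchy property in this squared form.\<close>

lemma complete_sq:
  assumes "\<And>k m. (hnorm H (X k - X m))\<^sup>2 \<le> D k + D m" and "D \<longlonglongrightarrow> 0"
  obtains x where "hlim H X x"
proof (rule complete)
  fix e :: real assume e: "e > 0"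
  hence "e\<^sup>2 / 2 > 0" by simp
  with assms(2) obtain N where N: "\<And>n. n \<ge> N \<Longrightarrow> \<bar>D n\<bar> < e\<^sup>2 / 2"
    by (metis LIMSEQ_D real_norm_def diff_zero)
  have "hnorm H (X m - X n) < e" if "m \<ge> N" "n \<ge> N" for m n
  proof -
    have "(hnorm H (X m - X n))\<^sup>2 < e\<^sup>2"
      using assms(1)[of m n] N[OF that(1)] N[OF that(2)] by linarith
    thus ?thesis using e by (simp add: power2_less_imp_less)
  qed
  thus "\<exists>N. \<forall>m\<ge>N. \<forall>n\<ge>N. hnorm H (X m - X n) < e" by blast
qed (use that in blast)

lemma riesz:
  assumes add: "\<And>x y. \<phi> (x + y) = \<phi> x + \<phi> y"
    and scale: "\<And>c x. \<phi> (c *\<^sub>C x) = c * \<phi> x"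
    and bound: "\<And>x. cmod (\<phi> x) \<le> C * hnorm H x"
  obtains w where "\<And>x. \<phi> x = H w x"
proof -
  obtain X where X: "\<And>k m. (hnorm H (X k - X m))\<^sup>2 \<le> 2 / (real k + 1) + 2 / (real m + 1)"
    "\<And>v. (\<lambda>k. H (X k) v) \<longlonglongrightarrow> \<phi> v"
    by (rule riesz_sequence[of \<phi> C]) (use assms in blast)+
  have "(\<lambda>k. 2 / (real k + 1)) \<longlonglongrightarrow> 0" by real_asymp
  with X(1) obtain w where w: "hlim H X w" by (rule complete_sq)
  have "\<phi> v = H w v" for v
    using LIMSEQ_unique[OF X(2) hlim_inner[OF w hlim_const]] .
  thus ?thesis using that by blast
qed

lemma eqI: "(\<And>x. H x u = H x v) \<Longrightarrow> u = v"
  using inner_self_eq_0[of "u - v"] by (simp add: lin)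

text \<open>Riesz is applied to the conjugate of \<open>b x y\<close>, since \<open>b\<close> is
  conjugate linear in \<open>x\<close>; linearity of \<open>T\<close> then follows from uniqueness
  of representers.\<close>

lemma bounded_form_operator:
  assumes addl: "\<And>x y z. b (x + y) z = b x z + b y z"
    and scalel: "\<And>c x y. b (c *\<^sub>C x) y = cnj c * b x y"
    and addr: "\<And>x y z. b x (y + z) = b x y + b x z"
    and scaler: "\<And>c x y. b x (c *\<^sub>C y) = c * b x y"
    and bound: "\<And>x y. cmod (b x y) \<le> C * hnorm H x * hnorm H y"
  obtains T where "Vector_Spaces.linear scaleC scaleC T" "\<And>x y. b x y = H x (T y)"
proof -
  have "\<exists>w. \<forall>x. b x y = H x w" for y
  proof -
    obtain w where w: "\<And>x. cnj (b x y) = H w x"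
      by (rule riesz[of "\<lambda>x. cnj (b x y)" "C * hnorm H y"])
         (use bound[of _ y] in \<open>simp_all add: addl scalel mult_ac\<close>)
    have "b x y = H x w" for x
      using herm[of x w] w[of x] by (simp add: complex_cnj_cnj[symmetric] del: complex_cnj_cnj)
    thus ?thesis by blast
  qed
  then obtain T where T: "\<And>x y. b x y = H x (T y)" by metis
  have "Vector_Spaces.linear scaleC scaleC T"
    by (intro Vector_Spaces.linear_iff[THEN iffD2] conjI allI eqI)
       (auto simp: cvec.vector_space_axioms lin addr scaler simp flip: T)
  thus ?thesis using T that by blast
qed

lemma pythagoras: "H x y = 0 \<Longrightarrow> (hnorm H (x + y))\<^sup>2 = (hnorm H x)\<^sup>2 + (hnorm H y)\<^sup>2"
  by (simp add: norm_sq add_sq)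

lemma orthonormal_sum_sq:
  assumes "finite I" "\<And>i j. i \<in> I \<Longrightarrow> j \<in> I \<Longrightarrow> H (e i) (e j) = (if i = j then 1 else 0)"
  shows "(hnorm H (\<Sum>i\<in>I. c i *\<^sub>C e i))\<^sup>2 = (\<Sum>i\<in>I. (cmod (c i))\<^sup>2)"
proof -
  have "H (\<Sum>i\<in>I. c i *\<^sub>C e i) y = (\<Sum>i\<in>I. cnj (c i) * H (e i) y)" for y
    by (simp add: sum_left lin)
  hence "H (\<Sum>i\<in>I. c i *\<^sub>C e i) (\<Sum>i\<in>I. c i *\<^sub>C e i) = (\<Sum>i\<in>I. \<Sum>j\<in>I. cnj (c i) * (c j * H (e i) (e j)))"
    by (simp add: sum_right lin sum_distrib_left)
  also have "\<dots> = (\<Sum>i\<in>I. \<Sum>j\<in>I. if i = j then cnj (c i) * c j else 0)"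
    using assms(2) by (intro sum.cong refl) auto
  also have "\<dots> = (\<Sum>i\<in>I. of_real ((cmod (c i))\<^sup>2))"
    using assms(1) by (intro sum.cong refl) (simp add: complex_norm_square mult.commute del: of_real_power)
  finally show ?thesis by (simp add: norm_sq flip: of_real_sum)
qed

lemma orthonormal_inner_sum:
  assumes "finite I" "\<And>i j. i \<in> I \<Longrightarrow> j \<in> I \<Longrightarrow> H (e i) (e j) = (if i = j then 1 else 0)" "k \<in> I"
  shows "H (e k) (\<Sum>i\<in>I. c i *\<^sub>C e i) = c k"
proof -
  have "H (e k) (\<Sum>i\<in>I. c i *\<^sub>C e i) = (\<Sum>i\<in>I. if k = i then c i else 0)"
    unfolding sum_right[OF UNIV_I UNIV_I]
  proof (rule sum.cong[OF refl])
    show "H (e k) (c i *\<^sub>C e i) = (if k = i then c i else 0)" if "i \<in> I" for i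
      using assms(2)[OF assms(3) that] by (simp add: scale_right)
  qed
  thus ?thesis using assms by simp
qed

lemma bessel:
  assumes "finite I" "\<And>i j. i \<in> I \<Longrightarrow> j \<in> I \<Longrightarrow> H (e i) (e j) = (if i = j then 1 else 0)"
  shows "(\<Sum>i\<in>I. (cmod (H (e i) x))\<^sup>2) \<le> (hnorm H x)\<^sup>2"
proof -
  let ?p = "\<Sum>i\<in>I. H (e i) x *\<^sub>C e i"
  have "H (e k) (x - ?p) = 0" if "k \<in> I" for k
    using orthonormal_inner_sum[OF assms that] by (simp add: lin)
  hence "H ?p (x - ?p) = 0" by (simp add: sum_left scale_left)
  from pythagoras[OF this] have "(hnorm H x)\<^sup>2 = (hnorm H ?p)\<^sup>2 + (hnorm H (x - ?p))\<^sup>2" by simp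
  thus ?thesis using orthonormal_sum_sq[OF assms] by simp
qed

end

section \<open>Integration with respect to a projection valued measure\<close>

context hilb
begin

text \<open>The coefficient of \<open>H x y\<close> in the k-th term is the squared modulus of
  \<open>\<i> ^ k\<close>, hence 1; the other terms carry the sum of the \<open>\<i> ^ k\<close> or
  of their squares, and both vanish. The convention is that of
  \<open>spectral_integral\<close>.\<close>

lemma polarization:
  "H x y = (1/4) * (\<Sum>k<4. \<i> ^ k * of_real ((hnorm H (y + \<i> ^ k *\<^sub>C x))\<^sup>2))"
proof -
  have "\<i> ^ k * of_real ((hnorm H (y + \<i> ^ k *\<^sub>C x))\<^sup>2)
      = \<i> ^ k * (H y y + H x x * (cnj (\<i> ^ k) * \<i> ^ k)) + (\<i> ^ k * \<i> ^ k) * H y x + (\<i> ^ k * cnj (\<i> ^ k)) * H x y" for k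
    unfolding self_eq[OF UNIV_I, symmetric] by (simp add: lin algebra_simps del: complex_cnj_power)
  thus ?thesis by (simp add: eval_nat_numeral)
qed

end

locale pvm = hilb H for H :: "'h::complex_vector inner_prod" +
  fixes E :: "real set \<Rightarrow> 'h \<Rightarrow> 'h"
  assumes pvm: "projection_valued_measure H E"
begin

lemma E_lin: "S \<in> sets borel \<Longrightarrow> Vector_Spaces.linear scaleC scaleC (E S)"
  and E_idem: "S \<in> sets borel \<Longrightarrow> E S (E S x) = E S x"
  and E_sym: "S \<in> sets borel \<Longrightarrow> H (E S x) y = H x (E S y)"
  and E_UNIV [simp]: "E UNIV x = x"
  and E_inter: "S \<in> sets borel \<Longrightarrow> T \<in> sets borel \<Longrightarrow> E S (E T x) = E (S \<inter> T) x"
  using pvm by (auto simp: projection_valued_measure_def)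

lemma E_add: "S \<in> sets borel \<Longrightarrow> E S (x + y) = E S x + E S y"
  and E_scale: "S \<in> sets borel \<Longrightarrow> E S (c *\<^sub>C x) = c *\<^sub>C E S x"
  using E_lin[of S] by (auto simp: Vector_Spaces.linear_iff)

lemma E_zero: "S \<in> sets borel \<Longrightarrow> E S 0 = 0"
  using E_scale[of S 0 0] by simp

lemma E_sum: "S \<in> sets borel \<Longrightarrow> E S (sum f I) = (\<Sum>i\<in>I. E S (f i))"
  by (induction I rule: infinite_finite_induct) (auto simp: E_add E_zero)

lemma E_sigma_additive:
  "range F \<subseteq> sets borel \<Longrightarrow> disjoint_family F \<Longrightarrow> hlim H (\<lambda>n. \<Sum>k<n. E (F k) x) (E (\<Union>k. F k) x)"
  for F :: "nat \<Rightarrow> real set"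
  using pvm limitin_iff by (auto simp: projection_valued_measure_def)

text \<open>The partial sums of the constant family \<open>{}\<close> converge, so their increments
  tend to 0, and every increment is \<open>E {} x\<close>.\<close>

lemma E_empty [simp]: "E {} x = 0"
proof -
  have 1: "hlim H (\<lambda>n. \<Sum>k<n. E {} x) (E {} x)"
    using E_sigma_additive[of "\<lambda>_. {}" x] by (simp add: disjoint_family_on_def)
  have "hlim H (\<lambda>n. (\<Sum>k<Suc n. E {} x) - (\<Sum>k<n. E {} x)) (E {} x - E {} x)"
    using hlim_diff[OF LIMSEQ_Suc[OF 1] 1] .
  hence "hlim H (\<lambda>n. E {} x) 0" by simp
  from hlim_unique[OF this hlim_const] show ?thesis by simp
qed

lemma E_norm: "S \<in> sets borel \<Longrightarrow> H x (E S x) = of_real ((hnorm H (E S x))\<^sup>2)"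
  using E_sym[of S x "E S x"] self_eq[of "E S x"] by (simp add: E_idem)

abbreviation mu :: "'h \<Rightarrow> real measure" where
  "mu \<equiv> scalar_spectral_measure H E"

lemma sets_mu [simp, measurable_cong]: "sets (mu x) = sets borel"
  unfolding scalar_spectral_measure_def by (metis sets.sets_measure_of_eq space_borel)

lemma space_mu [simp]: "space (mu x) = UNIV"
  using sets_eq_imp_space_eq[OF sets_mu] by simp

lemma emeasure_mu:
  assumes "S \<in> sets borel"
  shows "emeasure (mu x) S = ennreal ((hnorm H (E S x))\<^sup>2)"
proof -
  let ?m = "\<lambda>S. ennreal (Re (H x (E S x)))"
  have m: "Re (H x (E S x)) = (hnorm H (E S x))\<^sup>2" if "S \<in> sets borel" for S
    using E_norm[OF that] by simp
  have "countably_additive (sets borel) ?m"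
  proof (rule countably_additiveI)
    fix F :: "nat \<Rightarrow> real set" assume F: "range F \<subseteq> sets borel" "disjoint_family F"
    have Fk: "F k \<in> sets borel" for k using F by auto
    have "(\<lambda>n. H x (\<Sum>k<n. E (F k) x)) \<longlonglongrightarrow> H x (E (\<Union>k. F k) x)"
      using hlim_inner[OF hlim_const E_sigma_additive[OF F]] .
    hence "(\<lambda>n. Re (H x (\<Sum>k<n. E (F k) x))) \<longlonglongrightarrow> Re (H x (E (\<Union>k. F k) x))" by (rule tendsto_Re)
    hence "(\<lambda>k. Re (H x (E (F k) x))) sums Re (H x (E (\<Union>k. F k) x))"
      by (simp add: sums_def sum_right)
    thus "(\<Sum>k. ?m (F k)) = ?m (\<Union>k. F k)"
      by (rule suminf_ennreal_eq[rotated]) (simp add: m Fk)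
  qed
  hence "emeasure (mu x) S = ?m S"
    unfolding scalar_spectral_measure_def using assms
    by (intro emeasure_measure_of_sigma)
       (auto simp: positive_def zero_right, metis sets.sigma_algebra_axioms space_borel)
  thus ?thesis using m[OF assms] by simp
qed

lemma finite_measure_mu: "finite_measure (mu x)"
  by (rule finite_measureI) (simp add: emeasure_mu)

lemma measure_mu: "S \<in> sets borel \<Longrightarrow> measure (mu x) S = (hnorm H (E S x))\<^sup>2"
  by (simp add: measure_def emeasure_mu)

text \<open>On the diagonal this is additivity of the scalar measures; polarization carries it to
  arbitrary pairs of vectors.\<close>

lemma E_additive:
  assumes S: "S \<in> sets borel" and T: "T \<in> sets borel" and "S \<inter> T = {}"
  shows "E (S \<union> T) x = E S x + E T x"
proof (rule eqI)
  fix y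
  interpret finite_measure "mu z" for z by (rule finite_measure_mu)
  have "(hnorm H (E (S \<union> T) z))\<^sup>2 = (hnorm H (E S z))\<^sup>2 + (hnorm H (E T z))\<^sup>2" for z
    using finite_measure_Union[of S z T] assms by (simp add: measure_mu)
  hence eqz: "H z (E (S \<union> T) z) = H z (E S z) + H z (E T z)" for z
    using E_norm[of "S \<union> T" z] E_norm[of S z] E_norm[of T z] assms by simp
  have pol: "H y (E R x) = (1/4) * (\<Sum>k<4. \<i> ^ k * H (x + \<i> ^ k *\<^sub>C y) (E R (x + \<i> ^ k *\<^sub>C y)))"
    if R: "R \<in> sets borel" for R
  proof -
    have "of_real ((hnorm H (E R x + c *\<^sub>C E R y))\<^sup>2) = H (x + c *\<^sub>C y) (E R (x + c *\<^sub>C y))" for c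
      using E_norm[OF R, of "x + c *\<^sub>C y"] R by (simp add: E_add E_scale)
    thus ?thesis using polarization[of "E R y" "E R x"] R by (simp only: E_sym E_idem)
  qed
  have "H y (E (S \<union> T) x) = H y (E S x) + H y (E T x)"
    unfolding pol[OF S] pol[OF T] pol[OF sets.Un[OF S T]] eqz
    by (simp only: distrib_left sum.distrib)
  thus "H y (E (S \<union> T) x) = H y (E S x + E T x)" by (simp only: add_right UNIV_I)
qed

lemma E_Compl: "S \<in> sets borel \<Longrightarrow> E (- S) x = x - E S x"
  using E_additive[of S "- S" x] by (metis Compl_disjoint E_UNIV Compl_partition add_diff_cancel_left' borel_comp)

lemma AE_mu:
  assumes "S \<in> sets borel" "E (- S) x = 0" shows "AE t in mu x. t \<in> S"
  using assms by (intro AE_I'[where N = "- S"]) (auto simp: null_sets_def emeasure_mu)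

lemma E_null_of_AE:
  assumes "S \<in> sets borel" "AE t in mu x. t \<notin> S" shows "E S x = 0"
proof -
  have "emeasure (mu x) S = 0"
    using assms by (subst (asm) AE_iff_measurable[where N = S]) auto
  thus ?thesis using assms by (simp add: emeasure_mu)
qed

lemma E_mono_zero:
  assumes "S \<in> sets borel" "T \<in> sets borel" "S \<subseteq> T" "E T x = 0" shows "E S x = 0"
  using E_inter[of S T x] assms by (simp add: Int_absorb2 E_zero)

section \<open>Operators of simple functions\<close>

definition sop :: "(real \<Rightarrow> real) \<Rightarrow> 'h \<Rightarrow> 'h" where
  "sop r y = (\<Sum>c\<in>range r. of_real c *\<^sub>C E (r -` {c}) y)"

lemma simple_vimage [simp]: "simple_function borel r \<Longrightarrow> r -` {c} \<in> sets borel" for r :: "real \<Rightarrow> real"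
  using simple_functionD(2)[of borel r "{c}"] by simp

lemma simple_finite [simp]: "simple_function borel r \<Longrightarrow> finite (range r)" for r :: "real \<Rightarrow> real"
  using simple_functionD(1)[of borel r] by simp

lemma simple_measurable: "simple_function borel r \<Longrightarrow> r \<in> borel_measurable borel" for r :: "real \<Rightarrow> real"
  by (rule borel_measurable_simple_function)

lemma simple_bounded:
  fixes r :: "real \<Rightarrow> real"
  assumes "simple_function borel r" shows "\<exists>B. \<forall>t. \<bar>r t\<bar> \<le> B"
proof (intro exI allI)
  show "\<bar>r t\<bar> \<le> Max ((\<lambda>c. \<bar>c\<bar>) ` range r)" for t using assms by (intro Max_ge) auto
qed

lemma integrable_bounded:
  fixes f :: "real \<Rightarrow> real"
  assumes "f \<in> borel_measurable borel" "\<And>t. \<bar>f t\<bar> \<le> B" shows "integrable (mu x) f"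
proof -
  interpret finite_measure "mu x" by (rule finite_measure_mu)
  show ?thesis by (rule integrable_const_bound[of _ B]) (use assms in auto)
qed

lemma integrable_simple: "simple_function borel r \<Longrightarrow> integrable (mu x) r" for r :: "real \<Rightarrow> real"
  by (metis simple_bounded integrable_bounded simple_measurable)

lemma integrable_indicator_mu [simp]: "S \<in> sets borel \<Longrightarrow> integrable (mu x) (indicat_real S)"
  by (rule integrable_bounded[of _ 1]) auto

lemma integral_simple:
  fixes r :: "real \<Rightarrow> real"
  assumes r: "simple_function borel r"
  shows "integral\<^sup>L (mu x) r = (\<Sum>c\<in>range r. c * (hnorm H (E (r -` {c}) x))\<^sup>2)"
proof -
  interpret finite_measure "mu x" by (rule finite_measure_mu)
  have rt: "r t = (\<Sum>c\<in>range r. c * indicator (r -` {c}) t)" for t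
  proof -
    have "(\<Sum>c\<in>range r. c * indicator (r -` {c}) t) = (\<Sum>c\<in>range r. if r t = c then c else 0)"
      by (intro sum.cong) (auto simp: indicator_def)
    thus ?thesis using r by simp
  qed
  have "integral\<^sup>L (mu x) r = (\<integral>t. (\<Sum>c\<in>range r. c * indicator (r -` {c}) t) \<partial>mu x)"
    by (rule Bochner_Integration.integral_cong[OF refl], rule rt)
  also have "\<dots> = (\<Sum>c\<in>range r. c * measure (mu x) (r -` {c}))"
    using r by (subst Bochner_Integration.integral_sum) (auto intro!: integrable_mult_right)
  finally show ?thesis using r by (simp add: measure_mu)
qed

lemma sop_sym: "simple_function borel r \<Longrightarrow> H (sop r x) y = H x (sop r y)"
  by (simp add: sop_def sum_left sum_right lin E_sym)

lemma sop_add: "simple_function borel r \<Longrightarrow> sop r (x + y) = sop r x + sop r y"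
  by (simp add: sop_def E_add cvec.scale_right_distrib sum.distrib)

lemma sop_scale: "simple_function borel r \<Longrightarrow> sop r (c *\<^sub>C x) = c *\<^sub>C sop r x"
  by (simp add: sop_def E_scale cvec.scale_sum_right mult.commute)

lemma sop_minus: "simple_function borel r \<Longrightarrow> sop r (x - y) = sop r x - sop r y"
  using sop_add[of r x "- y"] sop_scale[of r "-1" y] by simp

lemma inner_sop: "simple_function borel r \<Longrightarrow> H x (sop r x) = of_real (integral\<^sup>L (mu x) r)"
  by (simp add: integral_simple sop_def sum_right lin E_norm)

text \<open>The formula inside \<open>spectral_integral\<close>. It involves only positive scalar
  measures, so dominated convergence applies to it term by term.\<close>

definition pint :: "(real \<Rightarrow> real) \<Rightarrow> 'h \<Rightarrow> 'h \<Rightarrow> complex" where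
  "pint f x y = (1/4) * (\<Sum>k<4. \<i> ^ k * of_real (integral\<^sup>L (mu (y + \<i> ^ k *\<^sub>C x)) f))"

lemma pint_simple:
  assumes r: "simple_function borel r" shows "pint r x y = H x (sop r y)"
proof -
  have pol: "H x (E S y) = (1/4) * (\<Sum>k<4. \<i> ^ k * of_real ((hnorm H (E S (y + \<i> ^ k *\<^sub>C x)))\<^sup>2))"
    if "S \<in> sets borel" for S
    using polarization[of "E S x" "E S y"] that by (simp add: E_sym E_idem E_add E_scale)
  have "H x (sop r y) = (\<Sum>c\<in>range r. of_real c * H x (E (r -` {c}) y))"
    by (simp add: sop_def sum_right lin)
  also have "\<dots> = (\<Sum>c\<in>range r. of_real c * ((1/4) * (\<Sum>k<4. \<i> ^ k * of_real ((hnorm H (E (r -` {c}) (y + \<i> ^ k *\<^sub>C x)))\<^sup>2))))"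
    by (intro sum.cong refl arg_cong2[where f = "(*)"] pol simple_vimage r)
  also have "\<dots> = (1/4) * (\<Sum>k<4. \<i> ^ k * (\<Sum>c\<in>range r. of_real c * of_real ((hnorm H (E (r -` {c}) (y + \<i> ^ k *\<^sub>C x)))\<^sup>2)))"
    unfolding sum_distrib_left by (subst sum.swap) (simp add: mult_ac)
  also have "\<dots> = pint r x y" unfolding pint_def integral_simple[OF r] by simp
  finally show ?thesis ..
qed

text \<open>Preimages of different values are disjoint and their projections have orthogonal ranges,
  so mixed terms vanish: this is the isometry with L2 of \<open>mu y\<close>.\<close>

lemma norm_sop:
  assumes r: "simple_function borel r"
  shows "(hnorm H (sop r y))\<^sup>2 = (\<integral>t. (r t)\<^sup>2 \<partial>mu y)"
proof -
  have r2: "simple_function borel (\<lambda>t. (r t)\<^sup>2)" using r by (rule simple_function_compose1)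
  have orth: "H (E (r -` {c}) y) (E (r -` {d}) y) = (if c = d then of_real ((hnorm H (E (r -` {c}) y))\<^sup>2) else 0)" for c d
  proof (cases "c = d")
    case True thus ?thesis using r by (simp add: E_sym E_inter E_norm)
  next
    case False
    hence "r -` {c} \<inter> r -` {d} = {}" by auto
    thus ?thesis using r False by (simp add: E_sym E_inter zero_right)
  qed
  have A: "H (sop r y) z = (\<Sum>c\<in>range r. of_real c * H (E (r -` {c}) y) z)" for z
    by (simp add: sop_def sum_left lin)
  have B: "H z (sop r y) = (\<Sum>c\<in>range r. of_real c * H z (E (r -` {c}) y))" for z
    by (simp add: sop_def sum_right lin)
  have "H (sop r y) (sop r y) = (\<Sum>c\<in>range r. \<Sum>d\<in>range r. of_real c * (of_real d * (if c = d then of_real ((hnorm H (E (r -` {c}) y))\<^sup>2) else 0)))"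
    unfolding A unfolding B orth sum_distrib_left ..
  also have "\<dots> = (\<Sum>c\<in>range r. of_real (c\<^sup>2 * (hnorm H (E (r -` {c}) y))\<^sup>2))"
    using r by (intro sum.cong refl) (simp add: if_distrib power2_eq_square cong: if_cong)
  also have "\<dots> = of_real (\<Sum>c\<in>range r. c\<^sup>2 * measure (mu y) (r -` {c}))"
    using r by (simp add: measure_mu)
  also have "(\<Sum>c\<in>range r. c\<^sup>2 * measure (mu y) (r -` {c})) = (\<integral>t. (r t)\<^sup>2 \<partial>mu y)"
  proof -
    interpret finite_measure "mu y" by (rule finite_measure_mu)
    have rt: "(r t)\<^sup>2 = (\<Sum>c\<in>range r. c\<^sup>2 * indicator (r -` {c}) t)" for t
    proof -
      have "(\<Sum>c\<in>range r. c\<^sup>2 * indicator (r -` {c}) t) = (\<Sum>c\<in>range r. if r t = c then c\<^sup>2 else 0)"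
        by (intro sum.cong) (auto simp: indicator_def)
      thus ?thesis using r by simp
    qed
    have "(\<integral>t. (r t)\<^sup>2 \<partial>mu y) = (\<integral>t. (\<Sum>c\<in>range r. c\<^sup>2 * indicator (r -` {c}) t) \<partial>mu y)"
      by (rule Bochner_Integration.integral_cong[OF refl], rule rt)
    also have "\<dots> = (\<Sum>c\<in>range r. c\<^sup>2 * measure (mu y) (r -` {c}))"
      using r by (subst Bochner_Integration.integral_sum) (auto intro!: integrable_mult_right)
    finally show ?thesis ..
  qed
  finally show ?thesis by (simp add: norm_sq del: of_real_sum)
qed

lemma sop_diff_fun:
  assumes "simple_function borel r" "simple_function borel s"
  shows "sop (\<lambda>t. r t - s t) y = sop r y - sop s y"
proof (rule eqI)
  fix x
  have "simple_function borel (\<lambda>t. r t - s t)" using assms by (rule simple_function_diff)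
  hence "H x (sop (\<lambda>t. r t - s t) y) = pint (\<lambda>t. r t - s t) x y" by (simp add: pint_simple)
  also have "\<dots> = pint r x y - pint s x y"
    using assms by (simp add: pint_def integrable_simple right_diff_distrib sum_subtractf)
  finally show "H x (sop (\<lambda>t. r t - s t) y) = H x (sop r y - sop s y)"
    using assms by (simp add: pint_simple lin)
qed

lemma inner_sop_sop:
  assumes r: "simple_function borel r"
  shows "H (sop r x) (sop r y) = H x (sop (\<lambda>t. (r t)\<^sup>2) y)"
proof -
  have r2: "simple_function borel (\<lambda>t. (r t)\<^sup>2)" using r by (rule simple_function_compose1)
  have "H (sop r x) (sop r y) = pint (\<lambda>t. (r t)\<^sup>2) x y"
    unfolding polarization[of "sop r x"] pint_def
    using norm_sop[OF r, of "y + _ *\<^sub>C x"] r by (simp add: sop_add sop_scale)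
  thus ?thesis using r2 by (simp add: pint_simple)
qed

section \<open>Approximation in L2 and domains of spectral integrals\<close>

text \<open>Domination by a multiple of \<open>f\<close> itself makes one sequence work in L2 of
  \<open>mu y\<close> for every \<open>y\<close> in \<open>sdom f\<close>, and lets its squares
  approximate the square of \<open>f\<close> in the same sense.\<close>

definition approx_seq :: "(real \<Rightarrow> real) \<Rightarrow> (nat \<Rightarrow> real \<Rightarrow> real) \<Rightarrow> bool" where
  "approx_seq f r \<longleftrightarrow> f \<in> borel_measurable borel \<and> (\<forall>i. simple_function borel (r i)) \<and>
     (\<forall>t. (\<lambda>i. r i t) \<longlonglongrightarrow> f t) \<and> (\<exists>C. \<forall>i t. \<bar>r i t\<bar> \<le> C * \<bar>f t\<bar>)"

lemma approx_seqD:
  assumes "approx_seq f r"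
  shows "f \<in> borel_measurable borel" "simple_function borel (r i)" "(\<lambda>i. r i t) \<longlonglongrightarrow> f t"
    "r i \<in> borel_measurable borel" "\<exists>C\<ge>0. \<forall>i t. \<bar>r i t\<bar> \<le> C * \<bar>f t\<bar>"
proof -
  show "\<exists>C\<ge>0. \<forall>i t. \<bar>r i t\<bar> \<le> C * \<bar>f t\<bar>"
  proof -
    obtain C where "\<forall>i t. \<bar>r i t\<bar> \<le> C * \<bar>f t\<bar>" using assms by (auto simp: approx_seq_def)
    hence "\<bar>r i t\<bar> \<le> max C 0 * \<bar>f t\<bar>" for i t
      by (meson abs_ge_zero max.cobounded1 mult_right_mono order_trans)
    thus ?thesis by (intro exI[of _ "max C 0"]) auto
  qed
qed (use assms in \<open>auto simp: approx_seq_def intro: simple_measurable\<close>)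

lemma approx_seq_exists:
  fixes f :: "real \<Rightarrow> real"
  assumes f: "f \<in> borel_measurable borel"
  shows "\<exists>r. approx_seq f r \<and> (\<forall>i t. \<bar>r i t\<bar> \<le> 2 * \<bar>f t\<bar>)"
proof -
  obtain F where "\<And>i. simple_function borel (F i)" "\<And>x. (\<lambda>i. F i x) \<longlonglongrightarrow> f x"
      "\<And>i x. dist (F i x) 0 \<le> 2 * dist (f x) 0"
    using borel_measurable_implies_sequence_metric[OF f, of 0] by auto
  hence "approx_seq f F \<and> (\<forall>i t. \<bar>F i t\<bar> \<le> 2 * \<bar>f t\<bar>)"
    unfolding approx_seq_def using f by (auto simp: dist_norm intro!: exI[of _ 2])
  thus ?thesis by blast
qed

abbreviation sdom :: "(real \<Rightarrow> real) \<Rightarrow> 'h set" where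
  "sdom \<equiv> spectral_domain H E"

lemma sdom_int: "y \<in> sdom f \<longleftrightarrow> integrable (mu y) (\<lambda>t. (f t)\<^sup>2)"
  by (simp add: spectral_domain_def)

lemma sdom_int1:
  assumes "y \<in> sdom f" and [measurable]: "f \<in> borel_measurable borel" shows "integrable (mu y) f"
proof (rule Bochner_Integration.integrable_bound)
  show "integrable (mu y) (\<lambda>t. 1 + (f t)\<^sup>2)"
    using assms integrable_bounded[of "\<lambda>_. 1" 1 y] by (auto simp: sdom_int)
  have "\<bar>f t\<bar> \<le> 1 + (f t)\<^sup>2" for t
    using sum_squares_ge_zero[of "\<bar>f t\<bar> - 1" 1] zero_le_power2[of "\<bar>f t\<bar> - 1"]
    by (simp add: power2_diff)
  thus "AE t in mu y. norm (f t) \<le> norm (1 + (f t)\<^sup>2)" by simp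
qed simp

lemma approx_L2:
  assumes r: "approx_seq f r" and y: "y \<in> sdom f"
  shows "(\<lambda>i. \<integral>t. (r i t - f t)\<^sup>2 \<partial>mu y) \<longlonglongrightarrow> 0"
    and "integrable (mu y) (\<lambda>t. (r i t - f t)\<^sup>2)"
proof -
  obtain C where C: "C \<ge> 0" "\<And>i t. \<bar>r i t\<bar> \<le> C * \<bar>f t\<bar>" using approx_seqD(5)[OF r] by blast
  note [measurable] = approx_seqD(1,4)[OF r]
  have bd: "(r i t - f t)\<^sup>2 \<le> (C + 1)\<^sup>2 * (f t)\<^sup>2" for i t
  proof -
    have "\<bar>r i t - f t\<bar> \<le> (C + 1) * \<bar>f t\<bar>" using C(2)[of i t] abs_triangle_ineq4[of "r i t" "f t"] by (simp add: distrib_right)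
    hence "\<bar>r i t - f t\<bar>\<^sup>2 \<le> ((C + 1) * \<bar>f t\<bar>)\<^sup>2" by (intro power_mono) auto
    thus ?thesis by (simp add: power_mult_distrib)
  qed
  have w: "integrable (mu y) (\<lambda>t. (C + 1)\<^sup>2 * (f t)\<^sup>2)" using y by (simp add: sdom_int)
  show "integrable (mu y) (\<lambda>t. (r i t - f t)\<^sup>2)"
    by (rule Bochner_Integration.integrable_bound[OF w]) (use bd in auto)
  have "(\<lambda>i. \<integral>t. (r i t - f t)\<^sup>2 \<partial>mu y) \<longlonglongrightarrow> (\<integral>t. 0 \<partial>mu y)"
  proof (rule integral_dominated_convergence[OF _ _ w])
    show "AE t in mu y. (\<lambda>i. (r i t - f t)\<^sup>2) \<longlonglongrightarrow> 0"
    proof (rule AE_I2)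
      fix t show "(\<lambda>i. (r i t - f t)\<^sup>2) \<longlonglongrightarrow> 0"
        using tendsto_power[OF tendsto_diff[OF approx_seqD(3)[OF r, of t] tendsto_const], of "f t" 2] by simp
    qed
  qed (use bd in auto)
  thus "(\<lambda>i. \<integral>t. (r i t - f t)\<^sup>2 \<partial>mu y) \<longlonglongrightarrow> 0" by simp
qed

lemma sop_converges:
  assumes r: "approx_seq f r" and y: "y \<in> sdom f"
  shows "\<exists>w. hlim H (\<lambda>i. sop (r i) y) w"
proof -
  note s = approx_seqD(2)[OF r]
  let ?D = "\<lambda>i. 2 * (\<integral>t. (r i t - f t)\<^sup>2 \<partial>mu y)"
  have bd: "(hnorm H (sop (r k) y - sop (r m) y))\<^sup>2 \<le> ?D k + ?D m" for k m
  proof -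
    have sd: "simple_function borel (\<lambda>t. r k t - r m t)" by (intro simple_function_diff s)
    have "(hnorm H (sop (r k) y - sop (r m) y))\<^sup>2 = (\<integral>t. (r k t - r m t)\<^sup>2 \<partial>mu y)"
      using norm_sop[OF sd] by (simp add: sop_diff_fun s)
    also have "\<dots> \<le> (\<integral>t. 2 * (r k t - f t)\<^sup>2 + 2 * (r m t - f t)\<^sup>2 \<partial>mu y)"
    proof (rule integral_mono)
      show "integrable (mu y) (\<lambda>t. (r k t - r m t)\<^sup>2)"
        by (rule integrable_simple, rule simple_function_compose1[OF sd])
      show "(r k t - r m t)\<^sup>2 \<le> 2 * (r k t - f t)\<^sup>2 + 2 * (r m t - f t)\<^sup>2" for t
        using zero_le_power2[of "(r k t - f t) + (r m t - f t)"] by (simp add: power2_eq_square algebra_simps)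
    qed (use approx_L2(2)[OF r y] in auto)
    also have "\<dots> = ?D k + ?D m" using approx_L2(2)[OF r y] by simp
    finally show ?thesis .
  qed
  have "?D \<longlonglongrightarrow> 0" using tendsto_mult_left[OF approx_L2(1)[OF r y], of 2] by simp
  from complete_sq[OF bd this] show ?thesis by blast
qed

text \<open>Fatou's lemma converts a uniform bound on bounded operators into square integrability.
  It gives linearity and closedness of domains, where \<open>mu (x + y)\<close> cannot be computed
  from \<open>mu x\<close> and \<open>mu y\<close>.\<close>

lemma sdom_criterion:
  assumes r: "approx_seq f r" and bd: "\<And>i. hnorm H (sop (r i) y) \<le> C"
  shows "y \<in> sdom f" "(\<integral>t. (f t)\<^sup>2 \<partial>mu y) \<le> C\<^sup>2"
proof -
  note [measurable] = approx_seqD(1,4)[OF r]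
  have C: "C \<ge> 0" using bd[of 0] hnorm_ge0[OF UNIV_I] order_trans by blast
  have "(\<integral>\<^sup>+t. ennreal ((f t)\<^sup>2) \<partial>mu y) = (\<integral>\<^sup>+t. liminf (\<lambda>i. ennreal ((r i t)\<^sup>2)) \<partial>mu y)"
  proof (rule nn_integral_cong)
    fix t
    have "(\<lambda>i. ennreal ((r i t)\<^sup>2)) \<longlonglongrightarrow> ennreal ((f t)\<^sup>2)"
      by (intro tendsto_ennrealI tendsto_power approx_seqD(3)[OF r])
    thus "ennreal ((f t)\<^sup>2) = liminf (\<lambda>i. ennreal ((r i t)\<^sup>2))" by (rule lim_imp_Liminf[OF sequentially_bot, symmetric])
  qed
  also have "\<dots> \<le> liminf (\<lambda>i. \<integral>\<^sup>+t. ennreal ((r i t)\<^sup>2) \<partial>mu y)"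
    by (rule nn_integral_liminf) measurable
  also have "\<dots> \<le> ennreal (C\<^sup>2)"
  proof -
    have "(\<integral>\<^sup>+t. ennreal ((r i t)\<^sup>2) \<partial>mu y) \<le> ennreal (C\<^sup>2)" for i
    proof -
      have "integrable (mu y) (\<lambda>t. (r i t)\<^sup>2)"
        by (rule integrable_simple, rule simple_function_compose1[OF approx_seqD(2)[OF r]])
      hence "(\<integral>\<^sup>+t. ennreal ((r i t)\<^sup>2) \<partial>mu y) = ennreal ((hnorm H (sop (r i) y))\<^sup>2)"
        by (simp add: nn_integral_eq_integral norm_sop approx_seqD(2)[OF r])
      also have "\<dots> \<le> ennreal (C\<^sup>2)" by (intro ennreal_leI power_mono bd) auto
      finally show ?thesis .
    qed
    thus ?thesis by (intro Liminf_le) auto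
  qed
  finally have le: "(\<integral>\<^sup>+t. ennreal ((f t)\<^sup>2) \<partial>mu y) \<le> ennreal (C\<^sup>2)" .
  hence fin: "(\<integral>\<^sup>+t. ennreal ((f t)\<^sup>2) \<partial>mu y) < \<infinity>"
    by (metis ennreal_less_top infinity_ennreal_def order_le_less_trans)
  thus y: "y \<in> sdom f" unfolding sdom_int by (intro integrableI_nonneg) auto
  show "(\<integral>t. (f t)\<^sup>2 \<partial>mu y) \<le> C\<^sup>2"
    using le y by (simp add: sdom_int nn_integral_eq_integral)
qed

lemma norm_sop_le:
  assumes r: "approx_seq f r" and C: "C \<ge> 0" "\<And>i t. \<bar>r i t\<bar> \<le> C * \<bar>f t\<bar>" and y: "y \<in> sdom f"
  shows "hnorm H (sop (r i) y) \<le> C * sqrt (\<integral>t. (f t)\<^sup>2 \<partial>mu y)"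
proof -
  have "(hnorm H (sop (r i) y))\<^sup>2 = (\<integral>t. (r i t)\<^sup>2 \<partial>mu y)" by (rule norm_sop[OF approx_seqD(2)[OF r]])
  also have "\<dots> \<le> (\<integral>t. C\<^sup>2 * (f t)\<^sup>2 \<partial>mu y)"
  proof (rule integral_mono)
    show "integrable (mu y) (\<lambda>t. (r i t)\<^sup>2)"
      by (rule integrable_simple, rule simple_function_compose1[OF approx_seqD(2)[OF r]])
    show "(r i t)\<^sup>2 \<le> C\<^sup>2 * (f t)\<^sup>2" for t
      using power_mono[OF C(2)[of i t], of 2] by (simp add: power_mult_distrib)
  qed (use y in \<open>simp add: sdom_int\<close>)
  also have "\<dots> = (C * sqrt (\<integral>t. (f t)\<^sup>2 \<partial>mu y))\<^sup>2" by (simp add: power_mult_distrib)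
  finally show ?thesis by (rule power2_le_imp_le) (simp add: C(1))
qed

lemma sdom_subspace:
  assumes f: "f \<in> borel_measurable borel" shows "cvec.subspace (sdom f)"
proof -
  obtain r where r: "approx_seq f r" "\<And>i t. \<bar>r i t\<bar> \<le> 2 * \<bar>f t\<bar>" using approx_seq_exists[OF f] by blast
  note s = approx_seqD(2)[OF r(1)]
  note b = norm_sop_le[OF r(1) _ r(2)]
  show ?thesis
  proof (rule cvec.subspaceI)
    show "0 \<in> sdom f"
      by (rule sdom_criterion[OF r(1), of 0 0]) (simp add: sop_def E_zero s)
    fix x y assume xy: "x \<in> sdom f" "y \<in> sdom f"
    show "x + y \<in> sdom f"
    proof (rule sdom_criterion(1)[OF r(1)])
      show "hnorm H (sop (r i) (x + y)) \<le> 2 * sqrt (\<integral>t. (f t)\<^sup>2 \<partial>mu x) + 2 * sqrt (\<integral>t. (f t)\<^sup>2 \<partial>mu y)" for i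
        using triangle[of "sop (r i) x" "sop (r i) y"] b[OF _ xy(1), of i] b[OF _ xy(2), of i]
        by (simp add: sop_add s)
    qed
    show "c *\<^sub>C x \<in> sdom f" for c
    proof (rule sdom_criterion(1)[OF r(1)])
      show "hnorm H (sop (r i) (c *\<^sub>C x)) \<le> cmod c * (2 * sqrt (\<integral>t. (f t)\<^sup>2 \<partial>mu x))" for i
        using b[OF _ xy(1), of i] by (simp add: sop_scale s norm_scale mult_left_mono)
    qed
  qed
qed

lemma sdom_add: "\<lbrakk>f \<in> borel_measurable borel; x \<in> sdom f; y \<in> sdom f\<rbrakk> \<Longrightarrow> x + y \<in> sdom f"
  and sdom_scale: "\<lbrakk>f \<in> borel_measurable borel; x \<in> sdom f\<rbrakk> \<Longrightarrow> c *\<^sub>C x \<in> sdom f"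
  by (auto intro: cvec.subspace_add cvec.subspace_scale sdom_subspace)

lemma E_in_sdom_bounded:
  fixes f :: "real \<Rightarrow> real"
  assumes [measurable]: "f \<in> borel_measurable borel" "S \<in> sets borel"
    and b: "\<And>t. t \<in> S \<Longrightarrow> \<bar>f t\<bar> \<le> B"
  shows "E S y \<in> sdom f"
proof -
  interpret finite_measure "mu (E S y)" by (rule finite_measure_mu)
  have "AE t in mu (E S y). t \<in> S"
    by (rule AE_mu) (auto simp: E_inter)
  hence "AE t in mu (E S y). norm ((f t)\<^sup>2) \<le> B\<^sup>2"
  proof (rule eventually_mono)
    fix t assume "t \<in> S"
    from power_mono[OF b[OF this], of 2] show "norm ((f t)\<^sup>2) \<le> B\<^sup>2" by simp
  qed
  thus ?thesis unfolding sdom_int by (intro integrable_const_bound) auto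
qed

lemma E_increasing_limit:
  assumes F: "\<And>n. F n \<in> sets borel" "incseq F" "(\<Union>n. F n) = UNIV"
  shows "hlim H (\<lambda>n. E (F n) y) y"
proof -
  interpret finite_measure "mu y" by (rule finite_measure_mu)
  have "(\<lambda>n. measure (mu y) (- F n)) \<longlonglongrightarrow> measure (mu y) (\<Inter>n. - F n)"
    using F by (intro finite_Lim_measure_decseq) (auto simp: decseq_def incseq_def)
  also have "(\<Inter>n. - F n) = {}" using F(3) by auto
  finally have "(\<lambda>n. (hnorm H (E (- F n) y))\<^sup>2) \<longlonglongrightarrow> 0" using F by (simp add: measure_mu)
  from tendsto_real_sqrt[OF this] have "(\<lambda>n. hnorm H (E (- F n) y)) \<longlonglongrightarrow> 0" by simp
  moreover have "hnorm H (E (- F n) y) = hnorm H (E (F n) y - y)" for n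
    using F by (simp add: E_Compl norm_diff_commute)
  ultimately show ?thesis by simp
qed

text \<open>Cutting off where the modulus of \<open>f\<close> exceeds n gives vectors of the domain.
  Density is what makes the weak equation in \<open>spectral_integral\<close> determine its
  solution.\<close>

lemma sdom_dense:
  fixes f :: "real \<Rightarrow> real"
  assumes [measurable]: "f \<in> borel_measurable borel"
  shows "\<exists>Y. (\<forall>n. Y n \<in> sdom f) \<and> hlim H Y y"
proof (intro exI conjI allI)
  define F where "F n = {t. \<bar>f t\<bar> \<le> real n}" for n
  have F [measurable]: "F n \<in> sets borel" for n unfolding F_def by measurable
  show "E (F n) y \<in> sdom f" for n by (rule E_in_sdom_bounded[of _ _ "real n"]) (auto simp: F_def)
  show "hlim H (\<lambda>n. E (F n) y) y"
  proof (rule E_increasing_limit)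
    show "incseq F" by (auto simp: incseq_def F_def)
    show "(\<Union>n. F n) = UNIV" by (auto simp: F_def real_arch_simple)
  qed simp
qed

section \<open>Calculus of spectral integrals\<close>

abbreviation sint :: "(real \<Rightarrow> real) \<Rightarrow> 'h \<Rightarrow> 'h" where
  "sint f y \<equiv> the (spectral_integral H E f y)"

lemma dom_spectral_integral: "dom (spectral_integral H E f) = sdom f"
  by (auto simp: spectral_integral_def dom_def split: if_splits)

lemma spectral_integral_Some: "y \<in> sdom f \<Longrightarrow> spectral_integral H E f y = Some (sint f y)"
  by (simp add: spectral_integral_def)

text \<open>By dominated convergence the limit solves the weak equation defining
  \<open>spectral_integral\<close>; density of \<open>sdom f\<close> makes it the only solution, so
  the THE evaluates to it.\<close>

lemma sop_tendsto:
  assumes r: "approx_seq f r" and y: "y \<in> sdom f"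
  shows "hlim H (\<lambda>i. sop (r i) y) (sint f y)"
proof -
  note f = approx_seqD(1)[OF r]
  note [measurable] = f approx_seqD(4)[OF r]
  obtain C where C: "C \<ge> 0" "\<And>i t. \<bar>r i t\<bar> \<le> C * \<bar>f t\<bar>" using approx_seqD(5)[OF r] by blast
  obtain w where w: "hlim H (\<lambda>i. sop (r i) y) w" using sop_converges[OF r y] by blast
  have eq: "H x w = pint f x y" if x: "x \<in> sdom f" for x
  proof (rule LIMSEQ_unique[OF hlim_inner[OF hlim_const w]])
    have "(\<lambda>i. integral\<^sup>L (mu (y + \<i> ^ k *\<^sub>C x)) (r i)) \<longlonglongrightarrow> integral\<^sup>L (mu (y + \<i> ^ k *\<^sub>C x)) f" for k
    proof (rule integral_dominated_convergence)
      show "integrable (mu (y + \<i> ^ k *\<^sub>C x)) (\<lambda>t. C * \<bar>f t\<bar>)"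
        using f x y by (intro integrable_mult_right integrable_abs sdom_int1 sdom_add sdom_scale)
      show "AE t in mu (y + \<i> ^ k *\<^sub>C x). norm (r i t) \<le> C * \<bar>f t\<bar>" for i using C by simp
    qed (use approx_seqD(3)[OF r] in auto)
    hence "(\<lambda>i. pint (r i) x y) \<longlonglongrightarrow> pint f x y" unfolding pint_def by (intro tendsto_intros)
    thus "(\<lambda>i. H x (sop (r i) y)) \<longlonglongrightarrow> pint f x y" by (simp add: pint_simple approx_seqD(2)[OF r])
  qed
  have "sint f y = (THE w. \<forall>x\<in>sdom f. H x w = pint f x y)"
    using y by (simp add: spectral_integral_def pint_def)
  also have "\<dots> = w"
  proof (rule the_equality)
    fix v assume v: "\<forall>x\<in>sdom f. H x v = pint f x y"
    obtain Y where Y: "\<And>n. Y n \<in> sdom f" "hlim H Y (v - w)" using sdom_dense[OF f] by blast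
    have "(\<lambda>n. H (Y n) (v - w)) \<longlonglongrightarrow> H (v - w) (v - w)" by (rule hlim_inner[OF Y(2) hlim_const])
    moreover have "H (Y n) (v - w) = 0" for n using v eq Y(1) by (simp add: lin)
    ultimately have "(\<lambda>_. 0 :: complex) \<longlonglongrightarrow> H (v - w) (v - w)" by (simp only:)
    hence "H (v - w) (v - w) = 0" by (simp add: LIMSEQ_const_iff)
    thus "v = w" by (simp add: inner_self_eq_0)
  qed (use eq in auto)
  finally show ?thesis using w by simp
qed

lemma sint_unique:
  "approx_seq f r \<Longrightarrow> y \<in> sdom f \<Longrightarrow> hlim H (\<lambda>i. sop (r i) y) w \<Longrightarrow> sint f y = w"
  by (rule hlim_unique[OF sop_tendsto])

lemma norm_sint:
  assumes [measurable]: "f \<in> borel_measurable borel" and y: "y \<in> sdom f"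
  shows "(hnorm H (sint f y))\<^sup>2 = (\<integral>t. (f t)\<^sup>2 \<partial>mu y)"
proof -
  obtain r where r: "approx_seq f r" "\<And>i t. \<bar>r i t\<bar> \<le> 2 * \<bar>f t\<bar>" using approx_seq_exists[OF assms(1)] by blast
  have "(\<lambda>i. (hnorm H (sop (r i) y))\<^sup>2) \<longlonglongrightarrow> (hnorm H (sint f y))\<^sup>2"
    by (intro tendsto_power hlim_norm sop_tendsto[OF r(1) y])
  moreover have "(\<lambda>i. \<integral>t. (r i t)\<^sup>2 \<partial>mu y) \<longlonglongrightarrow> (\<integral>t. (f t)\<^sup>2 \<partial>mu y)"
  proof (rule integral_dominated_convergence)
    show "integrable (mu y) (\<lambda>t. 4 * (f t)\<^sup>2)" using y by (simp add: sdom_int)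
    show "AE t in mu y. norm ((r i t)\<^sup>2) \<le> 4 * (f t)\<^sup>2" for i
      using power_mono[OF r(2)[of i], of _ 2] by (simp add: power_mult_distrib)
    show "AE t in mu y. (\<lambda>i. (r i t)\<^sup>2) \<longlonglongrightarrow> (f t)\<^sup>2"
      by (intro AE_I2 tendsto_power approx_seqD(3)[OF r(1)])
  qed (use approx_seqD(4)[OF r(1)] in auto)
  ultimately show ?thesis using LIMSEQ_unique by (simp add: norm_sop approx_seqD(2)[OF r(1)])
qed

lemma inner_sint:
  assumes [measurable]: "f \<in> borel_measurable borel" and y: "y \<in> sdom f"
  shows "H y (sint f y) = of_real (integral\<^sup>L (mu y) f)"
proof -
  obtain r where r: "approx_seq f r" "\<And>i t. \<bar>r i t\<bar> \<le> 2 * \<bar>f t\<bar>" using approx_seq_exists[OF assms(1)] by blast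
  have "(\<lambda>i. H y (sop (r i) y)) \<longlonglongrightarrow> H y (sint f y)"
    by (intro hlim_inner[OF hlim_const] sop_tendsto[OF r(1) y])
  moreover have "(\<lambda>i. integral\<^sup>L (mu y) (r i)) \<longlonglongrightarrow> integral\<^sup>L (mu y) f"
  proof (rule integral_dominated_convergence)
    show "integrable (mu y) (\<lambda>t. 2 * \<bar>f t\<bar>)" using y by (simp add: sdom_int1)
    show "AE t in mu y. (\<lambda>i. r i t) \<longlonglongrightarrow> f t"
      by (intro AE_I2 approx_seqD(3)[OF r(1)])
  qed (use approx_seqD(4)[OF r(1)] r(2) in auto)
  hence "(\<lambda>i. complex_of_real (integral\<^sup>L (mu y) (r i))) \<longlonglongrightarrow> of_real (integral\<^sup>L (mu y) f)"
    by (rule tendsto_of_real)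
  ultimately show ?thesis using LIMSEQ_unique by (simp add: inner_sop approx_seqD(2)[OF r(1)])
qed

lemma sint_add:
  assumes f: "f \<in> borel_measurable borel" and "x \<in> sdom f" "y \<in> sdom f"
  shows "sint f (x + y) = sint f x + sint f y"
proof -
  obtain r where r: "approx_seq f r" using approx_seq_exists[OF f] by blast
  show ?thesis
    using hlim_add[OF sop_tendsto[OF r assms(2)] sop_tendsto[OF r assms(3)]] assms
    by (intro sint_unique[OF r]) (auto simp: sdom_add sop_add approx_seqD(2)[OF r])
qed

lemma sint_scale:
  assumes f: "f \<in> borel_measurable borel" and "x \<in> sdom f"
  shows "sint f (c *\<^sub>C x) = c *\<^sub>C sint f x"
proof -
  obtain r where r: "approx_seq f r" using approx_seq_exists[OF f] by blast
  show ?thesis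
    using hlim_scale[OF sop_tendsto[OF r assms(2)], of c] assms
    by (intro sint_unique[OF r]) (auto simp: sdom_scale sop_scale approx_seqD(2)[OF r])
qed

lemma sint_sym:
  assumes f: "f \<in> borel_measurable borel" and xy: "x \<in> sdom f" "y \<in> sdom f"
  shows "H (sint f x) y = H x (sint f y)"
proof -
  obtain r where r: "approx_seq f r" using approx_seq_exists[OF f] by blast
  have "(\<lambda>i. H (sop (r i) x) y) \<longlonglongrightarrow> H (sint f x) y"
    by (intro hlim_inner hlim_const sop_tendsto[OF r] xy)
  moreover have "(\<lambda>i. H x (sop (r i) y)) \<longlonglongrightarrow> H x (sint f y)"
    by (intro hlim_inner hlim_const sop_tendsto[OF r] xy)
  ultimately show ?thesis using LIMSEQ_unique by (simp add: sop_sym approx_seqD(2)[OF r])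
qed

lemma mu_AE_of_null:
  assumes "N \<in> sets borel" "\<And>x. E N x = 0" shows "AE t in mu y. t \<notin> N"
  using AE_mu[of "- N" y] assms by simp

lemma spectral_integral_cong:
  assumes [measurable]: "f \<in> borel_measurable borel" "g \<in> borel_measurable borel" "N \<in> sets borel"
    and N: "\<And>x. E N x = 0" and eq: "\<And>t. t \<notin> N \<Longrightarrow> f t = g t"
  shows "spectral_integral H E f = spectral_integral H E g"
proof -
  have ae: "AE t in mu y. f t = g t" for y
    by (rule AE_mp[OF mu_AE_of_null[OF _ N]]) (use eq in auto)
  have "sdom f = sdom g"
    unfolding set_eq_iff sdom_int
  proof
    fix y
    have "AE t in mu y. (f t)\<^sup>2 = (g t)\<^sup>2" by (rule eventually_mono[OF ae]) simp
    thus "integrable (mu y) (\<lambda>t. (f t)\<^sup>2) \<longleftrightarrow> integrable (mu y) (\<lambda>t. (g t)\<^sup>2)"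
      by (intro integrable_cong_AE) simp_all
  qed
  moreover have "integral\<^sup>L (mu y) f = integral\<^sup>L (mu y) g" for y
    by (intro integral_cong_AE ae) simp_all
  ultimately show ?thesis unfolding spectral_integral_def by (simp only:)
qed

lemma sdom_mono:
  assumes [measurable]: "g \<in> borel_measurable borel" "f \<in> borel_measurable borel"
    and le: "\<And>t. (g t)\<^sup>2 \<le> 1 + (f t)\<^sup>2" and y: "y \<in> sdom f"
  shows "y \<in> sdom g"
  unfolding sdom_int
proof (rule Bochner_Integration.integrable_bound)
  show "integrable (mu y) (\<lambda>t. 1 + (f t)\<^sup>2)"
    using y integrable_bounded[of "\<lambda>_. 1" 1 y] by (auto simp: sdom_int)
qed (use le in auto)

text \<open>With \<open>g\<close> the root of \<open>\<bar>t\<bar>\<close>, \<open>f\<close> the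
  identity and \<open>N\<close> the negative half-line, this becomes the rule
  \<open>energy_A\<close> for the energy product with an element of \<open>dom A\<close>.\<close>

lemma inner_sint_sqrt:
  assumes [measurable]: "g \<in> borel_measurable borel" "f \<in> borel_measurable borel" "N \<in> sets borel"
    and N: "\<And>x. E N x = 0" and eq: "\<And>t. t \<notin> N \<Longrightarrow> f t = (g t)\<^sup>2"
    and x: "x \<in> sdom g" and y: "y \<in> sdom g" "y \<in> sdom f"
  shows "H (sint g x) (sint g y) = H x (sint f y)"
proof -
  obtain r where r: "approx_seq g r" "\<And>i t. \<bar>r i t\<bar> \<le> 2 * \<bar>g t\<bar>" using approx_seq_exists[OF assms(1)] by blast
  have fg: "spectral_integral H E f = spectral_integral H E (\<lambda>t. (g t)\<^sup>2)"
    by (rule spectral_integral_cong[OF _ _ _ N eq]) auto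
  hence y': "y \<in> sdom (\<lambda>t. (g t)\<^sup>2)" using y(2) dom_spectral_integral by metis
  have r2: "approx_seq (\<lambda>t. (g t)\<^sup>2) (\<lambda>i t. (r i t)\<^sup>2)"
    unfolding approx_seq_def
  proof (intro conjI allI exI[of _ 4])
    show "simple_function borel (\<lambda>t. (r i t)\<^sup>2)" for i
      by (rule simple_function_compose1[OF approx_seqD(2)[OF r(1)]])
    show "(\<lambda>i. (r i t)\<^sup>2) \<longlonglongrightarrow> (g t)\<^sup>2" for t by (intro tendsto_power approx_seqD(3)[OF r(1)])
    show "\<bar>(r i t)\<^sup>2\<bar> \<le> 4 * \<bar>(g t)\<^sup>2\<bar>" for i t
      using power_mono[OF r(2)[of i t], of 2] by (simp add: power_mult_distrib)
  qed simp
  have "(\<lambda>i. H (sop (r i) x) (sop (r i) y)) \<longlonglongrightarrow> H (sint g x) (sint g y)"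
    by (intro hlim_inner sop_tendsto[OF r(1)] x y)
  moreover have "(\<lambda>i. H x (sop (\<lambda>t. (r i t)\<^sup>2) y)) \<longlonglongrightarrow> H x (sint (\<lambda>t. (g t)\<^sup>2) y)"
    by (intro hlim_inner hlim_const sop_tendsto[OF r2] y')
  ultimately show ?thesis
    using LIMSEQ_unique fg by (simp add: inner_sop_sop approx_seqD(2)[OF r(1)])
qed

text \<open>Only boundedness of the images is given, not their convergence, so this is lower
  semicontinuity. Each \<open>sop (r i)\<close> is a bounded operator and passes its bound to the
  limit; the factor 2 is the domination constant of \<open>approx_seq_exists\<close>.\<close>

lemma sdom_limit:
  assumes f: "f \<in> borel_measurable borel" and Y: "\<And>n. Y n \<in> sdom f" "hlim H Y y"
    and bd: "\<And>n. hnorm H (sint f (Y n)) \<le> C"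
  shows "y \<in> sdom f" "hnorm H (sint f y) \<le> 2 * C"
proof -
  obtain r where r: "approx_seq f r" "\<And>i t. \<bar>r i t\<bar> \<le> 2 * \<bar>f t\<bar>" using approx_seq_exists[OF f] by blast
  note s = approx_seqD(2)[OF r(1)]
  have C: "C \<ge> 0" using bd[of 0] hnorm_ge0[OF UNIV_I] order_trans by blast
  have le: "hnorm H (sop (r i) y) \<le> 2 * C" for i
  proof -
    obtain B where B: "\<And>t. \<bar>r i t\<bar> \<le> B" using simple_bounded[OF s] by blast
    hence B0: "B \<ge> 0" using abs_ge_zero order_trans by blast
    have bdd: "hnorm H (sop (r i) z) \<le> B * hnorm H z" for z
    proof -
      interpret finite_measure "mu z" by (rule finite_measure_mu)
      have "(hnorm H (sop (r i) z))\<^sup>2 = (\<integral>t. (r i t)\<^sup>2 \<partial>mu z)" by (rule norm_sop[OF s])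
      also have "\<dots> \<le> (\<integral>t. B\<^sup>2 \<partial>mu z)"
      proof (rule integral_mono)
        show "integrable (mu z) (\<lambda>t. (r i t)\<^sup>2)"
          by (rule integrable_simple, rule simple_function_compose1[OF s])
        show "(r i t)\<^sup>2 \<le> B\<^sup>2" for t using power_mono[OF B[of t], of 2] by simp
      qed simp
      also have "\<dots> = (B * hnorm H z)\<^sup>2" using measure_mu[of UNIV z] by (simp add: power_mult_distrib)
      finally show ?thesis by (rule power2_le_imp_le) (simp add: B0)
    qed
    have "hlim H (\<lambda>n. sop (r i) (Y n)) (sop (r i) y)"
    proof (rule Lim_null_comparison)
      show "(\<lambda>n. B * hnorm H (Y n - y)) \<longlonglongrightarrow> 0" using tendsto_mult_left[OF Y(2), of B] by simp
      show "\<forall>\<^sub>F n in sequentially. norm (hnorm H (sop (r i) (Y n) - sop (r i) y)) \<le> B * hnorm H (Y n - y)"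
        using bdd by (simp add: s flip: sop_minus)
    qed
    from hlim_norm[OF this] show ?thesis
    proof (rule LIMSEQ_le_const2, intro exI[of _ 0] allI impI)
      fix n
      have "hnorm H (sop (r i) (Y n)) \<le> 2 * sqrt (\<integral>t. (f t)\<^sup>2 \<partial>mu (Y n))"
        by (rule norm_sop_le[OF r(1) _ r(2) Y(1)]) simp
      also have "\<dots> = 2 * hnorm H (sint f (Y n))" using norm_sint[OF f Y(1)[of n], symmetric] by simp
      also have "\<dots> \<le> 2 * C" using bd[of n] by simp
      finally show "hnorm H (sop (r i) (Y n)) \<le> 2 * C" .
    qed
  qed
  show y: "y \<in> sdom f" using sdom_criterion(1)[OF r(1) le] .
  have "(hnorm H (sint f y))\<^sup>2 \<le> (2 * C)\<^sup>2"
    using sdom_criterion(2)[OF r(1) le] norm_sint[OF f y] by simp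
  thus "hnorm H (sint f y) \<le> 2 * C" by (rule power2_le_imp_le) (simp add: C)
qed

lemma sint_atom:
  assumes f: "f \<in> borel_measurable borel" and y: "E {a} y = y"
  shows "y \<in> sdom f" "sint f y = of_real (f a) *\<^sub>C y"
proof -
  obtain r where r: "approx_seq f r" "\<And>i t. \<bar>r i t\<bar> \<le> 2 * \<bar>f t\<bar>" using approx_seq_exists[OF f] by blast
  show dom: "y \<in> sdom f"
    using E_in_sdom_bounded[OF f, of "{a}" "\<bar>f a\<bar>" y] y by simp
  have "sop (r i) y = of_real (r i a) *\<^sub>C y" for i
  proof -
    note s = approx_seqD(2)[OF r(1), of i]
    have "E (r i -` {c}) y = (if c = r i a then y else 0)" for c
    proof -
      have "E (r i -` {c}) y = E (r i -` {c} \<inter> {a}) y" using E_inter[of "r i -` {c}" "{a}" y] s y by simp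
      also have "r i -` {c} \<inter> {a} = (if c = r i a then {a} else {})" by auto
      finally show ?thesis using y by simp
    qed
    hence "sop (r i) y = (\<Sum>c\<in>range (r i). if c = r i a then of_real c *\<^sub>C y else 0)"
      unfolding sop_def by (intro sum.cong) auto
    thus ?thesis using s by simp
  qed
  moreover have "hlim H (\<lambda>i. of_real (r i a) *\<^sub>C y) (of_real (f a) *\<^sub>C y)"
  proof -
    have "(\<lambda>i. \<bar>r i a - f a\<bar> * hnorm H y) \<longlonglongrightarrow> \<bar>f a - f a\<bar> * hnorm H y"
      by (intro tendsto_intros approx_seqD(3)[OF r(1)])
    moreover have "hnorm H (of_real (r i a) *\<^sub>C y - of_real (f a) *\<^sub>C y) = \<bar>r i a - f a\<bar> * hnorm H y" for i
      by (simp add: norm_scale flip: cvec.scale_left_diff_distrib of_real_diff)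
    ultimately show ?thesis by simp
  qed
  ultimately show "sint f y = of_real (f a) *\<^sub>C y" using sint_unique[OF r(1) dom] by simp
qed

lemma norm_sint_id_minus:
  assumes y: "y \<in> sdom (\<lambda>t. t)"
  shows "(hnorm H (sint (\<lambda>t. t) y - of_real b *\<^sub>C y))\<^sup>2 = (\<integral>t. (t - b)\<^sup>2 \<partial>mu y)"
proof -
  interpret finite_measure "mu y" by (rule finite_measure_mu)
  have i: "integrable (mu y) (\<lambda>t. t\<^sup>2)" "integrable (mu y) (\<lambda>t. t)" "integrable (mu y) (\<lambda>t. b\<^sup>2)"
    using y sdom_int1[OF y] by (auto simp: sdom_int)
  have "(\<integral>t. (t - b)\<^sup>2 \<partial>mu y) = (\<integral>t. t\<^sup>2 - (2 * b) * t + b\<^sup>2 \<partial>mu y)"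
    by (intro arg_cong[where f = "integral\<^sup>L (mu y)"] ext) (simp add: power2_diff)
  also have "\<dots> = (\<integral>t. t\<^sup>2 \<partial>mu y) - 2 * b * (\<integral>t. t \<partial>mu y) + b\<^sup>2 * (hnorm H y)\<^sup>2"
    using i measure_mu[of UNIV y] by simp
  also have "\<dots> = (hnorm H (sint (\<lambda>t. t) y))\<^sup>2 - 2 * Re (H (sint (\<lambda>t. t) y) (of_real b *\<^sub>C y)) + (hnorm H (of_real b *\<^sub>C y))\<^sup>2"
    using y inner_sint[OF _ y] Re_commute[of "sint (\<lambda>t. t) y" y]
    by (simp add: norm_sint lin norm_scale power_mult_distrib)
  also have "\<dots> = (hnorm H (sint (\<lambda>t. t) y - of_real b *\<^sub>C y))\<^sup>2"
    by (simp add: norm_sq diff_sq del: Re_complex_of_real)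
  finally show ?thesis ..
qed

text \<open>The measure \<open>mu y\<close> has zero second moment about \<open>a\<close>, so it is
  concentrated there.\<close>

lemma eigenvector_atom:
  assumes y: "y \<in> sdom (\<lambda>t. t)" "sint (\<lambda>t. t) y = of_real a *\<^sub>C y"
  shows "E {a} y = y"
proof -
  interpret finite_measure "mu y" by (rule finite_measure_mu)
  have "integrable (mu y) (\<lambda>t. t\<^sup>2)" "integrable (mu y) (\<lambda>t. t)" "integrable (mu y) (\<lambda>t. a\<^sup>2)"
    using y sdom_int1[OF y(1)] by (auto simp: sdom_int)
  hence i: "integrable (mu y) (\<lambda>t. (t - a)\<^sup>2)" by (simp add: power2_diff mult_ac)
  have "(\<integral>t. (t - a)\<^sup>2 \<partial>mu y) = 0" using norm_sint_id_minus[OF y(1), of a] y(2) by simp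
  hence "AE t in mu y. (t - a)\<^sup>2 = 0" using i by (subst (asm) integral_nonneg_eq_0_iff_AE) auto
  hence "AE t in mu y. t \<notin> - {a}" by auto
  hence "E (- {a}) y = 0" by (intro E_null_of_AE) auto
  thus ?thesis by (simp add: E_Compl)
qed

end

section \<open>The spectral measure of a positive contraction\<close>

text \<open>The spectral measures constructed here live on \<^term>\<open>{0..1 :: real}\<close>, so only the values there matter.\<close>

definition tame :: "(real \<Rightarrow> real) \<Rightarrow> bool" where
  "tame f \<longleftrightarrow> f \<in> borel_measurable borel \<and> (\<exists>B. \<forall>t\<in>{0..1}. \<bar>f t\<bar> \<le> B)"

text \<open>Stands for integration against a complex measure carried by [0,1]; the second clause is
  bounded convergence.\<close>

definition continuous_functional :: "((real \<Rightarrow> real) \<Rightarrow> complex) \<Rightarrow> bool" where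
  "continuous_functional \<Phi> \<longleftrightarrow>
     (\<forall>f g a b. tame f \<longrightarrow> tame g \<longrightarrow> \<Phi> (\<lambda>t. a * f t + b * g t) = of_real a * \<Phi> f + of_real b * \<Phi> g) \<and>
     (\<forall>F f B. (\<forall>n. F n \<in> borel_measurable borel) \<longrightarrow> f \<in> borel_measurable borel \<longrightarrow>
        (\<forall>n. \<forall>t\<in>{0..1}. \<bar>F n t\<bar> \<le> B) \<longrightarrow> (\<forall>t\<in>{0..1}. (\<lambda>n. F n t) \<longlonglongrightarrow> f t) \<longrightarrow> (\<lambda>n. \<Phi> (F n)) \<longlonglongrightarrow> \<Phi> f)"

lemma tame_bounded: "f \<in> borel_measurable borel \<Longrightarrow> (\<And>t. t \<in> {0..1} \<Longrightarrow> \<bar>f t\<bar> \<le> B) \<Longrightarrow> tame f"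
  unfolding tame_def by blast

lemma tame_lincomb: "tame f \<Longrightarrow> tame g \<Longrightarrow> tame (\<lambda>t. a * f t + b * g t)"
proof -
  assume "tame f" "tame g"
  then obtain B C where *: "f \<in> borel_measurable borel" "g \<in> borel_measurable borel"
    "\<And>t. t \<in> {0..1} \<Longrightarrow> \<bar>f t\<bar> \<le> B" "\<And>t. t \<in> {0..1} \<Longrightarrow> \<bar>g t\<bar> \<le> C" unfolding tame_def by blast
  have bd: "\<bar>a * f t + b * g t\<bar> \<le> \<bar>a\<bar> * B + \<bar>b\<bar> * C" if "t \<in> {0..1}" for t
    using abs_triangle_ineq[of "a * f t" "b * g t"] mult_left_mono[OF *(3)[OF that], of "\<bar>a\<bar>"]
      mult_left_mono[OF *(4)[OF that], of "\<bar>b\<bar>"] by (simp add: abs_mult)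
  show ?thesis
    by (rule tame_bounded[OF _ bd]) (intro borel_measurable_add borel_measurable_times borel_measurable_const *(1,2))
qed

lemma tame_mult: "tame f \<Longrightarrow> tame g \<Longrightarrow> tame (\<lambda>t. f t * g t)"
proof -
  assume "tame f" "tame g"
  then obtain B C where *: "f \<in> borel_measurable borel" "g \<in> borel_measurable borel"
    "\<And>t. t \<in> {0..1} \<Longrightarrow> \<bar>f t\<bar> \<le> B" "\<And>t. t \<in> {0..1} \<Longrightarrow> \<bar>g t\<bar> \<le> C" unfolding tame_def by blast
  have bd: "\<bar>f t * g t\<bar> \<le> B * C" if "t \<in> {0..1}" for t
    unfolding abs_mult using *(3,4)[OF that] abs_ge_zero order_trans by (intro mult_mono) blast+
  show ?thesis
    by (rule tame_bounded[OF _ bd]) (intro borel_measurable_add borel_measurable_times borel_measurable_const *(1,2))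
qed

lemma tame_const: "tame (\<lambda>t. c)"
  by (rule tame_bounded[of _ "\<bar>c\<bar>"]) auto

lemma tame_indicator: "S \<in> sets borel \<Longrightarrow> tame (indicator S)"
  by (rule tame_bounded[of _ 1]) (auto simp: indicator_def)

lemma tame_continuous: "continuous_on UNIV f \<Longrightarrow> tame f"
proof (rule tame_bounded)
  assume c: "continuous_on UNIV f"
  have b: "bounded (f ` {0..1})"
    by (intro compact_imp_bounded compact_continuous_image continuous_on_subset[OF c]) auto
  show "\<bar>f t\<bar> \<le> (SOME B. \<forall>t\<in>{0..1}. \<bar>f t\<bar> \<le> B)" if "t \<in> {0..1}" for t
  proof -
    have "\<exists>B. \<forall>t\<in>{0..1}. \<bar>f t\<bar> \<le> B" using b unfolding bounded_iff by auto
    from someI_ex[OF this] show ?thesis using that by blast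
  qed
qed (rule borel_measurable_continuous_onI)

lemma tame_poly: "tame (poly p)"
  by (intro tame_continuous continuous_intros)

lemma continuous_functionalI:
  assumes "\<And>f g a b. tame f \<Longrightarrow> tame g \<Longrightarrow> \<Phi> (\<lambda>t. a * f t + b * g t) = of_real a * \<Phi> f + of_real b * \<Phi> g"
    and "\<And>F f B. \<lbrakk>\<And>n. F n \<in> borel_measurable borel; f \<in> borel_measurable borel; \<And>n t. t \<in> {0..1} \<Longrightarrow> \<bar>F n t\<bar> \<le> B;
      \<And>t. t \<in> {0..1} \<Longrightarrow> (\<lambda>n. F n t) \<longlonglongrightarrow> f t\<rbrakk> \<Longrightarrow> (\<lambda>n. \<Phi> (F n)) \<longlonglongrightarrow> \<Phi> f"
  shows "continuous_functional \<Phi>"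
  using assms unfolding continuous_functional_def by blast

lemma continuous_functionalD:
  assumes "continuous_functional \<Phi>"
  shows "tame f \<Longrightarrow> tame g \<Longrightarrow> \<Phi> (\<lambda>t. a * f t + b * g t) = of_real a * \<Phi> f + of_real b * \<Phi> g"
    and "\<lbrakk>\<And>n. F n \<in> borel_measurable borel; f \<in> borel_measurable borel; \<And>n t. t \<in> {0..1} \<Longrightarrow> \<bar>F n t\<bar> \<le> B;
      \<And>t. t \<in> {0..1} \<Longrightarrow> (\<lambda>n. F n t) \<longlonglongrightarrow> f t\<rbrakk> \<Longrightarrow> (\<lambda>n. \<Phi> (F n)) \<longlonglongrightarrow> \<Phi> f"
  using assms unfolding continuous_functional_def by blast+

text \<open>Polynomials determine such a functional, by Bernstein approximation and Dynkin's lemma.\<close>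

lemma continuous_functional_eq:
  assumes \<Phi>: "continuous_functional \<Phi>" and \<Psi>: "continuous_functional \<Psi>"
    and poly: "\<And>p. \<Phi> (poly p) = \<Psi> (poly p)" and S: "S \<in> sets borel"
  shows "\<Phi> (indicator S) = \<Psi> (indicator S)"
proof -
  note lin = continuous_functionalD(1)[OF \<Phi>] continuous_functionalD(1)[OF \<Psi>]
  note lim = continuous_functionalD(2)[OF \<Phi>] continuous_functionalD(2)[OF \<Psi>]
  have cont: "\<Phi> f = \<Psi> f" if f: "continuous_on UNIV f" for f
  proof -
    \<comment> \<open>The n-th Bernstein polynomial of \<open>f\<close>, written as a
      \<open>poly\<close> so that the hypothesis on polynomials applies.\<close>
    define P where "P n = (\<Sum>k\<le>n. smult (f (k/n) * real (n choose k)) ([:0,1:] ^ k * [:1,-1:] ^ (n - k)))" for n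
    have P: "poly (P n) t = (\<Sum>k\<le>n. f (k/n) * Bernstein n k t)" for n t
      by (simp add: P_def poly_sum Bernstein_def mult_ac)
    obtain B where B: "\<And>t. t \<in> {0..1} \<Longrightarrow> \<bar>f t\<bar> \<le> B"
      using tame_continuous[OF f] unfolding tame_def by blast
    have bd: "\<bar>poly (P n) t\<bar> \<le> B" if t: "t \<in> {0..1}" for n t
    proof -
      have "\<bar>poly (P n) t\<bar> \<le> (\<Sum>k\<le>n. \<bar>f (k/n) * Bernstein n k t\<bar>)" unfolding P by (rule sum_abs)
      also have "\<dots> \<le> (\<Sum>k\<le>n. B * Bernstein n k t)"
      proof (rule sum_mono)
        fix k assume "k \<in> {..n}"
        hence "real k / real n \<in> {0..1}" by (auto simp: divide_simps)
        from B[OF this] show "\<bar>f (k/n) * Bernstein n k t\<bar> \<le> B * Bernstein n k t"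
          using t by (simp add: abs_mult Bernstein_nonneg mult_right_mono)
      qed
      also have "\<dots> = B" by (simp flip: sum_distrib_left)
      finally show ?thesis .
    qed
    have conv: "(\<lambda>n. poly (P n) t) \<longlonglongrightarrow> f t" if t: "t \<in> {0..1}" for t
    proof (rule LIMSEQ_I)
      fix e :: real assume "e > 0"
      from Bernstein_Weierstrass[OF continuous_on_subset[OF f] this] t
      obtain N where "\<And>n. n \<ge> N \<Longrightarrow> \<bar>f t - (\<Sum>k\<le>n. f (k/n) * Bernstein n k t)\<bar> < e" by auto
      thus "\<exists>N. \<forall>n\<ge>N. norm (poly (P n) t - f t) < e" unfolding P by (auto simp: abs_minus_commute)
    qed
    have m: "poly (P n) \<in> borel_measurable borel" "f \<in> borel_measurable borel" for n
      using tame_poly[of "P n"] tame_continuous[OF f] by (auto simp: tame_def)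
    have "(\<lambda>n. \<Phi> (poly (P n))) \<longlonglongrightarrow> \<Phi> f" "(\<lambda>n. \<Psi> (poly (P n))) \<longlonglongrightarrow> \<Psi> f"
      using lim[of "\<lambda>n. poly (P n)", OF m bd conv] by blast+
    thus ?thesis using LIMSEQ_unique poly by simp
  qed
  have ray: "\<Phi> (indicator {..a}) = \<Psi> (indicator {..a})" for a :: real
  proof -
    \<comment> \<open>Continuous cut-offs that are 1 up to \<open>a\<close> and reach 0 at
      \<open>a + 1 / Suc n\<close>; they converge to the indicator of the ray everywhere, also at
      \<open>a\<close>.\<close>
    define F where "F n = cts_step a (a + 1 / Suc n)" for n
    have c: "continuous_on UNIV (F n)" for n
      unfolding F_def by (intro uniformly_continuous_imp_continuous cts_step_uniformly_continuous) simp
    have m: "F n \<in> borel_measurable borel" for n using tame_continuous[OF c] by (simp add: tame_def)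
    have bd: "\<bar>F n t\<bar> \<le> 1" for n t by (auto simp: F_def cts_step_def divide_simps)
    have conv: "(\<lambda>n. F n t) \<longlonglongrightarrow> indicator {..a} t" for t
    proof (cases "t \<le> a")
      case True thus ?thesis by (simp add: F_def cts_step_def)
    next
      case False
      have "(\<lambda>n. a + 1 / real (Suc n)) \<longlonglongrightarrow> a" by real_asymp
      hence "\<forall>\<^sub>F n in sequentially. a + 1 / real (Suc n) < t"
        using False by (intro order_tendstoD(2)[of _ a]) auto
      hence "\<forall>\<^sub>F n in sequentially. F n t = indicator {..a} t"
        by (rule eventually_mono) (use False in \<open>auto simp: F_def cts_step_def\<close>)
      thus ?thesis by (rule tendsto_eventually)
    qed
    have i: "indicat_real {..a} \<in> borel_measurable borel" by simp
    have "(\<lambda>n. \<Phi> (F n)) \<longlonglongrightarrow> \<Phi> (indicator {..a})" "(\<lambda>n. \<Psi> (F n)) \<longlonglongrightarrow> \<Psi> (indicator {..a})"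
      using lim[of F, OF m i bd conv] by blast+
    thus ?thesis using LIMSEQ_unique cont[OF c] by simp
  qed
  have sets: "sets borel = sigma_sets UNIV (range (\<lambda>a. {..a::real}))"
    by (subst borel_eq_atMost) simp
  have S': "S \<in> sigma_sets UNIV (range (\<lambda>a. {..a::real}))" using S sets by simp
  have pow: "range (\<lambda>a. {..a::real}) \<subseteq> Pow UNIV" by simp
  have stable: "Int_stable (range (\<lambda>a. {..a::real}))"
    unfolding Int_stable_def by (auto intro!: range_eqI[where x = "min _ _"])
  from stable pow S' show ?thesis
  proof (induction S rule: sigma_sets_induct_disjoint)
    case (basic A) thus ?case using ray by auto
  next
    case empty
    have "indicat_real {} = poly 0" by auto
    thus ?case by (simp only: poly)
  next
    case (compl A)
    hence A: "tame (indicator A)" using sets by (intro tame_indicator) simp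
    have "indicat_real (UNIV - A) = (\<lambda>t. 1 * 1 + (-1) * indicator A t)" by (auto simp: indicator_def)
    moreover have "(\<lambda>t. 1 :: real) = poly 1" by auto
    ultimately show ?case
      using lin[OF tame_const[of 1] A, of 1 "-1"] compl.IH poly[of 1] by simp
  next
    case (union A)
    have Am: "A i \<in> sets borel" for i using union sets by auto
    define F where "F n = indicat_real (\<Union>i<n. A i)" for n
    have Fs: "F (Suc n) = (\<lambda>t. 1 * F n t + 1 * indicator (A n) t)" for n
    proof
      fix t
      have "A n \<inter> A i = {}" if "i < n" for i
        using that by (intro disjoint_family_onD[OF union(1)]) auto
      hence "A n \<inter> (\<Union>i<n. A i) = {}" by blast
      thus "F (Suc n) t = 1 * F n t + 1 * indicator (A n) t"
        unfolding F_def lessThan_Suc by (auto simp: indicator_def)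
    qed
    have Ft: "tame (F n)" for n unfolding F_def using Am by (intro tame_indicator) auto
    have eq: "\<Phi> (F n) = \<Psi> (F n)" for n
    proof (induction n)
      case 0
      have "F 0 = poly 0" by (auto simp: F_def)
      thus ?case by (simp only: poly)
    next
      case (Suc n)
      thus ?case unfolding Fs using lin[OF Ft[of n] tame_indicator[OF Am[of n]], of 1 1] union.IH by simp
    qed
    have m: "F n \<in> borel_measurable borel" for n using Ft by (auto simp: tame_def)
    have bd: "\<bar>F n t\<bar> \<le> 1" for n t by (auto simp: F_def indicator_def)
    have conv: "(\<lambda>n. F n t) \<longlonglongrightarrow> indicator (\<Union>i. A i) t" for t
      unfolding F_def by (rule LIMSEQ_indicator_UN)
    have i: "indicat_real (\<Union>i. A i) \<in> borel_measurable borel" using Am by auto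
    have "(\<lambda>n. \<Phi> (F n)) \<longlonglongrightarrow> \<Phi> (indicator (\<Union>i. A i))" "(\<lambda>n. \<Psi> (F n)) \<longlonglongrightarrow> \<Psi> (indicator (\<Union>i. A i))"
      using lim[of F, OF m i bd conv] by blast+
    thus ?case using LIMSEQ_unique eq by simp
  qed
qed

lemma smult_sum_right: "smult c (sum f I) = (\<Sum>i\<in>I. smult c (f i))"
  by (induction I rule: infinite_finite_induct) (auto simp: smult_add_right)

text \<open>The ratio is a product of the j factors (k - i) / (n - i), and each differs from k / n
  by at most i / (n - i). Exchanging one factor at a time adds up these errors, as the remaining
  products are at most 1 in modulus.\<close>

lemma binomial_ratio:
  assumes "j \<le> n" "k \<le> n"
  shows "\<bar>real (k choose j) / real (n choose j) - (real k / real n) ^ j\<bar> \<le> (\<Sum>i<j. real i / (real n - real i))"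
  using assms(1)
proof (induction j)
  case 0 thus ?case by simp
next
  case (Suc j)
  have n: "real n > real j" using Suc.prems by simp
  have step: "real (m choose Suc j) = real (m choose j) * (real m - real j) / real (Suc j)" for m
    by (simp add: binomial_gbinomial gbinomial_prod_rev)
  have nz: "real (n choose j) > 0" using Suc.prems by (simp add: zero_less_binomial)
  let ?r = "real (k choose j) / real (n choose j)" and ?q = "(real k - real j) / (real n - real j)"
  have r1: "\<bar>?r\<bar> \<le> 1" using binomial_right_mono[OF assms(2), of j] nz by simp
  have kn: "real k \<le> real n" using assms by simp
  have q: "\<bar>?q - real k / real n\<bar> \<le> real j / (real n - real j)"
  proof -
    have "?q - real k / real n = - (real j * ((real n - real k) / (real n * (real n - real j))))"
      using n by (simp add: field_simps)
    hence "\<bar>?q - real k / real n\<bar> = real j * ((real n - real k) / (real n * (real n - real j)))"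
      using n kn by (simp only: abs_minus_cancel) simp
    also have "\<dots> \<le> real j * (real n / (real n * (real n - real j)))"
      using n by (intro mult_left_mono divide_right_mono) auto
    finally show ?thesis using n by simp
  qed
  have rec: "real (k choose Suc j) / real (n choose Suc j) = ?r * ?q"
    unfolding step by (simp add: times_divide_times_eq)
  have "r * q - z ^ Suc j = r * (q - z) + z * (r - z ^ j)" for r q z :: real
    by (simp add: algebra_simps)
  hence "real (k choose Suc j) / real (n choose Suc j) - (real k / real n) ^ Suc j
      = ?r * (?q - real k / real n) + (real k / real n) * (?r - (real k / real n) ^ j)"
    unfolding rec .
  also have "\<bar>\<dots>\<bar> \<le> \<bar>?r\<bar> * \<bar>?q - real k / real n\<bar> + \<bar>real k / real n\<bar> * \<bar>?r - (real k / real n) ^ j\<bar>"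
    by (intro order_trans[OF abs_triangle_ineq]) (simp add: abs_mult)
  also have "\<dots> \<le> 1 * (real j / (real n - real j)) + 1 * (\<Sum>i<j. real i / (real n - real i))"
    using r1 q Suc kn n by (intro add_mono mult_mono) auto
  finally show ?case by simp
qed

lemma mult_split:
  fixes a b :: "'a::comm_ring_1" assumes "a + b = 1" shows "a * b = b * (a * b) + a * (b * a)"
proof -
  have "a * b = (a * b) * (a + b)" using assms by simp
  thus ?thesis by (simp add: algebra_simps)
qed

section \<open>Polynomials of a positive contraction and their moments\<close>

locale contraction = hilb H for H :: "'h::complex_vector inner_prod" +
  fixes T :: "'h \<Rightarrow> 'h"
  assumes T_add: "T (x + y) = T x + T y" and T_scale: "T (c *\<^sub>C x) = c *\<^sub>C T x"
    and T_sym: "H (T x) y = H x (T y)"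
    and T_pos: "Re (H x (T x)) \<ge> 0" and T_le: "Re (H x (T x)) \<le> Re (H x x)"
begin

lemma T_zero [simp]: "T 0 = 0" using T_scale[of 0 0] by simp

text \<open>Horner's scheme for p(T) x, which makes induction along \<open>pCons\<close>
  direct.\<close>

definition peval :: "real poly \<Rightarrow> 'h \<Rightarrow> 'h" where
  "peval p x = foldr (\<lambda>a y. of_real a *\<^sub>C x + T y) (coeffs p) 0"

lemma peval_0 [simp]: "peval 0 x = 0" by (simp add: peval_def)

lemma peval_pCons [simp]: "peval (pCons a p) x = of_real a *\<^sub>C x + T (peval p x)"
  by (auto simp: peval_def cCons_def)

lemma peval_1 [simp]: "peval 1 x = x"
  by (simp add: one_pCons)

lemma peval_add: "peval (p + q) x = peval p x + peval q x"
  by (induction p q rule: poly_induct2) (auto simp: cvec.scale_left_distrib T_add)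

lemma peval_smult: "peval (smult c p) x = of_real c *\<^sub>C peval p x"
  by (induction p) (auto simp: cvec.scale_right_distrib T_scale)

lemma peval_T: "peval p (T x) = T (peval p x)"
  by (induction p) (auto simp: T_add T_scale)

lemma peval_mult: "peval (p * q) x = peval p (peval q x)"
  by (induction p) (auto simp: peval_add peval_smult)

lemma peval_add_right: "peval p (x + y) = peval p x + peval p y"
  by (induction p) (auto simp: T_add cvec.scale_right_distrib)

lemma peval_scale_right: "peval p (c *\<^sub>C x) = c *\<^sub>C peval p x"
  by (induction p) (auto simp: T_scale cvec.scale_right_distrib mult.commute)

lemma peval_sym: "H (peval p x) y = H x (peval p y)"
  by (induction p arbitrary: y) (auto simp: lin T_sym peval_T)

abbreviation moment :: "real poly \<Rightarrow> 'h \<Rightarrow> real" where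
  "moment p x \<equiv> Re (H x (peval p x))"

lemma moment_lin: "moment (p + q) x = moment p x + moment q x" "moment (smult c p) x = c * moment p x"
  "moment 0 x = 0"
  by (simp_all add: peval_add peval_smult lin zero_right)

lemma moment_sum: "moment (sum f I) x = (\<Sum>i\<in>I. moment (f i) x)"
  by (induction I rule: infinite_finite_induct) (auto simp: moment_lin zero_right)

lemma moment_real: "H x (peval p x) = of_real (moment p x)"
  using peval_sym[of p x x] herm[of x "peval p x"] by (simp add: complex_eq_iff)

abbreviation (input) X :: "real poly" where "X \<equiv> [:0, 1:]"
abbreviation (input) Y :: "real poly" where "Y \<equiv> [:1, -1:]"

lemma peval_X: "peval X x = T x" by simp
lemma peval_Y: "peval Y x = x - T x"
  using T_scale[of "-1" x] by simp

lemma moment_sandwich: "moment (r * (p * r)) x = moment p (peval r x)"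
  by (simp add: peval_mult peval_sym)

text \<open>A factor X or Y on both sides keeps moments nonnegative by
  \<open>moment_sandwich\<close>, so the exponents reduce to 0 and 1. The product X Y is itself no
  such sandwich; since X + Y = 1, \<open>mult_split\<close> writes it as Y X Y plus X Y X.\<close>

lemma moment_nonneg: "moment (X ^ k * Y ^ m) x \<ge> 0"
proof (induction k arbitrary: x rule: induct_nat_012)
  case 0
  show ?case
  proof (induction m arbitrary: x rule: induct_nat_012)
    case 0 show ?case by (simp add: nonneg)
  next
    case 1 show ?case using T_le[of x] by (simp add: peval_Y lin del: peval_pCons)
  next
    case (ge2 n)
    have "X ^ 0 * Y ^ Suc (Suc n) = Y * ((X ^ 0 * Y ^ n) * Y)" by (simp only: power_Suc mult_ac)
    thus ?case using ge2(1) by (simp only: moment_sandwich)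
  qed
next
  case 1
  show ?case
  proof (induction m arbitrary: x rule: induct_nat_012)
    case 0 show ?case using T_pos by simp
  next
    case 1
    have "X + Y = 1" by (simp add: one_pCons)
    hence "X * Y = Y * (X * Y) + X * (Y * X)" by (rule mult_split)
    hence "moment (X * Y) x = moment (Y * (X * Y) + X * (Y * X)) x" by (rule arg_cong)
    also have "\<dots> = moment X (peval Y x) + moment Y (peval X x)"
      by (simp only: moment_lin moment_sandwich)
    also have "\<dots> \<ge> 0"
    proof (rule add_nonneg_nonneg)
      show "moment X (peval Y x) \<ge> 0" unfolding peval_X by (rule T_pos)
      show "moment Y (peval X x) \<ge> 0" unfolding peval_Y using T_le[of "peval X x"] by (simp only: diff_right UNIV_I) simp
    qed
    finally show ?case by (simp only: power_Suc power_0 mult_1_right)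
  next
    case (ge2 n)
    have "X ^ Suc 0 * Y ^ Suc (Suc n) = Y * ((X ^ Suc 0 * Y ^ n) * Y)" by (simp only: power_Suc mult_ac)
    thus ?case using ge2(1) by (simp only: moment_sandwich)
  qed
next
  case (ge2 n)
  have "X ^ Suc (Suc n) * Y ^ m = X * ((X ^ n * Y ^ m) * X)" by (simp only: power_Suc mult_ac)
  thus ?case using ge2(1) by (simp only: moment_sandwich)
qed

text \<open>By \<open>bweight_moments\<close>, the discrete measures with mass \<^term>\<open>bweight n x k\<close> at \<^term>\<open>real k / real n\<close>
  converge weakly to a measure with moments \<^term>\<open>moment (X ^ j) x\<close>, as in the Hausdorff moment problem.\<close>

definition bweight :: "nat \<Rightarrow> 'h \<Rightarrow> nat \<Rightarrow> real" where
  "bweight n x k = real (n choose k) * moment (X ^ k * Y ^ (n - k)) x"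

lemma bweight_nonneg: "bweight n x k \<ge> 0"
  by (simp add: bweight_def moment_nonneg)

lemma binomial_poly: "(\<Sum>k\<le>n. smult (real (n choose k)) (X ^ k * Y ^ (n - k))) = 1"
proof -
  have "X + Y = 1" by (simp add: one_pCons)
  hence "1 = (X + Y) ^ n" by (simp only: power_one)
  also have "\<dots> = (\<Sum>k\<le>n. smult (real (n choose k)) (X ^ k * Y ^ (n - k)))"
    unfolding binomial_ring by (simp add: of_nat_poly mult.assoc del: mult_pCons_right)
  finally show ?thesis ..
qed

lemma sum_bweight: "(\<Sum>k\<le>n. bweight n x k) = (hnorm H x)\<^sup>2"
proof -
  have "(\<Sum>k\<le>n. bweight n x k) = moment (\<Sum>k\<le>n. smult (real (n choose k)) (X ^ k * Y ^ (n - k))) x"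
    unfolding moment_sum moment_lin bweight_def ..
  thus ?thesis unfolding binomial_poly by (simp add: one_pCons norm_sq)
qed

text \<open>The identity (n choose k) (k choose j) = (n choose j) (n - j choose k - j) pulls out
  \<open>X ^ j\<close>, and the binomial theorem sums the rest to 1. Factorial moments of the
  weights are thus exact; only their comparison with powers costs an error.\<close>

lemma sum_bweight_binomial:
  assumes "j \<le> n"
  shows "(\<Sum>k\<le>n. bweight n x k * real (k choose j)) = real (n choose j) * moment (X ^ j) x"
proof -
  have "(\<Sum>k\<le>n. smult (real (n choose k) * real (k choose j)) (X ^ k * Y ^ (n - k)))
      = (\<Sum>k=j..n. smult (real (n choose k) * real (k choose j)) (X ^ k * Y ^ (n - k)))"
    by (rule sum.mono_neutral_right) (auto simp: binomial_eq_0)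
  also have "\<dots> = (\<Sum>k=j..n. smult (real (n choose j) * real (n - j choose (k - j))) (X ^ k * Y ^ (n - k)))"
  proof (rule sum.cong[OF refl])
    fix k assume k: "k \<in> {j..n}"
    have "real ((n choose k) * (k choose j)) = real ((n choose j) * (n - j choose (k - j)))"
      using k choose_mult[of j k n] by simp
    thus "smult (real (n choose k) * real (k choose j)) (X ^ k * Y ^ (n - k))
        = smult (real (n choose j) * real (n - j choose (k - j))) (X ^ k * Y ^ (n - k))"
      by simp
  qed
  also have "{j..n} = {0 + j..(n - j) + j}" using assms by simp
  also have "(\<Sum>k=0 + j..(n - j) + j. smult (real (n choose j) * real (n - j choose (k - j))) (X ^ k * Y ^ (n - k)))
      = (\<Sum>i=0..n - j. smult (real (n choose j) * real (n - j choose i)) (X ^ (i + j) * Y ^ (n - j - i)))"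
    unfolding sum.shift_bounds_cl_nat_ivl by (simp add: add.commute del: mult_pCons_left mult_pCons_right)
  also have "\<dots> = (\<Sum>i=0..n - j. smult (real (n choose j)) (X ^ j * smult (real (n - j choose i)) (X ^ i * Y ^ (n - j - i))))"
    by (intro sum.cong refl) (simp only: mult_smult_right smult_smult power_add mult_ac)
  also have "\<dots> = smult (real (n choose j)) (X ^ j * (\<Sum>i\<le>n - j. smult (real (n - j choose i)) (X ^ i * Y ^ (n - j - i))))"
    unfolding atMost_atLeast0 sum_distrib_left smult_sum_right ..
  also have "\<dots> = smult (real (n choose j)) (X ^ j)" unfolding binomial_poly by simp
  finally have eq: "(\<Sum>k\<le>n. smult (real (n choose k) * real (k choose j)) (X ^ k * Y ^ (n - k))) = smult (real (n choose j)) (X ^ j)" .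
  have "(\<Sum>k\<le>n. bweight n x k * real (k choose j))
      = moment (\<Sum>k\<le>n. smult (real (n choose k) * real (k choose j)) (X ^ k * Y ^ (n - k))) x"
    unfolding moment_sum moment_lin bweight_def by (simp add: mult_ac del: mult_pCons_left mult_pCons_right)
  thus ?thesis unfolding eq moment_lin .
qed

lemma bweight_moments: "(\<lambda>n. \<Sum>k\<le>n. bweight n x k * (real k / real n) ^ j) \<longlonglongrightarrow> moment (X ^ j) x"
proof (rule LIM_zero_cancel, rule Lim_null_comparison)
  show "\<forall>\<^sub>F n in sequentially. norm ((\<Sum>k\<le>n. bweight n x k * (real k / real n) ^ j) - moment (X ^ j) x)
      \<le> (hnorm H x)\<^sup>2 * (\<Sum>i<j. real i / (real n - real i))"
    using eventually_ge_at_top[of j]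
  proof eventually_elim
    case (elim n)
    have nz: "real (n choose j) > 0" using elim by (simp add: zero_less_binomial)
    have "moment (X ^ j) x = (\<Sum>k\<le>n. bweight n x k * (real (k choose j) / real (n choose j)))"
      using sum_bweight_binomial[OF elim, of x] nz by (simp add: field_simps flip: sum_divide_distrib)
    hence "norm ((\<Sum>k\<le>n. bweight n x k * (real k / real n) ^ j) - moment (X ^ j) x)
        = \<bar>\<Sum>k\<le>n. bweight n x k * ((real k / real n) ^ j - real (k choose j) / real (n choose j))\<bar>"
      by (simp add: right_diff_distrib sum_subtractf)
    also have "\<dots> \<le> (\<Sum>k\<le>n. bweight n x k * (\<Sum>i<j. real i / (real n - real i)))"
      using binomial_ratio[OF elim] bweight_nonneg
      by (intro order_trans[OF sum_abs] sum_mono) (auto simp: abs_mult abs_minus_commute intro!: mult_left_mono)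
    also have "\<dots> = (hnorm H x)\<^sup>2 * (\<Sum>i<j. real i / (real n - real i))"
      by (simp add: sum_bweight flip: sum_distrib_right)
    finally show ?case .
  qed
  have "(\<lambda>n. \<Sum>i<j. real i / (real n - real i)) \<longlonglongrightarrow> (\<Sum>i<j. 0)"
  proof (rule tendsto_sum)
    show "(\<lambda>n. real i / (real n - real i)) \<longlonglongrightarrow> 0" for i by real_asymp
  qed
  from tendsto_mult_left[OF this, of "(hnorm H x)\<^sup>2"]
  show "(\<lambda>n. (hnorm H x)\<^sup>2 * (\<Sum>i<j. real i / (real n - real i))) \<longlonglongrightarrow> 0" by simp
qed

section \<open>Moment measures of vectors\<close>

text \<open>Unit norm makes the weights a probability distribution, so tightness and Helly selection
  provide a weak limit.\<close>

lemma unit_moment_measure: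
  assumes x: "hnorm H x = 1"
  shows "\<exists>M. prob_space M \<and> sets M = sets borel \<and> (AE t in M. t \<in> {0..1}) \<and>
    (\<forall>p. (\<integral>t. poly p t \<partial>M) = moment p x)"
proof -
  define W where "W n = point_measure {..n} (bweight n x)" for n
  have W: "prob_space (W n)" for n
    unfolding W_def using sum_bweight[of n x] x by (intro prob_space_point_measure) (auto simp: bweight_nonneg sum_ennreal)
  define K where "K n = distr (W n) borel (\<lambda>k. real k / real n)" for n
  have meas [measurable]: "(\<lambda>k. real k / real n) \<in> measurable (W n) borel" for n
    unfolding W_def by (simp add: measurable_point_measure_eq1)
  have K: "real_distribution (K n)" for n
    unfolding K_def using prob_space.real_distribution_distr[OF W] meas by blast
  have integral_K: "(\<integral>t. f t \<partial>K n) = (\<Sum>k\<le>n. bweight n x k * f (real k / real n))"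
    if [measurable]: "f \<in> borel_measurable borel" for f :: "real \<Rightarrow> real" and n
    unfolding K_def by (subst integral_distr)
      (use that bweight_nonneg in \<open>simp_all add: W_def lebesgue_integral_point_measure_finite measurable_point_measure_eq1\<close>)
  \<comment> \<open>Tightness is stated with half-open intervals; the left end -1 keeps a possible
    atom at 0 inside.\<close>
  have K1: "measure (K n) {-1<..1} = 1" for n
  proof -
    interpret K: real_distribution "K n" by (rule K)
    have "measure (K n) {-1<..1} = (\<integral>t. indicator {-1<..1} t \<partial>K n)" by simp
    also have "\<dots> = (\<Sum>k\<le>n. bweight n x k * indicator {-1<..1} (real k / real n))"
      by (rule integral_K) simp
    also have "\<dots> = (\<Sum>k\<le>n. bweight n x k)"
    proof (rule sum.cong[OF refl])
      fix k assume "k \<in> {..n}"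
      hence "real k / real n \<le> 1" by (simp add: divide_simps)
      moreover have "- 1 < real k / real n" by (rule less_le_trans[of _ 0]) simp_all
      ultimately show "bweight n x k * indicator {-1<..1} (real k / real n) = bweight n x k" by simp
    qed
    finally show ?thesis using sum_bweight[of n x] x by simp
  qed
  have "tight K"
    unfolding tight_def using K1 by (intro conjI allI impI K exI[of _ "-1"] exI[of _ 1]) simp_all
  from tight_imp_convergent_subsubsequence[OF this strict_mono_id]
  obtain r M where r: "strict_mono r" and M: "real_distribution M" and wc: "weak_conv_m (\<lambda>n. K (r n)) M"
    by (auto simp: o_def)
  interpret M: real_distribution M by (rule M)
  \<comment> \<open>Powers are unbounded on the line. Composition with this clamp gives bounded
    continuous test functions and changes nothing at the atoms k / n; the pushforward of the weak
    limit by \<open>cl\<close> then lives on [0,1].\<close>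
  define cl where "cl t = max 0 (min 1 t)" for t :: real
  have clc: "continuous_on UNIV cl" unfolding cl_def by (intro continuous_intros)
  have cl01: "cl t \<in> {0..1}" for t by (simp add: cl_def)
  have [measurable]: "cl \<in> borel_measurable borel" by (rule borel_measurable_continuous_onI[OF clc])
  have mono: "(\<integral>t. (cl t) ^ j \<partial>M) = moment (X ^ j) x" for j
  proof -
    have "(\<lambda>n. \<integral>t. (cl t) ^ j \<partial>K (r n)) \<longlonglongrightarrow> (\<integral>t. (cl t) ^ j \<partial>M)"
    proof (rule weak_conv_imp_integral_bdd_continuous_conv[OF K M wc])
      show "isCont (\<lambda>t. (cl t) ^ j) t" for t
        using clc by (intro continuous_intros) (simp add: continuous_on_eq_continuous_at)
      show "norm ((cl t) ^ j) \<le> 1" for t using cl01[of t] by (auto simp: power_abs intro!: power_le_one)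
    qed
    moreover have "(\<lambda>n. \<integral>t. (cl t) ^ j \<partial>K (r n)) \<longlonglongrightarrow> moment (X ^ j) x"
    proof -
      have "(\<integral>t. (cl t) ^ j \<partial>K n) = (\<Sum>k\<le>n. bweight n x k * (real k / real n) ^ j)" for n
      proof (subst integral_K)
        show "(\<Sum>k\<le>n. bweight n x k * cl (real k / real n) ^ j) = (\<Sum>k\<le>n. bweight n x k * (real k / real n) ^ j)"
        proof (rule sum.cong[OF refl])
          fix k assume "k \<in> {..n}"
          hence "0 \<le> real k / real n" "real k / real n \<le> 1" by (simp_all add: divide_simps)
          thus "bweight n x k * cl (real k / real n) ^ j = bweight n x k * (real k / real n) ^ j"
            by (simp add: cl_def)
        qed
      qed simp
      thus ?thesis using LIMSEQ_subseq_LIMSEQ[OF bweight_moments r] by (simp add: o_def)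
    qed
    ultimately show ?thesis by (rule LIMSEQ_unique)
  qed
  have "(\<integral>t. poly p (cl t) \<partial>M) = moment p x" for p
  proof -
    have int: "integrable M (\<lambda>t. coeff p i * cl t ^ i)" for i
      using cl01 by (intro integrable_mult_right M.integrable_const_bound[of _ 1])
        (auto simp: power_abs intro!: power_le_one)
    have p: "p = (\<Sum>i\<le>degree p. smult (coeff p i) (X ^ i))"
      using poly_as_sum_of_monoms[of p] by (simp add: monom_altdef)
    have "(\<integral>t. poly p (cl t) \<partial>M) = (\<Sum>i\<le>degree p. coeff p i * (\<integral>t. (cl t) ^ i \<partial>M))"
      unfolding poly_altdef using int by (subst Bochner_Integration.integral_sum) auto
    also have "\<dots> = moment (\<Sum>i\<le>degree p. smult (coeff p i) (X ^ i)) x"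
      unfolding mono moment_sum moment_lin ..
    finally show ?thesis using p by simp
  qed
  moreover have "poly p \<in> borel_measurable borel" for p :: "real poly" using tame_poly by (simp add: tame_def)
  ultimately have "prob_space (distr M borel cl) \<and> sets (distr M borel cl) = sets borel \<and>
      (AE t in distr M borel cl. t \<in> {0..1}) \<and> (\<forall>p. (\<integral>t. poly p t \<partial>distr M borel cl) = moment p x)"
    using cl01 by (auto simp: M.prob_space_distr AE_distr_iff integral_distr)
  thus ?thesis by blast
qed

lemma moment_measure:
  "\<exists>M. finite_measure M \<and> sets M = sets borel \<and> (AE t in M. t \<in> {0..1}) \<and>
    (\<forall>p. (\<integral>t. poly p t \<partial>M) = moment p x)"
proof (cases "x = 0")
  case True
  have "finite_measure (null_measure (borel :: real measure))" by (rule finite_measureI) simp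
  thus ?thesis using True
    by (intro exI[of _ "null_measure borel"]) (auto simp: zero_left AE_iff_null_sets null_sets_def intro!: AE_I[of _ _ UNIV])
next
  case False
  hence n: "hnorm H x > 0" by (rule norm_pos)
  define e where "e = of_real (1 / hnorm H x) *\<^sub>C x"
  have e: "hnorm H e = 1" using n False by (simp add: e_def norm_scale norm_divide)
  have x: "x = of_real (hnorm H x) *\<^sub>C e" using n by (simp add: e_def \<open>x \<noteq> 0\<close>)
  obtain M where M: "prob_space M" "sets M = sets borel" "AE t in M. t \<in> {0..1}"
    "\<And>p. (\<integral>t. poly p t \<partial>M) = moment p e" using unit_moment_measure[OF e] by blast
  interpret prob_space M by (rule M)
  define c where "c = (hnorm H x)\<^sup>2"
  have mom: "moment p x = c * moment p e" for p
  proof -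
    have "H x (peval p x) = of_real (hnorm H x) * (of_real (hnorm H x) * H e (peval p e))"
      by (subst (1 2) x) (simp add: peval_scale_right lin)
    thus ?thesis by (simp add: c_def power2_eq_square)
  qed
  let ?D = "density M (\<lambda>_. ennreal c)"
  have fm: "finite_measure ?D"
    by (rule finite_measureI) (simp add: emeasure_density nn_integral_cmult ennreal_mult_eq_top_iff emeasure_eq_measure)
  have pm: "poly p \<in> borel_measurable M" for p :: "real poly"
    using tame_poly M(2) by (simp add: tame_def cong: measurable_cong_sets)
  have "(\<integral>t. poly p t \<partial>?D) = moment p x" for p
    using M(4)[of p] pm by (subst integral_density) (auto simp: c_def mom)
  moreover have "AE t in ?D. t \<in> {0..1}"
    using M(3) by (subst AE_density) auto
  ultimately show ?thesis using fm M(2) by (intro exI[of _ ?D]) simp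
qed

text \<open>Chosen separately for each vector. Measures of different vectors are related only
  through their moments, and \<open>continuous_functional_eq\<close> turns such relations into
  relations between the measures.\<close>

definition mm :: "'h \<Rightarrow> real measure" where
  "mm x = (SOME M. finite_measure M \<and> sets M = sets borel \<and> (AE t in M. t \<in> {0..1}) \<and>
    (\<forall>p. (\<integral>t. poly p t \<partial>M) = moment p x))"

lemma mm: "finite_measure (mm x)" "sets (mm x) = sets borel" "AE t in mm x. t \<in> {0..1}"
  "(\<integral>t. poly p t \<partial>mm x) = moment p x"
  using someI_ex[OF moment_measure[of x]] unfolding mm_def by blast+

lemma space_mm [simp]: "space (mm x) = UNIV"
  using sets_eq_imp_space_eq[OF mm(2)] by simp

lemma meas_mm [simp]: "measurable (mm x) N = measurable borel N"
  by (rule measurable_cong_sets[OF mm(2) refl])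

lemma integrable_mm: "tame f \<Longrightarrow> integrable (mm x) f"
proof -
  interpret finite_measure "mm x" by (rule mm)
  assume f: "tame f"
  then obtain B where B: "\<forall>t\<in>{0..1}. \<bar>f t\<bar> \<le> B" unfolding tame_def by blast
  have "AE t in mm x. norm (f t) \<le> B" by (rule eventually_mono[OF mm(3)]) (use B in auto)
  thus ?thesis using f by (intro integrable_const_bound) (auto simp: tame_def)
qed

lemma continuous_functional_mm: "continuous_functional (\<lambda>f. of_real (integral\<^sup>L (mm x) f))"
proof (rule continuous_functionalI)
  fix F :: "nat \<Rightarrow> real \<Rightarrow> real" and f :: "real \<Rightarrow> real" and B :: real
  assume m: "\<And>n. F n \<in> borel_measurable borel" "f \<in> borel_measurable borel"
    and bd: "\<And>n t. t \<in> {0..1} \<Longrightarrow> \<bar>F n t\<bar> \<le> B" and lim: "\<And>t. t \<in> {0..1} \<Longrightarrow> (\<lambda>n. F n t) \<longlonglongrightarrow> f t"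
  interpret finite_measure "mm x" by (rule mm)
  have "(\<lambda>n. integral\<^sup>L (mm x) (F n)) \<longlonglongrightarrow> integral\<^sup>L (mm x) f"
  proof (rule integral_dominated_convergence[where w = "\<lambda>_. B"])
    show "AE t in mm x. (\<lambda>n. F n t) \<longlonglongrightarrow> f t" by (rule eventually_mono[OF mm(3)]) (use lim in blast)
    show "AE t in mm x. norm (F n t) \<le> B" for n by (rule eventually_mono[OF mm(3)]) (use bd in auto)
  qed (use m in auto)
  thus "(\<lambda>n. complex_of_real (integral\<^sup>L (mm x) (F n))) \<longlonglongrightarrow> of_real (integral\<^sup>L (mm x) f)"
    by (rule tendsto_of_real)
qed (simp add: integrable_mm)

section \<open>From moment measures to spectral projections\<close>

definition mint :: "(real \<Rightarrow> real) \<Rightarrow> 'h \<Rightarrow> 'h \<Rightarrow> complex" where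
  "mint f x y = (1/4) * (\<Sum>k<4. \<i> ^ k * of_real (integral\<^sup>L (mm (y + \<i> ^ k *\<^sub>C x)) f))"

lemma continuous_functional_add:
  assumes "continuous_functional \<Phi>" "continuous_functional \<Psi>"
  shows "continuous_functional (\<lambda>f. \<Phi> f + \<Psi> f)"
proof (rule continuous_functionalI)
  show "\<Phi> (\<lambda>t. a * f t + b * g t) + \<Psi> (\<lambda>t. a * f t + b * g t) = of_real a * (\<Phi> f + \<Psi> f) + of_real b * (\<Phi> g + \<Psi> g)"
    if "tame f" "tame g" for f g a b
    using continuous_functionalD(1)[OF assms(1) that] continuous_functionalD(1)[OF assms(2) that]
    by (simp add: algebra_simps)
qed (intro tendsto_add continuous_functionalD(2)[OF assms(1)] continuous_functionalD(2)[OF assms(2)]; assumption)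

lemma continuous_functional_cmult:
  assumes "continuous_functional \<Phi>"
  shows "continuous_functional (\<lambda>f. c * \<Phi> f)"
proof (rule continuous_functionalI)
  show "c * \<Phi> (\<lambda>t. a * f t + b * g t) = of_real a * (c * \<Phi> f) + of_real b * (c * \<Phi> g)"
    if "tame f" "tame g" for f g a b
    using continuous_functionalD(1)[OF assms(1) that] by (simp add: algebra_simps)
qed (intro tendsto_mult_left continuous_functionalD(2)[OF assms(1)]; assumption)

lemma continuous_functional_cnj:
  assumes "continuous_functional \<Phi>"
  shows "continuous_functional (\<lambda>f. cnj (\<Phi> f))"
proof (rule continuous_functionalI)
  show "cnj (\<Phi> (\<lambda>t. a * f t + b * g t)) = of_real a * cnj (\<Phi> f) + of_real b * cnj (\<Phi> g)"
    if "tame f" "tame g" for f g a b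
    using continuous_functionalD(1)[OF assms(1) that] by simp
qed (intro tendsto_cnj continuous_functionalD(2)[OF assms(1)]; assumption)

lemma continuous_functional_mint: "continuous_functional (\<lambda>f. mint f x y)"
proof -
  have "continuous_functional (\<lambda>f. \<Sum>k<n. \<i> ^ k * of_real (integral\<^sup>L (mm (y + \<i> ^ k *\<^sub>C x)) f))" for n :: nat
  proof (induction n)
    case 0 show ?case by (simp add: continuous_functional_def)
  next
    case (Suc n) thus ?case
      by (simp only: sum.lessThan_Suc) (intro continuous_functional_add continuous_functional_cmult continuous_functional_mm)
  qed
  thus ?thesis unfolding mint_def by (intro continuous_functional_cmult)
qed

lemma continuous_functional_compose_mult:
  assumes \<Phi>: "continuous_functional \<Phi>" and g: "tame g"
  shows "continuous_functional (\<lambda>f. \<Phi> (\<lambda>t. f t * g t))"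
proof -
  obtain C where C: "\<forall>t\<in>{0..1}. \<bar>g t\<bar> \<le> C" and [measurable]: "g \<in> borel_measurable borel"
    using g unfolding tame_def by blast
  show ?thesis
  proof (rule continuous_functionalI)
    show "\<Phi> (\<lambda>t. (a * f t + b * f' t) * g t) = of_real a * \<Phi> (\<lambda>t. f t * g t) + of_real b * \<Phi> (\<lambda>t. f' t * g t)"
      if "tame f" "tame f'" for f f' a b
      using continuous_functionalD(1)[OF \<Phi> tame_mult[OF that(1) g] tame_mult[OF that(2) g], of a b]
      by (simp add: algebra_simps)
    fix F :: "nat \<Rightarrow> real \<Rightarrow> real" and f :: "real \<Rightarrow> real" and B :: real
    assume [measurable]: "\<And>n. F n \<in> borel_measurable borel" "f \<in> borel_measurable borel"
      and bd: "\<And>n t. t \<in> {0..1} \<Longrightarrow> \<bar>F n t\<bar> \<le> B" and lim: "\<And>t. t \<in> {0..1} \<Longrightarrow> (\<lambda>n. F n t) \<longlonglongrightarrow> f t"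
    show "(\<lambda>n. \<Phi> (\<lambda>t. F n t * g t)) \<longlonglongrightarrow> \<Phi> (\<lambda>t. f t * g t)"
    proof (rule continuous_functionalD(2)[OF \<Phi>])
      show "\<bar>F n t * g t\<bar> \<le> B * C" if "t \<in> {0..1}" for n t
        unfolding abs_mult
        using C bd[OF that] that abs_ge_zero order_trans by (intro mult_mono) blast+
      show "(\<lambda>n. F n t * g t) \<longlonglongrightarrow> f t * g t" if "t \<in> {0..1}" for t
        by (intro tendsto_mult tendsto_const lim that)
    qed simp_all
  qed
qed

lemma mint_poly: "mint (poly p) x y = H x (peval p y)"
proof -
  have "of_real (integral\<^sup>L (mm z) (poly p)) = H z (peval p z)" for z
    unfolding mm(4) by (rule moment_real[symmetric])
  hence "mint (poly p) x y = (1/4) * (\<Sum>k<4. \<i> ^ k * H (y + \<i> ^ k *\<^sub>C x) (peval p (y + \<i> ^ k *\<^sub>C x)))"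
    by (simp add: mint_def)
  also have "\<dots> = H x (peval p y)"
    by (simp add: eval_nat_numeral peval_add_right peval_scale_right lin algebra_simps)
  finally show ?thesis .
qed

lemma mint_lincomb: "tame f \<Longrightarrow> tame g \<Longrightarrow> mint (\<lambda>t. a * f t + b * g t) x y = of_real a * mint f x y + of_real b * mint g x y"
  using continuous_functionalD(1)[OF continuous_functional_mint] .

lemmas mint_limit = continuous_functionalD(2)[OF continuous_functional_mint]

text \<open>Additivity is invisible in the polarized formula. Both sides are continuous functionals
  of the integrand, and on polynomials \<open>mint_poly\<close> reduces the claim to the inner
  product; the next lemmas follow the same pattern.\<close>

lemma mint_add_left: "S \<in> sets borel \<Longrightarrow> mint (indicator S) (x + x') y = mint (indicator S) x y + mint (indicator S) x' y"
  by (rule continuous_functional_eq)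
     (auto intro: continuous_functional_mint continuous_functional_add simp: mint_poly lin)

lemma mint_add_right: "S \<in> sets borel \<Longrightarrow> mint (indicator S) x (y + y') = mint (indicator S) x y + mint (indicator S) x y'"
  by (rule continuous_functional_eq)
     (auto intro: continuous_functional_mint continuous_functional_add simp: mint_poly lin peval_add_right)

lemma mint_scale_left: "S \<in> sets borel \<Longrightarrow> mint (indicator S) (c *\<^sub>C x) y = cnj c * mint (indicator S) x y"
  by (rule continuous_functional_eq)
     (auto intro: continuous_functional_mint continuous_functional_cmult simp: mint_poly lin)

lemma mint_scale_right: "S \<in> sets borel \<Longrightarrow> mint (indicator S) x (c *\<^sub>C y) = c * mint (indicator S) x y"
  by (rule continuous_functional_eq)
     (auto intro: continuous_functional_mint continuous_functional_cmult simp: mint_poly lin peval_scale_right)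

lemma mint_herm: "S \<in> sets borel \<Longrightarrow> mint (indicator S) y x = cnj (mint (indicator S) x y)"
proof (rule continuous_functional_eq)
  show "mint (poly p) y x = cnj (mint (poly p) x y)" for p
    unfolding mint_poly using peval_sym[of p y x] herm[of x "peval p y"] by simp
qed (intro continuous_functional_mint continuous_functional_cnj)+

lemma mint_diag: "S \<in> sets borel \<Longrightarrow> mint (indicator S) x x = of_real (measure (mm x) S)"
proof -
  interpret finite_measure "mm x" by (rule mm)
  assume S: "S \<in> sets borel"
  have "mint (indicator S) x x = of_real (integral\<^sup>L (mm x) (indicator S))"
  proof (rule continuous_functional_eq[OF _ _ _ S])
    show "mint (poly p) x x = of_real (integral\<^sup>L (mm x) (poly p))" for p
      unfolding mint_poly mm(4) by (rule moment_real)
  qed (intro continuous_functional_mint continuous_functional_mm)+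
  thus ?thesis using S mm(2)[of x] by simp
qed

lemma measure_mm_le: "measure (mm x) S \<le> (hnorm H x)\<^sup>2"
proof -
  interpret finite_measure "mm x" by (rule mm)
  have "measure (mm x) UNIV = moment 1 x" using mm(4)[of x 1] by simp
  thus ?thesis using bounded_measure[of S] by (simp add: norm_sq)
qed

text \<open>The diagonal of the form is a measure of mass at most the squared norm of
  \<open>x\<close>. So the form is semidefinite, its Cauchy-Schwarz inequality bounds it by 1, and
  it is represented by an operator.\<close>

lemma projection_exists:
  assumes S: "S \<in> sets borel"
  shows "\<exists>P. Vector_Spaces.linear scaleC scaleC P \<and> (\<forall>x y. mint (indicator S) x y = H x (P y))"
proof -
  interpret F: psd_form UNIV "mint (indicator S)"
  proof
    show "Re (mint (indicator S) x x) \<ge> 0" for x using S by (simp add: mint_diag)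
    show "mint (indicator S) y x = cnj (mint (indicator S) x y)" for x y by (rule mint_herm[OF S])
  qed (use S in \<open>simp_all add: mint_add_right mint_scale_right cvec.subspace_UNIV\<close>)
  have le: "hnorm (mint (indicator S)) x \<le> hnorm H x" for x
    using F.norm_sq[of x] measure_mm_le[of x S] S by (auto simp: mint_diag intro: power2_le_imp_le)
  have bd: "cmod (mint (indicator S) x y) \<le> 1 * hnorm H x * hnorm H y" for x y
  proof -
    have "cmod (mint (indicator S) x y) \<le> hnorm (mint (indicator S)) x * hnorm (mint (indicator S)) y"
      by (rule F.cauchy_schwarz[OF UNIV_I UNIV_I])
    also have "\<dots> \<le> hnorm H x * hnorm H y" by (rule mult_mono[OF le le]) simp_all
    finally show ?thesis by simp
  qed
  show ?thesis
    by (rule bounded_form_operator[OF mint_add_left[OF S] mint_scale_left[OF S] mint_add_right[OF S]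
          mint_scale_right[OF S] bd]) (intro exI conjI allI)
qed

definition ET :: "real set \<Rightarrow> 'h \<Rightarrow> 'h" where
  "ET S = (SOME P. Vector_Spaces.linear scaleC scaleC P \<and> (\<forall>x y. mint (indicator S) x y = H x (P y)))"

lemma ET_spec:
  assumes "S \<in> sets borel"
  shows "Vector_Spaces.linear scaleC scaleC (ET S) \<and> (\<forall>x y. mint (indicator S) x y = H x (ET S y))"
  unfolding ET_def by (rule someI_ex[OF projection_exists[OF assms]])

lemma ET_linear: "S \<in> sets borel \<Longrightarrow> Vector_Spaces.linear scaleC scaleC (ET S)"
  using ET_spec[of S] by (rule conjunct1)

lemma inner_ET: "S \<in> sets borel \<Longrightarrow> H x (ET S y) = mint (indicator S) x y"
  using ET_spec[of S] by simp

lemma ET_sym: "S \<in> sets borel \<Longrightarrow> H (ET S x) y = H x (ET S y)"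
  using herm[of y "ET S x"] mint_herm[of S x y] by (simp add: inner_ET)

lemma mint_indicator_poly:
  assumes S: "S \<in> sets borel"
  shows "mint (\<lambda>t. indicator S t * poly p t) x y = H x (ET S (peval p y))"
proof -
  have "mint (\<lambda>t. indicator S t * poly p t) x y = mint (indicator S) x (peval p y)"
  proof (rule continuous_functional_eq[OF _ _ _ S])
    have "(\<lambda>t. poly q t * poly p t) = poly (q * p)" for q by auto
    thus "mint (\<lambda>t. poly q t * poly p t) x y = mint (poly q) x (peval p y)" for q
      by (simp add: mint_poly peval_mult)
  qed (intro continuous_functional_compose_mult continuous_functional_mint tame_poly)+
  thus ?thesis by (simp add: inner_ET S)
qed

text \<open>Multiplicativity is extended from polynomials one factor at a time:
  \<open>mint_indicator_poly\<close> keeps a polynomial fixed, and here the indicator of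
  \<open>S\<close> is fixed while polynomials give way to the indicator of \<open>R\<close>.\<close>

lemma ET_inter:
  assumes S: "S \<in> sets borel" and R: "R \<in> sets borel"
  shows "ET (S \<inter> R) y = ET S (ET R y)"
proof (rule eqI)
  fix x
  have "mint (\<lambda>t. indicator R t * indicator S t) x y = mint (indicator R) (ET S x) y"
  proof (rule continuous_functional_eq[OF _ _ _ R])
    show "mint (\<lambda>t. poly p t * indicator S t) x y = mint (poly p) (ET S x) y" for p
      using mint_indicator_poly[OF S, of p x y] by (simp add: mint_poly ET_sym[OF S] mult.commute)
  qed (intro continuous_functional_compose_mult continuous_functional_mint tame_indicator S)+
  moreover have "(\<lambda>t. indicat_real R t * indicator S t) = indicator (S \<inter> R)" by (auto simp: indicator_def)
  ultimately have "H x (ET (S \<inter> R) y) = H (ET S x) (ET R y)"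
    by (simp only: inner_ET[OF R] inner_ET[OF sets.Int[OF S R]])
  thus "H x (ET (S \<inter> R) y) = H x (ET S (ET R y))" by (simp only: ET_sym[OF S])
qed

lemma ET_UNIV: "ET UNIV y = y"
proof (rule eqI)
  have "indicat_real UNIV = poly 1" by auto
  thus "H x (ET UNIV y) = H x y" for x by (simp add: inner_ET mint_poly one_pCons)
qed

lemma ET_sigma:
  fixes F :: "nat \<Rightarrow> real set"
  assumes F: "range F \<subseteq> sets borel" "disjoint_family F"
  shows "hlim H (\<lambda>n. \<Sum>k<n. ET (F k) x) (ET (\<Union>k. F k) x)"
proof -
  have Fm: "F k \<in> sets borel" for k using F by auto
  \<comment> \<open>These remainders decrease to the empty set. As \<open>ET (R n)\<close> is a
    projection, the squared norm of its value at \<open>x\<close> is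
    \<open>mint (indicator (R n)) x x\<close>, which tends to 0.\<close>
  define R where "R n = (\<Union>k. F k) - (\<Union>k<n. F k)" for n
  have R: "R n \<in> sets borel" for n unfolding R_def using Fm by auto
  have part: "ET (\<Union>k. F k) x - (\<Sum>k<n. ET (F k) x) = ET (R n) x" for n
  proof (induction n)
    case 0 show ?case by (simp add: R_def)
  next
    case (Suc n)
    have "ET (R n) x = ET (F n) x + ET (R (Suc n)) x"
    proof (rule eqI)
      fix y
      have "F n \<inter> F k = {}" if "k < n" for k
        using that by (intro disjoint_family_onD[OF F(2)]) auto
      hence "F n \<inter> (\<Union>k<n. F k) = {}" by blast
      hence "indicat_real (R n) t = 1 * indicator (F n) t + 1 * indicator (R (Suc n)) t" for t
        unfolding R_def lessThan_Suc by (auto simp: indicator_def)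
      hence "indicat_real (R n) = (\<lambda>t. 1 * indicator (F n) t + 1 * indicator (R (Suc n)) t)" by (rule ext)
      thus "H y (ET (R n) x) = H y (ET (F n) x + ET (R (Suc n)) x)"
        using mint_lincomb[OF tame_indicator[OF Fm[of n]] tame_indicator[OF R[of "Suc n"]], of 1 1 y x]
        by (simp add: lin inner_ET Fm R)
    qed
    thus ?case using Suc by (simp add: algebra_simps)
  qed
  have sq: "(hnorm H (ET (R n) x))\<^sup>2 = Re (mint (indicator (R n)) x x)" for n
  proof -
    have "H (ET (R n) x) (ET (R n) x) = H x (ET (R n) x)"
      unfolding ET_sym[OF R] ET_inter[OF R R, symmetric] Int_absorb ..
    thus ?thesis by (simp add: norm_sq inner_ET[OF R])
  qed
  have conv: "(\<lambda>n. indicat_real (R n) t) \<longlonglongrightarrow> 0" for t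
  proof -
    have "\<forall>\<^sub>F n in sequentially. indicat_real (R n) t = 0"
    proof (cases "t \<in> (\<Union>k. F k)")
      case True
      then obtain k where "t \<in> F k" by blast
      thus ?thesis by (intro eventually_sequentiallyI[of "Suc k"]) (auto simp: R_def indicator_def)
    next
      case False thus ?thesis by (simp add: R_def)
    qed
    thus ?thesis by (rule tendsto_eventually)
  qed
  have "(\<lambda>n. mint (indicator (R n)) x x) \<longlonglongrightarrow> mint (\<lambda>_. 0) x x"
  proof (rule mint_limit)
    show "\<bar>indicat_real (R n) t\<bar> \<le> 1" for n t by (auto simp: indicator_def)
  qed (use R conv in auto)
  hence "(\<lambda>n. Re (mint (indicator (R n)) x x)) \<longlonglongrightarrow> Re (mint (\<lambda>_. 0) x x)" by (rule tendsto_Re)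
  moreover have "mint (\<lambda>_. 0) x x = 0" by (simp add: mint_def)
  ultimately have "(\<lambda>n. (hnorm H (ET (R n) x))\<^sup>2) \<longlonglongrightarrow> 0" using sq by simp
  from tendsto_real_sqrt[OF this] have "(\<lambda>n. hnorm H (ET (R n) x)) \<longlonglongrightarrow> 0" by simp
  thus ?thesis
    by (simp add: norm_diff_commute[of "\<Sum>k<_. ET (F k) x"] part)
qed

lemma ET_pvm: "projection_valued_measure H ET"
  unfolding projection_valued_measure_def
proof (intro conjI ballI allI impI)
  fix S :: "real set" and x assume S: "S \<in> sets borel"
  show "ET S (ET S x) = ET S x" using ET_inter[OF S S, of x] by simp
qed (auto simp: ET_linear ET_sym ET_UNIV ET_inter limitin_iff ET_sigma fun_eq_iff)

text \<open>Each of the four measures in the polarization has mass at most the square of the sum of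
  the norms. The crude bound serves to control operators of simple functions uniformly in
  \<open>spectral_resolution_exists\<close>.\<close>

lemma mint_bound:
  assumes f: "f \<in> borel_measurable borel" and bd: "\<And>t. t \<in> {0..1} \<Longrightarrow> \<bar>f t\<bar> \<le> B"
  shows "cmod (mint f x y) \<le> B * (hnorm H x + hnorm H y)\<^sup>2"
proof -
  have B: "B \<ge> 0" using bd[of 0] by auto
  have "cmod (\<i> ^ k * of_real (integral\<^sup>L (mm (y + \<i> ^ k *\<^sub>C x)) f)) \<le> B * (hnorm H x + hnorm H y)\<^sup>2" for k
  proof -
    let ?z = "y + \<i> ^ k *\<^sub>C x"
    interpret finite_measure "mm ?z" by (rule mm)
    have "\<bar>integral\<^sup>L (mm ?z) f\<bar> \<le> (\<integral>t. \<bar>f t\<bar> \<partial>mm ?z)" by (rule integral_abs_bound)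
    also have "\<dots> \<le> (\<integral>t. B \<partial>mm ?z)"
    proof (rule integral_mono_AE)
      show "AE t in mm ?z. \<bar>f t\<bar> \<le> B" by (rule eventually_mono[OF mm(3)]) (use bd in auto)
      show "integrable (mm ?z) (\<lambda>t. \<bar>f t\<bar>)" using f bd by (intro integrable_abs integrable_mm tame_bounded)
    qed simp
    also have "\<dots> \<le> B * (hnorm H ?z)\<^sup>2"
      using measure_mm_le[of ?z UNIV] B by (simp add: mult_left_mono mult.commute)
    also have "\<dots> \<le> B * (hnorm H x + hnorm H y)\<^sup>2"
      using triangle[of y "\<i> ^ k *\<^sub>C x"] B
      by (intro mult_left_mono power_mono) (auto simp: norm_scale norm_power)
    finally show ?thesis by (simp add: norm_mult norm_power)
  qed
  hence "cmod (\<Sum>k<4. \<i> ^ k * of_real (integral\<^sup>L (mm (y + \<i> ^ k *\<^sub>C x)) f)) \<le> (\<Sum>k<4::nat. B * (hnorm H x + hnorm H y)\<^sup>2)"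
    by (intro order_trans[OF norm_sum] sum_mono)
  thus ?thesis by (simp add: mint_def norm_divide)
qed

end

lemma (in contraction) mint_sum:
  assumes "finite I" "\<And>c. c \<in> I \<Longrightarrow> tame (f c)"
  shows "tame (\<lambda>t. \<Sum>c\<in>I. a c * f c t) \<and> mint (\<lambda>t. \<Sum>c\<in>I. a c * f c t) x y = (\<Sum>c\<in>I. of_real (a c) * mint (f c) x y)"
  using assms
proof (induction I rule: finite_induct)
  case empty
  show ?case using tame_const[of 0] by (simp add: mint_def)
next
  case (insert c I)
  hence *: "tame (f c)" "tame (\<lambda>t. \<Sum>c\<in>I. a c * f c t)"
    "mint (\<lambda>t. \<Sum>c\<in>I. a c * f c t) x y = (\<Sum>c\<in>I. of_real (a c) * mint (f c) x y)" by auto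
  have eq: "(\<lambda>t. \<Sum>c\<in>insert c I. a c * f c t) = (\<lambda>t. a c * f c t + 1 * (\<Sum>c\<in>I. a c * f c t))"
    using insert by simp
  show ?case unfolding eq
    using tame_lincomb[OF *(1,2), of "a c" 1] mint_lincomb[OF *(1,2), of "a c" 1 x y] insert(1,2) *(3) by simp
qed

section \<open>Positive definite selfadjoint operators\<close>

locale positive_selfadjoint = hilb H for H :: "'h::complex_vector inner_prod" +
  fixes A :: "'h operator"
  assumes sa: "selfadjoint H A" and pd: "positive_definite H A"
begin

abbreviation AA :: "'h \<Rightarrow> 'h" where "AA u \<equiv> the (A u)"

lemma dom_subspace: "cvec.subspace (dom A)"
  and A_add: "x \<in> dom A \<Longrightarrow> y \<in> dom A \<Longrightarrow> AA (x + y) = AA x + AA y"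
  and A_scale: "x \<in> dom A \<Longrightarrow> AA (c *\<^sub>C x) = c *\<^sub>C AA x"
  using sa by (auto simp: selfadjoint_def linear_operator_def)

lemma dom_add: "x \<in> dom A \<Longrightarrow> y \<in> dom A \<Longrightarrow> x + y \<in> dom A"
  by (rule cvec.subspace_add[OF dom_subspace])

lemma dom_scale: "x \<in> dom A \<Longrightarrow> c *\<^sub>C x \<in> dom A"
  by (rule cvec.subspace_scale[OF dom_subspace])

lemma dom_zero: "0 \<in> dom A"
  by (rule cvec.subspace_0[OF dom_subspace])

lemma dom_diff: "x \<in> dom A \<Longrightarrow> y \<in> dom A \<Longrightarrow> x - y \<in> dom A"
  by (rule cvec.subspace_diff[OF dom_subspace])

lemma dom_sum: "(\<And>i. i \<in> I \<Longrightarrow> f i \<in> dom A) \<Longrightarrow> sum f I \<in> dom A"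
  by (rule cvec.subspace_sum[OF dom_subspace])

lemma A_zero: "AA 0 = 0"
  using A_scale[OF dom_zero, of 0] by simp

lemma A_diff: "x \<in> dom A \<Longrightarrow> y \<in> dom A \<Longrightarrow> AA (x - y) = AA x - AA y"
  using A_add[of x "- y"] A_scale[of y "-1"] dom_scale[of y "-1"] by simp

lemma A_sum: "(\<And>i. i \<in> I \<Longrightarrow> f i \<in> dom A) \<Longrightarrow> AA (sum f I) = (\<Sum>i\<in>I. AA (f i))"
  by (induction I rule: infinite_finite_induct) (auto simp: A_zero A_add dom_sum)

lemma A_adjoint:
  assumes "\<And>v. v \<in> dom A \<Longrightarrow> H w v = H u (AA v)"
  shows "u \<in> dom A" "AA u = w"
proof -
  have "A u = Some w" using sa assms unfolding selfadjoint_def by blast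
  thus "u \<in> dom A" "AA u = w" by auto
qed

lemma A_sym: "x \<in> dom A \<Longrightarrow> y \<in> dom A \<Longrightarrow> H (AA x) y = H x (AA y)"
proof -
  assume "x \<in> dom A" "y \<in> dom A"
  moreover from this(1) have "A x = Some (AA x)" by auto
  ultimately show ?thesis using sa unfolding selfadjoint_def by blast
qed

definition alpha :: real where
  "alpha = (SOME \<alpha>. \<alpha> > 0 \<and> (\<forall>u\<in>dom A. Re (H (AA u) u) \<ge> \<alpha> * (hnorm H u)\<^sup>2))"

lemma alpha: "alpha > 0 \<and> (\<forall>u\<in>dom A. Re (H (AA u) u) \<ge> alpha * (hnorm H u)\<^sup>2)"
  unfolding alpha_def by (rule someI_ex) (use pd[unfolded positive_definite_def] in \<open>simp only:\<close>)

lemma alpha_pos: "alpha > 0" using alpha by blast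

lemma coercive: "u \<in> dom A \<Longrightarrow> alpha * (hnorm H u)\<^sup>2 \<le> Re (H u (AA u))"
proof -
  assume u: "u \<in> dom A"
  have "alpha * (hnorm H u)\<^sup>2 \<le> Re (H (AA u) u)" using alpha u by blast
  thus ?thesis by (simp only: A_sym[OF u u])
qed

lemma alpha_norm_le: "u \<in> dom A \<Longrightarrow> alpha * hnorm H u \<le> hnorm H (AA u)"
proof (cases "u = 0")
  case False
  assume u: "u \<in> dom A"
  have "hnorm H u * (alpha * hnorm H u) \<le> Re (H u (AA u))"
    using coercive[OF u] by (simp add: power2_eq_square mult_ac)
  also have "\<dots> \<le> hnorm H u * hnorm H (AA u)"
    using cauchy_schwarz[of u "AA u"] complex_Re_le_cmod order_trans by blast
  finally show ?thesis using norm_pos[OF False] by simp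
qed simp

text \<open>A weak solution, obtained by minimizing the energy; it is a limit of elements of \<^term>\<open>V\<close>.\<close>

lemma weak_solution:
  assumes V: "cvec.subspace V" "V \<subseteq> dom A" and \<gamma>: "\<gamma> > 0"
    and co: "\<And>v. v \<in> V \<Longrightarrow> \<gamma> * (hnorm H v)\<^sup>2 \<le> Re (H v (AA v - of_real s *\<^sub>C v))"
  shows "\<exists>g. (\<forall>v\<in>V. H g (AA v - of_real s *\<^sub>C v) = H f v) \<and> (\<forall>z. (\<forall>v\<in>V. H z v = 0) \<longrightarrow> H z g = 0)"
proof -
  \<comment> \<open>With \<open>V = dom A\<close> and \<open>s = 0\<close> the weak solution gives
    the inverse of \<open>A\<close>; with \<open>V\<close> orthogonal to finitely many eigenvectors
    it gives a reduced resolvent.\<close>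
  let ?B = "\<lambda>u v. H u (AA v - of_real s *\<^sub>C v)"
  have d: "v \<in> dom A" if "v \<in> V" for v using V that by blast
  interpret F: psd_form V ?B
  proof
    show "?B v u = cnj (?B u v)" if "u \<in> V" "v \<in> V" for u v
      using A_sym[OF d[OF that(2)] d[OF that(1)]] herm[of u "AA v"] herm[of u v] by (simp add: lin)
    show "?B u (v + v') = ?B u v + ?B u v'" if "v \<in> V" "v' \<in> V" for u v v'
      using that d by (simp add: A_add lin algebra_simps)
    show "?B u (c *\<^sub>C v) = c * ?B u v" if "v \<in> V" for u v c
      using that d by (simp add: A_scale lin algebra_simps)
    show "Re (?B v v) \<ge> 0" if "v \<in> V" for v
      using co[OF that] \<gamma> zero_le_power2[of "hnorm H v"] by (meson mult_nonneg_nonneg less_imp_le order_trans)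
  qed (rule V)
  have le: "hnorm H v \<le> (1 / sqrt \<gamma>) * hnorm ?B v" if v: "v \<in> V" for v
  proof -
    have "(sqrt \<gamma> * hnorm H v)\<^sup>2 \<le> (hnorm ?B v)\<^sup>2"
      using co[OF v] F.norm_sq[OF v] \<gamma> by (simp add: power_mult_distrib)
    hence "sqrt \<gamma> * hnorm H v \<le> hnorm ?B v" by (rule power2_le_imp_le) (simp add: v)
    thus ?thesis using \<gamma> by (simp add: field_simps)
  qed
  have bd: "cmod (H f v) \<le> (hnorm H f * (1 / sqrt \<gamma>)) * hnorm ?B v" if v: "v \<in> V" for v
  proof -
    have "cmod (H f v) \<le> hnorm H f * hnorm H v" by (rule cauchy_schwarz) simp_all
    also have "\<dots> \<le> hnorm H f * ((1 / sqrt \<gamma>) * hnorm ?B v)" by (rule mult_left_mono[OF le[OF v]]) simp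
    finally show ?thesis by (simp add: mult.assoc)
  qed
  obtain X where X: "\<And>k. X k \<in> V" "\<And>k m. (hnorm ?B (X k - X m))\<^sup>2 \<le> 2 / (real k + 1) + 2 / (real m + 1)"
    "\<And>v. v \<in> V \<Longrightarrow> (\<lambda>k. ?B (X k) v) \<longlonglongrightarrow> H f v"
    by (rule F.riesz_sequence[of "H f", OF _ _ bd]) (auto simp: add_right scale_right)
  have "(hnorm H (X k - X m))\<^sup>2 \<le> (1 / \<gamma>) * (2 / (real k + 1)) + (1 / \<gamma>) * (2 / (real m + 1))" for k m
  proof -
    have m: "X k - X m \<in> V" using X(1) by (intro F.V_diff)
    have "(hnorm H (X k - X m))\<^sup>2 \<le> ((1 / sqrt \<gamma>) * hnorm ?B (X k - X m))\<^sup>2"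
      by (rule power_mono[OF le[OF m]]) simp
    also have "\<dots> = (1 / \<gamma>) * (hnorm ?B (X k - X m))\<^sup>2" using \<gamma> by (simp add: power_mult_distrib power_divide)
    also have "\<dots> \<le> (1 / \<gamma>) * (2 / (real k + 1) + 2 / (real m + 1))"
      using X(2)[of k m] \<gamma> by (intro mult_left_mono) auto
    finally show ?thesis by (simp only: distrib_left)
  qed
  moreover have "(\<lambda>k. (1 / \<gamma>) * (2 / (real k + 1))) \<longlonglongrightarrow> 0" by real_asymp
  ultimately obtain g where g: "hlim H X g" by (rule complete_sq)
  have "H g (AA v - of_real s *\<^sub>C v) = H f v" if "v \<in> V" for v
    by (rule LIMSEQ_unique[OF hlim_inner[OF g hlim_const] X(3)[OF that]])
  moreover have "H z g = 0" if "\<forall>v\<in>V. H z v = 0" for z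
  proof -
    have "H z (X n) = 0" for n using that X(1) by blast
    thus ?thesis using hlim_inner[OF hlim_const g, of z] by (simp add: LIMSEQ_const_iff)
  qed
  ultimately show ?thesis by blast
qed

text \<open>The weak equation, tested on all of \<open>dom A\<close>, says that \<open>g\<close>
  lies in the domain of the adjoint, which is \<open>A\<close> itself.\<close>

lemma A_surj: "\<exists>u\<in>dom A. AA u = f"
proof -
  obtain g where g: "\<forall>v\<in>dom A. H g (AA v - of_real 0 *\<^sub>C v) = H f v"
    using weak_solution[OF dom_subspace subset_refl alpha_pos, of 0 f] coercive by auto
  have "H f v = H g (AA v)" if "v \<in> dom A" for v using g that by simp
  from A_adjoint[OF this] show ?thesis by blast
qed

lemma A_bij: "bij_betw AA (dom A) UNIV"
proof -
  have "inj_on AA (dom A)"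
  proof (rule inj_onI)
    fix x y assume "x \<in> dom A" "y \<in> dom A" "AA x = AA y"
    hence "alpha * hnorm H (x - y) \<le> 0" using alpha_norm_le[OF dom_diff, of x y] by (simp add: A_diff)
    hence "hnorm H (x - y) \<le> 0" using alpha_pos by (simp add: mult_le_0_iff)
    hence "hnorm H (x - y) = 0" using hnorm_ge0[OF UNIV_I, of "x - y"] by linarith
    thus "x = y" by simp
  qed
  moreover have "f \<in> AA ` dom A" for f using A_surj[of f] by (metis imageI)
  ultimately show ?thesis unfolding bij_betw_def by blast
qed

definition Ainv :: "'h \<Rightarrow> 'h" where "Ainv = inv_into (dom A) AA"

lemma Ainv_dom: "Ainv f \<in> dom A" and A_Ainv: "AA (Ainv f) = f"
  using A_bij unfolding Ainv_def bij_betw_def by (metis UNIV_I inv_into_into, metis UNIV_I f_inv_into_f)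

lemma Ainv_A: "u \<in> dom A \<Longrightarrow> Ainv (AA u) = u"
  using A_bij unfolding Ainv_def bij_betw_def by (simp add: inv_into_f_f[of AA])

lemma Ainv_eqI: "u \<in> dom A \<Longrightarrow> AA u = f \<Longrightarrow> Ainv f = u"
  using Ainv_A by blast

lemma alpha_Ainv_le: "alpha * hnorm H (Ainv f) \<le> hnorm H f"
  using alpha_norm_le[OF Ainv_dom, of f] by (simp add: A_Ainv)

text \<open>Multiplication by \<open>alpha\<close> moves the spectrum of the inverse into [0,1],
  where the moment construction applies.\<close>

lemma contraction_Ainv: "contraction H (\<lambda>x. of_real alpha *\<^sub>C Ainv x)"
proof
  show "of_real alpha *\<^sub>C Ainv (x + y) = of_real alpha *\<^sub>C Ainv x + of_real alpha *\<^sub>C Ainv y" for x y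
  proof -
    have "Ainv (x + y) = Ainv x + Ainv y"
      by (rule Ainv_eqI) (auto simp: dom_add Ainv_dom A_add A_Ainv)
    thus ?thesis by (simp add: cvec.scale_right_distrib)
  qed
  show "of_real alpha *\<^sub>C Ainv (c *\<^sub>C x) = c *\<^sub>C of_real alpha *\<^sub>C Ainv x" for c x
  proof -
    have "Ainv (c *\<^sub>C x) = c *\<^sub>C Ainv x"
      by (rule Ainv_eqI) (auto simp: dom_scale Ainv_dom A_scale A_Ainv)
    thus ?thesis by (simp add: mult.commute)
  qed
  show "H (of_real alpha *\<^sub>C Ainv x) y = H x (of_real alpha *\<^sub>C Ainv y)" for x y
    using A_sym[OF Ainv_dom[of x] Ainv_dom[of y]] by (simp add: lin A_Ainv)
  fix x
  have c: "alpha * (hnorm H (Ainv x))\<^sup>2 \<le> Re (H (Ainv x) x)"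
    using coercive[OF Ainv_dom[of x]] by (simp add: A_Ainv)
  have e: "Re (H x (of_real alpha *\<^sub>C Ainv x)) = alpha * Re (H (Ainv x) x)"
    using Re_commute[of x "Ainv x"] by (simp add: lin)
  show "Re (H x (of_real alpha *\<^sub>C Ainv x)) \<ge> 0"
    unfolding e using c alpha_pos by (intro mult_nonneg_nonneg) (auto intro: order_trans[rotated])
  have "Re (H (Ainv x) x) \<le> hnorm H (Ainv x) * hnorm H x"
    using cauchy_schwarz[of "Ainv x" x] complex_Re_le_cmod order_trans by blast
  hence "alpha * Re (H (Ainv x) x) \<le> (alpha * hnorm H (Ainv x)) * hnorm H x"
    using alpha_pos by (simp add: mult.assoc)
  also have "\<dots> \<le> hnorm H x * hnorm H x" by (rule mult_right_mono[OF alpha_Ainv_le]) simp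
  also have "\<dots> = Re (H x x)" by (simp add: norm_sq flip: power2_eq_square)
  finally show "Re (H x (of_real alpha *\<^sub>C Ainv x)) \<le> Re (H x x)" unfolding e .
qed

text \<open>The spectral measure of \<^term>\<open>A\<close> is the image of that of \<^term>\<open>\<lambda>x. of_real alpha *\<^sub>C Ainv x\<close> under
  \<^term>\<open>\<lambda>s. alpha / s\<close>. The value at 0 is irrelevant, because 0 has spectral measure zero by injectivity.\<close>

lemma spectral_resolution_exists: "\<exists>E. spectral_resolution H A E"
proof -
  define T where "T x = of_real alpha *\<^sub>C Ainv x" for x
  have ctr: "contraction H T" unfolding T_def[abs_def] by (rule contraction_Ainv)
  interpret C: contraction H T by (rule ctr)
  interpret PT: pvm H C.ET by unfold_locales (rule C.ET_pvm)
  define g where "g s = alpha / s" for s :: real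
  have gm [measurable]: "g \<in> borel_measurable borel" unfolding g_def by measurable
  have gS: "g -` S \<in> sets borel" if "S \<in> sets borel" for S
    using measurable_sets_borel[OF gm that] .
  define E where "E S = C.ET (g -` S)" for S
  have "projection_valued_measure H E"
    unfolding projection_valued_measure_def
  proof (intro conjI ballI allI impI)
    fix F :: "nat \<Rightarrow> real set" and x
    assume F: "range F \<subseteq> sets borel" "disjoint_family F"
    have "range (\<lambda>k. g -` F k) \<subseteq> sets borel" using F(1) gS by auto
    moreover have "disjoint_family (\<lambda>k. g -` F k)" using F(2) by (auto simp: disjoint_family_on_def)
    ultimately have "hlim H (\<lambda>n. \<Sum>k<n. C.ET (g -` F k) x) (C.ET (\<Union>k. g -` F k) x)"
      by (rule PT.E_sigma_additive)
    thus "limitin (htop H) (\<lambda>n. \<Sum>k<n. E (F k) x) (E (\<Union>k. F k) x) sequentially"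
      by (simp add: limitin_iff E_def vimage_UN)
  next
    show "E UNIV = id" by (auto simp: E_def)
  qed (simp_all add: E_def PT.E_lin PT.E_idem PT.E_sym gS PT.E_inter fun_eq_iff)
  interpret P: pvm H E by unfold_locales fact
  have inj: "w = 0" if "T w = 0" for w
  proof -
    have "Ainv w = 0" using that alpha_pos by (simp add: T_def)
    thus ?thesis using A_Ainv[of w] A_zero by simp
  qed
  have ET0: "C.ET {0} x = 0" for x
  proof -
    \<comment> \<open>The function t times the indicator of {0} is zero, so the spectral projection
      of {0} kills the range of \<open>T\<close>; by symmetry \<open>T\<close> kills the range of
      that projection.\<close>
    have T0: "C.ET {0} (T z) = 0" for z
    proof (rule eqI)
      fix y
      have "H y (C.ET {0} (T z)) = C.mint (\<lambda>t. indicator {0} t * poly [:0, 1:] t) y z"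
        using C.mint_indicator_poly[of "{0}" "[:0, 1:]" y z] by simp
      also have "(\<lambda>t. indicator {0} t * poly [:0, 1:] t) = (\<lambda>t. 0 :: real)" by (auto simp: indicator_def)
      finally show "H y (C.ET {0} (T z)) = H y 0" by (simp add: C.mint_def zero_right)
    qed
    have "T (C.ET {0} x) = 0"
    proof (rule eqI)
      fix y
      have "H y (T (C.ET {0} x)) = H (C.ET {0} (T y)) x" by (simp add: C.ET_sym C.T_sym)
      thus "H y (T (C.ET {0} x)) = H y 0" by (simp add: T0 zero_left zero_right)
    qed
    thus ?thesis by (rule inj)
  qed
  have ext: "y \<in> P.sdom (\<lambda>t. t) \<and> P.sint (\<lambda>t. t) y = AA y" if y: "y \<in> dom A" for y
  proof -
    define z where "z = AA y"
    have yz: "y = of_real (1 / alpha) *\<^sub>C T z"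
      using alpha_pos y by (simp add: z_def T_def Ainv_A)
    \<comment> \<open>As \<open>y\<close> is \<open>T z\<close> up to a constant, the integrand
      gains the factor t / alpha. It compensates the growth of \<open>g\<close> near 0, so the
      transported functions stay bounded although the identity is not.\<close>
    have sop: "H x (P.sop r y) = C.mint (\<lambda>t. r (g t) * (t / alpha)) x z"
      if r: "simple_function borel r" for r x
    proof -
      have S: "g -` (r -` {c}) \<in> sets borel" for c using r gS by simp
      define F where "F c t = indicator (g -` (r -` {c})) t * poly [:0, 1:] t" for c t
      have Ft: "tame (F c)" for c unfolding F_def by (intro tame_mult tame_indicator S tame_poly)
      have "H x (E (r -` {c}) y) = of_real (1 / alpha) * C.mint (F c) x z" for c
      proof -
        have "H x (C.ET (g -` (r -` {c})) (T z)) = C.mint (F c) x z"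
          using C.mint_indicator_poly[OF S[of c], of "[:0, 1:]" x z] by (simp add: F_def[abs_def])
        thus ?thesis unfolding yz using r by (simp add: P.E_scale lin) (simp add: E_def)
      qed
      hence "H x (P.sop r y) = (\<Sum>c\<in>range r. of_real (c / alpha) * C.mint (F c) x z)"
        by (simp add: P.sop_def sum_right lin mult.assoc)
      also have "\<dots> = C.mint (\<lambda>t. \<Sum>c\<in>range r. c / alpha * F c t) x z"
        using C.mint_sum[of "range r" F "\<lambda>c. c / alpha" x z] r Ft by simp
      also have "(\<lambda>t. \<Sum>c\<in>range r. c / alpha * F c t) = (\<lambda>t. r (g t) * (t / alpha))"
      proof
        fix t
        have "(\<Sum>c\<in>range r. c / alpha * F c t) = (\<Sum>c\<in>range r. if r (g t) = c then c * (t / alpha) else 0)"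
          by (intro sum.cong) (auto simp: F_def)
        thus "(\<Sum>c\<in>range r. c / alpha * F c t) = r (g t) * (t / alpha)" using r by simp
      qed
      finally show ?thesis .
    qed
    obtain r where r: "P.approx_seq (\<lambda>t. t) r" "\<forall>i t. \<bar>r i t\<bar> \<le> 2 * \<bar>t\<bar>"
      using P.approx_seq_exists[of "\<lambda>t. t"] by auto
    note [measurable] = P.approx_seqD(4)[OF r(1)]
    have hm: "(\<lambda>t. r i (g t) * (t / alpha)) \<in> borel_measurable borel" for i by measurable
    have hb: "\<bar>r i (g t) * (t / alpha)\<bar> \<le> 2" for i t
    proof -
      have "\<bar>r i (g t) * (t / alpha)\<bar> \<le> (2 * \<bar>g t\<bar>) * \<bar>t / alpha\<bar>"
        unfolding abs_mult using r(2) by (intro mult_right_mono) auto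
      also have "\<dots> \<le> 2" using alpha_pos by (cases "t = 0") (simp_all add: g_def abs_mult abs_divide)
      finally show ?thesis .
    qed
    \<comment> \<open>Division by zero gives \<open>g 0 = 0\<close>, so the limit is 1 except at the
      point 0, which has spectral measure zero.\<close>
    have conv: "(\<lambda>i. r i (g t) * (t / alpha)) \<longlonglongrightarrow> indicator (- {0}) t" for t
    proof -
      have "(\<lambda>i. r i (g t) * (t / alpha)) \<longlonglongrightarrow> g t * (t / alpha)"
        by (intro tendsto_intros P.approx_seqD(3)[OF r(1)])
      also have "g t * (t / alpha) = indicator (- {0}) t" using alpha_pos by (simp add: g_def)
      finally show ?thesis .
    qed
    have "hnorm H (P.sop (r i) y) \<le> 2 * (1 + hnorm H z)\<^sup>2" for i
    proof (cases "P.sop (r i) y = 0")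
      case False
      \<comment> \<open>The norm is read off by duality, testing with the normalized vector
        itself.\<close>
      let ?s = "P.sop (r i) y"
      let ?x = "of_real (1 / hnorm H ?s) *\<^sub>C ?s"
      have n: "hnorm H ?s > 0" using False by (rule norm_pos)
      have x1: "hnorm H ?x = 1" using n False by (simp add: norm_scale norm_divide)
      have "H ?x ?s = of_real (hnorm H ?s)"
        using n self_eq[of ?s] by (simp add: lin power2_eq_square)
      hence "hnorm H ?s = cmod (C.mint (\<lambda>t. r i (g t) * (t / alpha)) ?x z)"
        using n unfolding sop[OF P.approx_seqD(2)[OF r(1)], symmetric] by simp
      also have "\<dots> \<le> 2 * (hnorm H ?x + hnorm H z)\<^sup>2" by (rule C.mint_bound[OF hm hb])
      finally show ?thesis unfolding x1 .
    qed (use zero_le_power2[of "1 + hnorm H z"] in simp)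
    hence dom: "y \<in> P.sdom (\<lambda>t. t)" by (rule P.sdom_criterion(1)[OF r(1)])
    have "P.sint (\<lambda>t. t) y = z"
    proof (rule eqI)
      fix x
      have "(\<lambda>i. H x (P.sop (r i) y)) \<longlonglongrightarrow> H x (P.sint (\<lambda>t. t) y)"
        by (intro hlim_inner[OF hlim_const] P.sop_tendsto[OF r(1) dom])
      moreover have "(\<lambda>i. C.mint (\<lambda>t. r i (g t) * (t / alpha)) x z) \<longlonglongrightarrow> C.mint (indicator (- {0})) x z"
        by (rule C.mint_limit[OF hm _ hb conv]) simp
      ultimately have "H x (P.sint (\<lambda>t. t) y) = C.mint (indicator (- {0})) x z"
        using LIMSEQ_unique by (simp add: sop P.approx_seqD(2)[OF r(1)])
      also have "\<dots> = H x (C.ET (- {0}) z)" by (simp add: C.inner_ET)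
      also have "C.ET (- {0}) z = z" by (simp add: PT.E_Compl ET0)
      finally show "H x (P.sint (\<lambda>t. t) y) = H x z" .
    qed
    thus ?thesis using dom by (simp add: z_def)
  qed
  have "spectral_integral H E (\<lambda>t. t) = A"
  proof
    fix y
    show "spectral_integral H E (\<lambda>t. t) y = A y"
    proof (cases "y \<in> P.sdom (\<lambda>t. t)")
      case True
      \<comment> \<open>So far the spectral integral is a symmetric extension of \<open>A\<close>; a
        selfadjoint operator has no proper one.\<close>
      have "H (P.sint (\<lambda>t. t) y) v = H y (AA v)" if "v \<in> dom A" for v
        using P.sint_sym[OF _ True, of v] ext[OF that] by simp
      from A_adjoint[OF this] have "A y = Some (P.sint (\<lambda>t. t) y)" by auto
      thus ?thesis using P.spectral_integral_Some[OF True] by simp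
    next
      case False
      hence "y \<notin> dom A" using ext by blast
      thus ?thesis using False P.dom_spectral_integral[of "\<lambda>t. t"] by (metis domIff)
    qed
  qed
  thus ?thesis using P.pvm unfolding spectral_resolution_def by blast
qed

section \<open>The square root and the energy form\<close>

text \<open>The same choice as in \<open>op_power\<close>, which therefore unfolds to a spectral
  integral over \<open>EA\<close>.\<close>

definition EA :: "real set \<Rightarrow> 'h \<Rightarrow> 'h" where
  "EA = (SOME E. spectral_resolution H A E)"

lemma EA: "spectral_resolution H A EA"
  unfolding EA_def by (rule someI_ex[OF spectral_resolution_exists])

sublocale pvm H EA
  using EA by unfold_locales (simp add: spectral_resolution_def)

lemma spectral_integral_id: "spectral_integral H EA (\<lambda>t. t) = A"
  using EA by (simp add: spectral_resolution_def)

lemma sdom_id: "sdom (\<lambda>t. t) = dom A"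
  using dom_spectral_integral[of "\<lambda>t. t"] by (simp add: spectral_integral_id)

lemma sint_id: "sint (\<lambda>t. t) y = AA y"
  by (simp add: spectral_integral_id)

lemma E_countable_zero:
  assumes "countable FF" "\<And>S. S \<in> FF \<Longrightarrow> S \<in> sets borel \<and> EA S x = 0"
  shows "EA (\<Union>FF) x = 0"
proof -
  have "(\<Union>S\<in>FF. S) \<in> null_sets (mu x)"
    using assms by (intro null_sets_UN') (auto simp: null_sets_def emeasure_mu)
  hence "emeasure (mu x) (\<Union>FF) = 0" "\<Union>FF \<in> sets borel" by (auto simp: null_sets_def)
  thus ?thesis by (simp add: emeasure_mu)
qed

text \<open>Vectors spectrally localized near \<open>b\<close> are approximate eigenvectors; this
  links the spectral projections with \<open>spectrum\<close> and with compactness.\<close>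

lemma E_bounded_dom:
  assumes S: "S \<in> sets borel" "\<And>t. t \<in> S \<Longrightarrow> \<bar>t - b\<bar> \<le> d"
  shows "EA S x \<in> dom A" "hnorm H (AA (EA S x) - of_real b *\<^sub>C EA S x) \<le> d * hnorm H (EA S x)"
proof -
  let ?u = "EA S x"
  have bd: "\<bar>t\<bar> \<le> \<bar>b\<bar> + d" if "t \<in> S" for t using S(2)[OF that] by linarith
  show u: "?u \<in> dom A"
    unfolding sdom_id[symmetric] by (rule E_in_sdom_bounded[OF _ S(1) bd]) simp_all
  interpret finite_measure "mu ?u" by (rule finite_measure_mu)
  have ae: "AE t in mu ?u. t \<in> S" by (rule AE_mu) (use S in \<open>simp_all add: E_inter\<close>)
  show "hnorm H (AA ?u - of_real b *\<^sub>C ?u) \<le> d * hnorm H ?u"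
  proof (cases "S = {}")
    case True thus ?thesis by (simp add: A_zero)
  next
    case False
    hence d: "d \<ge> 0" using S(2) abs_ge_zero order_trans by blast
    have "(hnorm H (AA ?u - of_real b *\<^sub>C ?u))\<^sup>2 = (\<integral>t. (t - b)\<^sup>2 \<partial>mu ?u)"
      using norm_sint_id_minus[of ?u b] u by (simp add: sdom_id sint_id)
    also have "\<dots> \<le> (\<integral>t. d\<^sup>2 \<partial>mu ?u)"
    proof (rule integral_mono_AE)
      have le: "AE t in mu ?u. (t - b)\<^sup>2 \<le> d\<^sup>2"
      proof (rule eventually_mono[OF ae])
        fix t assume "t \<in> S"
        from power_mono[OF S(2)[OF this], of 2] show "(t - b)\<^sup>2 \<le> d\<^sup>2" by simp
      qed
      show "AE t in mu ?u. (t - b)\<^sup>2 \<le> d\<^sup>2" by (rule le)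
      show "integrable (mu ?u) (\<lambda>t. (t - b)\<^sup>2)"
        using le by (intro integrable_const_bound[of _ "d\<^sup>2"]) auto
    qed simp
    also have "\<dots> = (d * hnorm H ?u)\<^sup>2" using measure_mu[of UNIV ?u] by (simp add: power_mult_distrib)
    finally show ?thesis by (rule power2_le_imp_le) (simp add: d)
  qed
qed

lemma form_ge:
  assumes x: "x \<in> dom A" and c: "EA {..<c} x = 0"
  shows "c * (hnorm H x)\<^sup>2 \<le> Re (H x (AA x))"
proof -
  interpret finite_measure "mu x" by (rule finite_measure_mu)
  have "AE t in mu x. t \<in> {c..}"
    using c by (intro AE_mu) (auto simp: Compl_atLeast)
  hence "(\<integral>t. c \<partial>mu x) \<le> (\<integral>t. t \<partial>mu x)"
    using x sdom_int1[of x "\<lambda>t. t"] by (intro integral_mono_AE) (auto simp: sdom_id)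
  moreover have "H x (AA x) = of_real (\<integral>t. t \<partial>mu x)"
    using inner_sint[of "\<lambda>t. t" x] x by (simp add: sdom_id sint_id)
  ultimately show ?thesis using measure_mu[of UNIV x] by (simp add: mult.commute)
qed

text \<open>On a bounded part of the negative axis the form would be nonpositive, against
  coercivity. The result lets \<open>t powr (1/2)\<close> be replaced by the root of
  \<open>\<bar>t\<bar>\<close>, whose square is \<open>t\<close> off this null set.\<close>

lemma E_negative: "EA {..<0} x = 0"
proof -
  have "EA {- real n..<0} x = 0" for n
  proof -
    let ?u = "EA {- real n..<0} x"
    interpret finite_measure "mu ?u" by (rule finite_measure_mu)
    have u: "?u \<in> dom A"
      by (rule E_bounded_dom(1)[where b = 0 and d = "real n"]) auto
    have "AE t in mu ?u. t \<in> {- real n..<0}" by (rule AE_mu) (simp_all add: E_inter)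
    hence "AE t in mu ?u. t \<le> 0" by (rule eventually_mono) simp
    hence "(\<integral>t. t \<partial>mu ?u) \<le> (\<integral>t. 0 \<partial>mu ?u)"
      using u sdom_int1[of ?u "\<lambda>t. t"] by (intro integral_mono_AE) (auto simp: sdom_id)
    moreover have "H ?u (AA ?u) = of_real (\<integral>t. t \<partial>mu ?u)"
      using inner_sint[of "\<lambda>t. t" ?u] u by (simp add: sdom_id sint_id)
    ultimately have "alpha * (hnorm H ?u)\<^sup>2 \<le> 0" using coercive[OF u] by simp
    thus ?thesis using alpha_pos by (simp add: mult_le_0_iff)
  qed
  hence "EA (\<Union>(range (\<lambda>n. {- real n..<0}))) x = 0" by (intro E_countable_zero) auto
  moreover have "(\<Union>(range (\<lambda>n. {- real n..<0}))) = {..<0}"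
  proof (intro set_eqI iffI)
    fix t :: real assume "t \<in> {..<0}"
    moreover obtain n where "- t \<le> real n" using real_arch_simple by blast
    ultimately show "t \<in> \<Union>(range (\<lambda>n. {- real n..<0}))" by (auto intro!: exI[of _ n])
  qed auto
  ultimately show ?thesis by simp
qed

abbreviation half :: "'h operator" where "half \<equiv> op_power H A (1/2)"
abbreviation energy :: "'h inner_prod" where "energy \<equiv> pow_inner H A (1/2)"

lemma half_eq: "half = spectral_integral H EA (\<lambda>t. sqrt \<bar>t\<bar>)"
proof -
  have "half = spectral_integral H EA (\<lambda>t. t powr (1/2))"
    by (simp add: op_power_def EA_def)
  also have "\<dots> = spectral_integral H EA (\<lambda>t. sqrt \<bar>t\<bar>)"
    by (rule spectral_integral_cong[where N = "{..<0}"]) (auto simp: E_negative powr_half_sqrt)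
  finally show ?thesis .
qed

lemma dom_half: "dom half = sdom (\<lambda>t. sqrt \<bar>t\<bar>)"
  by (simp add: half_eq dom_spectral_integral)

lemma sqrt_meas: "(\<lambda>t. sqrt \<bar>t\<bar>) \<in> borel_measurable borel"
  by measurable

lemma dom_A_half: "dom A \<subseteq> dom half"
proof -
  have "\<bar>t\<bar> \<le> 1 + t\<^sup>2" for t :: real
    using zero_le_power2[of "\<bar>t\<bar> - 1"] by (simp add: power2_diff)
  thus ?thesis unfolding dom_half sdom_id[symmetric]
    by (auto intro: sdom_mono[of _ "\<lambda>t. t"])
qed

text \<open>Only the second argument has to lie in \<open>dom A\<close>, so projection errors, known
  only to be in \<open>dom half\<close>, can be paired with dual solutions.\<close>

lemma energy_A:
  assumes "x \<in> dom half" "y \<in> dom A"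
  shows "energy x y = H x (AA y)"
proof -
  have "y \<in> sdom (\<lambda>t. sqrt \<bar>t\<bar>)" using assms(2) dom_A_half by (auto simp: dom_half)
  thus ?thesis
    using inner_sint_sqrt[OF sqrt_meas _ _ E_negative, of "\<lambda>t. t" x y] assms
    by (simp add: pow_inner_def half_eq sdom_id sint_id dom_spectral_integral)
qed

sublocale en: psd_form "dom half" energy
proof
  show "cvec.subspace (dom half)" unfolding dom_half by (rule sdom_subspace[OF sqrt_meas])
qed (auto simp: pow_inner_def half_eq dom_spectral_integral sint_add[OF sqrt_meas] sint_scale[OF sqrt_meas]
    lin nonneg intro: herm[OF UNIV_I UNIV_I])

lemma energy_limit:
  assumes "\<And>n. Y n \<in> dom half" "hlim H Y y" "\<And>n. hnorm energy (Y n) \<le> C"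
  shows "y \<in> dom half" "hnorm energy y \<le> 2 * C"
proof -
  have e: "hnorm energy z = hnorm H (sint (\<lambda>t. sqrt \<bar>t\<bar>) z)" for z
    by (simp add: hnorm_def pow_inner_def half_eq)
  show "y \<in> dom half" "hnorm energy y \<le> 2 * C"
    using sdom_limit[OF sqrt_meas, of Y y C] assms unfolding e dom_half by blast+
qed

lemma energy_coercive:
  assumes x: "x \<in> dom A" shows "sqrt alpha * hnorm H x \<le> hnorm energy x"
proof -
  have xh: "x \<in> dom half" using x dom_A_half by blast
  have "(sqrt alpha * hnorm H x)\<^sup>2 \<le> (hnorm energy x)\<^sup>2"
    unfolding en.norm_sq[OF xh] energy_A[OF xh x] using coercive[OF x] alpha_pos
    by (simp add: power_mult_distrib)
  thus ?thesis by (rule power2_le_imp_le) (simp add: xh)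
qed

end

section \<open>Discrete spectrum and eigenvectors\<close>

context hilb
begin

lemma orthonormal_independent:
  assumes e: "orthonormal_on H J e" and I: "finite I" "I \<subseteq> J"
  shows "inj_on e I" "cvec.independent (e ` I)"
proof -
  have o: "H (e i) (e j) = (if i = j then 1 else 0)" if "i \<in> I" "j \<in> I" for i j
    using e I that unfolding orthonormal_on_def by blast
  show inj: "inj_on e I"
  proof (rule inj_onI)
    fix i j assume ij: "i \<in> I" "j \<in> I" "e i = e j"
    show "i = j" using o[OF ij(1,2)] o[OF ij(1,1)] ij(3) by (auto split: if_splits)
  qed
  show "cvec.independent (e ` I)"
  proof
    assume "cvec.dependent (e ` I)"
    then obtain c v where c: "v \<in> e ` I" "c v \<noteq> 0" "(\<Sum>v\<in>e ` I. c v *\<^sub>C v) = 0"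
      using I cvec.dependent_finite[of "e ` I"] by auto
    then obtain k where k: "k \<in> I" "v = e k" by blast
    have "(\<Sum>i\<in>I. c (e i) *\<^sub>C e i) = 0" using c(3) inj by (simp add: sum.reindex)
    moreover have "H (e k) (\<Sum>i\<in>I. c (e i) *\<^sub>C e i) = c (e k)"
      by (rule orthonormal_inner_sum[OF I(1) o k(1)])
    ultimately show False using c(2) k by (simp add: zero_right)
  qed
qed

text \<open>Gram-Schmidt by recursion on finite orthonormal sets: infinite dimension always leaves a
  vector of \<open>W\<close> outside their span.\<close>

lemma orthonormal_sequence:
  assumes W: "cvec.subspace W" and inf: "\<And>F. finite F \<Longrightarrow> \<not> W \<subseteq> cvec.span F"
  shows "\<exists>e :: nat \<Rightarrow> 'h. (\<forall>n. e n \<in> W \<and> H (e n) (e n) = 1) \<and> (\<forall>m n. m < n \<longrightarrow> H (e m) (e n) = 0)"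
proof -
  let ?P = "\<lambda>F v. v \<in> W \<and> H v v = 1 \<and> (\<forall>z\<in>F. H z v = 0)"
  let ?O = "\<lambda>F. finite F \<and> F \<subseteq> W \<and> (\<forall>a\<in>F. \<forall>b\<in>F. H a b = (if a = b then 1 else 0))"
  have ex: "\<exists>v. ?P F v" if F: "?O F" for F
  proof -
    obtain v where v: "v \<in> W" "v \<notin> cvec.span F" using inf F by blast
    define p where "p = (\<Sum>z\<in>F. H z v *\<^sub>C z)"
    have pF: "p \<in> cvec.span F" unfolding p_def by (intro cvec.span_sum cvec.span_scale cvec.span_base)
    have pW: "p \<in> W" unfolding p_def using F
      by (intro cvec.subspace_sum[OF W] cvec.subspace_scale[OF W]) blast
    have orth: "H z (v - p) = 0" if "z \<in> F" for z
    proof -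
      have "H z p = (\<Sum>i\<in>F. H i v * H z i)" by (simp add: p_def sum_right lin)
      also have "\<dots> = (\<Sum>i\<in>F. if z = i then H i v else 0)"
        using F that by (intro sum.cong) auto
      finally show ?thesis using F that by (simp add: lin)
    qed
    have "v - p \<noteq> 0" using v(2) pF by auto
    hence n: "hnorm H (v - p) > 0" by (rule norm_pos)
    let ?u = "of_real (1 / hnorm H (v - p)) *\<^sub>C (v - p)"
    have "hnorm H ?u = 1" using n \<open>v - p \<noteq> 0\<close> by (simp add: norm_scale norm_divide)
    hence "H ?u ?u = 1" using self_eq[of ?u] by simp
    moreover have "?u \<in> W" using v(1) pW by (intro cvec.subspace_scale[OF W] cvec.subspace_diff[OF W])
    moreover have "\<forall>z\<in>F. H z ?u = 0" using orth by (simp add: scale_right)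
    ultimately show ?thesis by blast
  qed
  define pick where "pick F = (SOME v. ?P F v)" for F
  have pick: "?P F (pick F)" if "?O F" for F
    unfolding pick_def by (rule someI_ex[OF ex[OF that]])
  define Fs where "Fs = rec_nat {} (\<lambda>_ F. insert (pick F) F)"
  have Fs: "Fs 0 = {}" "Fs (Suc n) = insert (pick (Fs n)) (Fs n)" for n by (simp_all add: Fs_def)
  have O: "?O (Fs n)" for n
  proof (induction n)
    case 0 show ?case by (simp add: Fs)
  next
    case (Suc n)
    have p: "?P (Fs n) (pick (Fs n))" by (rule pick[OF Suc])
    have sym: "H (pick (Fs n)) z = 0" if "z \<in> Fs n" for z
      using p that herm[of z "pick (Fs n)"] by simp
    have ne: "pick (Fs n) \<notin> Fs n" using p by force
    have "H a b = (if a = b then 1 else 0)" if "a \<in> Fs (Suc n)" "b \<in> Fs (Suc n)" for a b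
      using that Suc p sym ne unfolding Fs by (elim insertE) (auto split: if_splits)
    thus ?case using Suc p unfolding Fs by simp
  qed
  have mem: "pick (Fs m) \<in> Fs n" if "m < n" for m n
    using that by (induction n) (auto simp: Fs less_Suc_eq)
  show ?thesis
  proof (intro exI[of _ "\<lambda>n. pick (Fs n)"] conjI allI impI)
    fix n show "pick (Fs n) \<in> W" "H (pick (Fs n)) (pick (Fs n)) = 1" using pick[OF O[of n]] by blast+
    fix m assume "m < n"
    thus "H (pick (Fs m)) (pick (Fs n)) = 0" using pick[OF O[of n]] mem by blast
  qed
qed

lemma orthonormal_expansion:
  assumes e: "\<And>i j. i \<ge> 1 \<Longrightarrow> j \<ge> 1 \<Longrightarrow> H (e i) (e j) = (if i = j then 1 else 0)"
    and complete: "\<And>x. (\<And>k::nat. k \<ge> 1 \<Longrightarrow> H (e k) x = 0) \<Longrightarrow> x = 0"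
  shows "hlim H (\<lambda>n. \<Sum>k=1..n. H (e k) v *\<^sub>C e k) v"
proof -
  let ?S = "\<lambda>n. \<Sum>k=1..n. H (e k) v *\<^sub>C e k"
  let ?s = "\<lambda>n. \<Sum>k=1..n. (cmod (H (e k) v))\<^sup>2"
  have o: "\<And>i j. i \<in> {1..n} \<Longrightarrow> j \<in> {1..n} \<Longrightarrow> H (e i) (e j) = (if i = j then 1 else 0)" for n
    using e by auto
  have "incseq ?s" by (auto simp: incseq_def intro!: sum_mono2)
  moreover have "?s n \<le> (hnorm H v)\<^sup>2" for n by (rule bessel[OF _ o]) auto
  ultimately obtain L where L: "?s \<longlonglongrightarrow> L" "\<forall>n. ?s n \<le> L"
    using incseq_convergent[of ?s "(hnorm H v)\<^sup>2"] by blast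
  hence le: "?s n \<le> L" for n by blast
  have diff: "(hnorm H (?S m - ?S n))\<^sup>2 = ?s m - ?s n" if "n \<le> m" for m n
  proof -
    have split: "{1..m} = {1..n} \<union> {n<..m}" using that by auto
    have "?S m - ?S n = (\<Sum>k\<in>{n<..m}. H (e k) v *\<^sub>C e k)"
      unfolding split by (subst sum.union_disjoint) auto
    moreover have "?s m - ?s n = (\<Sum>k\<in>{n<..m}. (cmod (H (e k) v))\<^sup>2)"
      unfolding split by (subst sum.union_disjoint) auto
    ultimately show ?thesis using e by (auto intro!: orthonormal_sum_sq)
  qed
  have "(hnorm H (?S k - ?S m))\<^sup>2 \<le> (L - ?s k) + (L - ?s m)" for k m
  proof (cases "k \<le> m")
    case True
    thus ?thesis using diff[OF True] le[of m] norm_diff_commute[of "?S k" "?S m"] le[of k] by simp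
  next
    case False
    thus ?thesis using diff[of m k] le[of m] le[of k] by simp
  qed
  moreover have "(\<lambda>n. L - ?s n) \<longlonglongrightarrow> 0" using tendsto_diff[OF tendsto_const L(1), of L] by simp
  ultimately obtain w where w: "hlim H ?S w" by (rule complete_sq)
  have "v - w = 0"
  proof (rule complete)
    fix k :: nat assume k: "k \<ge> 1"
    have "\<forall>\<^sub>F n in sequentially. H (e k) (?S n) = H (e k) v"
      by (rule eventually_sequentiallyI[of k], rule orthonormal_inner_sum[OF _ o]) (use k in auto)
    hence "(\<lambda>n. H (e k) (?S n)) \<longlonglongrightarrow> H (e k) v" by (rule tendsto_eventually)
    moreover have "(\<lambda>n. H (e k) (?S n)) \<longlonglongrightarrow> H (e k) w" by (rule hlim_inner[OF hlim_const w])
    ultimately have "H (e k) v = H (e k) w" by (rule LIMSEQ_unique)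
    thus "H (e k) (v - w) = 0" by (simp add: diff_right)
  qed
  thus ?thesis using w by simp
qed

end

section \<open>The spectrum below the essential spectrum\<close>

context positive_selfadjoint
begin

lemma eigenspace_subspace: "cvec.subspace (eigenspace A z)"
proof (rule cvec.subspaceI)
  show "0 \<in> eigenspace A z" using dom_zero A_zero by (simp add: eigenspace_def)
  fix x y assume "x \<in> eigenspace A z" "y \<in> eigenspace A z"
  hence *: "x \<in> dom A" "y \<in> dom A" "AA x = z *\<^sub>C x" "AA y = z *\<^sub>C y" by (simp_all add: eigenspace_def)
  show "x + y \<in> eigenspace A z"
    using dom_add[OF *(1,2)] A_add[OF *(1,2)] * by (simp add: eigenspace_def cvec.scale_right_distrib)
  show "c *\<^sub>C x \<in> eigenspace A z" for c
    using dom_scale[OF *(1)] A_scale[OF *(1)] * by (simp add: eigenspace_def mult.commute)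
qed

lemma eigen_atom: "y \<in> eigenspace A (of_real b) \<Longrightarrow> EA {b} y = y"
  by (rule eigenvector_atom) (simp_all add: eigenspace_def sdom_id sint_id)

lemma atom_eigen: "EA {b} x \<in> eigenspace A (of_real b)"
  using sint_atom[of "\<lambda>t. t" b "EA {b} x"] by (simp add: eigenspace_def E_idem sdom_id sint_id)

lemma atom_zero:
  assumes "\<And>y. y \<in> eigenspace A (of_real b) \<Longrightarrow> H y x = 0"
  shows "EA {b} x = 0"
proof -
  have "H (EA {b} x) (EA {b} x) = H (EA {b} (EA {b} x)) x" by (simp add: E_sym)
  also have "\<dots> = 0" by (simp add: E_idem assms[OF atom_eigen])
  finally show ?thesis by (simp add: inner_self_eq_0)
qed

text \<open>A dimension count. The dimension of an infinite-dimensional space is 0 by default, so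
  finite dimension has to be supplied before the count in \<open>eigenpairs_below\<close> says
  anything about spanning.\<close>

lemma eigenspace_span:
  assumes ep: "eigenpairs_below H A b J \<kappa> e" and t: "ereal t < b"
    and fin: "finite F" "eigenspace A (of_real t) \<subseteq> cvec.span F"
  shows "eigenspace A (of_real t) \<subseteq> cvec.span (e ` {j \<in> J. \<kappa> j = t})"
proof (rule ccontr)
  let ?W = "eigenspace A (of_real t)" and ?I = "{j \<in> J. \<kappa> j = t}"
  assume "\<not> ?W \<subseteq> cvec.span (e ` ?I)"
  then obtain y where y: "y \<in> ?W" "y \<notin> cvec.span (e ` ?I)" by blast
  have I: "finite ?I" "card ?I = cvec.dim ?W" and o: "orthonormal_on H J e"
    and ev: "\<forall>j\<in>J. e j \<in> eigenspace A (of_real (\<kappa> j))"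
    using ep t unfolding eigenpairs_below_def by blast+
  have eW: "e ` ?I \<subseteq> ?W" using ev by auto
  note ind = orthonormal_independent[OF o I(1)]
  have ind': "cvec.independent (insert y (e ` ?I))"
    using ind(2) y(2) by (intro cvec.independent_insertI) auto
  obtain B where B: "B \<subseteq> ?W" "cvec.independent B" "?W \<subseteq> cvec.span B" "card B = cvec.dim ?W"
    by (rule cvec.basis_exists)
  have fB: "finite B" using cvec.independent_span_bound[OF fin(1) B(2)] B(1) fin(2) by blast
  have "insert y (e ` ?I) \<subseteq> ?W" using y(1) eW by simp
  hence "card (insert y (e ` ?I)) \<le> card B"
    using cvec.independent_span_bound[OF fB ind' order_trans[OF _ B(3)]] by simp
  moreover have "y \<notin> e ` ?I"
  proof
    assume "y \<in> e ` ?I"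
    from cvec.span_base[OF this] y(2) show False by contradiction
  qed
  hence "card (insert y (e ` ?I)) = Suc (card ?I)"
    using I(1) ind(1) by (simp add: card_image)
  ultimately show False using B(4) I(2) by simp
qed

text \<open>An open set of points outside the support is null, because countably many null balls
  already cover it.\<close>

lemma lindelof_zero:
  assumes "open U" and loc: "\<And>b. b \<in> U \<Longrightarrow> \<exists>\<delta>>0. EA (ball b \<delta>) x = 0"
  shows "EA U x = 0"
proof -
  obtain FF where F: "FF \<subseteq> {ball b \<delta> | b \<delta>. EA (ball b \<delta>) x = 0}" "countable FF"
    "\<Union>FF = \<Union>{ball b \<delta> | b \<delta>. EA (ball b \<delta>) x = 0}"
    by (rule Lindelof[of "{ball b \<delta> | b \<delta>. EA (ball b \<delta>) x = 0}"]) auto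
  have "EA (\<Union>FF) x = 0"
    using F(1) by (intro E_countable_zero[OF F(2)]) auto
  moreover have "U \<subseteq> \<Union>FF" unfolding F(3)
  proof
    fix b assume "b \<in> U"
    then obtain \<delta> where "\<delta> > 0" "EA (ball b \<delta>) x = 0" using loc by blast
    thus "b \<in> \<Union>{ball b \<delta> | b \<delta>. EA (ball b \<delta>) x = 0}" by (intro UnionI[of "ball b \<delta>"]) auto
  qed
  moreover have "\<Union>FF \<in> sets borel" using F(1) by (intro borel_open open_Union) auto
  moreover have "U \<in> sets borel" using assms(1) by simp
  ultimately show ?thesis using E_mono_zero by blast
qed

text \<open>An approximate eigenvector with relative defect \<delta> contradicts the resolvent bound
  \<open>C\<close> once C times \<delta> is below 1; the choice made keeps this product at most
  1/2.\<close>

lemma not_spectrum_ball: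
  assumes "of_real b \<notin> spectrum H A" shows "\<exists>\<delta>>0. \<forall>x. EA (ball b \<delta>) x = 0"
proof -
  obtain C where C: "\<forall>u\<in>dom A. hnorm H u \<le> C * hnorm H (AA u - of_real b *\<^sub>C u)"
    using assms unfolding spectrum_def by blast
  define \<delta> where "\<delta> = 1 / (2 * (\<bar>C\<bar> + 1))"
  have \<delta>: "\<delta> > 0" "\<bar>C\<bar> * \<delta> \<le> 1 / 2" by (auto simp: \<delta>_def field_simps)
  have "EA (ball b \<delta>) x = 0" for x
  proof -
    let ?u = "EA (ball b \<delta>) x"
    have u: "?u \<in> dom A" "hnorm H (AA ?u - of_real b *\<^sub>C ?u) \<le> \<delta> * hnorm H ?u"
      by (rule E_bounded_dom[where b = b and d = \<delta>]; simp add: dist_real_def abs_minus_commute)+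
    have "hnorm H ?u \<le> C * hnorm H (AA ?u - of_real b *\<^sub>C ?u)" using C u(1) by blast
    also have "\<dots> \<le> \<bar>C\<bar> * hnorm H (AA ?u - of_real b *\<^sub>C ?u)" by (intro mult_right_mono) auto
    also have "\<dots> \<le> \<bar>C\<bar> * (\<delta> * hnorm H ?u)" by (rule mult_left_mono[OF u(2)]) simp
    also have "\<dots> = (\<bar>C\<bar> * \<delta>) * hnorm H ?u" by simp
    also have "\<dots> \<le> (1 / 2) * hnorm H ?u" by (rule mult_right_mono[OF \<delta>(2)]) simp
    finally have "hnorm H ?u = 0" using hnorm_ge0[OF UNIV_I, of ?u] by linarith
    thus ?thesis by simp
  qed
  thus ?thesis using \<delta>(1) by blast
qed

lemma isolated_neighbourhood:
  assumes "of_real b isolated_in spectrum H A"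
  shows "\<exists>\<epsilon>>0. \<forall>s. \<bar>s - b\<bar> < \<epsilon> \<longrightarrow> s \<noteq> b \<longrightarrow> of_real s \<notin> spectrum H A"
proof -
  obtain T where T: "open T" "T \<inter> spectrum H A = {of_real b}"
    using assms unfolding isolated_in_def by blast
  have "of_real b \<in> T" using T(2) by blast
  then obtain \<epsilon> where e: "\<epsilon> > 0" "ball (of_real b) \<epsilon> \<subseteq> T" using T(1) open_contains_ball by blast
  have "of_real s \<notin> spectrum H A" if "\<bar>s - b\<bar> < \<epsilon>" "s \<noteq> b" for s
  proof
    assume "of_real s \<in> spectrum H A"
    moreover have "dist (complex_of_real b) (of_real s) = \<bar>s - b\<bar>"
      by (simp add: dist_norm abs_minus_commute flip: of_real_diff)
    hence "complex_of_real s \<in> T" using e(2) that(1) by (auto simp: subset_iff)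
    ultimately have "complex_of_real s = of_real b" using T(2) by blast
    thus False using that(2) by simp
  qed
  thus ?thesis using e(1) by blast
qed

text \<open>A spectral point in \<open>U\<close> is an isolated eigenvalue: a punctured ball around
  it consists of resolvent points, and orthogonality removes the atom at its centre.\<close>

lemma E_open_zero:
  assumes U: "open U" and ess: "\<And>b. b \<in> U \<Longrightarrow> of_real b \<notin> essential_spectrum H A"
    and orth: "\<And>b y. b \<in> U \<Longrightarrow> y \<in> eigenspace A (of_real b) \<Longrightarrow> H y x = 0"
  shows "EA U x = 0"
proof (rule lindelof_zero[OF U])
  fix b assume b: "b \<in> U"
  show "\<exists>\<delta>>0. EA (ball b \<delta>) x = 0"
  proof (cases "of_real b \<in> spectrum H A")
    case False thus ?thesis using not_spectrum_ball by blast
  next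
    case True
    hence "of_real b isolated_in spectrum H A"
      using ess[OF b] unfolding essential_spectrum_def discrete_spectrum_def by blast
    then obtain \<epsilon> where e: "\<epsilon> > 0" "\<forall>s. \<bar>s - b\<bar> < \<epsilon> \<longrightarrow> s \<noteq> b \<longrightarrow> of_real s \<notin> spectrum H A"
      using isolated_neighbourhood by blast
    have "EA (ball b \<epsilon> - {b}) x = 0"
    proof (rule lindelof_zero)
      fix s assume "s \<in> ball b \<epsilon> - {b}"
      hence "of_real s \<notin> spectrum H A" using e(2) by (auto simp: dist_real_def abs_minus_commute)
      thus "\<exists>\<delta>>0. EA (ball s \<delta>) x = 0" using not_spectrum_ball by blast
    qed auto
    moreover have "EA {b} x = 0" by (rule atom_zero[OF orth[OF b]])
    moreover have "ball b \<epsilon> = (ball b \<epsilon> - {b}) \<union> {b}" using e(1) by auto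
    hence "EA (ball b \<epsilon>) x = EA (ball b \<epsilon> - {b}) x + EA {b} x"
      using E_additive[of "ball b \<epsilon> - {b}" "{b}" x] by simp
    ultimately show ?thesis using e(1) by auto
  qed
qed

lemma below_inf_essential:
  "ereal t < inf_essential_spectrum H A \<Longrightarrow> of_real t \<notin> essential_spectrum H A"
  unfolding inf_essential_spectrum_def by (metis INF_lower Re_complex_of_real not_less)

lemma below_finite_eigenspace:
  assumes "ereal t < inf_essential_spectrum H A"
  shows "\<exists>F. finite F \<and> eigenspace A (of_real t) \<subseteq> cvec.span F"
proof (cases "of_real t \<in> spectrum H A")
  case True
  thus ?thesis using below_inf_essential[OF assms]
    unfolding essential_spectrum_def discrete_spectrum_def by blast
next
  case False
  hence inj: "inj_on (\<lambda>u. AA u - of_real t *\<^sub>C u) (dom A)"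
    unfolding spectrum_def bij_betw_def by blast
  have "y = 0" if "y \<in> eigenspace A (of_real t)" for y
    using inj_onD[OF inj, of y 0] that dom_zero A_zero by (simp add: eigenspace_def)
  thus ?thesis by (intro exI[of _ "{}"]) auto
qed

lemma form_ge_below:
  assumes t: "ereal t \<le> inf_essential_spectrum H A" and x: "x \<in> dom A"
    and orth: "\<And>s y. s < t \<Longrightarrow> y \<in> eigenspace A (of_real s) \<Longrightarrow> H y x = 0"
  shows "t * (hnorm H x)\<^sup>2 \<le> Re (H x (AA x))"
proof (rule form_ge[OF x], rule E_open_zero)
  show "of_real b \<notin> essential_spectrum H A" if "b \<in> {..<t}" for b
    using that t by (intro below_inf_essential less_le_trans[OF _ t]) simp
qed (use orth in auto)

text \<open>An eigenvalue below the essential spectrum is isolated, so an interval above it lies in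
  the resolvent set; its length is the gap.\<close>

lemma form_gap:
  assumes t: "ereal t < inf_essential_spectrum H A" and u: "u \<in> eigenspace A (of_real t)" "u \<noteq> 0"
  shows "\<exists>\<gamma>>t. \<forall>x\<in>dom A. (\<forall>s y. s \<le> t \<longrightarrow> y \<in> eigenspace A (of_real s) \<longrightarrow> H y x = 0) \<longrightarrow>
    \<gamma> * (hnorm H x)\<^sup>2 \<le> Re (H x (AA x))"
proof -
  have "of_real t \<in> spectrum H A"
  proof (rule ccontr)
    assume "of_real t \<notin> spectrum H A"
    hence inj: "inj_on (\<lambda>u. AA u - of_real t *\<^sub>C u) (dom A)"
      unfolding spectrum_def bij_betw_def by blast
    show False
      using inj_onD[OF inj, of u 0] u dom_zero A_zero by (simp add: eigenspace_def)
  qed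
  hence "of_real t isolated_in spectrum H A"
    using below_inf_essential[OF t] unfolding essential_spectrum_def discrete_spectrum_def by blast
  then obtain \<epsilon> where e: "\<epsilon> > 0" "\<forall>s. \<bar>s - t\<bar> < \<epsilon> \<longrightarrow> s \<noteq> t \<longrightarrow> of_real s \<notin> spectrum H A"
    using isolated_neighbourhood by blast
  have ns: "of_real s \<notin> spectrum H A" if "t < s" "s < t + \<epsilon>" for s
    using e(2) that by auto
  show ?thesis
  proof (intro exI[of _ "t + \<epsilon>"] conjI ballI impI)
    fix x assume x: "x \<in> dom A"
      and orth: "\<forall>s y. s \<le> t \<longrightarrow> y \<in> eigenspace A (of_real s) \<longrightarrow> H y x = 0"
    show "(t + \<epsilon>) * (hnorm H x)\<^sup>2 \<le> Re (H x (AA x))"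
    proof (rule form_ge[OF x], rule E_open_zero)
      fix b assume b: "b \<in> {..<t + \<epsilon>}"
      show "of_real b \<notin> essential_spectrum H A"
      proof (cases "b \<le> t")
        case True
        hence "ereal b < inf_essential_spectrum H A" using t by (metis ereal_less_eq(3) order_le_less_trans)
        thus ?thesis by (rule below_inf_essential)
      next
        case False thus ?thesis using ns b by (auto simp: essential_spectrum_def)
      qed
      fix y assume y: "y \<in> eigenspace A (of_real b)"
      show "H y x = 0"
      proof (cases "b \<le> t")
        case True thus ?thesis using orth y by blast
      next
        case False
        hence "inj_on (\<lambda>u. AA u - of_real b *\<^sub>C u) (dom A)"
          using ns b unfolding spectrum_def bij_betw_def by auto
        from inj_onD[OF this, of y 0] y dom_zero A_zero have "y = 0" by (simp add: eigenspace_def)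
        thus ?thesis by (simp add: zero_left)
      qed
    qed simp
  qed (use e in simp)
qed

lemma A_closed:
  assumes Y: "\<And>n. Y n \<in> dom A" "hlim H Y y" "hlim H (\<lambda>n. AA (Y n)) z"
  shows "y \<in> dom A" "AA y = z"
proof -
  have "H z v = H y (AA v)" if v: "v \<in> dom A" for v
  proof (rule LIMSEQ_unique)
    show "(\<lambda>n. H (AA (Y n)) v) \<longlonglongrightarrow> H z v" by (rule hlim_inner[OF Y(3) hlim_const])
    show "(\<lambda>n. H (AA (Y n)) v) \<longlonglongrightarrow> H y (AA v)"
      unfolding A_sym[OF Y(1) v] by (rule hlim_inner[OF Y(2) hlim_const])
  qed
  thus "y \<in> dom A" "AA y = z" using A_adjoint by blast+
qed

section \<open>Compact inverse and completeness of eigenvectors\<close>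

context
  assumes cpt: "compact_inverse H A"
begin

lemma compact_subsequence:
  assumes Y: "\<And>n. Y n \<in> dom A" "\<And>n. hnorm H (AA (Y n)) \<le> C"
  shows "\<exists>r y. strict_mono (r :: nat \<Rightarrow> nat) \<and> hlim H (\<lambda>n. Y (r n)) y"
proof -
  interpret MS: Metric_space UNIV "hdist H" by (rule metric)
  let ?S = "range (\<lambda>n. AA (Y n))"
  have "MS.mbounded ?S"
    unfolding MS.mbounded_def
    using Y(2) by (intro exI[of _ 0] exI[of _ C]) (auto simp: MS.mcball_def hdist_def norm_minus)
  hence "compactin (htop H) (htop H closure_of (Ainv ` ?S))"
    using cpt unfolding compact_inverse_def compact_operator_def Ainv_def by blast
  hence seq: "\<forall>\<sigma> :: nat \<Rightarrow> 'h. range \<sigma> \<subseteq> htop H closure_of (Ainv ` ?S) \<longrightarrow>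
      (\<exists>l r. l \<in> htop H closure_of (Ainv ` ?S) \<and> strict_mono r \<and> limitin (htop H) (\<sigma> \<circ> r) l sequentially)"
    unfolding htop_def MS.compactin_sequentially by (rule conjunct2)
  have top: "topspace (htop H) = UNIV" by (simp add: htop_def)
  have "range Y \<subseteq> Ainv ` ?S"
  proof clarify
    fix n
    have "Y n = Ainv (AA (Y n))" by (rule Ainv_A[OF Y(1), symmetric])
    thus "Y n \<in> Ainv ` ?S" by (rule image_eqI) simp
  qed
  also have "\<dots> \<subseteq> htop H closure_of (Ainv ` ?S)" by (rule closure_of_subset) (simp add: top)
  finally have "\<exists>l r. l \<in> htop H closure_of (Ainv ` ?S) \<and> strict_mono r \<and> limitin (htop H) (Y \<circ> r) l sequentially"
    by (rule seq[rule_format])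
  thus ?thesis unfolding limitin_iff by (auto simp: o_def)
qed

text \<open>Along a convergent subsequence of an orthonormal sequence, products of consecutive terms
  and of equal terms have the same limit, which would be both 0 and 1.\<close>

lemma compact_finite_eigenspace: "\<exists>F. finite F \<and> eigenspace A (of_real b) \<subseteq> cvec.span F"
proof (rule ccontr)
  assume "\<not> ?thesis"
  hence inf: "\<And>F. finite F \<Longrightarrow> \<not> eigenspace A (of_real b) \<subseteq> cvec.span F" by blast
  from orthonormal_sequence[OF eigenspace_subspace inf]
  obtain e :: "nat \<Rightarrow> 'h" where e: "\<forall>n. e n \<in> eigenspace A (of_real b) \<and> H (e n) (e n) = 1"
    "\<forall>m n. m < n \<longrightarrow> H (e m) (e n) = 0" by blast
  have n1: "hnorm H (e n) = 1" for n using e(1) by (simp add: hnorm_def)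
  have d: "e n \<in> dom A" "AA (e n) = of_real b *\<^sub>C e n" for n using e(1) by (auto simp: eigenspace_def)
  have "hnorm H (AA (e n)) \<le> \<bar>b\<bar>" for n by (simp add: d norm_scale n1)
  from compact_subsequence[of e, OF d(1) this]
  obtain r y where r: "strict_mono r" "hlim H (\<lambda>n. e (r n)) y" by blast
  have "(\<lambda>n. H (e (r n)) (e (r (Suc n)))) \<longlonglongrightarrow> H y y"
    by (rule hlim_inner[OF r(2) LIMSEQ_Suc[OF r(2)]])
  moreover have "H (e (r n)) (e (r (Suc n))) = 0" for n
    using e(2) r(1) by (simp add: strict_mono_Suc_iff)
  ultimately have "H y y = 0" by (simp add: LIMSEQ_const_iff)
  moreover have "(\<lambda>n. H (e (r n)) (e (r n))) \<longlonglongrightarrow> H y y" by (rule hlim_inner[OF r(2) r(2)])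
  hence "H y y = 1" using e(1) by (simp add: LIMSEQ_const_iff)
  ultimately show False by simp
qed

text \<open>Otherwise normalized vectors from shrinking balls are approximate eigenvectors, and
  compactness yields a unit eigenvector for \<open>b\<close> as their limit. It would also be
  orthogonal to all of them.\<close>

lemma compact_local_zero:
  assumes orth: "\<And>y. y \<in> eigenspace A (of_real b) \<Longrightarrow> H y x = 0"
  shows "\<exists>\<delta>>0. EA (ball b \<delta>) x = 0"
proof (rule ccontr)
  assume "\<not> ?thesis"
  hence nz: "EA (ball b (1 / (real n + 1))) x \<noteq> 0" for n by auto
  let ?e = "\<lambda>n. EA (ball b (1 / (real n + 1))) x"
  define Y where "Y n = of_real (1 / hnorm H (?e n)) *\<^sub>C ?e n" for n
  have pos: "hnorm H (?e n) > 0" for n by (rule norm_pos[OF nz])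
  have ed: "?e n \<in> dom A" "hnorm H (AA (?e n) - of_real b *\<^sub>C ?e n) \<le> 1 / (real n + 1) * hnorm H (?e n)" for n
    by (rule E_bounded_dom[where b = b and d = "1 / (real n + 1)"]; simp add: dist_real_def abs_minus_commute)+
  have Y1: "hnorm H (Y n) = 1" for n using pos[of n] nz[of n] by (simp add: Y_def norm_scale norm_divide)
  have Yd: "Y n \<in> dom A" for n unfolding Y_def by (rule dom_scale[OF ed(1)])
  have Ya: "hnorm H (AA (Y n) - of_real b *\<^sub>C Y n) \<le> 1 / (real n + 1)" for n
  proof -
    have "AA (Y n) - of_real b *\<^sub>C Y n = of_real (1 / hnorm H (?e n)) *\<^sub>C (AA (?e n) - of_real b *\<^sub>C ?e n)"
      unfolding Y_def A_scale[OF ed(1)] by (simp add: cvec.scale_right_diff_distrib mult.commute)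
    hence "hnorm H (AA (Y n) - of_real b *\<^sub>C Y n) = hnorm H (AA (?e n) - of_real b *\<^sub>C ?e n) / hnorm H (?e n)"
      using pos[of n] by (simp add: norm_scale norm_divide)
    thus ?thesis using ed(2)[of n] pos[of n] by (simp add: pos_divide_le_eq del: times_divide_eq_left)
  qed
  have "hnorm H (AA (Y n)) \<le> 1 + \<bar>b\<bar>" for n
  proof -
    have "hnorm H (AA (Y n)) \<le> hnorm H (AA (Y n) - of_real b *\<^sub>C Y n) + hnorm H (of_real b *\<^sub>C Y n)"
      using triangle[of "AA (Y n) - of_real b *\<^sub>C Y n" "of_real b *\<^sub>C Y n"] by simp
    also have "\<dots> \<le> 1 / (real n + 1) + \<bar>b\<bar>" using Ya[of n] by (simp add: norm_scale Y1)
    also have "1 / (real n + 1) \<le> 1" by simp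
    finally show ?thesis by simp
  qed
  from compact_subsequence[of Y, OF Yd this]
  obtain r y where r: "strict_mono r" "hlim H (\<lambda>n. Y (r n)) y" by blast
  have "hlim H (\<lambda>n. AA (Y (r n))) (of_real b *\<^sub>C y)"
  proof -
    have "hlim H (\<lambda>n. AA (Y n) - of_real b *\<^sub>C Y n) 0"
    proof (rule Lim_null_comparison)
      show "\<forall>\<^sub>F n in sequentially. norm (hnorm H (AA (Y n) - of_real b *\<^sub>C Y n - 0)) \<le> 1 / (real n + 1)"
        using Ya by simp
      show "(\<lambda>n. 1 / (real n + 1)) \<longlonglongrightarrow> 0" by real_asymp
    qed
    from LIMSEQ_subseq_LIMSEQ[OF this r(1)]
    have "hlim H (\<lambda>n. AA (Y (r n)) - of_real b *\<^sub>C Y (r n)) 0" by (simp add: o_def)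
    from hlim_add[OF this hlim_scale[OF r(2), of "of_real b"]] show ?thesis by simp
  qed
  from A_closed[of "\<lambda>n. Y (r n)", OF Yd r(2) this] have y: "y \<in> eigenspace A (of_real b)" by (simp add: eigenspace_def)
  \<comment> \<open>The eigenvector \<open>y\<close> is fixed by every
    \<open>EA (ball b (1 / (real n + 1)))\<close>, so by symmetry its product with
    \<open>Y n\<close> is a multiple of its product with \<open>x\<close>.\<close>
  have z: "H y (Y n) = 0" for n
  proof -
    have "EA (ball b (1 / (real n + 1))) y = EA (ball b (1 / (real n + 1))) (EA {b} y)"
      by (simp add: eigen_atom[OF y])
    also have "\<dots> = EA {b} y" by (subst E_inter) (simp_all add: Int_absorb1)
    finally have "EA (ball b (1 / (real n + 1))) y = y" by (simp add: eigen_atom[OF y])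
    hence "H y (?e n) = H y x" using E_sym[of "ball b (1 / (real n + 1))" y x] by simp
    thus ?thesis by (simp add: Y_def scale_right orth[OF y])
  qed
  have "(\<lambda>n. H y (Y (r n))) \<longlonglongrightarrow> H y y" by (rule hlim_inner[OF hlim_const r(2)])
  hence "H y y = 0" by (simp add: z LIMSEQ_const_iff)
  moreover have "(\<lambda>n. hnorm H (Y (r n))) \<longlonglongrightarrow> hnorm H y" by (rule hlim_norm[OF r(2)])
  hence "hnorm H y = 1" by (simp add: Y1 LIMSEQ_const_iff)
  ultimately show False by (simp add: inner_self_eq_0)
qed

text \<open>No real point lies in the support of the spectral measure of \<open>x\<close>, so this
  measure vanishes.\<close>

lemma compact_eigenvectors_complete:
  assumes ep: "eigenpairs_below H A \<infinity> {1..} \<kappa> e" and x: "\<And>k. k \<ge> 1 \<Longrightarrow> H (e k) x = 0"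
  shows "x = 0"
proof -
  have "H y x = 0" if y: "y \<in> eigenspace A (of_real b)" for b y
  proof -
    obtain F where F: "finite F" "eigenspace A (of_real b) \<subseteq> cvec.span F"
      using compact_finite_eigenspace by blast
    have "y \<in> cvec.span (e ` {j \<in> {1..}. \<kappa> j = b})"
      using eigenspace_span[OF ep _ F] y by auto
    hence "H x y = 0"
    proof (induction rule: cvec.span_induct_alt)
      case base thus ?case by (simp add: zero_right)
    next
      case (step c z w)
      then obtain k where "k \<ge> 1" "z = e k" by auto
      hence "H x z = 0" using x[of k] herm[of z x] by simp
      thus ?case using step by (simp add: lin)
    qed
    thus ?thesis using herm[of x y] by simp
  qed
  hence "EA UNIV x = 0"
    by (intro lindelof_zero compact_local_zero) auto
  thus ?thesis by simp
qed

end

end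

section \<open>Comparison of two energy norms\<close>

lemma (in psd_form) restrict:
  assumes "cvec.subspace W" "W \<subseteq> V" shows "psd_form W B"
proof
  have V: "x \<in> W \<Longrightarrow> x \<in> V" for x using assms(2) by blast
  show "x \<in> W \<Longrightarrow> y \<in> W \<Longrightarrow> z \<in> W \<Longrightarrow> B x (y + z) = B x y + B x z" for x y z by (intro add_right V)
  show "x \<in> W \<Longrightarrow> y \<in> W \<Longrightarrow> B x (c *\<^sub>C y) = c * B x y" for x y c by (intro scale_right V)
  show "x \<in> W \<Longrightarrow> y \<in> W \<Longrightarrow> B y x = cnj (B x y)" for x y by (intro herm V)
  show "x \<in> W \<Longrightarrow> Re (B x x) \<ge> 0" for x by (intro nonneg V)
qed (rule assms(1))

text \<open>Krein's lemma: the numbers \<^term>\<open>hnorm B ((T ^^ k) v)\<close> are log-convex in \<^term>\<open>k\<close>, so they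
  cannot grow faster than the stronger seminorm allows.\<close>

lemma (in psd_form) krein:
  assumes T: "\<And>v. v \<in> V \<Longrightarrow> T v \<in> V"
    and sym: "\<And>u v. u \<in> V \<Longrightarrow> v \<in> V \<Longrightarrow> B (T u) v = B u (T v)"
    and N: "\<And>v. v \<in> V \<Longrightarrow> hnorm B v \<le> K * N v" "\<And>v. v \<in> V \<Longrightarrow> N (T v) \<le> \<rho> * N v"
    and pos: "K \<ge> 0" "\<rho> > 0" and v: "v \<in> V"
  shows "hnorm B (T v) \<le> \<rho> * hnorm B v"
proof (rule ccontr)
  define x where "x k = hnorm B ((T ^^ k) v)" for k
  assume "\<not> ?thesis"
  hence gt: "x (Suc 0) > \<rho> * x 0" by (simp add: x_def)
  have mem: "(T ^^ k) v \<in> V" for k by (induction k) (auto simp: T v)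
  have x0: "x k \<ge> 0" for k unfolding x_def by (simp add: mem)
  have convex: "(x (Suc k))\<^sup>2 \<le> x k * x (Suc (Suc k))" for k
  proof -
    have "(x (Suc k))\<^sup>2 = Re (B ((T ^^ k) v) ((T ^^ Suc (Suc k)) v))"
      unfolding x_def norm_sq[OF mem] using sym[OF mem[of k] mem[of "Suc k"]] by simp
    also have "\<dots> \<le> x k * x (Suc (Suc k))"
      unfolding x_def using cauchy_schwarz[OF mem[of k] mem[of "Suc (Suc k)"]] complex_Re_le_cmod order_trans by blast
    finally show ?thesis .
  qed
  have p0: "x 0 > 0"
  proof (rule ccontr)
    assume "\<not> x 0 > 0"
    hence "x 0 = 0" using x0[of 0] by simp
    thus False using convex[of 0] gt by simp
  qed
  \<comment> \<open>By log-convexity no later growth ratio falls below this first one, so the norms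
    grow at least like its powers.\<close>
  define \<theta> where "\<theta> = x (Suc 0) / x 0"
  have \<theta>: "\<theta> > \<rho>" using gt p0 by (simp add: \<theta>_def field_simps)
  have grow: "x k > 0 \<and> x (Suc k) \<ge> \<theta> * x k" for k
  proof (induction k)
    case 0 show ?case using p0 by (simp add: \<theta>_def)
  next
    case (Suc k)
    have p: "x (Suc k) > 0"
      using Suc \<theta> pos(2) mult_pos_pos[of \<theta> "x k"] by linarith
    have "x k * (\<theta> * x (Suc k)) = x (Suc k) * (\<theta> * x k)" by simp
    also have "\<dots> \<le> x (Suc k) * x (Suc k)" using Suc p by (intro mult_left_mono) auto
    also have "\<dots> \<le> x k * x (Suc (Suc k))" using convex[of k] by (simp add: power2_eq_square)
    finally show ?case using p Suc by simp
  qed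
  have low: "\<theta> ^ k * x 0 \<le> x k" for k
  proof (induction k)
    case (Suc k)
    have "\<theta> ^ Suc k * x 0 = \<theta> * (\<theta> ^ k * x 0)" by simp
    also have "\<dots> \<le> \<theta> * x k" using Suc \<theta> pos(2) by (intro mult_left_mono) auto
    finally show ?case using grow[of k] by simp
  qed simp
  have up: "N ((T ^^ k) v) \<le> \<rho> ^ k * N v" for k
  proof (induction k)
    case (Suc k)
    have "N ((T ^^ Suc k) v) \<le> \<rho> * N ((T ^^ k) v)" using N(2)[OF mem[of k]] by simp
    also have "\<dots> \<le> \<rho> * (\<rho> ^ k * N v)" using Suc pos(2) by (intro mult_left_mono) auto
    finally show ?case by (simp add: mult_ac)
  qed simp
  have bounded: "(\<theta> / \<rho>) ^ k \<le> K * N v / x 0" for k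
  proof -
    have "\<theta> ^ k * x 0 \<le> K * N ((T ^^ k) v)" using low[of k] N(1)[OF mem[of k]] by (simp add: x_def)
    also have "\<dots> \<le> K * (\<rho> ^ k * N v)" by (rule mult_left_mono[OF up pos(1)])
    finally show ?thesis using p0 pos(2) by (simp add: power_divide field_simps)
  qed
  have "\<theta> / \<rho> > 1" using \<theta> pos(2) by simp
  from real_arch_pow[OF this, of "K * N v / x 0"] show False using bounded not_less by blast
qed

locale operator_pair = H: positive_selfadjoint H A + G: positive_selfadjoint G M
  for H G :: "'h::complex_vector inner_prod" and A M :: "'h operator" +
  fixes \<mu> :: "nat \<Rightarrow> real" and q :: "nat \<Rightarrow> 'h"
  assumes norms: "equivalent_norms_on UNIV (hnorm G) (hnorm H)"
    and dom_eq: "dom A = dom M"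
    and graph_norms: "equivalent_norms_on (dom A) (\<lambda>v. hnorm G (the (M v))) (\<lambda>v. hnorm H (the (A v)))"
    and cpt: "compact_inverse G M"
    and M_eigen: "eigenpairs_below G M \<infinity> {1..} \<mu> q"
begin

lemma H_le_G: "\<exists>c>0. \<forall>v. hnorm H v \<le> c * hnorm G v"
proof -
  obtain c where c: "c > 0" "\<And>v. c * hnorm H v \<le> hnorm G v"
    using norms unfolding equivalent_norms_on_def by blast
  have "hnorm H v \<le> (1 / c) * hnorm G v" for v using c(1) c(2)[of v] by (simp add: field_simps)
  thus ?thesis using c(1) by (intro exI[of _ "1 / c"]) auto
qed

lemma M_le_A: "\<exists>c>0. \<forall>v\<in>dom A. hnorm G (G.AA v) \<le> c * hnorm H (H.AA v)"
  using graph_norms unfolding equivalent_norms_on_def by blast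

lemma A_le_M: "\<exists>c>0. \<forall>v\<in>dom A. hnorm H (H.AA v) \<le> c * hnorm G (G.AA v)"
proof -
  obtain c where c: "c > 0" "\<forall>v\<in>dom A. c * hnorm H (H.AA v) \<le> hnorm G (G.AA v)"
    using graph_norms unfolding equivalent_norms_on_def by blast
  have "hnorm H (H.AA v) \<le> (1 / c) * hnorm G (G.AA v)" if "v \<in> dom A" for v
    using c(1) bspec[OF c(2) that] by (simp add: field_simps)
  thus ?thesis using c(1) by (intro exI[of _ "1 / c"]) auto
qed

text \<open>Heinz's inequality for square roots: Krein's lemma applies to \<^term>\<open>T u = G.Ainv (L (H.AA u))\<close>, where
  \<^term>\<open>H x y = G (L x) y\<close>, because \<^term>\<open>T\<close> represents the energy form of \<^term>\<open>A\<close> in that of \<^term>\<open>M\<close>.\<close>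

lemma form_comparison: "\<exists>C>0. \<forall>u\<in>dom A. Re (H u (H.AA u)) \<le> C * Re (G u (G.AA u))"
proof -
  obtain c where c: "c > 0" "\<forall>v. hnorm H v \<le> c * hnorm G v" using H_le_G by blast
  obtain d where d: "d > 0" "\<forall>v\<in>dom A. hnorm H (H.AA v) \<le> d * hnorm G (G.AA v)" using A_le_M by blast
  have "\<exists>w. \<forall>y. H x y = G w y" for x
  proof -
    have "cmod (H x y) \<le> (hnorm H x * c) * hnorm G y" for y
    proof -
      have "cmod (H x y) \<le> hnorm H x * hnorm H y" by (rule H.cauchy_schwarz) auto
      also have "\<dots> \<le> hnorm H x * (c * hnorm G y)" using c(2) by (intro mult_left_mono) auto
      finally show ?thesis by (simp add: mult.assoc)
    qed
    from G.riesz[of "H x", OF _ _ this] show ?thesis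
      by (auto simp: H.add_right H.scale_right)
  qed
  then obtain L where L: "\<And>x y. H x y = G (L x) y" by metis
  have Ln: "hnorm G (L x) \<le> c * hnorm H x" for x
  proof (cases "L x = 0")
    case False
    have "(hnorm G (L x))\<^sup>2 = Re (H x (L x))" by (simp add: G.norm_sq L)
    also have "\<dots> \<le> hnorm H x * hnorm H (L x)"
      using H.cauchy_schwarz[of x "L x"] complex_Re_le_cmod order_trans by blast
    also have "\<dots> \<le> hnorm H x * (c * hnorm G (L x))" using c(2) by (intro mult_left_mono) auto
    finally have "hnorm G (L x) * hnorm G (L x) \<le> hnorm G (L x) * (c * hnorm H x)"
      by (simp add: power2_eq_square mult_ac)
    thus ?thesis using G.norm_pos[OF False] by simp
  qed (use c in simp)
  interpret F: psd_form "dom M" G.energy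
    by (rule G.en.restrict[OF G.dom_subspace G.dom_A_half])
  have B: "G.energy u v = G u (G.AA v)" if "u \<in> dom M" "v \<in> dom M" for u v
    using that G.dom_A_half by (intro G.energy_A) auto
  define T where "T u = G.Ainv (L (H.AA u))" for u
  have MT: "T u \<in> dom M" "G.AA (T u) = L (H.AA u)" for u
    unfolding T_def by (rule G.Ainv_dom, rule G.A_Ainv)
  have BT: "G.energy u (T v) = H u (H.AA v)" if "u \<in> dom M" for u v
  proof -
    have "G.energy u (T v) = cnj (G (L (H.AA v)) u)"
      using B[OF that MT(1)] G.herm[of "L (H.AA v)" u] by (simp add: MT(2))
    also have "\<dots> = cnj (H (H.AA v) u)" by (simp only: L)
    also have "\<dots> = H u (H.AA v)" by (rule H.herm[symmetric]) auto
    finally show ?thesis .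
  qed
  \<comment> \<open>The strong seminorm in Krein's lemma is that of \<open>G.AA v\<close>: by
    coercivity it dominates the energy norm, and \<open>T\<close> is bounded in it because
    \<open>G.AA (T v)\<close> equals \<open>L (H.AA v)\<close> and the graph norms are
    comparable.\<close>
  have bound: "hnorm G.energy (T u) \<le> (c * d) * hnorm G.energy u" if u: "u \<in> dom M" for u
  proof (rule F.krein[where K = "1 / sqrt G.alpha" and N = "\<lambda>v. hnorm G (G.AA v)", OF MT(1) _ _ _ _ _ u])
    show "G.energy (T u) v = G.energy u (T v)" if "u \<in> dom M" "v \<in> dom M" for u v
      using F.herm[OF that(2) MT(1)[of u]] H.herm[of v "H.AA u"] H.A_sym[of u v] that
      by (simp add: BT dom_eq)
    show "hnorm G.energy v \<le> 1 / sqrt G.alpha * hnorm G (G.AA v)" if v: "v \<in> dom M" for v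
    proof -
      have "(hnorm G.energy v)\<^sup>2 = Re (G v (G.AA v))" using F.norm_sq[OF v] B[OF v v] by simp
      also have "\<dots> \<le> hnorm G v * hnorm G (G.AA v)"
        using G.cauchy_schwarz[of v "G.AA v"] complex_Re_le_cmod order_trans by blast
      also have "\<dots> \<le> (hnorm G (G.AA v) / G.alpha) * hnorm G (G.AA v)"
        using G.alpha_norm_le[OF v] G.alpha_pos by (intro mult_right_mono) (auto simp: field_simps)
      also have "\<dots> = (1 / sqrt G.alpha * hnorm G (G.AA v))\<^sup>2"
        using G.alpha_pos by (simp add: power_mult_distrib power_divide power2_eq_square)
      finally show ?thesis by (rule power2_le_imp_le) (use G.alpha_pos in simp)
    qed
    show "hnorm G (G.AA (T v)) \<le> c * d * hnorm G (G.AA v)" if v: "v \<in> dom M" for v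
    proof -
      have "hnorm G (G.AA (T v)) \<le> c * hnorm H (H.AA v)" using Ln by (simp add: MT(2))
      also have "\<dots> \<le> c * (d * hnorm G (G.AA v))" using d(2) c(1) v dom_eq by (intro mult_left_mono) auto
      finally show ?thesis by simp
    qed
    show "1 / sqrt G.alpha \<ge> 0" "c * d > 0" using G.alpha_pos c d by auto
  qed
  have "Re (H u (H.AA u)) \<le> (c * d) * Re (G u (G.AA u))" if "u \<in> dom A" for u
  proof -
    have u: "u \<in> dom M" using that dom_eq by simp
    have "Re (H u (H.AA u)) = Re (G.energy u (T u))" by (simp add: BT[OF u])
    also have "\<dots> \<le> hnorm G.energy u * hnorm G.energy (T u)"
      using F.cauchy_schwarz[OF u MT(1)] complex_Re_le_cmod order_trans by blast
    also have "\<dots> \<le> hnorm G.energy u * ((c * d) * hnorm G.energy u)"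
      by (rule mult_left_mono[OF bound[OF u]]) (simp add: u)
    also have "\<dots> = (c * d) * (hnorm G.energy u)\<^sup>2" by (simp add: power2_eq_square)
    also have "(hnorm G.energy u)\<^sup>2 = Re (G u (G.AA u))" using F.norm_sq[OF u] B[OF u u] by simp
    finally show ?thesis .
  qed
  moreover have "c * d > 0" using c d by simp
  ultimately show ?thesis by blast
qed

section \<open>Truncated eigenfunction expansions\<close>

lemma q_dom: "k \<ge> 1 \<Longrightarrow> q k \<in> dom M"
  and M_q: "k \<ge> 1 \<Longrightarrow> G.AA (q k) = of_real (\<mu> k) *\<^sub>C q k"
  and q_orth: "i \<ge> 1 \<Longrightarrow> j \<ge> 1 \<Longrightarrow> G (q i) (q j) = (if i = j then 1 else 0)"
  and \<mu>_mono: "1 \<le> i \<Longrightarrow> i \<le> j \<Longrightarrow> \<mu> i \<le> \<mu> j"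
  using M_eigen unfolding eigenpairs_below_def eigenspace_def orthonormal_on_def by auto

lemma \<mu>_pos: "k \<ge> 1 \<Longrightarrow> \<mu> k > 0"
proof -
  assume k: "k \<ge> 1"
  have "hnorm G (q k) = 1" using q_orth[OF k k] by (simp add: hnorm_def)
  hence "G.alpha \<le> \<mu> k" using G.coercive[OF q_dom[OF k]] q_orth[OF k k] by (simp add: M_q[OF k] G.lin)
  thus ?thesis using G.alpha_pos by simp
qed

definition ps :: "nat \<Rightarrow> 'h \<Rightarrow> 'h" where
  "ps n v = (\<Sum>k=1..n. G (q k) v *\<^sub>C q k)"

text \<open>Completeness of the eigenvectors gives convergence in \<open>G\<close>, and equivalence
  of norms transfers it to \<open>H\<close>.\<close>

lemma ps_limit: "hlim H (\<lambda>n. ps n v) v"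
proof -
  obtain c where c: "c > 0" "\<forall>v. hnorm H v \<le> c * hnorm G v" using H_le_G by blast
  have "hlim G (\<lambda>n. ps n v) v"
    unfolding ps_def using q_orth G.compact_eigenvectors_complete[OF cpt M_eigen]
    by (intro G.orthonormal_expansion) auto
  from tendsto_mult_left[OF this, of c]
  have "(\<lambda>n. c * hnorm G (ps n v - v)) \<longlonglongrightarrow> 0" by simp
  thus ?thesis by (rule Lim_null_comparison[rotated]) (use c(2) in simp)
qed

lemma ps_dom: "ps n v \<in> dom A"
  unfolding ps_def dom_eq by (intro G.dom_sum G.dom_scale q_dom) simp

lemma ps_span: "ps n v \<in> cvec.span (q ` {1..n})"
  unfolding ps_def by (intro cvec.span_sum cvec.span_scale cvec.span_base) auto

text \<open>Stated for a bound on coefficient sums, so that it covers both the given \<sigma> and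
  the case \<sigma> = 1 of dual solutions. The factor \<open>r n\<close> is the root of the n-th
  tail of the series: it tends to 0, and it is at most \<open>sqrt S\<close> uniformly.\<close>

lemma partial_sum_estimate:
  fixes S :: real
  assumes \<sigma>: "\<sigma> \<ge> 1/2"
    and bd: "\<And>m. (\<Sum>k=1..m. (\<mu> k powr \<sigma>)\<^sup>2 * (cmod (G (q k) v))\<^sup>2) \<le> S"
  shows "v \<in> dom H.half \<and> (\<exists>r. r \<longlonglongrightarrow> 0 \<and> (\<forall>n. 0 \<le> r n \<and> r n \<le> sqrt S) \<and>
    (\<forall>C>0. (\<forall>u\<in>dom A. Re (H u (H.AA u)) \<le> C * Re (G u (G.AA u))) \<longrightarrow>
      (\<forall>n. hnorm H.energy (v - ps n v) \<le> 2 * sqrt C * (r n * \<mu> (n + 1) powr (1/2 - \<sigma>)))))"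
proof -
  define s where "s i = (\<mu> (Suc i) powr \<sigma>)\<^sup>2 * (cmod (G (q (Suc i)) v))\<^sup>2" for i
  have s0: "s i \<ge> 0" for i by (simp add: s_def)
  have sb: "(\<Sum>i<m. s i) \<le> S" for m
    using bd[of m] unfolding s_def by (simp add: sum.atLeast1_atMost_eq)
  have sm: "summable s" by (rule summableI_nonneg_bounded[OF s0 sb])
  define R where "R n = (\<Sum>i. s (i + n))" for n
  have smn: "summable (\<lambda>i. s (i + n))" for n using sm by (simp add: summable_iff_shift)
  have R0: "R n \<ge> 0" for n unfolding R_def by (rule suminf_nonneg[OF smn s0])
  have RS: "R n \<le> S" for n
  proof -
    have "R n \<le> R n + (\<Sum>i<n. s i)" using s0 by (simp add: sum_nonneg)
    also have "\<dots> = suminf s" unfolding R_def by (rule suminf_split_initial_segment[OF sm, symmetric])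
    also have "\<dots> \<le> S" by (rule suminf_le_const[OF sm sb])
    finally show ?thesis .
  qed
  have Rlim: "R \<longlonglongrightarrow> 0" unfolding R_def by (rule suminf_exist_split2[OF sm])
  have est: "hnorm H.energy (ps (n + j) v - ps n v) \<le> sqrt C * (sqrt (R n) * \<mu> (n + 1) powr (1/2 - \<sigma>))"
    if C: "C > 0" "\<forall>u\<in>dom A. Re (H u (H.AA u)) \<le> C * Re (G u (G.AA u))" for C n j
  proof -
    let ?y = "ps (n + j) v - ps n v" and ?I = "{n<..n + j}"
    have y: "?y = (\<Sum>k\<in>?I. G (q k) v *\<^sub>C q k)"
    proof -
      have split: "{1..n + j} = {1..n} \<union> ?I" by auto
      show ?thesis unfolding ps_def split by (subst sum.union_disjoint) auto
    qed
    have yd: "?y \<in> dom A" by (intro H.dom_diff ps_dom)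
    have My: "G.AA ?y = (\<Sum>k\<in>?I. (of_real (\<mu> k) * G (q k) v) *\<^sub>C q k)"
    proof -
      have "G.AA ?y = (\<Sum>k\<in>?I. G.AA (G (q k) v *\<^sub>C q k))"
        unfolding y by (intro G.A_sum G.dom_scale q_dom) auto
      also have "\<dots> = (\<Sum>k\<in>?I. (of_real (\<mu> k) * G (q k) v) *\<^sub>C q k)"
        by (intro sum.cong refl) (auto simp: G.A_scale q_dom M_q mult.commute)
      finally show ?thesis .
    qed
    have "G ?y (G.AA ?y) = (\<Sum>k\<in>?I. cnj (G (q k) v) * G (q k) (G.AA ?y))"
      unfolding y by (simp add: G.sum_left G.scale_left)
    also have "\<dots> = (\<Sum>k\<in>?I. cnj (G (q k) v) * (of_real (\<mu> k) * G (q k) v))"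
      unfolding My by (intro sum.cong refl arg_cong2[where f = "(*)"] G.orthonormal_inner_sum) (auto simp: q_orth)
    also have "\<dots> = (\<Sum>k\<in>?I. of_real (\<mu> k * (cmod (G (q k) v))\<^sup>2))"
      by (intro sum.cong refl) (simp add: complex_norm_square mult_ac del: of_real_power)
    finally have Gy: "Re (G ?y (G.AA ?y)) = (\<Sum>k\<in>?I. \<mu> k * (cmod (G (q k) v))\<^sup>2)" by simp
    \<comment> \<open>The exponent 1 - 2 \<sigma> is nonpositive, so the power of the larger number
      \<mu> k is at most that of \<open>\<mu> (n + 1)\<close>.\<close>
    have mu: "\<mu> k * a \<le> \<mu> (n + 1) powr (1 - 2 * \<sigma>) * ((\<mu> k powr \<sigma>)\<^sup>2 * a)" if "k \<in> ?I" "a \<ge> 0" for k a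
    proof -
      have k: "k \<ge> 1" "n + 1 \<le> k" using that by auto
      have "\<mu> k = \<mu> k powr (1 - 2 * \<sigma>) * (\<mu> k powr \<sigma>)\<^sup>2"
        using \<mu>_pos[OF k(1)] by (simp add: power2_eq_square flip: powr_add)
      also have "\<dots> \<le> \<mu> (n + 1) powr (1 - 2 * \<sigma>) * (\<mu> k powr \<sigma>)\<^sup>2"
        using \<sigma> \<mu>_pos[of "n + 1"] \<mu>_mono[of "n + 1" k] k by (intro mult_right_mono powr_mono2') auto
      finally show ?thesis using that(2) by (simp add: mult_right_mono flip: mult.assoc)
    qed
    have sI: "(\<Sum>k\<in>?I. (\<mu> k powr \<sigma>)\<^sup>2 * (cmod (G (q k) v))\<^sup>2) \<le> R n"
    proof -
      have "(\<Sum>k\<in>?I. (\<mu> k powr \<sigma>)\<^sup>2 * (cmod (G (q k) v))\<^sup>2) = (\<Sum>i<j. s (i + n))"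
        unfolding s_def
        by (rule sum.reindex_bij_witness[of _ "\<lambda>i. Suc (i + n)" "\<lambda>k. k - Suc n"]) auto
      also have "\<dots> \<le> R n" unfolding R_def by (intro sum_le_suminf[OF smn]) (auto simp: s0)
      finally show ?thesis .
    qed
    have yh: "?y \<in> dom H.half" by (rule subsetD[OF H.dom_A_half yd])
    have "(hnorm H.energy ?y)\<^sup>2 = Re (H ?y (H.AA ?y))"
      unfolding H.en.norm_sq[OF yh] H.energy_A[OF yh yd] ..
    also have "\<dots> \<le> C * Re (G ?y (G.AA ?y))" using C(2) yd by blast
    also have "\<dots> \<le> C * (\<Sum>k\<in>?I. \<mu> (n + 1) powr (1 - 2 * \<sigma>) * ((\<mu> k powr \<sigma>)\<^sup>2 * (cmod (G (q k) v))\<^sup>2))"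
      unfolding Gy using C(1) by (intro mult_left_mono sum_mono mu) auto
    also have "\<dots> = C * (\<mu> (n + 1) powr (1 - 2 * \<sigma>) * (\<Sum>k\<in>?I. (\<mu> k powr \<sigma>)\<^sup>2 * (cmod (G (q k) v))\<^sup>2))"
      by (simp add: sum_distrib_left)
    also have "\<dots> \<le> C * (\<mu> (n + 1) powr (1 - 2 * \<sigma>) * R n)"
      using C(1) sI by (intro mult_left_mono) auto
    also have "\<dots> = (sqrt C * (sqrt (R n) * \<mu> (n + 1) powr (1/2 - \<sigma>)))\<^sup>2"
    proof -
      have "(\<mu> (n + 1) powr (1/2 - \<sigma>))\<^sup>2 = \<mu> (n + 1) powr (1 - 2 * \<sigma>)"
        by (simp add: power2_eq_square flip: powr_add)
      thus ?thesis using C(1) R0[of n] by (simp add: power_mult_distrib)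
    qed
    finally show ?thesis by (rule power2_le_imp_le) (use C(1) R0[of n] in simp)
  qed
  \<comment> \<open>The infinite tail is the \<open>H\<close>-limit of the finite blocks just
    estimated; \<open>energy_limit\<close> passes the energy bound to it at the cost of a factor
    2.\<close>
  have lim: "hlim H (\<lambda>j. ps (n + j) v - ps n v) (v - ps n v)" for n
    using H.hlim_diff[OF LIMSEQ_ignore_initial_segment[OF ps_limit[of v], of n] H.hlim_const[of "ps n v"]]
    by (simp add: add.commute)
  have yd: "ps (n + j) v - ps n v \<in> dom H.half" for n j
    using H.dom_A_half H.dom_diff[OF ps_dom ps_dom] by blast
  have est2: "v - ps n v \<in> dom H.half" "hnorm H.energy (v - ps n v) \<le> 2 * (sqrt C * (sqrt (R n) * \<mu> (n + 1) powr (1/2 - \<sigma>)))"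
    if C: "C > 0" "\<forall>u\<in>dom A. Re (H u (H.AA u)) \<le> C * Re (G u (G.AA u))" for C n
    using H.energy_limit[OF yd lim est[OF C], of n] by simp_all
  have "v \<in> dom H.half"
  proof -
    obtain C where C: "C > 0" "\<forall>u\<in>dom A. Re (H u (H.AA u)) \<le> C * Re (G u (G.AA u))" using form_comparison by blast
    have "v - ps 0 v \<in> dom H.half" by (rule est2(1)[OF C])
    thus ?thesis by (simp add: ps_def)
  qed
  moreover have "(\<lambda>n. sqrt (R n)) \<longlonglongrightarrow> 0" using tendsto_real_sqrt[OF Rlim] by simp
  moreover have "0 \<le> sqrt (R n) \<and> sqrt (R n) \<le> sqrt S" for n using R0 RS by simp
  ultimately show ?thesis using est2(2) by (intro conjI exI[of _ "\<lambda>n. sqrt (R n)"]) (auto simp: mult.assoc)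
qed

text \<open>The coefficients of the \<sigma>-th power of \<open>M\<close> applied to
  \<open>v\<close> are those of \<open>v\<close> times the \<sigma>-th powers of the eigenvalues, so
  Bessel's inequality supplies the bound on coefficient sums.\<close>

lemma approximation_power:
  assumes \<sigma>: "\<sigma> \<ge> 1/2" and v: "v \<in> dom (op_power G M \<sigma>)"
  shows "v \<in> dom H.half \<and> (\<exists>r. r \<longlonglongrightarrow> 0 \<and> (\<forall>n. 0 \<le> r n \<and> hnorm H.energy (v - ps n v) \<le> r n * \<mu> (n + 1) powr (1/2 - \<sigma>)))"
proof -
  let ?f = "\<lambda>t. t powr \<sigma>"
  have f: "?f \<in> borel_measurable borel" by measurable
  have op: "op_power G M \<sigma> = spectral_integral G G.EA ?f" by (simp add: op_power_def G.EA_def)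
  have v': "v \<in> G.sdom ?f" using v by (simp add: op G.dom_spectral_integral)
  have "G (q k) (G.sint ?f v) = of_real (\<mu> k powr \<sigma>) * G (q k) v" if k: "k \<ge> 1" for k
  proof -
    have "q k \<in> eigenspace M (of_real (\<mu> k))" using q_dom[OF k] M_q[OF k] by (simp add: eigenspace_def)
    from G.sint_atom[OF f G.eigen_atom[OF this]]
    have "q k \<in> G.sdom ?f" "G.sint ?f (q k) = of_real (\<mu> k powr \<sigma>) *\<^sub>C q k" by auto
    thus ?thesis using G.sint_sym[OF f _ v', of "q k"] by (simp add: G.scale_left)
  qed
  hence "(\<Sum>k=1..m. (\<mu> k powr \<sigma>)\<^sup>2 * (cmod (G (q k) v))\<^sup>2) = (\<Sum>k=1..m. (cmod (G (q k) (G.sint ?f v)))\<^sup>2)" for m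
    by (intro sum.cong refl) (auto simp: norm_mult power_mult_distrib)
  hence bd: "(\<Sum>k=1..m. (\<mu> k powr \<sigma>)\<^sup>2 * (cmod (G (q k) v))\<^sup>2) \<le> (hnorm G (G.sint ?f v))\<^sup>2" for m
    using G.bessel[of "{1..m}" q "G.sint ?f v"] q_orth by simp
  obtain C where C: "C > 0" "\<forall>u\<in>dom A. Re (H u (H.AA u)) \<le> C * Re (G u (G.AA u))" using form_comparison by blast
  obtain r where r: "r \<longlonglongrightarrow> 0" "\<And>n. 0 \<le> r n"
    "\<forall>n. hnorm H.energy (v - ps n v) \<le> 2 * sqrt C * (r n * \<mu> (n + 1) powr (1/2 - \<sigma>))" and vh: "v \<in> dom H.half"
    using partial_sum_estimate[OF \<sigma> bd] C by blast
  have "(\<lambda>n. 2 * sqrt C * r n) \<longlonglongrightarrow> 0" using tendsto_mult_left[OF r(1), of "2 * sqrt C"] by simp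
  thus ?thesis using vh r(2,3) C(1) by (intro conjI exI[of _ "\<lambda>n. 2 * sqrt C * r n"]) (auto simp: mult.assoc)
qed

text \<open>Here the tail is bounded by the norm of \<open>G.AA g\<close>. The rate has to be
  uniform in \<open>g\<close>, because the dual solution changes with n, and so o is given up for
  O.\<close>

lemma approximation_dom:
  "\<exists>K>0. \<forall>g\<in>dom A. \<forall>n. hnorm H.energy (g - ps n g) \<le> K * \<mu> (n + 1) powr (-1/2) * hnorm H (H.AA g)"
proof -
  obtain c where c: "c > 0" "\<forall>v\<in>dom A. hnorm G (G.AA v) \<le> c * hnorm H (H.AA v)" using M_le_A by blast
  obtain C where C: "C > 0" "\<forall>u\<in>dom A. Re (H u (H.AA u)) \<le> C * Re (G u (G.AA u))" using form_comparison by blast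
  have "hnorm H.energy (g - ps n g) \<le> (2 * sqrt C * c) * \<mu> (n + 1) powr (-1/2) * hnorm H (H.AA g)"
    if g: "g \<in> dom A" for g n
  proof -
    have "G (q k) (G.AA g) = of_real (\<mu> k) * G (q k) g" if k: "k \<ge> 1" for k
      using G.A_sym[OF q_dom[OF k], of g] g dom_eq by (simp add: M_q[OF k] G.scale_left)
    hence "(\<Sum>k=1..m. (\<mu> k powr 1)\<^sup>2 * (cmod (G (q k) g))\<^sup>2) = (\<Sum>k=1..m. (cmod (G (q k) (G.AA g)))\<^sup>2)" for m
      by (intro sum.cong refl) (auto simp: norm_mult power_mult_distrib less_imp_le[OF \<mu>_pos])
    hence bd: "(\<Sum>k=1..m. (\<mu> k powr 1)\<^sup>2 * (cmod (G (q k) g))\<^sup>2) \<le> (hnorm G (G.AA g))\<^sup>2" for m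
      using G.bessel[of "{1..m}" q "G.AA g"] q_orth by simp
    have half: "(1 :: real) \<ge> 1/2" by simp
    obtain r where r: "\<And>n. 0 \<le> r n \<and> r n \<le> sqrt ((hnorm G (G.AA g))\<^sup>2)"
      "\<forall>n. hnorm H.energy (g - ps n g) \<le> 2 * sqrt C * (r n * \<mu> (n + 1) powr (1/2 - 1))"
      using partial_sum_estimate[OF half bd] C by blast
    have "hnorm H.energy (g - ps n g) \<le> 2 * sqrt C * (r n * \<mu> (n + 1) powr (1/2 - 1))" using r(2) by blast
    also have "\<dots> \<le> 2 * sqrt C * ((c * hnorm H (H.AA g)) * \<mu> (n + 1) powr (1/2 - 1))"
    proof (intro mult_left_mono mult_right_mono)
      show "r n \<le> c * hnorm H (H.AA g)" using r(1)[of n] bspec[OF c(2) g] by simp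
    qed (use C in auto)
    finally show ?thesis by (simp add: mult_ac)
  qed
  moreover have "2 * sqrt C * c > 0" using C c by simp
  ultimately show ?thesis by blast
qed

end

section \<open>The Rayleigh-Ritz method\<close>

declare domIff [iff del]

text \<open>Gaussian elimination of one unknown. It supplies the trial vectors of both min-max
  arguments.\<close>

lemma underdetermined_system:
  fixes K :: "'k \<Rightarrow> 'i \<Rightarrow> complex"
  assumes "finite J" "finite I" "card J < card I"
  shows "\<exists>c. (\<exists>i\<in>I. c i \<noteq> 0) \<and> (\<forall>k\<in>J. (\<Sum>i\<in>I. K k i * c i) = 0)"
  using assms
proof (induction J arbitrary: I K rule: finite_induct)
  case empty
  hence "I \<noteq> {}" by auto
  thus ?case by (intro exI[of _ "\<lambda>_. 1"]) auto
next
  case (insert k J)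
  show ?case
  proof (cases "\<forall>i\<in>I. K k i = 0")
    case True
    obtain c where "(\<exists>i\<in>I. c i \<noteq> 0) \<and> (\<forall>k\<in>J. (\<Sum>i\<in>I. K k i * c i) = 0)"
      using insert.IH[of I K] insert.prems insert.hyps by auto
    thus ?thesis using True by (intro exI[of _ c]) auto
  next
    case False
    then obtain p where p: "p \<in> I" "K k p \<noteq> 0" by blast
    define K' where "K' m i = K m i - K m p * K k i / K k p" for m i
    have "card J < card (I - {p})" using insert.prems insert.hyps p by (simp add: card_Diff_singleton)
    then obtain c where c: "\<exists>i\<in>I - {p}. c i \<noteq> 0" "\<forall>m\<in>J. (\<Sum>i\<in>I - {p}. K' m i * c i) = 0"
      using insert.IH[of "I - {p}" K'] insert.prems by blast
    define t where "t = (\<Sum>i\<in>I - {p}. K k i * c i)"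
    define d where "d = c(p := - t / K k p)"
    have dsum: "(\<Sum>i\<in>I. K m i * d i) = (\<Sum>i\<in>I - {p}. K m i * c i) - K m p * t / K k p" for m
    proof -
      have "(\<Sum>i\<in>I. K m i * d i) = K m p * d p + (\<Sum>i\<in>I - {p}. K m i * d i)"
        using insert.prems p by (simp add: sum.remove)
      also have "(\<Sum>i\<in>I - {p}. K m i * d i) = (\<Sum>i\<in>I - {p}. K m i * c i)"
        by (intro sum.cong) (auto simp: d_def)
      finally show ?thesis by (simp add: d_def)
    qed
    have "(\<Sum>i\<in>I. K m i * d i) = 0" if "m \<in> insert k J" for m
    proof (cases "m = k")
      case True
      thus ?thesis using p by (simp add: dsum t_def)
    next
      case False
      hence "(\<Sum>i\<in>I - {p}. K' m i * c i) = 0" using that c(2) by blast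
      moreover have "(\<Sum>i\<in>I - {p}. K' m i * c i) = (\<Sum>i\<in>I - {p}. K m i * c i) - K m p * t / K k p"
        unfolding K'_def t_def by (simp add: left_diff_distrib sum_subtractf sum_distrib_left sum_divide_distrib mult.assoc)
      ultimately show ?thesis by (simp add: dsum)
    qed
    moreover have "\<exists>i\<in>I. d i \<noteq> 0" using c(1) by (auto simp: d_def)
    ultimately show ?thesis by blast
  qed
qed

lemma smallo_of_bound:
  fixes f g r :: "nat \<Rightarrow> real"
  assumes "r \<longlonglongrightarrow> 0" "\<forall>\<^sub>F n in sequentially. \<bar>f n\<bar> \<le> r n * g n" "\<And>n. g n \<ge> 0"
  shows "f \<in> o(g)"
proof (rule landau_o.smallI)
  fix c :: real assume "c > 0"
  with assms(1) have "\<forall>\<^sub>F n in sequentially. r n < c" by (rule order_tendstoD)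
  with assms(2) show "\<forall>\<^sub>F n in sequentially. norm (f n) \<le> c * norm (g n)"
  proof eventually_elim
    case (elim n)
    have "r n * g n \<le> c * g n" using elim assms(3) by (intro mult_right_mono) auto
    thus ?case using elim assms(3)[of n] by simp
  qed
qed

lemma (in hilb) orth_span:
  assumes "x \<in> cvec.span S" "\<And>s. s \<in> S \<Longrightarrow> H s y = 0" shows "H x y = 0"
  using assms(1)
proof (induction rule: cvec.span_induct_alt)
  case base show ?case by (simp add: zero_left)
next
  case (step c a b) thus ?case using assms(2) by (simp add: lin)
qed

section \<open>Ritz vectors and the energy projection\<close>

locale ritz = operator_pair H G A M \<mu> q
  for H G :: "'h::complex_vector inner_prod" and A M :: "'h operator" and \<mu> :: "nat \<Rightarrow> real" and q :: "nat \<Rightarrow> 'h" +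
  fixes \<Lambda> :: "nat \<Rightarrow> nat \<Rightarrow> real" and w :: "nat \<Rightarrow> nat \<Rightarrow> 'h"
  assumes RR: "rayleigh_ritz H.energy H q n (\<Lambda> n) (w n)"
begin

abbreviation W :: "nat \<Rightarrow> 'h set" where "W n \<equiv> cvec.span (q ` {1..n})"
abbreviation P :: "nat \<Rightarrow> 'h \<Rightarrow> 'h" where "P n \<equiv> orth_proj H.energy (W n)"

lemma W_dom: "W n \<subseteq> dom A"
  unfolding dom_eq by (rule cvec.span_minimal[OF _ G.dom_subspace]) (auto simp: q_dom)

lemma W_half: "W n \<subseteq> dom H.half"
  using W_dom H.dom_A_half by blast

lemma w_W:
  assumes "j \<in> {1..n}" shows "w n j \<in> W n"
proof -
  obtain x where x: "w n j = (\<Sum>k=1..n. x k *\<^sub>C q k)"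
    using RR[of n] assms unfolding rayleigh_ritz_def by blast
  show ?thesis unfolding x by (intro cvec.span_sum cvec.span_scale cvec.span_base) auto
qed

lemma w_dom: "j \<in> {1..n} \<Longrightarrow> w n j \<in> dom A"
  using w_W W_dom by blast

lemma \<Lambda>_mono: "i \<in> {1..n} \<Longrightarrow> j \<in> {1..n} \<Longrightarrow> i \<le> j \<Longrightarrow> \<Lambda> n i \<le> \<Lambda> n j"
  using RR[of n] unfolding rayleigh_ritz_def by blast

lemma w_orth: "i \<in> {1..n} \<Longrightarrow> j \<in> {1..n} \<Longrightarrow> H (w n i) (w n j) = (if i = j then 1 else 0)"
  and w_energy: "i \<in> {1..n} \<Longrightarrow> j \<in> {1..n} \<Longrightarrow> H.energy (w n i) (w n j) = (if i = j then of_real (\<Lambda> n i) else 0)"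
  using RR[of n] unfolding rayleigh_ritz_def by blast+

lemma w_norm: "j \<in> {1..n} \<Longrightarrow> hnorm H (w n j) = 1"
  using w_orth[of j n j] by (simp add: hnorm_def)

lemma ritz_equation:
  assumes j: "j \<in> {1..n}" and z: "z \<in> W n"
  shows "H.energy z (w n j) = of_real (\<Lambda> n j) * H z (w n j)"
proof -
  \<comment> \<open>Membership in \<open>dom half\<close> is carried through the induction, because
    only there is the energy form sesquilinear.\<close>
  have "z \<in> dom H.half \<and> H.energy z (w n j) = of_real (\<Lambda> n j) * H z (w n j)"
    using z
  proof (induction rule: cvec.span_induct_alt)
    case base
    show ?case using w_dom[OF j] H.dom_A_half H.en.V_zero by (auto simp: H.zero_left H.en.zero_left)
  next
    case (step c x y)
    then obtain i where i: "i \<in> {1..n}" "x = q i" by blast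
    have qh: "q k \<in> dom H.half" if "k \<in> {1..n}" for k
      using that W_half cvec.span_base[of "q k" "q ` {1..n}"] by blast
    have yh: "y \<in> dom H.half" using step by blast
    have wh: "w n j \<in> dom H.half" using w_W[OF j] W_half by blast
    obtain x' where x': "w n j = (\<Sum>k=1..n. x' k *\<^sub>C q k)"
      "(\<Sum>k=1..n. H.energy (q i) (q k) * x' k) = of_real (\<Lambda> n j) * (\<Sum>k=1..n. H (q i) (q k) * x' k)"
      using RR[of n] j i unfolding rayleigh_ritz_def by blast
    have "H.energy (q i) (w n j) = (\<Sum>k=1..n. H.energy (q i) (q k) * x' k)"
    proof -
      have "H.energy (q i) (w n j) = (\<Sum>k=1..n. H.energy (q i) (x' k *\<^sub>C q k))"
        unfolding x'(1) by (rule H.en.sum_right) (use qh i in \<open>auto intro: H.en.V_scale\<close>)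
      also have "\<dots> = (\<Sum>k=1..n. H.energy (q i) (q k) * x' k)"
        using qh i by (intro sum.cong refl) (simp add: H.en.scale_right)
      finally show ?thesis .
    qed
    moreover have "H (q i) (w n j) = (\<Sum>k=1..n. H (q i) (q k) * x' k)"
      unfolding x'(1) by (simp add: H.sum_right H.scale_right mult.commute)
    ultimately have "H.energy (q i) (w n j) = of_real (\<Lambda> n j) * H (q i) (w n j)" using x'(2) by simp
    thus ?case
      using step.IH i qh[OF i(1)] yh wh
      by (simp add: H.en.add_left H.en.scale_left H.en.V_add H.en.V_scale H.lin algebra_simps)
  qed
  thus ?thesis by blast
qed

lemma \<Lambda>_pos: "j \<in> {1..n} \<Longrightarrow> \<Lambda> n j > 0"
proof -
  assume j: "j \<in> {1..n}"
  have wh: "w n j \<in> dom H.half" using w_W[OF j] W_half by blast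
  have "H (w n j) (H.AA (w n j)) = of_real (\<Lambda> n j)"
    using w_energy[OF j j] H.energy_A[OF wh w_dom[OF j]] by simp
  thus ?thesis using H.coercive[OF w_dom[OF j]] H.alpha_pos by (simp add: w_norm[OF j])
qed

text \<open>A dimension count: the Ritz vectors are n orthonormal elements of a span of at most n
  vectors.\<close>

lemma W_span_w: "W n \<subseteq> cvec.span (w n ` {1..n})"
proof -
  have o: "orthonormal_on H {1..n} (w n)"
    unfolding orthonormal_on_def using w_orth by blast
  note ind = H.orthonormal_independent[OF o finite_atLeastAtMost subset_refl]
  have "q k \<in> cvec.span (w n ` {1..n})" if k: "k \<in> {1..n}" for k
  proof (rule ccontr)
    assume nk: "q k \<notin> cvec.span (w n ` {1..n})"
    have "cvec.independent (insert (q k) (w n ` {1..n}))"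
      by (rule cvec.independent_insertI[OF nk ind(2)])
    moreover have "insert (q k) (w n ` {1..n}) \<subseteq> W n"
      using k w_W by (auto intro: cvec.span_base)
    ultimately have "card (insert (q k) (w n ` {1..n})) \<le> card (q ` {1..n})"
      using cvec.independent_span_bound[of "q ` {1..n}"] by blast
    also have "\<dots> \<le> n" using card_image_le[of "{1..n}" q] by simp
    finally have "card (insert (q k) (w n ` {1..n})) \<le> n" .
    moreover have "q k \<notin> w n ` {1..n}"
    proof
      assume "q k \<in> w n ` {1..n}"
      from cvec.span_base[OF this] nk show False by contradiction
    qed
    ultimately show False using ind(1) by (simp add: card_image)
  qed
  thus ?thesis by (intro cvec.span_minimal cvec.subspace_span) auto
qed

lemma W_expansion:
  assumes z: "z \<in> W n" shows "z = (\<Sum>j\<in>{1..n}. H (w n j) z *\<^sub>C w n j)"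
proof -
  let ?p = "\<Sum>j\<in>{1..n}. H (w n j) z *\<^sub>C w n j"
  have orth: "H (w n k) (z - ?p) = 0" if "k \<in> {1..n}" for k
    using H.orthonormal_inner_sum[of "{1..n}" "w n" k "\<lambda>j. H (w n j) z"] w_orth that
    by (simp add: H.diff_right)
  have "z - ?p \<in> cvec.span (w n ` {1..n})"
    using z W_span_w
    by (intro cvec.span_diff cvec.span_sum cvec.span_scale) (auto intro: cvec.span_base)
  moreover have "H s (z - ?p) = 0" if "s \<in> w n ` {1..n}" for s using that orth by blast
  ultimately have "H (z - ?p) (z - ?p) = 0" by (rule H.orth_span)
  thus ?thesis by (simp add: H.inner_self_eq_0)
qed

text \<open>The Ritz vectors diagonalize both forms on \<open>W n\<close>, which turns Rayleigh
  quotients into weighted means of Ritz values.\<close>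

lemma ritz_sum:
  assumes I: "I \<subseteq> {1..n}" and z: "z = (\<Sum>i\<in>I. c i *\<^sub>C w n i)"
  shows "z \<in> W n" "(hnorm H z)\<^sup>2 = (\<Sum>i\<in>I. (cmod (c i))\<^sup>2)"
    "(hnorm H.energy z)\<^sup>2 = (\<Sum>i\<in>I. \<Lambda> n i * (cmod (c i))\<^sup>2)"
proof -
  have f: "finite I" using I finite_subset by blast
  have o: "H (w n i) (w n j) = (if i = j then 1 else 0)" if "i \<in> I" "j \<in> I" for i j
    using w_orth that I by blast
  show zW: "z \<in> W n" unfolding z using I w_W by (intro cvec.span_sum cvec.span_scale) blast
  show "(hnorm H z)\<^sup>2 = (\<Sum>i\<in>I. (cmod (c i))\<^sup>2)" unfolding z by (rule H.orthonormal_sum_sq[OF f o])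
  have zh: "z \<in> dom H.half" using zW W_half by blast
  have wh: "w n i \<in> dom H.half" if "i \<in> I" for i using w_W W_half that I by blast
  have "H.energy z z = (\<Sum>i\<in>I. c i * H.energy z (w n i))"
  proof -
    have "H.energy z z = H.energy z (\<Sum>i\<in>I. c i *\<^sub>C w n i)" using z by simp
    also have "\<dots> = (\<Sum>i\<in>I. H.energy z (c i *\<^sub>C w n i))"
      by (rule H.en.sum_right[OF zh]) (use wh in \<open>auto intro: H.en.V_scale\<close>)
    also have "\<dots> = (\<Sum>i\<in>I. c i * H.energy z (w n i))"
      by (intro sum.cong refl H.en.scale_right zh wh)
    finally show ?thesis .
  qed
  also have "\<dots> = (\<Sum>i\<in>I. of_real (\<Lambda> n i * (cmod (c i))\<^sup>2))"
  proof (rule sum.cong[OF refl])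
    fix i assume i: "i \<in> I"
    have "H (w n i) z = c i" unfolding z by (rule H.orthonormal_inner_sum[OF f o i])
    hence "H z (w n i) = cnj (c i)" using H.herm[of "w n i" z] by simp
    moreover have "H.energy z (w n i) = of_real (\<Lambda> n i) * H z (w n i)"
      using i I by (intro ritz_equation[OF _ zW]) blast
    ultimately show "c i * H.energy z (w n i) = of_real (\<Lambda> n i * (cmod (c i))\<^sup>2)"
      by (simp add: complex_norm_square mult_ac del: of_real_power)
  qed
  finally show "(hnorm H.energy z)\<^sup>2 = (\<Sum>i\<in>I. \<Lambda> n i * (cmod (c i))\<^sup>2)"
    using H.en.norm_sq[OF zh] by simp
qed

lemma ritz_value_le:
  assumes j: "j \<in> {1..n}" and z: "z \<in> W n" "\<And>i. i \<in> {1..<j} \<Longrightarrow> H (w n i) z = 0"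
  shows "\<Lambda> n j * (hnorm H z)\<^sup>2 \<le> (hnorm H.energy z)\<^sup>2"
proof -
  have "z = (\<Sum>i\<in>{1..n}. H (w n i) z *\<^sub>C w n i)" by (rule W_expansion[OF z(1)])
  note s = ritz_sum[OF subset_refl this]
  have "\<Lambda> n j * (cmod (H (w n i) z))\<^sup>2 \<le> \<Lambda> n i * (cmod (H (w n i) z))\<^sup>2" if i: "i \<in> {1..n}" for i
  proof (cases "i < j")
    case True thus ?thesis using z(2)[of i] i by simp
  next
    case False thus ?thesis using \<Lambda>_mono[OF j i] by (intro mult_right_mono) auto
  qed
  thus ?thesis unfolding s(2,3) sum_distrib_left by (intro sum_mono)
qed

lemma ritz_value_ge:
  assumes j: "j \<in> {1..n}" and z: "z = (\<Sum>i\<in>{1..j}. c i *\<^sub>C w n i)"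
  shows "(hnorm H.energy z)\<^sup>2 \<le> \<Lambda> n j * (hnorm H z)\<^sup>2"
proof -
  have "{1..j} \<subseteq> {1..n}" using j by auto
  note s = ritz_sum[OF this z]
  have "\<Lambda> n i * (cmod (c i))\<^sup>2 \<le> \<Lambda> n j * (cmod (c i))\<^sup>2" if "i \<in> {1..j}" for i
    using \<Lambda>_mono[of i n j] that j by (intro mult_right_mono) auto
  thus ?thesis unfolding s(2,3) sum_distrib_left by (intro sum_mono)
qed

text \<open>The Ritz vectors are energy-orthogonal with squares \<open>\<Lambda> n j\<close>, so the
  expansion in them is a witness for the THE in \<open>orth_proj\<close>; uniqueness is coercivity
  on \<open>W n\<close>.\<close>

lemma projection:
  assumes v: "v \<in> dom H.half"
  shows "P n v \<in> W n \<and> (\<forall>z\<in>W n. H.energy z (v - P n v) = 0)"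
proof -
  let ?p = "\<Sum>j\<in>{1..n}. (H.energy (w n j) v / of_real (\<Lambda> n j)) *\<^sub>C w n j"
  have p: "?p \<in> W n" by (rule ritz_sum(1)[OF subset_refl refl])
  have vp: "v - ?p \<in> dom H.half" using v p W_half by (intro H.en.V_diff) auto
  have wh: "w n k \<in> dom H.half" if "k \<in> {1..n}" for k using w_W[OF that] W_half by blast
  have wo: "H.energy (w n k) (v - ?p) = 0" if k: "k \<in> {1..n}" for k
  proof -
    have "H.energy (w n k) ?p = (\<Sum>j\<in>{1..n}. H.energy (w n k) ((H.energy (w n j) v / of_real (\<Lambda> n j)) *\<^sub>C w n j))"
      by (rule H.en.sum_right[OF wh[OF k]]) (intro H.en.V_scale wh)
    also have "\<dots> = (\<Sum>j\<in>{1..n}. if k = j then H.energy (w n j) v else 0)"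
    proof (rule sum.cong[OF refl])
      fix j assume j: "j \<in> {1..n}"
      show "H.energy (w n k) ((H.energy (w n j) v / of_real (\<Lambda> n j)) *\<^sub>C w n j) = (if k = j then H.energy (w n j) v else 0)"
        unfolding H.en.scale_right[OF wh[OF k] wh[OF j]] w_energy[OF k j] using \<Lambda>_pos[OF j] by simp
    qed
    also have "\<dots> = H.energy (w n k) v" using k by simp
    finally show ?thesis using v p W_half wh[OF k] by (subst H.en.diff_right) auto
  qed
  have orth: "H.energy z (v - ?p) = 0" if z: "z \<in> W n" for z
  proof -
    have "H.energy z (v - ?p) = (\<Sum>j\<in>{1..n}. H.energy (H (w n j) z *\<^sub>C w n j) (v - ?p))"
      by (subst W_expansion[OF z], rule H.en.sum_left[OF vp]) (intro H.en.V_scale wh)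
    also have "\<dots> = 0"
    proof (intro sum.neutral ballI)
      fix j assume j: "j \<in> {1..n}"
      show "H.energy (H (w n j) z *\<^sub>C w n j) (v - ?p) = 0"
        unfolding H.en.scale_left[OF wh[OF j] vp] wo[OF j] by simp
    qed
    finally show ?thesis .
  qed
  have "P n v = ?p"
    unfolding orth_proj_def
  proof (rule the_equality)
    fix y assume y: "y \<in> W n \<and> (\<forall>z\<in>W n. H.energy z (v - y) = 0)"
    let ?d = "?p - y"
    have d: "?d \<in> W n" using p y by (intro cvec.span_diff) auto
    have dd: "?d \<in> dom A" using d W_dom by blast
    have "H.energy ?d ?d = H.energy ?d ((v - y) - (v - ?p))" by simp
    also have "\<dots> = 0"
    proof -
      have "v - y \<in> dom H.half" using v y W_half by (intro H.en.V_diff) auto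
      thus ?thesis using H.en.diff_right[OF _ _ vp, of ?d "v - y"] d W_half orth[OF d] y by auto
    qed
    finally have "H.energy ?d ?d = 0" .
    hence "Re (H ?d (H.AA ?d)) = 0" unfolding H.energy_A[OF subsetD[OF W_half d] dd] by simp
    hence "H.alpha * (hnorm H ?d)\<^sup>2 \<le> 0" using H.coercive[OF dd] by simp
    hence "(hnorm H ?d)\<^sup>2 \<le> 0" using H.alpha_pos unfolding mult_le_0_iff by simp
    hence "hnorm H ?d = 0" by simp
    hence "?d = 0" unfolding H.norm_eq_0 .
    thus "y = ?p" by simp
  qed (use p orth in blast)
  thus ?thesis using p orth by simp
qed

lemma P_W: "v \<in> dom H.half \<Longrightarrow> P n v \<in> W n"
  and P_orth: "v \<in> dom H.half \<Longrightarrow> z \<in> W n \<Longrightarrow> H.energy z (v - P n v) = 0"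
  using projection by blast+

lemma P_dom: "v \<in> dom H.half \<Longrightarrow> P n v \<in> dom A"
  using P_W W_dom by blast

lemma P_diff_half: "v \<in> dom H.half \<Longrightarrow> v - P n v \<in> dom H.half"
  using P_dom H.dom_A_half by (intro H.en.V_diff) auto

lemma P_orth': "v \<in> dom H.half \<Longrightarrow> z \<in> W n \<Longrightarrow> H.energy (v - P n v) z = 0"
  using P_orth[of v z n] H.en.herm[of z "v - P n v"] P_diff_half[of v n] W_half by auto

lemma P_best:
  assumes v: "v \<in> dom H.half" and z: "z \<in> W n"
  shows "hnorm H.energy (v - P n v) \<le> hnorm H.energy (v - z)"
proof -
  let ?e = "v - P n v" and ?d = "P n v - z"
  have d: "?d \<in> W n" using P_W[OF v] z by (intro cvec.span_diff)
  have dh: "?d \<in> dom H.half" using d W_half by blast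
  have eh: "?e \<in> dom H.half" by (rule P_diff_half[OF v])
  have "Re (H.energy (?e + ?d) (?e + ?d)) = Re (H.energy ?e ?e) + Re (H.energy ?d ?d)"
    unfolding H.en.add_sq[OF eh dh] P_orth'[OF v d] by simp
  hence "(hnorm H.energy (v - z))\<^sup>2 = (hnorm H.energy ?e)\<^sup>2 + (hnorm H.energy ?d)\<^sup>2"
    using H.en.norm_sq[OF eh] H.en.norm_sq[OF dh] H.en.norm_sq[OF H.en.V_add[OF eh dh]] by simp
  hence "(hnorm H.energy ?e)\<^sup>2 \<le> (hnorm H.energy (v - z))\<^sup>2" by simp
  thus ?thesis
    by (rule power2_le_imp_le) (intro H.en.hnorm_ge0 H.en.V_diff v subsetD[OF W_half z])
qed

lemma energy_projection_error:
  assumes "\<sigma> \<ge> 1/2" "v \<in> dom (op_power G M \<sigma>)"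
  shows "v \<in> dom H.half \<and> (\<exists>r. r \<longlonglongrightarrow> 0 \<and> (\<forall>n. 0 \<le> r n \<and> hnorm H.energy (v - P n v) \<le> r n * \<mu> (n + 1) powr (1/2 - \<sigma>)))"
proof -
  obtain r where v: "v \<in> dom H.half" and r: "r \<longlonglongrightarrow> 0"
    "\<forall>n. 0 \<le> r n \<and> hnorm H.energy (v - ps n v) \<le> r n * \<mu> (n + 1) powr (1/2 - \<sigma>)"
    using approximation_power[OF assms] by blast
  have "hnorm H.energy (v - P n v) \<le> r n * \<mu> (n + 1) powr (1/2 - \<sigma>)" for n
    using P_best[OF v ps_span[of n v]] r(2) order_trans by blast
  thus ?thesis using v r by blast
qed

lemma energy_projection_error_dom:
  "\<exists>K>0. \<forall>g\<in>dom A. \<forall>n. hnorm H.energy (g - P n g) \<le> K * \<mu> (n + 1) powr (-1/2) * hnorm H (H.AA g)"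
proof -
  obtain K where K: "K > 0" "\<forall>g\<in>dom A. \<forall>n. hnorm H.energy (g - ps n g) \<le> K * \<mu> (n + 1) powr (-1/2) * hnorm H (H.AA g)"
    using approximation_dom by blast
  have "hnorm H.energy (g - P n g) \<le> K * \<mu> (n + 1) powr (-1/2) * hnorm H (H.AA g)" if "g \<in> dom A" for g n
  proof -
    have "hnorm H.energy (g - P n g) \<le> hnorm H.energy (g - ps n g)"
      using that H.dom_A_half by (intro P_best ps_span) blast
    also have "\<dots> \<le> K * \<mu> (n + 1) powr (-1/2) * hnorm H (H.AA g)" using K(2) that by blast
    finally show ?thesis .
  qed
  thus ?thesis using K(1) by blast
qed

text \<open>The Aubin-Nitsche duality argument.\<close>

lemma projection_error:
  "\<exists>K>0. (\<forall>g\<in>dom A. \<forall>n. hnorm H.energy (g - P n g) \<le> K * \<mu> (n + 1) powr (-1/2) * hnorm H (H.AA g)) \<and>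
    (\<forall>v\<in>dom H.half. \<forall>n. hnorm H (v - P n v) \<le> K * \<mu> (n + 1) powr (-1/2) * hnorm H.energy (v - P n v))"
proof -
  obtain K where K: "K > 0" "\<forall>g\<in>dom A. \<forall>n. hnorm H.energy (g - P n g) \<le> K * \<mu> (n + 1) powr (-1/2) * hnorm H (H.AA g)"
    using energy_projection_error_dom by blast
  have "hnorm H (v - P n v) \<le> K * \<mu> (n + 1) powr (-1/2) * hnorm H.energy (v - P n v)"
    if v: "v \<in> dom H.half" for v n
  proof (cases "v - P n v = 0")
    case True
    have "0 \<le> hnorm H.energy (v - P n v)" by (rule H.en.hnorm_ge0[OF P_diff_half[OF v]])
    thus ?thesis unfolding True using K(1) by simp
  next
    case False
    let ?e = "v - P n v"
    define g where "g = H.Ainv ?e"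
    have g: "g \<in> dom A" "H.AA g = ?e" by (simp_all add: g_def H.Ainv_dom H.A_Ainv)
    have gh: "g \<in> dom H.half" using g H.dom_A_half by blast
    have eh: "?e \<in> dom H.half" by (rule P_diff_half[OF v])
    have "(hnorm H ?e)\<^sup>2 = Re (H ?e (H.AA g))" by (simp add: g H.norm_sq)
    also have "H ?e (H.AA g) = H.energy ?e g" by (rule H.energy_A[OF eh g(1), symmetric])
    \<comment> \<open>Galerkin orthogonality allows any element of \<open>W n\<close> to be
      subtracted from \<open>g\<close>.\<close>
    also have "\<dots> = H.energy ?e (g - P n g)"
      using H.en.diff_right[OF eh gh subsetD[OF W_half P_W[OF gh]]] P_orth'[OF v P_W[OF gh]] by simp
    also have "Re \<dots> \<le> hnorm H.energy ?e * hnorm H.energy (g - P n g)"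
      using H.en.cauchy_schwarz[OF eh P_diff_half[OF gh]] complex_Re_le_cmod order_trans by blast
    also have "\<dots> \<le> hnorm H.energy ?e * (K * \<mu> (n + 1) powr (-1/2) * hnorm H ?e)"
      using bspec[OF K(2) g(1)] g(2) by (intro mult_left_mono H.en.hnorm_ge0[OF eh]) simp
    finally have "hnorm H ?e * hnorm H ?e \<le> hnorm H ?e * (K * \<mu> (n + 1) powr (-1/2) * hnorm H.energy ?e)"
      by (simp add: power2_eq_square mult_ac)
    thus ?thesis using H.norm_pos[OF False] by simp
  qed
  thus ?thesis using K by blast
qed

lemma projection_convergence:
  assumes "\<sigma> \<ge> 1/2" "v \<in> dom (op_power G M \<sigma>)"
  shows "(\<lambda>n. hnorm H (v - P n v)) \<in> o(\<lambda>n. \<mu> (n + 1) powr (-\<sigma>))"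
proof -
  obtain K where K: "K > 0" "\<forall>v\<in>dom H.half. \<forall>n. hnorm H (v - P n v) \<le> K * \<mu> (n + 1) powr (-1/2) * hnorm H.energy (v - P n v)"
    using projection_error by blast
  obtain r where v: "v \<in> dom H.half" and r: "r \<longlonglongrightarrow> 0"
    "\<forall>n. 0 \<le> r n \<and> hnorm H.energy (v - P n v) \<le> r n * \<mu> (n + 1) powr (1/2 - \<sigma>)"
    using energy_projection_error[OF assms] by blast
  have "\<bar>hnorm H (v - P n v)\<bar> \<le> (K * r n) * \<mu> (n + 1) powr (-\<sigma>)" for n
  proof -
    have "hnorm H (v - P n v) \<le> K * \<mu> (n + 1) powr (-1/2) * hnorm H.energy (v - P n v)" using K(2) v by blast
    also have "\<dots> \<le> K * \<mu> (n + 1) powr (-1/2) * (r n * \<mu> (n + 1) powr (1/2 - \<sigma>))"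
      using r(2) K(1) by (intro mult_left_mono) auto
    also have "\<dots> = (K * r n) * (\<mu> (n + 1) powr (-1/2) * \<mu> (n + 1) powr (1/2 - \<sigma>))" by simp
    also have "\<mu> (n + 1) powr (-1/2) * \<mu> (n + 1) powr (1/2 - \<sigma>) = \<mu> (n + 1) powr (-\<sigma>)"
      by (simp flip: powr_add)
    finally show ?thesis by simp
  qed
  moreover have "(\<lambda>n. K * r n) \<longlonglongrightarrow> 0" using tendsto_mult_left[OF r(1), of K] by simp
  ultimately show ?thesis by (intro smallo_of_bound[of "\<lambda>n. K * r n"]) auto
qed

end

section \<open>Errors of Ritz values and Ritz vectors\<close>

locale ritz_eigen = ritz H G A M \<mu> q \<Lambda> w
  for H G :: "'h::complex_vector inner_prod" and A M :: "'h operator" and \<mu> :: "nat \<Rightarrow> real" and q :: "nat \<Rightarrow> 'h"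
    and \<Lambda> :: "nat \<Rightarrow> nat \<Rightarrow> real" and w :: "nat \<Rightarrow> nat \<Rightarrow> 'h" +
  fixes N :: enat and lam :: "nat \<Rightarrow> real" and u :: "nat \<Rightarrow> 'h" and l :: nat
  assumes A_eigen: "eigenpairs_below H A (inf_essential_spectrum H A) {j. 1 \<le> j \<and> enat j \<le> N} lam u"
    and l: "enat l \<le> N"
begin

abbreviation J :: "nat set" where "J \<equiv> {j. 1 \<le> j \<and> enat j \<le> N}"

lemma lam_mono: "i \<in> J \<Longrightarrow> j \<in> J \<Longrightarrow> i \<le> j \<Longrightarrow> lam i \<le> lam j"
  using A_eigen unfolding eigenpairs_below_def by blast

lemma lam_below: "j \<in> J \<Longrightarrow> ereal (lam j) < inf_essential_spectrum H A"
  and u_eigen: "j \<in> J \<Longrightarrow> u j \<in> eigenspace A (of_real (lam j))"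
  using A_eigen unfolding eigenpairs_below_def by blast+

lemma u_orth: "i \<in> J \<Longrightarrow> j \<in> J \<Longrightarrow> H (u i) (u j) = (if i = j then 1 else 0)"
  using A_eigen unfolding eigenpairs_below_def orthonormal_on_def by blast

lemma finite_level: "ereal t < inf_essential_spectrum H A \<Longrightarrow> finite {j \<in> J. lam j = t}"
  using A_eigen unfolding eigenpairs_below_def by blast

lemma u_dom: "j \<in> J \<Longrightarrow> u j \<in> dom A"
  and A_u: "j \<in> J \<Longrightarrow> H.AA (u j) = of_real (lam j) *\<^sub>C u j"
  using u_eigen unfolding eigenspace_def by blast+

lemma u_norm: "j \<in> J \<Longrightarrow> hnorm H (u j) = 1"
  using u_orth[of j j] by (simp add: hnorm_def)

lemma lam_ge_alpha: "j \<in> J \<Longrightarrow> H.alpha \<le> lam j"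
  using H.coercive[OF u_dom, of j] u_orth[of j j] by (simp add: A_u u_norm H.lin)

lemma lam_pos: "j \<in> J \<Longrightarrow> lam j > 0"
  using lam_ge_alpha H.alpha_pos less_le_trans by blast

lemma in_J: "j \<in> {1..l} \<Longrightarrow> j \<in> J"
  using l by (auto intro: order_trans[of _ "enat l"])

lemma u_half: "j \<in> J \<Longrightarrow> u j \<in> dom H.half"
  using u_dom H.dom_A_half by blast

lemma orth_eigenspace:
  assumes s: "ereal s < inf_essential_spectrum H A"
    and orth: "\<And>i. i \<in> J \<Longrightarrow> lam i = s \<Longrightarrow> H (u i) x = 0" and y: "y \<in> eigenspace A (of_real s)"
  shows "H y x = 0"
proof -
  obtain F where "finite F" "eigenspace A (of_real s) \<subseteq> cvec.span F"
    using H.below_finite_eigenspace[OF s] by blast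
  from H.eigenspace_span[OF A_eigen s this] y have "y \<in> cvec.span (u ` {j \<in> J. lam j = s})" by blast
  thus ?thesis by (rule H.orth_span) (use orth in blast)
qed

lemma eigen_sum:
  assumes I: "finite I" "I \<subseteq> J" and x: "x = (\<Sum>i\<in>I. c i *\<^sub>C u i)"
  shows "x \<in> dom A" "H.AA x = (\<Sum>i\<in>I. (of_real (lam i) * c i) *\<^sub>C u i)"
    "(hnorm H x)\<^sup>2 = (\<Sum>i\<in>I. (cmod (c i))\<^sup>2)"
    "Re (H x (H.AA x)) = (\<Sum>i\<in>I. lam i * (cmod (c i))\<^sup>2)"
    "i \<in> I \<Longrightarrow> H (u i) x = c i"
proof -
  have d: "c i *\<^sub>C u i \<in> dom A" if "i \<in> I" for i using that I(2) by (intro H.dom_scale u_dom) blast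
  have o: "H (u i) (u j) = (if i = j then 1 else 0)" if "i \<in> I" "j \<in> I" for i j
    by (rule u_orth) (use that I(2) in blast)+
  show "x \<in> dom A" unfolding x by (rule H.dom_sum[OF d])
  have "H.AA x = (\<Sum>i\<in>I. H.AA (c i *\<^sub>C u i))" unfolding x by (rule H.A_sum[OF d])
  also have "\<dots> = (\<Sum>i\<in>I. (of_real (lam i) * c i) *\<^sub>C u i)"
  proof (rule sum.cong[OF refl])
    fix i assume "i \<in> I"
    hence i: "i \<in> J" using I(2) by blast
    show "H.AA (c i *\<^sub>C u i) = (of_real (lam i) * c i) *\<^sub>C u i"
      unfolding H.A_scale[OF u_dom[OF i]] A_u[OF i] by (simp add: mult.commute)
  qed
  finally show Ax: "H.AA x = (\<Sum>i\<in>I. (of_real (lam i) * c i) *\<^sub>C u i)" .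
  show "(hnorm H x)\<^sup>2 = (\<Sum>i\<in>I. (cmod (c i))\<^sup>2)" unfolding x by (rule H.orthonormal_sum_sq[OF I(1) o])
  show ux: "H (u i) x = c i" if "i \<in> I" for i unfolding x by (rule H.orthonormal_inner_sum[OF I(1) o that])
  have "H x (H.AA x) = (\<Sum>i\<in>I. of_real (lam i * (cmod (c i))\<^sup>2))"
    unfolding Ax H.sum_right[OF UNIV_I UNIV_I]
  proof (rule sum.cong[OF refl])
    fix i assume i: "i \<in> I"
    have "H x (u i) = cnj (c i)" using ux[OF i] H.herm[of "u i" x] by simp
    thus "H x ((of_real (lam i) * c i) *\<^sub>C u i) = of_real (lam i * (cmod (c i))\<^sup>2)"
      by (simp add: H.scale_right complex_norm_square del: of_real_power)
  qed
  thus "Re (H x (H.AA x)) = (\<Sum>i\<in>I. lam i * (cmod (c i))\<^sup>2)" by (simp flip: of_real_sum)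
qed

lemma energy_norm: "x \<in> dom A \<Longrightarrow> (hnorm H.energy x)\<^sup>2 = Re (H x (H.AA x))"
  using H.en.norm_sq[of x] H.energy_A[of x x] H.dom_A_half by auto

lemma lam_form_le:
  assumes j: "j \<in> J" and x: "x \<in> dom A" "\<And>i. i \<in> {1..<j} \<Longrightarrow> H (u i) x = 0"
  shows "lam j * (hnorm H x)\<^sup>2 \<le> Re (H x (H.AA x))"
proof (rule H.form_ge_below[OF _ x(1)])
  fix s y assume s: "s < lam j" and y: "y \<in> eigenspace A (of_real s)"
  have "ereal s < ereal (lam j)" using s by simp
  hence sb: "ereal s < inf_essential_spectrum H A" using lam_below[OF j] by (rule less_trans)
  show "H y x = 0"
  proof (rule orth_eigenspace[OF sb _ y])
    fix i assume i: "i \<in> J" "lam i = s"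
    have "i < j" using lam_mono[OF j i(1)] i(2) s by force
    thus "H (u i) x = 0" using i(1) by (intro x(2)) auto
  qed
qed (use lam_below[OF j] in simp)

lemma lam_gap:
  assumes j: "j \<in> J"
  shows "\<exists>\<gamma>>lam j. \<forall>x\<in>dom A. (\<forall>i\<in>J. lam i \<le> lam j \<longrightarrow> H (u i) x = 0) \<longrightarrow>
    \<gamma> * (hnorm H x)\<^sup>2 \<le> Re (H x (H.AA x))"
proof -
  have "u j \<noteq> 0" using u_norm[OF j] by auto
  from H.form_gap[OF lam_below[OF j] u_eigen[OF j] this]
  obtain \<gamma> where \<gamma>: "\<gamma> > lam j" "\<forall>x\<in>dom A. (\<forall>s y. s \<le> lam j \<longrightarrow> y \<in> eigenspace A (of_real s) \<longrightarrow> H y x = 0) \<longrightarrow>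
    \<gamma> * (hnorm H x)\<^sup>2 \<le> Re (H x (H.AA x))" by blast
  have "\<gamma> * (hnorm H x)\<^sup>2 \<le> Re (H x (H.AA x))"
    if x: "x \<in> dom A" "\<forall>i\<in>J. lam i \<le> lam j \<longrightarrow> H (u i) x = 0" for x
  proof -
    have "H y x = 0" if s: "s \<le> lam j" and y: "y \<in> eigenspace A (of_real s)" for s y
    proof (rule orth_eigenspace[OF _ _ y])
      have "ereal s \<le> ereal (lam j)" using s by simp
      thus "ereal s < inf_essential_spectrum H A" using lam_below[OF j] by (rule le_less_trans)
      show "H (u i) x = 0" if "i \<in> J" "lam i = s" for i using x(2) that s by blast
    qed
    thus ?thesis using \<gamma>(2) x(1) by blast
  qed
  thus ?thesis using \<gamma>(1) by blast
qed

text \<open>Counting conditions gives a nonzero combination of the first j Ritz vectors orthogonal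
  to the first j - 1 eigenvectors. Its Rayleigh quotient is at least \<open>lam j\<close> and at
  most \<open>\<Lambda> n j\<close>.\<close>

lemma ritz_value_lower:
  assumes j: "j \<in> {1..l}" and n: "j \<le> n"
  shows "lam j \<le> \<Lambda> n j"
proof -
  have jn: "j \<in> {1..n}" using j n by simp
  have "card {1..<j} < card {1..j}" using j by simp
  from underdetermined_system[OF _ _ this, of "\<lambda>k i. H (u k) (w n i)"]
  obtain c where c: "\<exists>i\<in>{1..j}. c i \<noteq> 0" "\<forall>k\<in>{1..<j}. (\<Sum>i\<in>{1..j}. H (u k) (w n i) * c i) = 0" by auto
  define z where "z = (\<Sum>i\<in>{1..j}. c i *\<^sub>C w n i)"
  have sub: "{1..j} \<subseteq> {1..n}" using n by auto
  note s = ritz_sum[OF sub z_def]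
  have "0 < (\<Sum>i\<in>{1..j}. (cmod (c i))\<^sup>2)"
    using c(1) by (auto intro!: sum_pos2)
  hence zp: "(hnorm H z)\<^sup>2 > 0" using s(2) by simp
  have zd: "z \<in> dom A" using s(1) W_dom by blast
  have "H (u k) z = 0" if "k \<in> {1..<j}" for k
    using c(2) that by (simp add: z_def H.sum_right H.scale_right mult.commute)
  hence "lam j * (hnorm H z)\<^sup>2 \<le> Re (H z (H.AA z))" by (rule lam_form_le[OF in_J[OF j] zd])
  also have "\<dots> = (hnorm H.energy z)\<^sup>2" using energy_norm[OF zd] by simp
  also have "\<dots> \<le> \<Lambda> n j * (hnorm H z)\<^sup>2" by (rule ritz_value_ge[OF jn z_def])
  finally show ?thesis using zp by simp
qed

text \<open>A single measure of the energy errors of all \<open>l\<close> eigenvectors; the rates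
  depending on \<sigma> enter the Ritz estimates only through \<open>err_bound\<close>.\<close>

definition err :: "nat \<Rightarrow> real" where
  "err n = (\<Sum>i=1..l. hnorm H.energy (u i - P n (u i)))"

lemma err_term:
  assumes "i \<in> {1..l}" shows "0 \<le> hnorm H.energy (u i - P n (u i))" "hnorm H.energy (u i - P n (u i)) \<le> err n"
proof -
  have nn: "0 \<le> hnorm H.energy (u i - P n (u i))" if "i \<in> {1..l}" for i
    by (rule H.en.hnorm_ge0[OF P_diff_half[OF u_half[OF in_J[OF that]]]])
  show "0 \<le> hnorm H.energy (u i - P n (u i))" by (rule nn[OF assms])
  show "hnorm H.energy (u i - P n (u i)) \<le> err n"
    unfolding err_def using assms nn by (intro member_le_sum) auto
qed

lemma err_nonneg: "err n \<ge> 0"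
  unfolding err_def using err_term(1) by (intro sum_nonneg) auto

text \<open>Passing to \<^term>\<open>P n\<close> changes the norm on the span of the \<^term>\<open>u i\<close> only to second order,
  because \<^term>\<open>H x e\<close> is an energy product of two projection errors.\<close>

lemma ritz_value_upper:
  assumes j: "j \<in> {1..l}" and n: "j \<le> n"
  shows "\<Lambda> n j * (1 - 2 * (err n)\<^sup>2 / H.alpha) \<le> lam j"
proof -
  let ?I = "{1..j}"
  have jn: "j \<in> {1..n}" using j n by simp
  have IJ: "?I \<subseteq> J" using in_J j by auto
  have Il: "i \<in> {1..l}" if "i \<in> ?I" for i using that j by auto
  \<comment> \<open>Some nonzero combination of the projected eigenvectors is orthogonal to the
    first j - 1 Ritz vectors, and its Rayleigh quotient bounds the j-th Ritz value from
    above.\<close>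
  have "card {1..<j} < card ?I" using j by simp
  from underdetermined_system[OF _ _ this, of "\<lambda>k i. H (w n k) (P n (u i))"]
  obtain c where c: "\<exists>i\<in>?I. c i \<noteq> 0" "\<forall>k\<in>{1..<j}. (\<Sum>i\<in>?I. H (w n k) (P n (u i)) * c i) = 0" by auto
  have uh: "u i \<in> dom H.half" if "i \<in> ?I" for i using u_half in_J[OF Il[OF that]] by blast
  define S where "S = (\<Sum>i\<in>?I. (cmod (c i))\<^sup>2)"
  have S: "S > 0" unfolding S_def using c(1) by (auto intro!: sum_pos2)
  define T where "T = sqrt S"
  have T: "T > 0" "T\<^sup>2 = S" using S by (simp_all add: T_def)
  have cT: "cmod (c i) \<le> T" if "i \<in> ?I" for i
  proof -
    have "(cmod (c i))\<^sup>2 \<le> S" unfolding S_def using that by (intro member_le_sum) auto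
    thus ?thesis unfolding T_def by (rule real_le_rsqrt)
  qed
  define x where "x = (\<Sum>i\<in>?I. c i *\<^sub>C u i)"
  define z where "z = (\<Sum>i\<in>?I. c i *\<^sub>C P n (u i))"
  define e where "e = x - z"
  note xs = eigen_sum[OF finite_atLeastAtMost IJ x_def]
  have comb: "hnorm H.energy ((\<Sum>i\<in>?I. a i *\<^sub>C u i) - (\<Sum>i\<in>?I. a i *\<^sub>C P n (u i))) \<le> b * err n"
    if a: "\<And>i. i \<in> ?I \<Longrightarrow> cmod (a i) \<le> b" for a b
  proof -
    have b: "b \<ge> 0" using a[of j] j by (meson atLeastAtMost_iff norm_ge_zero order_refl order_trans)
    have eq: "(\<Sum>i\<in>?I. a i *\<^sub>C u i) - (\<Sum>i\<in>?I. a i *\<^sub>C P n (u i)) = (\<Sum>i\<in>?I. a i *\<^sub>C (u i - P n (u i)))"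
      by (simp add: cvec.scale_right_diff_distrib sum_subtractf)
    have "hnorm H.energy ((\<Sum>i\<in>?I. a i *\<^sub>C u i) - (\<Sum>i\<in>?I. a i *\<^sub>C P n (u i)))
        \<le> (\<Sum>i\<in>?I. hnorm H.energy (a i *\<^sub>C (u i - P n (u i))))"
      unfolding eq by (intro H.en.triangle_sum H.en.V_scale P_diff_half uh)
    also have "\<dots> \<le> (\<Sum>i\<in>?I. b * hnorm H.energy (u i - P n (u i)))"
    proof (rule sum_mono)
      fix i assume i: "i \<in> ?I"
      show "hnorm H.energy (a i *\<^sub>C (u i - P n (u i))) \<le> b * hnorm H.energy (u i - P n (u i))"
        unfolding H.en.norm_scale[OF P_diff_half[OF uh[OF i]]]
        by (rule mult_right_mono[OF a[OF i] err_term(1)[OF Il[OF i]]])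
    qed
    also have "\<dots> \<le> b * err n"
      unfolding err_def sum_distrib_left[symmetric] using b j err_term(1)
      by (intro mult_left_mono sum_mono2) auto
    finally show ?thesis .
  qed
  have e_en: "hnorm H.energy e \<le> T * err n"
    unfolding e_def x_def z_def by (rule comb[OF cT])
  have zW: "z \<in> W n" unfolding z_def by (intro cvec.span_sum cvec.span_scale P_W uh)
  have zd: "z \<in> dom A" using zW W_dom by blast
  have zh: "z \<in> dom H.half" using zW W_half by blast
  have xh: "x \<in> dom H.half" using xs(1) H.dom_A_half by blast
  have ed: "e \<in> dom A" unfolding e_def by (rule H.dom_diff[OF xs(1) zd])
  have eh: "e \<in> dom H.half" using ed H.dom_A_half by blast
  have e_orth: "H.energy e y = 0" if y: "y \<in> W n" for y
  proof -
    have yh: "y \<in> dom H.half" using y W_half by blast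
    have ee: "e = (\<Sum>i\<in>?I. c i *\<^sub>C (u i - P n (u i)))"
      unfolding e_def x_def z_def by (simp add: cvec.scale_right_diff_distrib sum_subtractf)
    have "H.energy e y = (\<Sum>i\<in>?I. H.energy (c i *\<^sub>C (u i - P n (u i))) y)"
      unfolding ee by (rule H.en.sum_left[OF yh]) (intro H.en.V_scale P_diff_half uh)
    also have "\<dots> = 0"
    proof (intro sum.neutral ballI)
      fix i assume i: "i \<in> ?I"
      show "H.energy (c i *\<^sub>C (u i - P n (u i))) y = 0"
        unfolding H.en.scale_left[OF P_diff_half[OF uh[OF i]] yh] P_orth'[OF uh[OF i] y] by simp
    qed
    finally show ?thesis .
  qed
  have en_le: "(hnorm H.energy z)\<^sup>2 \<le> lam j * S"
  proof -
    have "Re (H.energy (e + z) (e + z)) = Re (H.energy e e) + Re (H.energy z z)"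
      unfolding H.en.add_sq[OF eh zh] e_orth[OF zW] by simp
    moreover have "e + z = x" by (simp add: e_def)
    ultimately have "(hnorm H.energy z)\<^sup>2 \<le> (hnorm H.energy x)\<^sup>2"
      using H.en.norm_sq[OF xh] H.en.norm_sq[OF zh] H.en.nonneg[OF eh] by simp
    also have "\<dots> = (\<Sum>i\<in>?I. lam i * (cmod (c i))\<^sup>2)" using energy_norm[OF xs(1)] xs(4) by simp
    also have "\<dots> \<le> (\<Sum>i\<in>?I. lam j * (cmod (c i))\<^sup>2)"
    proof (intro sum_mono mult_right_mono)
      fix i assume "i \<in> ?I"
      thus "lam i \<le> lam j" using IJ by (intro lam_mono[OF _ in_J[OF j]]) auto
    qed simp
    finally show ?thesis by (simp add: S_def sum_distrib_left)
  qed
  have Hxe: "cmod (H x e) \<le> (err n)\<^sup>2 * S / H.alpha"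
  proof -
    \<comment> \<open>The coefficients of the inverse of \<open>A\<close> applied to
      \<open>x\<close>. They turn \<open>H e x\<close> into an energy product, where
      \<open>z'\<close> may be subtracted because \<open>e\<close> is energy-orthogonal to
      \<open>W n\<close>. Dividing by eigenvalues at least \<open>alpha\<close> gives the factor 1 /
      alpha.\<close>
    define a where "a i = c i / of_real (lam i)" for i
    define x' where "x' = (\<Sum>i\<in>?I. a i *\<^sub>C u i)"
    define z' where "z' = (\<Sum>i\<in>?I. a i *\<^sub>C P n (u i))"
    note xs' = eigen_sum[OF finite_atLeastAtMost IJ x'_def]
    have "H.AA x' = x"
      unfolding xs'(2) x_def using lam_pos IJ by (intro sum.cong refl arg_cong2[where f = scaleC]) (force simp: a_def)+
    hence "H e x = H.energy e x'" using H.energy_A[OF eh xs'(1)] by simp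
    also have "\<dots> = H.energy e (x' - z')"
    proof -
      have z'W: "z' \<in> W n" unfolding z'_def by (intro cvec.span_sum cvec.span_scale P_W uh)
      have "x' \<in> dom H.half" "z' \<in> dom H.half" using xs'(1) H.dom_A_half z'W W_half by blast+
      thus ?thesis using H.en.diff_right[OF eh] e_orth[OF z'W] by simp
    qed
    finally have 1: "H e x = H.energy e (x' - z')" .
    have d: "x' - z' \<in> dom H.half"
      unfolding x'_def z'_def
      by (intro H.en.V_diff H.en.V_sum H.en.V_scale uh subsetD[OF W_half P_W]) auto
    have "cmod (a i) \<le> T / H.alpha" if i: "i \<in> ?I" for i
    proof -
      have iJ: "i \<in> J" using i IJ by blast
      have "cmod (a i) = cmod (c i) / lam i" using lam_pos[OF iJ] by (simp add: a_def norm_divide)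
      also have "\<dots> \<le> T / H.alpha"
        using cT[OF i] lam_ge_alpha[OF iJ] H.alpha_pos T(1) by (intro frac_le) auto
      finally show ?thesis .
    qed
    hence 2: "hnorm H.energy (x' - z') \<le> (T / H.alpha) * err n"
      unfolding x'_def z'_def by (rule comb)
    have "cmod (H x e) = cmod (H e x)" using H.herm[of e x] by simp
    also have "\<dots> \<le> hnorm H.energy e * hnorm H.energy (x' - z')"
      unfolding 1 by (rule H.en.cauchy_schwarz[OF eh d])
    also have "\<dots> \<le> (T * err n) * ((T / H.alpha) * err n)"
      by (rule mult_mono[OF e_en 2]) (use T(1) err_nonneg d in auto)
    also have "\<dots> = (err n)\<^sup>2 * S / H.alpha" using T(2) by (simp add: power2_eq_square)
    finally show ?thesis .
  qed
  have "(hnorm H z)\<^sup>2 \<ge> S * (1 - 2 * (err n)\<^sup>2 / H.alpha)"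
  proof -
    have "(hnorm H z)\<^sup>2 = Re (H (x - e) (x - e))" by (simp add: H.norm_sq e_def)
    also have "\<dots> = Re (H x x) - 2 * Re (H x e) + Re (H e e)" by (simp add: H.diff_sq)
    also have "\<dots> \<ge> S - 2 * ((err n)\<^sup>2 * S / H.alpha)"
      using Hxe complex_Re_le_cmod[of "H x e"] H.nonneg[of e] xs(3) H.norm_sq[of x] by (simp add: S_def)
    finally show ?thesis by (simp add: algebra_simps)
  qed
  hence "\<Lambda> n j * (S * (1 - 2 * (err n)\<^sup>2 / H.alpha)) \<le> \<Lambda> n j * (hnorm H z)\<^sup>2"
    using \<Lambda>_pos[OF jn] by (intro mult_left_mono) auto
  also have "\<dots> \<le> (hnorm H.energy z)\<^sup>2"
  proof (rule ritz_value_le[OF jn zW])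
    show "H (w n k) z = 0" if "k \<in> {1..<j}" for k
      using c(2) that by (simp add: z_def H.sum_right H.scale_right mult.commute)
  qed
  also have "\<dots> \<le> lam j * S" by (rule en_le)
  finally have "S * (\<Lambda> n j * (1 - 2 * (err n)\<^sup>2 / H.alpha)) \<le> S * lam j" by (simp add: mult_ac)
  thus ?thesis using S by simp
qed

text \<open>The energy product of \<open>u i\<close> and \<open>w n j\<close> is evaluated twice: by
  the eigenvalue equation, and by the Ritz equation after replacing \<open>u i\<close> with its
  projection. The bound is useful when \<open>lam i\<close> stays away from
  \<open>\<Lambda> n j\<close>.\<close>

lemma low_coefficient:
  assumes j: "j \<in> {1..n}" and i: "i \<in> J"
  shows "(\<Lambda> n j - lam i) * cmod (H (u i) (w n j)) \<le> \<Lambda> n j * hnorm H (u i - P n (u i))"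
proof -
  have uh: "u i \<in> dom H.half" by (rule u_half[OF i])
  have wW: "w n j \<in> W n" by (rule w_W[OF j])
  have wh: "w n j \<in> dom H.half" using wW W_half by blast
  have ph: "P n (u i) \<in> dom H.half" using P_W[OF uh] W_half by blast
  have "H.energy (u i) (w n j) = cnj (H.energy (w n j) (u i))" by (rule H.en.herm[OF wh uh])
  also have "\<dots> = of_real (lam i) * H (u i) (w n j)"
    using H.energy_A[OF wh u_dom[OF i]] H.herm[of "w n j" "u i"] by (simp add: A_u[OF i] H.scale_right)
  finally have 1: "H.energy (u i) (w n j) = of_real (lam i) * H (u i) (w n j)" .
  have "H.energy (u i) (w n j) = H.energy (P n (u i)) (w n j)"
    using H.en.diff_left[OF uh ph wh] P_orth'[OF uh wW] by simp
  also have "\<dots> = of_real (\<Lambda> n j) * H (P n (u i)) (w n j)" by (rule ritz_equation[OF j P_W[OF uh]])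
  also have "H (P n (u i)) (w n j) = H (u i) (w n j) - H (u i - P n (u i)) (w n j)"
    by (simp add: H.diff_left)
  finally have "of_real (\<Lambda> n j - lam i) * H (u i) (w n j) = of_real (\<Lambda> n j) * H (u i - P n (u i)) (w n j)"
    unfolding 1 by (simp add: algebra_simps)
  hence "\<bar>\<Lambda> n j - lam i\<bar> * cmod (H (u i) (w n j)) = \<Lambda> n j * cmod (H (u i - P n (u i)) (w n j))"
    using \<Lambda>_pos[OF j] by (metis abs_of_pos norm_mult norm_of_real)
  moreover have "cmod (H (u i - P n (u i)) (w n j)) \<le> hnorm H (u i - P n (u i))"
    using H.cauchy_schwarz[of "u i - P n (u i)" "w n j"] by (simp add: w_norm[OF j])
  hence "\<Lambda> n j * cmod (H (u i - P n (u i)) (w n j)) \<le> \<Lambda> n j * hnorm H (u i - P n (u i))"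
    using \<Lambda>_pos[OF j] by (intro mult_left_mono) auto
  moreover have "(\<Lambda> n j - lam i) * cmod (H (u i) (w n j)) \<le> \<bar>\<Lambda> n j - lam i\<bar> * cmod (H (u i) (w n j))"
    by (intro mult_right_mono) auto
  ultimately show ?thesis by linarith
qed

text \<open>On the complement of the listed eigenvectors the gap makes \<open>A - s\<close>
  coercive, so a weak solution exists there. Both \<open>g\<close> and \<open>r\<close> are
  orthogonal to the removed eigenvectors, so the equation holds against all of \<open>dom A\<close>,
  and selfadjointness puts \<open>g\<close> into the domain.\<close>

lemma reduced_resolvent:
  assumes F: "finite F" "F \<subseteq> J" and s: "s > 0" "\<gamma> > s"
    and gap: "\<And>x. x \<in> dom A \<Longrightarrow> (\<forall>i\<in>F. H (u i) x = 0) \<Longrightarrow> \<gamma> * (hnorm H x)\<^sup>2 \<le> Re (H x (H.AA x))"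
    and r: "\<forall>i\<in>F. H (u i) r = 0"
  shows "\<exists>g\<in>dom A. (\<forall>i\<in>F. H (u i) g = 0) \<and> H.AA g = r + of_real s *\<^sub>C g \<and> (\<gamma> - s) * hnorm H g \<le> hnorm H r"
proof -
  define V where "V = {x \<in> dom A. \<forall>i\<in>F. H (u i) x = 0}"
  have Vs: "cvec.subspace V"
    unfolding V_def by (rule cvec.subspaceI) (auto simp: H.lin H.dom_zero H.dom_add H.dom_scale)
  have co: "(\<gamma> - s) * (hnorm H v)\<^sup>2 \<le> Re (H v (H.AA v - of_real s *\<^sub>C v))" if "v \<in> V" for v
    using gap[of v] that H.norm_sq[of v] by (simp add: V_def H.lin algebra_simps)
  have "\<gamma> - s > 0" using s by simp
  from H.weak_solution[OF Vs _ this co, of r]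
  obtain g where g: "\<forall>v\<in>V. H g (H.AA v - of_real s *\<^sub>C v) = H r v" "\<forall>z. (\<forall>v\<in>V. H z v = 0) \<longrightarrow> H z g = 0"
    by (auto simp: V_def)
  have gF: "H (u i) g = 0" if "i \<in> F" for i using g(2) that by (auto simp: V_def)
  have sym0: "H x (u i) = 0" if "H (u i) x = 0" for x i using that H.herm[of "u i" x] by simp
  have "H (r + of_real s *\<^sub>C g) v = H g (H.AA v)" if v: "v \<in> dom A" for v
  proof -
    define p where "p = (\<Sum>i\<in>F. H (u i) v *\<^sub>C u i)"
    note ps = eigen_sum[OF F p_def]
    have vV: "v - p \<in> V"
      unfolding V_def using H.dom_diff[OF v ps(1)] ps(5) by (simp add: H.diff_right)
    have gp: "H g p = 0" and rp: "H r p = 0"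
      unfolding p_def using gF r by (simp_all add: H.sum_right H.scale_right sym0)
    have gAp: "H g (H.AA p) = 0"
      unfolding ps(2) using gF by (simp add: H.sum_right H.scale_right sym0)
    have "H r v = H r (v - p)" by (simp add: H.diff_right rp)
    also have "\<dots> = H g (H.AA (v - p) - of_real s *\<^sub>C (v - p))" using g(1) vV by simp
    also have "\<dots> = H g (H.AA v) - of_real s * H g v"
      unfolding H.A_diff[OF v ps(1)] by (simp add: H.lin gp gAp)
    finally show ?thesis by (simp add: H.lin)
  qed
  from H.A_adjoint[OF this] have gd: "g \<in> dom A" "H.AA g = r + of_real s *\<^sub>C g" by blast+
  have gV: "g \<in> V" using gd gF by (simp add: V_def)
  have "(\<gamma> - s) * hnorm H g \<le> hnorm H r"
  proof (cases "g = 0")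
    case False
    have "(\<gamma> - s) * (hnorm H g)\<^sup>2 \<le> Re (H g r)" using co[OF gV] by (simp add: gd)
    also have "\<dots> \<le> hnorm H g * hnorm H r"
      using H.cauchy_schwarz[of g r] complex_Re_le_cmod order_trans by blast
    finally have "hnorm H g * ((\<gamma> - s) * hnorm H g) \<le> hnorm H g * hnorm H r"
      by (simp add: power2_eq_square mult_ac)
    thus ?thesis using H.norm_pos[OF False] by simp
  qed simp
  thus ?thesis using gd gF by blast
qed

end

context ritz_eigen
begin

lemma energy_norm_ge: "x \<in> dom A \<Longrightarrow> hnorm H x \<le> hnorm H.energy x / sqrt H.alpha"
  using H.energy_coercive[of x] H.alpha_pos by (simp add: field_simps)

text \<open>The Ritz equation is tested with the solution \<^term>\<open>g\<close> of \<^term>\<open>H.AA g = r + of_real s *\<^sub>C g\<close>, which is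
  smoother than \<^term>\<open>r\<close>.\<close>

lemma residual_norm:
  assumes K: "K > 0" "\<forall>g\<in>dom A. \<forall>n. hnorm H.energy (g - P n g) \<le> K * \<mu> (n + 1) powr (-1/2) * hnorm H (H.AA g)"
    and j: "j \<in> {1..n}" and F: "finite F" "F \<subseteq> J" and s: "s \<ge> H.alpha" "\<gamma> > s"
    and gap: "\<And>x. x \<in> dom A \<Longrightarrow> (\<forall>i\<in>F. H (u i) x = 0) \<Longrightarrow> \<gamma> * (hnorm H x)\<^sup>2 \<le> Re (H x (H.AA x))"
    and \<Lambda>: "s \<le> \<Lambda> n j" "\<Lambda> n j \<le> 2 * s" "(\<Lambda> n j - s) / (\<gamma> - s) \<le> 1/2"
    and w: "w n j - r = (\<Sum>i\<in>F. h i *\<^sub>C u i)" and r: "\<forall>i\<in>F. H (u i) r = 0"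
    and v: "v \<in> dom A" "H.AA v = of_real s *\<^sub>C v"
  shows "hnorm H r \<le> 8 * s / H.alpha * K * (1 + s / (\<gamma> - s)) * (\<mu> (n + 1) powr (-1/2) * hnorm H.energy (w n j - v))"
proof (cases "r = 0")
  case True
  have "w n j - v \<in> dom H.half" using H.dom_diff[OF w_dom[OF j] v(1)] H.dom_A_half by blast
  thus ?thesis using True K s H.alpha_pos by simp
next
  case False
  define m where "m = \<mu> (n + 1) powr (-1/2)"
  define D where "D = w n j - v"
  have s0: "s > 0" using s H.alpha_pos by simp
  have L0: "\<Lambda> n j > 0" by (rule \<Lambda>_pos[OF j])
  have wW: "w n j \<in> W n" by (rule w_W[OF j])
  have wd: "w n j \<in> dom A" by (rule w_dom[OF j])
  have wh: "w n j \<in> dom H.half" using wd H.dom_A_half by blast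
  have Dd: "D \<in> dom A" unfolding D_def by (rule H.dom_diff[OF wd v(1)])
  have Dh: "D \<in> dom H.half" using Dd H.dom_A_half by blast
  have vh: "v \<in> dom H.half" using v H.dom_A_half by blast
  obtain g where g: "g \<in> dom A" "\<forall>i\<in>F. H (u i) g = 0" "H.AA g = r + of_real s *\<^sub>C g"
    "(\<gamma> - s) * hnorm H g \<le> hnorm H r"
    using reduced_resolvent[OF F s0 s(2) gap r] by blast
  have gh: "g \<in> dom H.half" using g H.dom_A_half by blast
  define b where "b = g - P n g"
  have bd: "b \<in> dom A" unfolding b_def by (rule H.dom_diff[OF g(1) P_dom[OF gh]])
  have bh: "b \<in> dom H.half" using bd H.dom_A_half by blast
  have perp: "H x (w n j) = H x r" if "\<forall>i\<in>F. H (u i) x = 0" for x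
  proof -
    have "H x (u i) = 0" if "i \<in> F" for i using \<open>\<forall>i\<in>F. H (u i) x = 0\<close> that H.herm[of "u i" x] by simp
    hence "H x (w n j - r) = 0" unfolding w by (simp add: H.sum_right H.scale_right)
    thus ?thesis by (simp add: H.diff_right)
  qed
  have bw: "H.energy b (w n j) = 0" unfolding b_def by (rule P_orth'[OF gh wW])
  have "H (H.AA g) (w n j) = H.energy g (w n j)"
    using H.energy_A[OF gh wd] H.A_sym[OF g(1) wd] by simp
  also have "\<dots> = H.energy (P n g) (w n j)"
    using H.en.diff_left[OF gh subsetD[OF W_half P_W[OF gh, of n]] wh] bw by (simp add: b_def)
  also have "\<dots> = of_real (\<Lambda> n j) * H (P n g) (w n j)" by (rule ritz_equation[OF j P_W[OF gh]])
  also have "H (P n g) (w n j) = H g (w n j) - H b (w n j)" by (simp add: b_def H.diff_left)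
  finally have "H r (w n j) = of_real (\<Lambda> n j - s) * H g (w n j) - of_real (\<Lambda> n j) * H b (w n j)"
    unfolding g(3) by (simp add: H.lin algebra_simps)
  \<comment> \<open>Both terms are small: the first because the Ritz value is close to
    \<open>s\<close>, the second because \<open>g\<close> is well approximated from
    \<open>W n\<close>.\<close>
  hence eq: "of_real ((hnorm H r)\<^sup>2) = of_real (\<Lambda> n j - s) * H g r - of_real (\<Lambda> n j) * H b (w n j)"
    unfolding perp[OF r] perp[OF g(2)] by (simp add: H.self_eq)
  \<comment> \<open>The product is of second order, which Cauchy-Schwarz on \<open>b\<close> and
    \<open>w n j\<close> would miss. With \<open>w n j = D + v\<close>, the part at \<open>v\<close>
    becomes an energy product by the eigenvalue equation, and there \<open>v\<close> may be replaced
    by \<open>- D\<close>, since \<open>b\<close> is energy-orthogonal to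
    \<open>w n j\<close>.\<close>
  have Hbw: "cmod (H b (w n j)) \<le> 2 / H.alpha * (hnorm H.energy b * hnorm H.energy D)"
  proof -
    have "H.energy b v = of_real s * H b v"
      using H.energy_A[OF bh v(1)] by (simp add: v(2) H.scale_right)
    moreover have "H.energy b D = - H.energy b v"
      unfolding D_def using H.en.diff_right[OF bh wh vh] bw by simp
    ultimately have bv: "H b v = - H.energy b D / of_real s" using s0 by (simp add: field_simps)
    have eD: "cmod (H.energy b D) \<le> hnorm H.energy b * hnorm H.energy D"
      by (rule H.en.cauchy_schwarz[OF bh Dh])
    have pos: "0 \<le> hnorm H.energy b * hnorm H.energy D" using bh Dh by simp
    have "cmod (H b v) = cmod (H.energy b D) / s" unfolding bv using s0 by (simp add: norm_divide)
    also have "\<dots> \<le> (hnorm H.energy b * hnorm H.energy D) / H.alpha"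
      using eD s H.alpha_pos pos by (intro frac_le) auto
    finally have 1: "cmod (H b v) \<le> (hnorm H.energy b * hnorm H.energy D) / H.alpha" .
    have "cmod (H b D) \<le> hnorm H b * hnorm H D" by (rule H.cauchy_schwarz) auto
    also have "\<dots> \<le> (hnorm H.energy b / sqrt H.alpha) * (hnorm H.energy D / sqrt H.alpha)"
      using bh H.alpha_pos by (intro mult_mono energy_norm_ge bd Dd) auto
    also have "\<dots> = (hnorm H.energy b * hnorm H.energy D) / H.alpha" using H.alpha_pos by simp
    finally have 2: "cmod (H b D) \<le> (hnorm H.energy b * hnorm H.energy D) / H.alpha" .
    have "H b (w n j) = H b D + H b v" by (simp add: D_def H.diff_right)
    hence "cmod (H b (w n j)) \<le> cmod (H b D) + cmod (H b v)" by (simp add: norm_triangle_ineq)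
    also have "\<dots> \<le> 2 / H.alpha * (hnorm H.energy b * hnorm H.energy D)" using 1 2 by simp
    finally show ?thesis .
  qed
  have gn: "hnorm H g \<le> hnorm H r / (\<gamma> - s)" using g(4) s by (simp add: field_simps)
  have Agn: "hnorm H (H.AA g) \<le> (1 + s / (\<gamma> - s)) * hnorm H r"
  proof -
    have "hnorm H (H.AA g) \<le> hnorm H r + s * hnorm H g"
      unfolding g(3) using H.triangle[of r "of_real s *\<^sub>C g"] s0 by (simp add: H.norm_scale)
    also have "\<dots> \<le> hnorm H r + s * (hnorm H r / (\<gamma> - s))" using mult_left_mono[OF gn, of s] s0 by simp
    finally show ?thesis by (simp add: algebra_simps)
  qed
  have bn: "hnorm H.energy b \<le> K * m * ((1 + s / (\<gamma> - s)) * hnorm H r)"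
  proof -
    have "hnorm H.energy b \<le> K * m * hnorm H (H.AA g)"
      using bspec[OF K(2) g(1)] by (simp add: b_def m_def)
    also have "\<dots> \<le> K * m * ((1 + s / (\<gamma> - s)) * hnorm H r)"
      using Agn K(1) by (intro mult_left_mono) (auto simp: m_def)
    finally show ?thesis .
  qed
  have "(hnorm H r)\<^sup>2 = cmod (of_real (\<Lambda> n j - s) * H g r - of_real (\<Lambda> n j) * H b (w n j))"
    unfolding eq[symmetric] norm_of_real by simp
  also have "\<dots> \<le> cmod (of_real (\<Lambda> n j - s) * H g r) + cmod (of_real (\<Lambda> n j) * H b (w n j))"
    by (rule norm_triangle_ineq4)
  also have "\<dots> = (\<Lambda> n j - s) * cmod (H g r) + \<Lambda> n j * cmod (H b (w n j))"
    using \<Lambda>(1) L0 unfolding norm_mult norm_of_real by simp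
  also have "\<dots> \<le> (\<Lambda> n j - s) * (hnorm H r / (\<gamma> - s) * hnorm H r)
      + (2 * s) * (2 / H.alpha * ((K * m * ((1 + s / (\<gamma> - s)) * hnorm H r)) * hnorm H.energy D))"
  proof (rule add_mono)
    have "cmod (H g r) \<le> hnorm H g * hnorm H r" by (rule H.cauchy_schwarz) auto
    also have "\<dots> \<le> hnorm H r / (\<gamma> - s) * hnorm H r" using gn by (rule mult_right_mono) simp
    finally show "(\<Lambda> n j - s) * cmod (H g r) \<le> (\<Lambda> n j - s) * (hnorm H r / (\<gamma> - s) * hnorm H r)"
      using \<Lambda>(1) by (intro mult_left_mono) auto
    have "cmod (H b (w n j)) \<le> 2 / H.alpha * ((K * m * ((1 + s / (\<gamma> - s)) * hnorm H r)) * hnorm H.energy D)"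
      by (rule order_trans[OF Hbw]) (intro mult_left_mono mult_right_mono bn, use Dh H.alpha_pos in auto)
    thus "\<Lambda> n j * cmod (H b (w n j)) \<le> (2 * s) * (2 / H.alpha * ((K * m * ((1 + s / (\<gamma> - s)) * hnorm H r)) * hnorm H.energy D))"
      using \<Lambda>(2) s0 by (intro mult_mono) auto
  qed
  also have "(\<Lambda> n j - s) * (hnorm H r / (\<gamma> - s) * hnorm H r) = ((\<Lambda> n j - s) / (\<gamma> - s)) * (hnorm H r)\<^sup>2"
    by (simp add: power2_eq_square)
  \<comment> \<open>This half is absorbed on the left, which doubles the constant 4 of the other
    term to 8.\<close>
  also have "((\<Lambda> n j - s) / (\<gamma> - s)) * (hnorm H r)\<^sup>2 \<le> 1/2 * (hnorm H r)\<^sup>2"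
    by (rule mult_right_mono[OF \<Lambda>(3)]) simp
  finally have fin: "(hnorm H r)\<^sup>2 \<le> 1/2 * (hnorm H r)\<^sup>2
      + (2 * s) * (2 / H.alpha * ((K * m * ((1 + s / (\<gamma> - s)) * hnorm H r)) * hnorm H.energy D))" by simp
  have "(2 * s) * (2 / H.alpha * ((K * m * (k * x)) * y)) = 1/2 * (x * (8 * s / H.alpha * K * k * (m * y)))"
    for k x y :: real by simp
  moreover have "x \<le> 1/2 * x + 1/2 * y \<Longrightarrow> x \<le> y" for x y :: real by simp
  ultimately have "(hnorm H r)\<^sup>2 \<le> hnorm H r * (8 * s / H.alpha * K * (1 + s / (\<gamma> - s)) * (m * hnorm H.energy D))"
    using fin by (simp only:)
  hence "hnorm H r * hnorm H r \<le> hnorm H r * (8 * s / H.alpha * K * (1 + s / (\<gamma> - s)) * (m * hnorm H.energy D))"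
    by (simp only: power2_eq_square)
  thus ?thesis using H.norm_pos[OF False] unfolding m_def D_def by (rule mult_left_le_imp_le)
qed

text \<open>The Ritz vector is \<open>lo + v + r\<close>, with components on smaller eigenvalues, on
  the eigenvalue \<open>lam j\<close> and on the complement. The witness is \<open>v\<close>
  normalized; \<open>lo\<close> is controlled by \<open>low_coefficient\<close>, and
  \<open>r\<close> first in energy and then, through \<open>residual_norm\<close>, in
  \<open>H\<close>.\<close>

lemma eigen_estimate:
  assumes j: "j \<in> {1..l}"
  shows "\<exists>C\<ge>0. \<exists>d>0. \<forall>n\<ge>j. err n \<le> d \<longrightarrow> \<bar>\<Lambda> n j - lam j\<bar> \<le> C * (err n)\<^sup>2 \<and>
    (\<exists>U\<in>eigenspace A (of_real (lam j)). hnorm H U = 1 \<and> hnorm H.energy (U - w n j) \<le> C * err n \<and>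
      hnorm H (U - w n j) \<le> C * (\<mu> (n + 1) powr (-1/2) * err n))"
proof -
  define s where "s = lam j"
  have jJ: "j \<in> J" by (rule in_J[OF j])
  have s\<alpha>: "s \<ge> H.alpha" and s0: "s > 0" using lam_ge_alpha[OF jJ] lam_pos[OF jJ] by (simp_all add: s_def)
  define Lo where "Lo = {i \<in> J. lam i < s}"
  define Eq where "Eq = {i \<in> J. lam i = s}"
  define F where "F = Lo \<union> Eq"
  \<comment> \<open>Smaller eigenvalues have indices below j, so \<open>err\<close> controls their
    eigenvectors. \<open>Eq\<close> may reach beyond l and is never compared with its
    projection.\<close>
  have Lo: "Lo \<subseteq> {1..l}"
  proof
    fix i assume "i \<in> Lo"
    hence i: "i \<in> J" "lam i < lam j" by (auto simp: Lo_def s_def)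
    have "i < j" using lam_mono[OF jJ i(1)] i(2) by force
    thus "i \<in> {1..l}" using i(1) j by auto
  qed
  have fin: "finite Lo" "finite Eq" "finite F"
    using finite_subset[OF Lo] finite_level[OF lam_below[OF jJ]] by (auto simp: F_def Eq_def s_def)
  have sub: "Lo \<subseteq> J" "Eq \<subseteq> J" "F \<subseteq> J" by (auto simp: Lo_def Eq_def F_def)
  have disj: "Lo \<inter> Eq = {}" by (auto simp: Lo_def Eq_def)
  obtain \<gamma> where \<gamma>: "\<gamma> > s" and gap': "\<forall>x\<in>dom A. (\<forall>i\<in>J. lam i \<le> lam j \<longrightarrow> H (u i) x = 0) \<longrightarrow>
      \<gamma> * (hnorm H x)\<^sup>2 \<le> Re (H x (H.AA x))"
    using lam_gap[OF jJ] unfolding s_def by blast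
  have gap: "\<gamma> * (hnorm H x)\<^sup>2 \<le> Re (H x (H.AA x))" if "x \<in> dom A" "\<forall>i\<in>F. H (u i) x = 0" for x
  proof -
    have "\<forall>i\<in>J. lam i \<le> lam j \<longrightarrow> H (u i) x = 0" using that(2) by (auto simp: F_def Lo_def Eq_def s_def)
    thus ?thesis using gap' that(1) by blast
  qed
  obtain K where K: "K > 0"
    "\<forall>g\<in>dom A. \<forall>n. hnorm H.energy (g - P n g) \<le> K * \<mu> (n + 1) powr (-1/2) * hnorm H (H.AA g)"
    "\<forall>v\<in>dom H.half. \<forall>n. hnorm H (v - P n v) \<le> K * \<mu> (n + 1) powr (-1/2) * hnorm H.energy (v - P n v)"
    using projection_error by blast
  \<comment> \<open>With e for \<open>err n\<close>: \<open>m1\<close> bounds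
    \<open>\<mu> (n + 1) powr (-1/2)\<close> for all n; \<open>Cd\<close> controls the excess of the
    Ritz value, \<open>C1\<close> the \<open>H\<close>-norm of \<open>lo\<close>, \<open>Q\<close>
    and \<open>Ce\<close> the energy of \<open>r\<close>, \<open>CD\<close> the energy of
    \<open>w n j - v\<close>, and \<open>C3\<close> its \<open>H\<close>-norm; \<open>C2\<close> is
    the factor in \<open>residual_norm\<close>.\<close>
  define m1 where "m1 = \<mu> 1 powr (-1/2)"
  define cs where "cs = (\<Sum>i\<in>Lo. 2 * s / (s - lam i))"
  define C1 where "C1 = cs * K"
  define Cd where "Cd = 4 * s / H.alpha"
  define Q where "Q = Cd + s * (C1 * m1)\<^sup>2"
  define Ce where "Ce = sqrt (Q / (1 - s / \<gamma>))"
  define CD where "CD = sqrt s * (C1 * m1) + Ce"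
  define C2 where "C2 = 8 * s / H.alpha * K * (1 + s / (\<gamma> - s))"
  define C3 where "C3 = C1 + C2 * CD"
  have m1: "m1 \<ge> 0" by (simp add: m1_def)
  have cs: "cs \<ge> 0" unfolding cs_def using s0 by (intro sum_nonneg) (auto simp: Lo_def)
  have C1: "C1 \<ge> 0" using cs K by (simp add: C1_def)
  have Cd: "Cd \<ge> 0" using s0 H.alpha_pos by (simp add: Cd_def)
  have Q: "Q \<ge> 0" using Cd s0 by (simp add: Q_def)
  have s\<gamma>: "1 - s / \<gamma> > 0" using \<gamma> s0 by simp
  have Ce: "Ce \<ge> 0" using Q s\<gamma> by (simp add: Ce_def)
  have CD: "CD \<ge> 0" using Ce C1 m1 s0 by (simp add: CD_def)
  have C2: "C2 \<ge> 0" using s0 H.alpha_pos K \<gamma> by (simp add: C2_def)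
  have C3: "C3 \<ge> 0" using C1 C2 CD by (simp add: C3_def)
  define C where "C = Cd + (sqrt s * (C3 * m1) + CD) + 2 * C3"
  \<comment> \<open>The four bounds give, in turn, that the square of e is at most e, that the Ritz
    value is at most 2 s, that its excess is at most half the gap, and that \<open>w n j - v\<close>
    has norm at most 1/2, so \<open>v\<close> is nonzero.\<close>
  define d where "d = min 1 (min (H.alpha / 4) (min (1 / (2 * Cd / (\<gamma> - s) + 1)) (1 / (2 * (C3 * m1) + 1))))"
  have p2: "2 * Cd / (\<gamma> - s) + 1 > 0" using Cd \<gamma> by (intro add_nonneg_pos divide_nonneg_pos) auto
  have p3: "2 * (C3 * m1) + 1 > 0" using C3 m1 by (intro add_nonneg_pos) auto
  have d: "d > 0" using H.alpha_pos p2 p3 by (simp add: d_def)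
  have C: "C \<ge> 0" using Cd C3 m1 CD s0 by (simp add: C_def)
  have CCd: "Cd \<le> C" and CCe: "sqrt s * (C3 * m1) + CD \<le> C" and CC3: "2 * C3 \<le> C"
    using Cd C3 m1 CD s0 by (simp_all add: C_def)
  show ?thesis
  proof (rule exI[of _ C], intro conjI C, rule exI[of _ d], intro conjI d allI impI)
    fix n assume n: "j \<le> n" and small: "err n \<le> d"
    have jn: "j \<in> {1..n}" using j n by simp
    define e where "e = err n"
    define m where "m = \<mu> (n + 1) powr (-1/2)"
    have e0: "e \<ge> 0" using err_nonneg by (simp add: e_def)
    have m0: "m \<ge> 0" by (simp add: m_def)
    have mm1: "m \<le> m1" unfolding m_def m1_def using \<mu>_pos[of 1] \<mu>_mono[of 1 "n + 1"]
      by (intro powr_mono2') auto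
    have e1: "e \<le> 1" "e \<le> H.alpha / 4" "e \<le> 1 / (2 * Cd / (\<gamma> - s) + 1)" "e \<le> 1 / (2 * (C3 * m1) + 1)"
      using small by (simp_all add: d_def e_def)
    have e2: "e\<^sup>2 \<le> e" using e0 e1(1) by (simp add: power2_eq_square mult_left_le)
    define L where "L = \<Lambda> n j"
    have L0: "L > 0" using \<Lambda>_pos[OF jn] by (simp add: L_def)
    have Ls: "s \<le> L" using ritz_value_lower[OF j n] by (simp add: L_def s_def)
    have up: "L * (1 - 2 * e\<^sup>2 / H.alpha) \<le> s" using ritz_value_upper[OF j n] by (simp add: L_def s_def e_def)
    have q: "2 * e\<^sup>2 / H.alpha \<le> 1/2" using e2 e1(2) H.alpha_pos by (simp add: field_simps)
    have L2: "L \<le> 2 * s"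
    proof -
      have "L * (1/2) \<le> L * (1 - 2 * e\<^sup>2 / H.alpha)" using q L0 by (intro mult_left_mono) auto
      thus ?thesis using up by linarith
    qed
    have Ld: "L - s \<le> Cd * e\<^sup>2"
    proof -
      have "L - s \<le> L * (2 * e\<^sup>2 / H.alpha)" using up by (simp add: algebra_simps)
      also have "\<dots> \<le> (2 * s) * (2 * e\<^sup>2 / H.alpha)" using L2 H.alpha_pos by (intro mult_right_mono) auto
      finally show ?thesis by (simp add: Cd_def)
    qed
    have Lg: "(L - s) / (\<gamma> - s) \<le> 1/2"
    proof -
      have "(L - s) / (\<gamma> - s) \<le> Cd * e\<^sup>2 / (\<gamma> - s)" using Ld \<gamma> by (intro divide_right_mono) auto
      also have "\<dots> = (Cd / (\<gamma> - s)) * e\<^sup>2" by simp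
      also have "\<dots> \<le> (Cd / (\<gamma> - s)) * e" using e2 Cd \<gamma> by (intro mult_left_mono) auto
      also have "\<dots> \<le> 1/2"
        using e1(3) p2 e0 by (simp add: pos_le_divide_eq algebra_simps)
      finally show ?thesis .
    qed
    define h where "h i = H (u i) (w n j)" for i
    define lo where "lo = (\<Sum>i\<in>Lo. h i *\<^sub>C u i)"
    define v where "v = (\<Sum>i\<in>Eq. h i *\<^sub>C u i)"
    define p where "p = (\<Sum>i\<in>F. h i *\<^sub>C u i)"
    define r where "r = w n j - p"
    define D where "D = w n j - v"
    note los = eigen_sum[OF fin(1) sub(1) lo_def]
    note vs = eigen_sum[OF fin(2) sub(2) v_def]
    note ps = eigen_sum[OF fin(3) sub(3) p_def]
    have p_split: "p = lo + v" unfolding p_def lo_def v_def F_def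
      using fin disj by (intro sum.union_disjoint)
    have D_split: "D = lo + r" by (simp add: D_def r_def p_split)
    have wd: "w n j \<in> dom A" by (rule w_dom[OF jn])
    have rd: "r \<in> dom A" unfolding r_def by (rule H.dom_diff[OF wd ps(1)])
    have Dd: "D \<in> dom A" unfolding D_def by (rule H.dom_diff[OF wd vs(1)])
    note half = subsetD[OF H.dom_A_half]
    have ur: "\<forall>i\<in>F. H (u i) r = 0" using ps(5) by (simp add: r_def H.diff_right h_def)
    have ru: "H r (u i) = 0" if "i \<in> F" for i using ur that H.herm[of "u i" r] by simp
    have Av: "H.AA v = of_real s *\<^sub>C v"
      unfolding vs(2) unfolding v_def cvec.scale_sum_right by (intro sum.cong) (auto simp: Eq_def)
    have h_le: "cmod (h i) \<le> 2 * s / (s - lam i) * (K * m * e)" if i: "i \<in> Lo" for i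
    proof -
      have iJ: "i \<in> J" and il: "i \<in> {1..l}" and lt: "lam i < s" using i Lo by (auto simp: Lo_def)
      have "hnorm H (u i - P n (u i)) \<le> K * m * hnorm H.energy (u i - P n (u i))"
        using K(3) u_half[OF iJ] by (simp add: m_def)
      also have "\<dots> \<le> K * m * e" using err_term(2)[OF il] K m0 by (intro mult_left_mono) (auto simp: e_def)
      finally have ui: "hnorm H (u i - P n (u i)) \<le> K * m * e" .
      have "(s - lam i) * cmod (h i) \<le> (L - lam i) * cmod (h i)" using Ls by (intro mult_right_mono) auto
      also have "\<dots> \<le> L * hnorm H (u i - P n (u i))" using low_coefficient[OF jn iJ] by (simp add: L_def h_def)
      also have "\<dots> \<le> (2 * s) * (K * m * e)" by (rule mult_mono[OF L2 ui]) (use s0 in auto)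
      finally show ?thesis using lt by (simp add: field_simps)
    qed
    have lo_le: "hnorm H lo \<le> C1 * (m * e)"
    proof -
      have "hnorm H lo \<le> (\<Sum>i\<in>Lo. hnorm H (h i *\<^sub>C u i))" unfolding lo_def by (rule H.triangle_sum) simp
      also have "\<dots> \<le> (\<Sum>i\<in>Lo. 2 * s / (s - lam i) * (K * m * e))"
        using h_le sub(1) by (intro sum_mono) (auto simp: H.norm_scale u_norm)
      also have "\<dots> = C1 * (m * e)" unfolding C1_def cs_def sum_distrib_right[symmetric] by simp
      finally show ?thesis .
    qed
    have lo_e: "hnorm H lo \<le> C1 * m1 * e"
      using lo_le mult_right_mono[OF mm1 e0] mult_left_mono[OF _ C1] by (force simp: mult.assoc)
    have lo_en: "hnorm H.energy lo \<le> sqrt s * (C1 * m1) * e"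
    proof -
      have "(hnorm H.energy lo)\<^sup>2 = (\<Sum>i\<in>Lo. lam i * (cmod (h i))\<^sup>2)" using energy_norm[OF los(1)] los(4) by simp
      also have "\<dots> \<le> (\<Sum>i\<in>Lo. s * (cmod (h i))\<^sup>2)" by (intro sum_mono mult_right_mono) (auto simp: Lo_def)
      also have "\<dots> = s * (hnorm H lo)\<^sup>2" by (simp add: los(3) sum_distrib_left)
      also have "\<dots> = (sqrt s * hnorm H lo)\<^sup>2" using s0 by (simp add: power_mult_distrib)
      finally have "hnorm H.energy lo \<le> sqrt s * hnorm H lo" by (rule power2_le_imp_le) (use s0 in simp)
      also have "\<dots> \<le> sqrt s * (C1 * m1 * e)" using lo_e s0 by (intro mult_left_mono) auto
      finally show ?thesis by (simp add: mult.assoc)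
    qed
    have r_en: "hnorm H.energy r \<le> Ce * e"
    proof -
      define X where "X = Re (H r (H.AA r))"
      have rp: "H r p = 0" unfolding p_def using ru by (simp add: H.sum_right H.scale_right)
      have rAp: "H r (H.AA p) = 0" unfolding ps(2) using ru by (simp add: H.sum_right H.scale_right)
      have pAr: "H p (H.AA r) = 0" using H.A_sym[OF ps(1) rd] rAp H.herm[of r "H.AA p"] by simp
      have wsum: "w n j = p + r" by (simp add: r_def)
      have "H (w n j) (H.AA (w n j)) = of_real L"
        using w_energy[OF jn jn] H.energy_A[OF half[OF wd] wd] by (simp add: L_def)
      hence "L = Re (H (w n j) (H.AA (w n j)))" by simp
      also have "\<dots> = Re (H p (H.AA p)) + X"
        unfolding wsum H.A_add[OF ps(1) rd] X_def by (simp add: H.add_left H.add_right rAp pAr)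
      finally have Leq: "L = Re (H p (H.AA p)) + X" .
      have "(hnorm H (p + r))\<^sup>2 = (hnorm H p)\<^sup>2 + (hnorm H r)\<^sup>2"
        using rp H.herm[of r p] by (intro H.pythagoras) simp
      hence one: "1 = (hnorm H p)\<^sup>2 + (hnorm H r)\<^sup>2" using w_norm[OF jn] wsum by simp
      \<comment> \<open>Indices in \<open>Eq\<close> contribute nothing, as their eigenvalue is
        \<open>s\<close>; the defect is therefore of second order although \<open>p\<close> itself
        is not small.\<close>
      have "s * (hnorm H p)\<^sup>2 - Re (H p (H.AA p)) = (\<Sum>i\<in>F. (s - lam i) * (cmod (h i))\<^sup>2)"
        unfolding ps(3,4) by (simp add: sum_distrib_left sum_subtractf left_diff_distrib)
      also have "\<dots> = (\<Sum>i\<in>Lo. (s - lam i) * (cmod (h i))\<^sup>2)"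
        unfolding F_def using fin by (intro sum.mono_neutral_right) (auto simp: Eq_def)
      also have "\<dots> \<le> (\<Sum>i\<in>Lo. s * (cmod (h i))\<^sup>2)"
        using lam_pos sub(1) by (intro sum_mono mult_right_mono) (auto simp: less_imp_le)
      also have "\<dots> = s * (hnorm H lo)\<^sup>2" by (simp add: los(3) sum_distrib_left)
      also have "\<dots> \<le> s * (C1 * m1 * e)\<^sup>2" using lo_e s0 by (intro mult_left_mono power_mono) auto
      finally have pl: "s * (hnorm H p)\<^sup>2 - Re (H p (H.AA p)) \<le> s * (C1 * m1 * e)\<^sup>2" .
      have "s = s * (hnorm H p)\<^sup>2 + s * (hnorm H r)\<^sup>2" using one by (metis distrib_left mult_1_right)
      hence "X - s * (hnorm H r)\<^sup>2 \<le> (L - s) + s * (C1 * m1 * e)\<^sup>2" using pl Leq by linarith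
      also have "\<dots> \<le> Cd * e\<^sup>2 + s * (C1 * m1 * e)\<^sup>2" using Ld by simp
      also have "\<dots> = Q * e\<^sup>2" by (simp add: Q_def power_mult_distrib algebra_simps)
      finally have XQ: "X - s * (hnorm H r)\<^sup>2 \<le> Q * e\<^sup>2" .
      \<comment> \<open>The gap bounds the squared norm of \<open>r\<close> by X / \<gamma>; because
        s < \<gamma>, its multiple by s is absorbed into X.\<close>
      have "(hnorm H r)\<^sup>2 \<le> X / \<gamma>" using gap[OF rd ur] \<gamma> s0 by (simp add: X_def field_simps)
      from mult_left_mono[OF this, of s] have "s * (hnorm H r)\<^sup>2 \<le> (s / \<gamma>) * X" using s0 by simp
      hence "(1 - s / \<gamma>) * X \<le> Q * e\<^sup>2" using XQ by (simp add: left_diff_distrib)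
      hence "X \<le> Q / (1 - s / \<gamma>) * e\<^sup>2" using s\<gamma> by (simp add: pos_le_divide_eq mult.commute)
      also have "\<dots> = (Ce * e)\<^sup>2" using Q s\<gamma> by (simp add: Ce_def power_mult_distrib)
      finally have "(hnorm H.energy r)\<^sup>2 \<le> (Ce * e)\<^sup>2" using energy_norm[OF rd] by (simp add: X_def)
      thus ?thesis by (rule power2_le_imp_le) (use Ce e0 in simp)
    qed
    have D_en: "hnorm H.energy D \<le> CD * e"
      using H.en.triangle[OF half[OF los(1)] half[OF rd]] lo_en r_en
      by (simp add: D_split CD_def distrib_right)
    have wr: "w n j - r = (\<Sum>i\<in>F. h i *\<^sub>C u i)" by (simp add: r_def p_def)
    have r_le: "hnorm H r \<le> C2 * (m * hnorm H.energy D)"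
      unfolding C2_def m_def D_def
      by (rule residual_norm[OF K(1,2) jn fin(3) sub(3) s\<alpha> \<gamma> gap _ _ _ wr ur vs(1) Av])
         (use Ls L2 Lg in \<open>simp_all add: L_def\<close>)
    have D_le: "hnorm H D \<le> C3 * (m * e)"
    proof -
      have "hnorm H D \<le> hnorm H lo + hnorm H r" unfolding D_split by (rule H.triangle) auto
      also have "\<dots> \<le> C1 * (m * e) + C2 * (m * (CD * e))"
        using lo_le r_le D_en C2 m0
        by (intro add_mono order_trans[OF r_le] mult_left_mono) auto
      finally show ?thesis by (simp add: C3_def algebra_simps)
    qed
    have D_e: "hnorm H D \<le> C3 * m1 * e"
      using D_le mult_right_mono[OF mm1 e0] mult_left_mono[OF _ C3] by (force simp: mult.assoc)
    have D_half: "hnorm H D \<le> 1/2"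
    proof -
      have "C3 * m1 * e \<le> 1/2" using e1(4) p3 e0 by (simp add: pos_le_divide_eq algebra_simps)
      thus ?thesis using D_e by simp
    qed
    have vw: "v = w n j - D" by (simp add: D_def)
    \<comment> \<open>Normalizing \<open>v\<close> costs no more than the norm of \<open>D\<close>,
      because the Ritz vector is a unit vector; hence the factor 2 in \<open>2 * C3\<close>.\<close>
    have vn: "\<bar>1 - hnorm H v\<bar> \<le> hnorm H D"
      using H.triangle_rev[of "w n j" v] w_norm[OF jn] by (simp add: D_def)
    have vpos: "hnorm H v > 0" using vn D_half by linarith
    define U where "U = of_real (1 / hnorm H v) *\<^sub>C v"
    have Ud: "U \<in> dom A" unfolding U_def by (rule H.dom_scale[OF vs(1)])
    have U_eig: "U \<in> eigenspace A (of_real (lam j))"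
      using Ud H.A_scale[OF vs(1), of "of_real (1 / hnorm H v)"] Av
      by (simp add: eigenspace_def U_def s_def mult.commute)
    have v0: "v \<noteq> 0" using vpos by auto
    have U1: "hnorm H U = 1" using vpos v0 by (simp add: U_def H.norm_scale norm_divide)
    have Uv: "U - v = of_real (1 - hnorm H v) *\<^sub>C U"
    proof -
      have "v = of_real (hnorm H v) *\<^sub>C U" using vpos v0 by (simp add: U_def)
      thus ?thesis by (metis cvec.scale_left_diff_distrib cvec.scale_one of_real_1 of_real_diff)
    qed
    have Uw: "U - w n j = (U - v) - D" by (simp add: D_def)
    have "hnorm H (U - w n j) \<le> hnorm H (U - v) + hnorm H D"
      unfolding Uw by (rule H.triangle_diff) auto
    also have "hnorm H (U - v) \<le> hnorm H D" unfolding Uv using vn by (simp add: H.norm_scale U1 del: of_real_diff)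
    finally have "hnorm H (U - w n j) \<le> 2 * C3 * (m * e)" using D_le by simp
    also have "\<dots> \<le> C * (m * e)" using CC3 m0 e0 by (intro mult_right_mono) auto
    finally have fin_norm: "hnorm H (U - w n j) \<le> C * (m * e)" .
    have Uen: "hnorm H.energy U = sqrt s"
    proof -
      have "(hnorm H.energy U)\<^sup>2 = Re (H U (of_real s *\<^sub>C U))"
        using energy_norm[OF Ud] U_eig by (simp add: eigenspace_def s_def)
      also have "\<dots> = s" using H.norm_sq[of U] U1 by (simp add: H.scale_right)
      finally show ?thesis using half[OF Ud] by (metis H.en.hnorm_ge0 real_sqrt_unique)
    qed
    have "hnorm H.energy (U - w n j) \<le> hnorm H.energy (U - v) + hnorm H.energy D"
      unfolding Uw by (rule H.en.triangle_diff) (intro half H.dom_diff Ud vs(1) Dd)+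
    also have "hnorm H.energy (U - v) \<le> sqrt s * (C3 * m1 * e)"
    proof -
      have "hnorm H.energy (U - v) = \<bar>1 - hnorm H v\<bar> * sqrt s"
        unfolding Uv H.en.norm_scale[OF half[OF Ud]] Uen norm_of_real ..
      also have "\<dots> \<le> (C3 * m1 * e) * sqrt s" using vn D_e s0 by (intro mult_right_mono) auto
      finally show ?thesis by (simp add: mult.commute)
    qed
    also note D_en
    finally have "hnorm H.energy (U - w n j) \<le> (sqrt s * (C3 * m1) + CD) * e"
      by (simp add: distrib_right mult.assoc)
    also have "\<dots> \<le> C * e" using CCe e0 by (intro mult_right_mono) auto
    finally have fin_en: "hnorm H.energy (U - w n j) \<le> C * e" .
    have "\<bar>L - s\<bar> \<le> C * e\<^sup>2"
      using Ls Ld mult_right_mono[OF CCd, of "e\<^sup>2"] by simp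
    thus "\<bar>\<Lambda> n j - lam j\<bar> \<le> C * (err n)\<^sup>2" by (simp add: L_def s_def e_def)
    show "\<exists>U\<in>eigenspace A (of_real (lam j)). hnorm H U = 1 \<and> hnorm H.energy (U - w n j) \<le> C * err n \<and>
      hnorm H (U - w n j) \<le> C * (\<mu> (n + 1) powr (-1/2) * err n)"
      using U_eig U1 fin_en fin_norm unfolding e_def m_def by blast
  qed
qed

lemma err_bound:
  assumes \<sigma>: "\<sigma> \<ge> 1/2" and reg: "\<forall>j\<in>{1..l}. u j \<in> dom (op_power G M \<sigma>)"
  shows "\<exists>r. r \<longlonglongrightarrow> 0 \<and> (\<forall>n. 0 \<le> r n \<and> err n \<le> r n * \<mu> (n + 1) powr (1/2 - \<sigma>))"
proof -
  have "\<forall>i\<in>{1..l}. \<exists>r. r \<longlonglongrightarrow> 0 \<and> (\<forall>n. 0 \<le> r n \<and> hnorm H.energy (u i - P n (u i)) \<le> r n * \<mu> (n + 1) powr (1/2 - \<sigma>))"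
    using energy_projection_error[OF \<sigma>] reg by blast
  then obtain r where r: "\<forall>i\<in>{1..l}. r i \<longlonglongrightarrow> 0 \<and>
      (\<forall>n. 0 \<le> r i n \<and> hnorm H.energy (u i - P n (u i)) \<le> r i n * \<mu> (n + 1) powr (1/2 - \<sigma>))"
    by (rule bchoice[THEN exE]) blast
  have "(\<lambda>n. \<Sum>i=1..l. r i n) \<longlonglongrightarrow> (\<Sum>i=1..l. 0)"
    using r by (intro tendsto_sum) blast
  hence "(\<lambda>n. \<Sum>i=1..l. r i n) \<longlonglongrightarrow> 0" by simp
  moreover have "0 \<le> (\<Sum>i=1..l. r i n)" for n using r by (intro sum_nonneg) blast
  moreover have "err n \<le> (\<Sum>i=1..l. r i n) * \<mu> (n + 1) powr (1/2 - \<sigma>)" for n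
    unfolding err_def sum_distrib_right using r by (intro sum_mono) blast
  ultimately show ?thesis by blast
qed

lemma ritz_convergence:
  assumes \<sigma>: "\<sigma> \<ge> 1/2" and reg: "\<forall>j\<in>{1..l}. u j \<in> dom (op_power G M \<sigma>)"
  shows "\<exists>U :: nat \<Rightarrow> nat \<Rightarrow> 'h.
     (\<forall>\<^sub>F n in sequentially. \<forall>j\<in>{1..l}. U n j \<in> eigenspace A (of_real (lam j)) \<and> hnorm H (U n j) = 1) \<and>
     (\<forall>j\<in>{1..l}.
        (\<lambda>n. \<Lambda> n j - lam j) \<in> o(\<lambda>n. \<mu> (n + 1) powr (1 - 2 * \<sigma>)) \<and>
        (\<lambda>n. hnorm H.energy (U n j - w n j)) \<in> o(\<lambda>n. \<mu> (n + 1) powr (1/2 - \<sigma>)) \<and>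
        (\<lambda>n. hnorm H (U n j - w n j)) \<in> o(\<lambda>n. \<mu> (n + 1) powr (-\<sigma>)))"
proof -
  obtain r where r: "r \<longlonglongrightarrow> 0" "\<forall>n. 0 \<le> r n \<and> err n \<le> r n * \<mu> (n + 1) powr (1/2 - \<sigma>)"
    using err_bound[OF assms] by blast
  \<comment> \<open>Since 1/2 - \<sigma> is nonpositive, the power of \<mu> never exceeds its value
    at n = 0. So \<open>err\<close> eventually falls below the threshold of
    \<open>eigen_estimate\<close>, also for \<sigma> = 1/2.\<close>
  have err0: "err \<longlonglongrightarrow> 0"
  proof (rule Lim_null_comparison)
    have "err n \<le> r n * \<mu> 1 powr (1/2 - \<sigma>)" for n
    proof -
      have "err n \<le> r n * \<mu> (n + 1) powr (1/2 - \<sigma>)" using r(2) by blast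
      also have "\<dots> \<le> r n * \<mu> 1 powr (1/2 - \<sigma>)"
        using r(2) \<sigma> \<mu>_pos[of 1] \<mu>_mono[of 1 "n + 1"] by (intro mult_left_mono powr_mono2') auto
      finally show ?thesis .
    qed
    thus "\<forall>\<^sub>F n in sequentially. norm (err n) \<le> r n * \<mu> 1 powr (1/2 - \<sigma>)"
      using err_nonneg by simp
    show "(\<lambda>n. r n * \<mu> 1 powr (1/2 - \<sigma>)) \<longlonglongrightarrow> 0"
      using tendsto_mult_right[OF r(1), of "\<mu> 1 powr (1/2 - \<sigma>)"] by simp
  qed
  let ?R = "\<lambda>C n j U. U \<in> eigenspace A (of_real (lam j)) \<and> hnorm H U = 1 \<and>
      hnorm H.energy (U - w n j) \<le> C * err n \<and> hnorm H (U - w n j) \<le> C * (\<mu> (n + 1) powr (-1/2) * err n)"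
  have "\<forall>j\<in>{1..l}. \<exists>C\<ge>0. \<forall>\<^sub>F n in sequentially. \<bar>\<Lambda> n j - lam j\<bar> \<le> C * (err n)\<^sup>2 \<and> (\<exists>U. ?R C n j U)"
  proof
    fix j assume j: "j \<in> {1..l}"
    from eigen_estimate[OF j] obtain C d where C: "C \<ge> 0" "d > 0"
      "\<forall>n\<ge>j. err n \<le> d \<longrightarrow> \<bar>\<Lambda> n j - lam j\<bar> \<le> C * (err n)\<^sup>2 \<and> (\<exists>U. ?R C n j U)" by blast
    have "\<forall>\<^sub>F n in sequentially. err n < d" using order_tendstoD(2)[OF err0] C(2) by blast
    hence "\<forall>\<^sub>F n in sequentially. \<bar>\<Lambda> n j - lam j\<bar> \<le> C * (err n)\<^sup>2 \<and> (\<exists>U. ?R C n j U)"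
      using eventually_ge_at_top[of j]
    proof eventually_elim
      case (elim n)
      thus ?case using C(3) by (meson less_imp_le)
    qed
    thus "\<exists>C\<ge>0. \<forall>\<^sub>F n in sequentially. \<bar>\<Lambda> n j - lam j\<bar> \<le> C * (err n)\<^sup>2 \<and> (\<exists>U. ?R C n j U)" using C(1) by blast
  qed
  then obtain C where C: "\<forall>j\<in>{1..l}. C j \<ge> 0 \<and>
      (\<forall>\<^sub>F n in sequentially. \<bar>\<Lambda> n j - lam j\<bar> \<le> C j * (err n)\<^sup>2 \<and> (\<exists>U. ?R (C j) n j U))"
    by (rule bchoice[THEN exE]) blast
  \<comment> \<open>Before the estimates take effect this choice is arbitrary, so properties of
    \<open>U\<close> hold for large n only.\<close>
  define U where "U n j = (SOME U. ?R (C j) n j U)" for n j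
  have ev: "\<forall>\<^sub>F n in sequentially. \<bar>\<Lambda> n j - lam j\<bar> \<le> C j * (err n)\<^sup>2 \<and> ?R (C j) n j (U n j)"
    if j: "j \<in> {1..l}" for j
  proof -
    have "\<forall>\<^sub>F n in sequentially. \<bar>\<Lambda> n j - lam j\<bar> \<le> C j * (err n)\<^sup>2 \<and> (\<exists>U. ?R (C j) n j U)" using C j by blast
    thus ?thesis
    proof eventually_elim
      case (elim n)
      from elim have "\<exists>U. ?R (C j) n j U" by blast
      from someI_ex[OF this] show ?case using elim unfolding U_def by blast
    qed
  qed
  have mpos: "\<mu> (n + 1) > 0" for n by (rule \<mu>_pos) simp
  have powr1: "(\<mu> (n + 1) powr (1/2 - \<sigma>))\<^sup>2 = \<mu> (n + 1) powr (1 - 2 * \<sigma>)" for n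
    by (simp add: power2_eq_square flip: powr_add)
  have powr2: "\<mu> (n + 1) powr (-1/2) * \<mu> (n + 1) powr (1/2 - \<sigma>) = \<mu> (n + 1) powr (-\<sigma>)" for n
    by (simp flip: powr_add)
  show ?thesis
  proof (intro exI[of _ U] conjI ballI)
    show "\<forall>\<^sub>F n in sequentially. \<forall>j\<in>{1..l}. U n j \<in> eigenspace A (of_real (lam j)) \<and> hnorm H (U n j) = 1"
    proof (rule eventually_ball_finite)
      show "\<forall>j\<in>{1..l}. \<forall>\<^sub>F n in sequentially. U n j \<in> eigenspace A (of_real (lam j)) \<and> hnorm H (U n j) = 1"
        using ev by (blast intro: eventually_mono)
    qed simp
    fix j assume j: "j \<in> {1..l}"
    have Cj: "C j \<ge> 0" using C j by blast
    show "(\<lambda>n. \<Lambda> n j - lam j) \<in> o(\<lambda>n. \<mu> (n + 1) powr (1 - 2 * \<sigma>))"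
    proof (rule smallo_of_bound)
      show "(\<lambda>n. C j * (r n)\<^sup>2) \<longlonglongrightarrow> 0" using tendsto_mult_left[OF tendsto_power[OF r(1), of 2], of "C j"] by simp
      show "\<forall>\<^sub>F n in sequentially. \<bar>\<Lambda> n j - lam j\<bar> \<le> C j * (r n)\<^sup>2 * \<mu> (n + 1) powr (1 - 2 * \<sigma>)"
        using ev[OF j]
      proof eventually_elim
        case (elim n)
        have "\<bar>\<Lambda> n j - lam j\<bar> \<le> C j * (err n)\<^sup>2" using elim by blast
        also have "\<dots> \<le> C j * (r n * \<mu> (n + 1) powr (1/2 - \<sigma>))\<^sup>2"
          using r(2) err_nonneg Cj by (intro mult_left_mono power_mono) auto
        finally show ?case by (simp only: power_mult_distrib powr1 mult.assoc)
      qed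
    qed simp
    have lim: "(\<lambda>n. C j * r n) \<longlonglongrightarrow> 0" using tendsto_mult_left[OF r(1), of "C j"] by simp
    show "(\<lambda>n. hnorm H.energy (U n j - w n j)) \<in> o(\<lambda>n. \<mu> (n + 1) powr (1/2 - \<sigma>))"
    proof (rule smallo_of_bound[OF lim])
      show "\<forall>\<^sub>F n in sequentially. \<bar>hnorm H.energy (U n j - w n j)\<bar> \<le> C j * r n * \<mu> (n + 1) powr (1/2 - \<sigma>)"
        using ev[OF j] eventually_ge_at_top[of j]
      proof eventually_elim
        case (elim n)
        have jn: "j \<in> {1..n}" using elim j by simp
        have "U n j \<in> dom A" using elim unfolding eigenspace_def by blast
        hence "U n j - w n j \<in> dom H.half" using H.dom_diff[OF _ w_dom[OF jn]] H.dom_A_half by blast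
        hence "\<bar>hnorm H.energy (U n j - w n j)\<bar> = hnorm H.energy (U n j - w n j)" by simp
        also have "\<dots> \<le> C j * err n" using elim by blast
        also have "\<dots> \<le> C j * (r n * \<mu> (n + 1) powr (1/2 - \<sigma>))" using r(2) Cj by (intro mult_left_mono) auto
        finally show ?case by (simp add: mult.assoc)
      qed
    qed simp
    show "(\<lambda>n. hnorm H (U n j - w n j)) \<in> o(\<lambda>n. \<mu> (n + 1) powr (-\<sigma>))"
    proof (rule smallo_of_bound[OF lim])
      show "\<forall>\<^sub>F n in sequentially. \<bar>hnorm H (U n j - w n j)\<bar> \<le> C j * r n * \<mu> (n + 1) powr (-\<sigma>)"
        using ev[OF j]
      proof eventually_elim
        case (elim n)
        have "\<bar>hnorm H (U n j - w n j)\<bar> \<le> C j * (\<mu> (n + 1) powr (-1/2) * err n)" using elim by simp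
        also have "\<dots> \<le> C j * (\<mu> (n + 1) powr (-1/2) * (r n * \<mu> (n + 1) powr (1/2 - \<sigma>)))"
          using r(2) Cj by (intro mult_left_mono) auto
        also have "\<dots> = C j * r n * (\<mu> (n + 1) powr (-1/2) * \<mu> (n + 1) powr (1/2 - \<sigma>))" by simp
        finally show ?case unfolding powr2 .
      qed
    qed simp
  qed
qed

end

theorem theorem4p5:
  fixes H G :: "'h::complex_vector inner_prod"
    and A M :: "'h operator"
    and N :: enat and lam :: "nat \<Rightarrow> real" and u :: "nat \<Rightarrow> 'h"
    and \<mu> :: "nat \<Rightarrow> real" and q :: "nat \<Rightarrow> 'h"
    and \<Lambda> :: "nat \<Rightarrow> nat \<Rightarrow> real" and w :: "nat \<Rightarrow> nat \<Rightarrow> 'h"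
    and l :: nat
  assumes H: "hilbert_space H" "separable_space (htop H)"
    and A: "selfadjoint H A" "positive_definite H A"
    and A_eigen: "eigenpairs_below H A (inf_essential_spectrum H A) {j. 1 \<le> j \<and> enat j \<le> N} lam u"
    and l: "enat l \<le> N"
    and G: "hilbert_space G" "equivalent_norms_on UNIV (hnorm G) (hnorm H)"
    and M: "selfadjoint G M" "positive_definite G M" "compact_inverse G M"
    and M_eigen: "eigenpairs_below G M \<infinity> {1..} \<mu> q"
    and \<mu>_lim: "filterlim \<mu> at_top sequentially"
    and RR: "\<And>n. rayleigh_ritz (pow_inner H A (1/2)) H q n (\<Lambda> n) (w n)"
    and dom_eq: "dom A = dom M"
    and graph_norms: "equivalent_norms_on (dom A) (\<lambda>v. hnorm G (the (M v))) (\<lambda>v. hnorm H (the (A v)))"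
  shows "(\<forall>\<sigma>\<ge>1/2. \<forall>v\<in>dom (op_power G M \<sigma>).
           (\<lambda>n. hnorm H (v - orth_proj (pow_inner H A (1/2)) (cvec.span (q ` {1..n})) v))
             \<in> o(\<lambda>n. \<mu> (n + 1) powr (-\<sigma>)))
       \<and> (\<forall>\<sigma>\<ge>1/2. (\<forall>j\<in>{1..l}. u j \<in> dom (op_power G M \<sigma>)) \<longrightarrow>
           (\<exists>U :: nat \<Rightarrow> nat \<Rightarrow> 'h.
             (\<forall>\<^sub>F n in sequentially. \<forall>j\<in>{1..l}.
                U n j \<in> eigenspace A (of_real (lam j)) \<and> hnorm H (U n j) = 1) \<and>
             (\<forall>j\<in>{1..l}.
                (\<lambda>n. \<Lambda> n j - lam j) \<in> o(\<lambda>n. \<mu> (n + 1) powr (1 - 2 * \<sigma>)) \<and>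
                (\<lambda>n. hnorm (pow_inner H A (1/2)) (U n j - w n j))
                  \<in> o(\<lambda>n. \<mu> (n + 1) powr (1/2 - \<sigma>)) \<and>
                (\<lambda>n. hnorm H (U n j - w n j)) \<in> o(\<lambda>n. \<mu> (n + 1) powr (-\<sigma>)))))"
proof -
  interpret ritz_eigen H G A M \<mu> q \<Lambda> w N lam u l
    by unfold_locales (rule assms)+
  show ?thesis using projection_convergence ritz_convergence by blast
qed

end
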